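(* Let $\mathcal{C}$ be a symmetric monoidal category such that: (0) $\mathcal{C}$ has all equalizers and coequalizers; (1) the monoidal structure of $\mathcal{C}$ is bistable; (2) the category $\mathsf{Hopf}^{\mathsf{bc}}(\mathcal{C})$ of bicommutative Hopf monoids in $\mathcal{C}$ is abelian. Let $\upsilon$ be a normalized 1-cochain on the category of Fredholm homomorphisms between bicommutative Hopf monoids, with coefficients in the abelian group $Aut_{\mathcal{C}}(\mathds{1})$, such that $\delta^1\upsilon=\omega_{\mathcal{C}}$, and for a Fredholm homomorphism $\xi:A\to B$ put $\xi_!=\upsilon(\xi)^{-1}\cdot\mu_\xi:B\to A$. Let $A,B,C$ be bicommutative Hopf monoids and $\xi:A\to B$, $\xi':B\to C$ be bimonoid homomorphisms. If $\xi,\xi'$ are Fredholm, then the composition $\xi'\circ\xi$ is Fredholm and $(\xi'\circ\xi)_!=\xi_!\circ\xi'_!$.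
   Context: Coherence isomorphisms are suppressed; $\mathds{1}$ is the unit object. A bimonoid $A$ has structure maps $\nabla_A,\eta_A,\Delta_A,\epsilon_A$; bicommutative means commutative and cocommutative; morphisms of $\mathsf{Hopf}^{\mathsf{bc}}(\mathcal{C})$ are bimonoid homomorphisms, and $ker(\xi):Ker(\xi)\to A$, $cok(\xi):B\to Cok(\xi)$ are the kernel and cokernel in $\mathsf{Hopf}^{\mathsf{bc}}(\mathcal{C})$. For $\lambda\in End_{\mathcal{C}}(\mathds{1})$ and $f:X\to Y$, $\lambda\cdot f:X\cong\mathds{1}\otimes X\xrightarrow{\lambda\otimes f}\mathds{1}\otimes Y\cong Y$. (Co)integrals and inverse volume. A morphism $\varphi:\mathds{1}\to A$ is an integral of $A$ if $\nabla_A\circ(\varphi\otimes id_A)=\varphi\otimes\epsilon_A$ and $\nabla_A\circ(id_A\otimes\varphi)=\epsilon_A\otimes\varphi$, normalized if $\epsilon_A\circ\varphi=id_{\mathds{1}}$; a morphism $\varphi:A\to\mathds{1}$ is a cointegral if $(\varphi\otimes id_A)\circ\Delta_A=\eta_A\circ\varphi=(id_A\otimes\varphi)\circ\Delta_A$, normalized if $\varphi\circ\eta_A=id_{\mathds{1}}$. Normalized (co)integrals are unique if they exist and are denoted $\sigma_A$, $\sigma^A$; a bismall bimonoid has both. $vol^{-1}(A)=\sigma^A\circ\sigma_A$. For a homomorphism $f:A\to B$ with $\sigma_A,\sigma^B$ existing, $\langle f\rangle=\sigma^B\circ f\circ\sigma_A\in End_{\mathcal{C}}(\mathds{1})$. Fredholm.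 A homomorphism $\xi$ between bicommutative Hopf monoids is Fredholm if $Ker(\xi)$ and $Cok(\xi)$ are bismall and $vol^{-1}(Ker(\xi))$, $vol^{-1}(Cok(\xi))$ are invertible in $End_{\mathcal{C}}(\mathds{1})$. Integrals along a homomorphism. $\mu:B\to A$ is a right integral along $\xi:A\to B$ if $\nabla_A\circ(\mu\otimes id_A)=\mu\circ\nabla_B\circ(id_B\otimes\xi)$ and $(\mu\otimes id_B)\circ\Delta_B=(id_A\otimes\xi)\circ\Delta_A\circ\mu$; a left integral if $\nabla_A\circ(id_A\otimes\mu)=\mu\circ\nabla_B\circ(\xi\otimes id_B)$ and $(id_B\otimes\mu)\circ\Delta_B=(\xi\otimes id_A)\circ\Delta_A\circ\mu$; an integral if both; normalized if $\xi\circ\mu\circ\xi=\xi$. An integral $\mu$ is a generator if $\mu\circ\xi\circ\mu'=\mu'=\mu'\circ\xi\circ\mu$ for every left or right integral $\mu'$ along $\xi$. For Fredholm $\xi$, $\mu_\xi$ denotes the normalized generator integral along $\xi$, which exists and is unique. Cochains. For composable Fredholm homomorphisms $\xi:A\to B$, $\xi':B\to C$, $\omega_{\mathcal{C}}(\xi,\xi')=\langle cok(\xi)\circ ker(\xi')\rangle$, which lies in $Aut_{\mathcal{C}}(\mathds{1})$. A normalized 1-cochain $\upsilon$ assigns to each Fredholm homomorphism $\xi$ an element $\upsilon(\xi)\in Aut_{\mathcal{C}}(\mathds{1})$ with $\upsilon(id_A)=id_{\mathds{1}}$; the condition $\delta^1\upsilon=\omega_{\mathcal{C}}$ means $\upsilon(\xi)\circ\upsilon(\xi')=\omega_{\mathcal{C}}(\xi,\xi')\circ\upsilon(\xi'\circ\xi)$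 for all composable Fredholm $\xi,\xi'$. Actions. A left action $(A,\alpha,X)$ is a bimonoid $A$, an object $X$ and $\alpha:A\otimes X\to X$ associative and unital; the trivial action is $\epsilon_A\otimes id_X$. Its stabilized object $\alpha\backslash X$ is a coequalizer of $\alpha$ and $\epsilon_A\otimes id_X$. Its invariant object is a morphism $i:\alpha\backslash\backslash X\to X$ with $\alpha\circ(id_A\otimes i)=\epsilon_A\otimes i$, universal with this property. Let ${}_\alpha\gamma:\alpha\backslash\backslash X\to X\to\alpha\backslash X$ be the canonical composite. Right actions are treated in the same way. Dually, for a left coaction $\beta:Y\to A\otimes Y$ of a bimonoid $A$ (coassociative, counital), the stabilized object $\beta/Y\to Y$ is an equalizer of $\beta$ and the trivial coaction $\eta_A\otimes id_Y$, the invariant object is a universal morphism $q:Y\to\beta//Y$ with $(id_A\otimes q)\circ\beta=\eta_A\otimes q$, and ${}^\beta\gamma:\beta/Y\to Y\to\beta//Y$; similarly for right coactions. Bismall. A bimonoid $A$ is small if for every left action and every right action of $A$ the invariant and stabilized objects exist and the canonical morphism from the invariant to the stabilized object is an isomorphism. It is cosmall if for every left and every right coaction of $A$ the invariant and stabilized objects exist and the canonical morphism from the stabilized to the invariant object is an isomorphism. Bismall means small and cosmall. Bistability. The tensor product of left actions $(A,\alpha,X)$ and $(A',\alpha',X')$ is $(A\otimes A',\alpha\tilde\otimes\alpha',X\otimes X')$, where $\alpha\tilde\otimes\alpha'=(\alpha\otimes\alpha')\circ(id_A\otimes\mathbf{s}_{A',X}\otimes id_{X'})$ and $\mathbf{s}$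 is the symmetry. The projections induce canonical morphisms $(\alpha\tilde\otimes\alpha')\backslash(X\otimes X')\to(\alpha\backslash X)\otimes(\alpha'\backslash X')$, making $(A,\alpha,X)\mapsto\alpha\backslash X$ a symmetric comonoidal functor; similarly for right actions. The monoidal structure of $\mathcal{C}$ is stable if these functors, for left and right actions, are strong symmetric monoidal, i.e. these canonical morphisms are isomorphisms. Dually, it is costable if the symmetric monoidal functors sending a left (resp. right) coaction to its stabilized object are strong. Bistable means stable and costable. *)

theory Defs
  imports Main
begin

text \<open>
  Coherence isomorphisms of the (not necessarily strict) monoidal category are written out
  everywhere.
\<close>

section \<open>Categories\<close>

text \<open>
  Hom-sets are indexed by their source and target and need not be disjoint, so that an arrow does
  not determine its source and target; these are passed as arguments wherever they matter.
  In this way bimonoid homomorphisms can literally be arrows of the underlying category.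
\<close>

record ('o, 'm) cat =
  ob :: "'o set"
  hom :: "'o \<Rightarrow> 'o \<Rightarrow> 'm set" ("Hom\<index>")
  ident :: "'o \<Rightarrow> 'm" ("ide\<index>")
  comp :: "'m \<Rightarrow> 'm \<Rightarrow> 'm" (infixr "\<cdot>\<index>" 55)

locale category =
  fixes \<C> :: "('o, 'm, 'x) cat_scheme" (structure)
  assumes hom_ob: "f \<in> Hom X Y \<Longrightarrow> X \<in> ob \<C> \<and> Y \<in> ob \<C>"
    and ide_hom: "X \<in> ob \<C> \<Longrightarrow> ide X \<in> Hom X X"
    and comp_hom: "f \<in> Hom X Y \<Longrightarrow> g \<in> Hom Y Z \<Longrightarrow> g \<cdot> f \<in> Hom X Z"
    and comp_assoc:
      "f \<in> Hom X Y \<Longrightarrow> g \<in> Hom Y Z \<Longrightarrow> h \<in> Hom Z W \<Longrightarrow> (h \<cdot> g) \<cdot> f = h \<cdot> (g \<cdot> f)"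
    and comp_ide_left: "f \<in> Hom X Y \<Longrightarrow> ide Y \<cdot> f = f"
    and comp_ide_right: "f \<in> Hom X Y \<Longrightarrow> f \<cdot> ide X = f"

context
  fixes \<C> :: "('o, 'm, 'x) cat_scheme" (structure)
begin

definition is_inverse :: "'o \<Rightarrow> 'o \<Rightarrow> 'm \<Rightarrow> 'm \<Rightarrow> bool" where
  "is_inverse X Y f g \<longleftrightarrow> g \<in> Hom Y X \<and> g \<cdot> f = ide X \<and> f \<cdot> g = ide Y"

definition iso_arr :: "'o \<Rightarrow> 'o \<Rightarrow> 'm \<Rightarrow> bool" where
  "iso_arr X Y f \<longleftrightarrow> f \<in> Hom X Y \<and> (\<exists>g. is_inverse X Y f g)"

definition inv_arr :: "'o \<Rightarrow> 'o \<Rightarrow> 'm \<Rightarrow> 'm" where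
  "inv_arr X Y f = (THE g. is_inverse X Y f g)"

definition Aut :: "'o \<Rightarrow> 'm set" where
  "Aut X = {f. iso_arr X X f}"

definition mono_arr :: "'o \<Rightarrow> 'o \<Rightarrow> 'm \<Rightarrow> bool" where
  "mono_arr X Y f \<longleftrightarrow> f \<in> Hom X Y \<and>
     (\<forall>W. \<forall>g \<in> Hom W X. \<forall>h \<in> Hom W X. f \<cdot> g = f \<cdot> h \<longrightarrow> g = h)"

definition epi_arr :: "'o \<Rightarrow> 'o \<Rightarrow> 'm \<Rightarrow> bool" where
  "epi_arr X Y f \<longleftrightarrow> f \<in> Hom X Y \<and>
     (\<forall>Z. \<forall>g \<in> Hom Y Z. \<forall>h \<in> Hom Y Z. g \<cdot> f = h \<cdot> f \<longrightarrow> g = h)"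

definition is_equalizer :: "'o \<Rightarrow> 'o \<Rightarrow> 'm \<Rightarrow> 'm \<Rightarrow> 'o \<Rightarrow> 'm \<Rightarrow> bool" where
  "is_equalizer X Y f g E e \<longleftrightarrow>
     f \<in> Hom X Y \<and> g \<in> Hom X Y \<and> e \<in> Hom E X \<and> f \<cdot> e = g \<cdot> e \<and>
     (\<forall>W. \<forall>h \<in> Hom W X. f \<cdot> h = g \<cdot> h \<longrightarrow> (\<exists>!k. k \<in> Hom W E \<and> e \<cdot> k = h))"

definition is_coequalizer :: "'o \<Rightarrow> 'o \<Rightarrow> 'm \<Rightarrow> 'm \<Rightarrow> 'o \<Rightarrow> 'm \<Rightarrow> bool" where
  "is_coequalizer X Y f g Q q \<longleftrightarrow>
     f \<in> Hom X Y \<and> g \<in> Hom X Y \<and> q \<in> Hom Y Q \<and> q \<cdot> f = q \<cdot> g \<and>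
     (\<forall>Z. \<forall>h \<in> Hom Y Z. h \<cdot> f = h \<cdot> g \<longrightarrow> (\<exists>!k. k \<in> Hom Q Z \<and> k \<cdot> q = h))"

definition has_equalizers :: bool where
  "has_equalizers \<longleftrightarrow>
     (\<forall>X Y. \<forall>f \<in> Hom X Y. \<forall>g \<in> Hom X Y. \<exists>E e. is_equalizer X Y f g E e)"

definition has_coequalizers :: bool where
  "has_coequalizers \<longleftrightarrow>
     (\<forall>X Y. \<forall>f \<in> Hom X Y. \<forall>g \<in> Hom X Y. \<exists>Q q. is_coequalizer X Y f g Q q)"

definition is_product :: "'o \<Rightarrow> 'o \<Rightarrow> 'o \<Rightarrow> 'm \<Rightarrow> 'm \<Rightarrow> bool" where
  "is_product X Y P p q \<longleftrightarrow> p \<in> Hom P X \<and> q \<in> Hom P Y \<and>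
     (\<forall>W. \<forall>f \<in> Hom W X. \<forall>g \<in> Hom W Y. \<exists>!k. k \<in> Hom W P \<and> p \<cdot> k = f \<and> q \<cdot> k = g)"

definition is_coproduct :: "'o \<Rightarrow> 'o \<Rightarrow> 'o \<Rightarrow> 'm \<Rightarrow> 'm \<Rightarrow> bool" where
  "is_coproduct X Y S i j \<longleftrightarrow> i \<in> Hom X S \<and> j \<in> Hom Y S \<and>
     (\<forall>Z. \<forall>f \<in> Hom X Z. \<forall>g \<in> Hom Y Z. \<exists>!k. k \<in> Hom S Z \<and> k \<cdot> i = f \<and> k \<cdot> j = g)"

definition is_zero_object :: "'o \<Rightarrow> bool" where
  "is_zero_object Z \<longleftrightarrow> Z \<in> ob \<C> \<and>
     (\<forall>X \<in> ob \<C>. (\<exists>!f. f \<in> Hom X Z) \<and> (\<exists>!f. f \<in> Hom Z X))"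

definition is_zero_arr :: "'o \<Rightarrow> 'o \<Rightarrow> 'm \<Rightarrow> bool" where
  "is_zero_arr X Y f \<longleftrightarrow>
     (\<exists>Z. is_zero_object Z \<and> (\<exists>g \<in> Hom X Z. \<exists>h \<in> Hom Z Y. f = h \<cdot> g))"

definition is_kernel :: "'o \<Rightarrow> 'o \<Rightarrow> 'm \<Rightarrow> 'o \<Rightarrow> 'm \<Rightarrow> bool" where
  "is_kernel X Y f K k \<longleftrightarrow>
     f \<in> Hom X Y \<and> k \<in> Hom K X \<and> is_zero_arr K Y (f \<cdot> k) \<and>
     (\<forall>W. \<forall>h \<in> Hom W X. is_zero_arr W Y (f \<cdot> h) \<longrightarrow> (\<exists>!u. u \<in> Hom W K \<and> k \<cdot> u = h))"

definition is_cokernel :: "'o \<Rightarrow> 'o \<Rightarrow> 'm \<Rightarrow> 'o \<Rightarrow> 'm \<Rightarrow> bool" where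
  "is_cokernel X Y f Q q \<longleftrightarrow>
     f \<in> Hom X Y \<and> q \<in> Hom Y Q \<and> is_zero_arr X Q (q \<cdot> f) \<and>
     (\<forall>Z. \<forall>h \<in> Hom Y Z. is_zero_arr X Z (h \<cdot> f) \<longrightarrow> (\<exists>!u. u \<in> Hom Q Z \<and> u \<cdot> q = h))"

text \<open>
  Freyd's definition, which needs no enrichment as a datum: the abelian group structure on the
  hom-sets is determined by the category.
\<close>

definition abelian_category :: bool where
  "abelian_category \<longleftrightarrow>
     category \<C> \<and>
     (\<exists>Z. is_zero_object Z) \<and>
     (\<forall>X \<in> ob \<C>. \<forall>Y \<in> ob \<C>. \<exists>P p q. is_product X Y P p q) \<and>
     (\<forall>X \<in> ob \<C>. \<forall>Y \<in> ob \<C>. \<exists>S i j. is_coproduct X Y S i j) \<and>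
     (\<forall>X Y. \<forall>f \<in> Hom X Y. \<exists>K k. is_kernel X Y f K k) \<and>
     (\<forall>X Y. \<forall>f \<in> Hom X Y. \<exists>Q q. is_cokernel X Y f Q q) \<and>
     (\<forall>X Y f. mono_arr X Y f \<longrightarrow> (\<exists>Z g. is_kernel Y Z g X f)) \<and>
     (\<forall>X Y f. epi_arr X Y f \<longrightarrow> (\<exists>W g. is_cokernel W X g Y f))"

end


section \<open>Symmetric monoidal categories\<close>

record ('o, 'm) smcat = "('o, 'm) cat" +
  tensor_ob :: "'o \<Rightarrow> 'o \<Rightarrow> 'o" (infixr "\<odot>\<index>" 70)
  tensor :: "'m \<Rightarrow> 'm \<Rightarrow> 'm" (infixr "\<otimes>\<index>" 70)
  unit_ob :: "'o" ("\<one>\<index>")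
  assoc :: "'o \<Rightarrow> 'o \<Rightarrow> 'o \<Rightarrow> 'm" ("\<a>\<index>")
  lunit :: "'o \<Rightarrow> 'm" ("\<l>\<index>")
  runit :: "'o \<Rightarrow> 'm" ("\<r>\<index>")
  symm :: "'o \<Rightarrow> 'o \<Rightarrow> 'm" ("\<s>\<index>")

locale symmetric_monoidal_category = category \<C>
  for \<C> :: "('o, 'm) smcat" (structure) +
  assumes tensor_ob_closed: "X \<in> ob \<C> \<Longrightarrow> Y \<in> ob \<C> \<Longrightarrow> X \<odot> Y \<in> ob \<C>"
    and tensor_hom: "f \<in> Hom X Y \<Longrightarrow> g \<in> Hom Z W \<Longrightarrow> f \<otimes> g \<in> Hom (X \<odot> Z) (Y \<odot> W)"
    and tensor_ide: "X \<in> ob \<C> \<Longrightarrow> Y \<in> ob \<C> \<Longrightarrow> ide X \<otimes> ide Y = ide (X \<odot> Y)"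
    and tensor_comp:
      "f \<in> Hom X Y \<Longrightarrow> f' \<in> Hom Y Z \<Longrightarrow> g \<in> Hom U V \<Longrightarrow> g' \<in> Hom V W
        \<Longrightarrow> (f' \<cdot> f) \<otimes> (g' \<cdot> g) = (f' \<otimes> g') \<cdot> (f \<otimes> g)"
    and unit_ob_closed: "\<one> \<in> ob \<C>"
    and assoc_iso:
      "X \<in> ob \<C> \<Longrightarrow> Y \<in> ob \<C> \<Longrightarrow> Z \<in> ob \<C>
        \<Longrightarrow> iso_arr \<C> ((X \<odot> Y) \<odot> Z) (X \<odot> (Y \<odot> Z)) (\<a> X Y Z)"
    and assoc_natural:
      "f \<in> Hom X X' \<Longrightarrow> g \<in> Hom Y Y' \<Longrightarrow> h \<in> Hom Z Z'
        \<Longrightarrow> \<a> X' Y' Z' \<cdot> ((f \<otimes> g) \<otimes> h) = (f \<otimes> (g \<otimes> h)) \<cdot> \<a> X Y Z"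
    and lunit_iso: "X \<in> ob \<C> \<Longrightarrow> iso_arr \<C> (\<one> \<odot> X) X (\<l> X)"
    and lunit_natural: "f \<in> Hom X Y \<Longrightarrow> \<l> Y \<cdot> (ide \<one> \<otimes> f) = f \<cdot> \<l> X"
    and runit_iso: "X \<in> ob \<C> \<Longrightarrow> iso_arr \<C> (X \<odot> \<one>) X (\<r> X)"
    and runit_natural: "f \<in> Hom X Y \<Longrightarrow> \<r> Y \<cdot> (f \<otimes> ide \<one>) = f \<cdot> \<r> X"
    and pentagon:
      "X \<in> ob \<C> \<Longrightarrow> Y \<in> ob \<C> \<Longrightarrow> Z \<in> ob \<C> \<Longrightarrow> W \<in> ob \<C>
        \<Longrightarrow> \<a> X Y (Z \<odot> W) \<cdot> \<a> (X \<odot> Y) Z W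
            = (ide X \<otimes> \<a> Y Z W) \<cdot> \<a> X (Y \<odot> Z) W \<cdot> (\<a> X Y Z \<otimes> ide W)"
    and triangle:
      "X \<in> ob \<C> \<Longrightarrow> Y \<in> ob \<C> \<Longrightarrow> (ide X \<otimes> \<l> Y) \<cdot> \<a> X \<one> Y = \<r> X \<otimes> ide Y"
    and symm_hom: "X \<in> ob \<C> \<Longrightarrow> Y \<in> ob \<C> \<Longrightarrow> \<s> X Y \<in> Hom (X \<odot> Y) (Y \<odot> X)"
    and symm_natural:
      "f \<in> Hom X X' \<Longrightarrow> g \<in> Hom Y Y' \<Longrightarrow> \<s> X' Y' \<cdot> (f \<otimes> g) = (g \<otimes> f) \<cdot> \<s> X Y"
    and symm_symm: "X \<in> ob \<C> \<Longrightarrow> Y \<in> ob \<C> \<Longrightarrow> \<s> Y X \<cdot> \<s> X Y = ide (X \<odot> Y)"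
    and hexagon:
      "X \<in> ob \<C> \<Longrightarrow> Y \<in> ob \<C> \<Longrightarrow> Z \<in> ob \<C>
        \<Longrightarrow> \<a> Y Z X \<cdot> \<s> X (Y \<odot> Z) \<cdot> \<a> X Y Z
            = (ide Y \<otimes> \<s> X Z) \<cdot> \<a> Y X Z \<cdot> (\<s> X Y \<otimes> ide Z)"

record ('o, 'm) bimon =
  und :: "'o"
  mul :: "'m" ("\<nabla>\<index>")
  uni :: "'m" ("\<eta>\<index>")
  comul :: "'m" ("\<Delta>\<index>")
  coun :: "'m" ("\<epsilon>\<index>")

context
  fixes \<C> :: "('o, 'm) smcat" (structure)
begin

definition assoc_inv :: "'o \<Rightarrow> 'o \<Rightarrow> 'o \<Rightarrow> 'm" where
  "assoc_inv X Y Z = inv_arr \<C> ((X \<odot> Y) \<odot> Z) (X \<odot> (Y \<odot> Z)) (\<a> X Y Z)"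

definition lunit_inv :: "'o \<Rightarrow> 'm" where
  "lunit_inv X = inv_arr \<C> (\<one> \<odot> X) X (\<l> X)"

definition runit_inv :: "'o \<Rightarrow> 'm" where
  "runit_inv X = inv_arr \<C> (X \<odot> \<one>) X (\<r> X)"

text \<open>
  The morphism \<open>id \<otimes> \<s> Y Z \<otimes> id\<close> from \<open>(X \<odot> Y) \<odot> (Z \<odot> W)\<close> to \<open>(X \<odot> Z) \<odot> (Y \<odot> W)\<close>.
\<close>

definition interchange :: "'o \<Rightarrow> 'o \<Rightarrow> 'o \<Rightarrow> 'o \<Rightarrow> 'm" where
  "interchange X Y Z W =
     assoc_inv X Z (Y \<odot> W)
     \<cdot> (ide X \<otimes> (\<a> Z Y W \<cdot> (\<s> Y Z \<otimes> ide W) \<cdot> assoc_inv Y Z W))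
     \<cdot> \<a> X Y (Z \<odot> W)"

definition scale :: "'o \<Rightarrow> 'o \<Rightarrow> 'm \<Rightarrow> 'm \<Rightarrow> 'm" where
  "scale X Y c f = \<l> Y \<cdot> (c \<otimes> f) \<cdot> lunit_inv X"


section \<open>Bimonoids and Hopf monoids\<close>

definition bimonoid :: "('o, 'm) bimon \<Rightarrow> bool" where
  "bimonoid A \<longleftrightarrow>
     und A \<in> ob \<C> \<and>
     \<nabla>\<^bsub>A\<^esub> \<in> Hom (und A \<odot> und A) (und A) \<and>
     \<eta>\<^bsub>A\<^esub> \<in> Hom \<one> (und A) \<and>
     \<Delta>\<^bsub>A\<^esub> \<in> Hom (und A) (und A \<odot> und A) \<and>
     \<epsilon>\<^bsub>A\<^esub> \<in> Hom (und A) \<one> \<and>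
     \<nabla>\<^bsub>A\<^esub> \<cdot> (\<nabla>\<^bsub>A\<^esub> \<otimes> ide (und A))
       = \<nabla>\<^bsub>A\<^esub> \<cdot> (ide (und A) \<otimes> \<nabla>\<^bsub>A\<^esub>) \<cdot> \<a> (und A) (und A) (und A) \<and>
     \<nabla>\<^bsub>A\<^esub> \<cdot> (\<eta>\<^bsub>A\<^esub> \<otimes> ide (und A)) = \<l> (und A) \<and>
     \<nabla>\<^bsub>A\<^esub> \<cdot> (ide (und A) \<otimes> \<eta>\<^bsub>A\<^esub>) = \<r> (und A) \<and>
     \<a> (und A) (und A) (und A) \<cdot> (\<Delta>\<^bsub>A\<^esub> \<otimes> ide (und A)) \<cdot> \<Delta>\<^bsub>A\<^esub>
       = (ide (und A) \<otimes> \<Delta>\<^bsub>A\<^esub>) \<cdot> \<Delta>\<^bsub>A\<^esub> \<and>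
     \<l> (und A) \<cdot> (\<epsilon>\<^bsub>A\<^esub> \<otimes> ide (und A)) \<cdot> \<Delta>\<^bsub>A\<^esub> = ide (und A) \<and>
     \<r> (und A) \<cdot> (ide (und A) \<otimes> \<epsilon>\<^bsub>A\<^esub>) \<cdot> \<Delta>\<^bsub>A\<^esub> = ide (und A) \<and>
     \<Delta>\<^bsub>A\<^esub> \<cdot> \<nabla>\<^bsub>A\<^esub>
       = (\<nabla>\<^bsub>A\<^esub> \<otimes> \<nabla>\<^bsub>A\<^esub>) \<cdot> interchange (und A) (und A) (und A) (und A) \<cdot> (\<Delta>\<^bsub>A\<^esub> \<otimes> \<Delta>\<^bsub>A\<^esub>) \<and>
     \<epsilon>\<^bsub>A\<^esub> \<cdot> \<nabla>\<^bsub>A\<^esub> = \<l> \<one> \<cdot> (\<epsilon>\<^bsub>A\<^esub> \<otimes> \<epsilon>\<^bsub>A\<^esub>) \<and>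
     \<Delta>\<^bsub>A\<^esub> \<cdot> \<eta>\<^bsub>A\<^esub> = (\<eta>\<^bsub>A\<^esub> \<otimes> \<eta>\<^bsub>A\<^esub>) \<cdot> lunit_inv \<one> \<and>
     \<epsilon>\<^bsub>A\<^esub> \<cdot> \<eta>\<^bsub>A\<^esub> = ide \<one>"

definition bimonoid_hom :: "('o, 'm) bimon \<Rightarrow> ('o, 'm) bimon \<Rightarrow> 'm \<Rightarrow> bool" where
  "bimonoid_hom A B f \<longleftrightarrow>
     bimonoid A \<and> bimonoid B \<and> f \<in> Hom (und A) (und B) \<and>
     f \<cdot> \<nabla>\<^bsub>A\<^esub> = \<nabla>\<^bsub>B\<^esub> \<cdot> (f \<otimes> f) \<and> f \<cdot> \<eta>\<^bsub>A\<^esub> = \<eta>\<^bsub>B\<^esub> \<and>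
     \<Delta>\<^bsub>B\<^esub> \<cdot> f = (f \<otimes> f) \<cdot> \<Delta>\<^bsub>A\<^esub> \<and> \<epsilon>\<^bsub>B\<^esub> \<cdot> f = \<epsilon>\<^bsub>A\<^esub>"

definition is_antipode :: "('o, 'm) bimon \<Rightarrow> 'm \<Rightarrow> bool" where
  "is_antipode A S \<longleftrightarrow> S \<in> Hom (und A) (und A) \<and>
     \<nabla>\<^bsub>A\<^esub> \<cdot> (S \<otimes> ide (und A)) \<cdot> \<Delta>\<^bsub>A\<^esub> = \<eta>\<^bsub>A\<^esub> \<cdot> \<epsilon>\<^bsub>A\<^esub> \<and>
     \<nabla>\<^bsub>A\<^esub> \<cdot> (ide (und A) \<otimes> S) \<cdot> \<Delta>\<^bsub>A\<^esub> = \<eta>\<^bsub>A\<^esub> \<cdot> \<epsilon>\<^bsub>A\<^esub>"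

definition hopf_monoid :: "('o, 'm) bimon \<Rightarrow> bool" where
  "hopf_monoid A \<longleftrightarrow> bimonoid A \<and> (\<exists>S. is_antipode A S)"

definition bicommutative :: "('o, 'm) bimon \<Rightarrow> bool" where
  "bicommutative A \<longleftrightarrow>
     \<nabla>\<^bsub>A\<^esub> \<cdot> \<s> (und A) (und A) = \<nabla>\<^bsub>A\<^esub> \<and> \<s> (und A) (und A) \<cdot> \<Delta>\<^bsub>A\<^esub> = \<Delta>\<^bsub>A\<^esub>"

definition bc_hopf_monoid :: "('o, 'm) bimon \<Rightarrow> bool" where
  "bc_hopf_monoid A \<longleftrightarrow> hopf_monoid A \<and> bicommutative A"

definition Hopf_bc :: "(('o, 'm) bimon, 'm) cat" where
  "Hopf_bc =
     \<lparr> ob = {A. bc_hopf_monoid A},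
       hom = (\<lambda>A B. {f. bc_hopf_monoid A \<and> bc_hopf_monoid B \<and> bimonoid_hom A B f}),
       ident = (\<lambda>A. ide (und A)),
       comp = (\<lambda>g f. g \<cdot> f) \<rparr>"

text \<open>
  A choice of kernel and cokernel in \<open>Hopf_bc\<close>; meaningful when these exist, in particular when
  \<open>Hopf_bc\<close> is abelian.
\<close>

definition kernel_pair :: "('o, 'm) bimon \<Rightarrow> ('o, 'm) bimon \<Rightarrow> 'm \<Rightarrow> ('o, 'm) bimon \<times> 'm" where
  "kernel_pair A B \<xi> = (SOME p. is_kernel Hopf_bc A B \<xi> (fst p) (snd p))"

definition cokernel_pair :: "('o, 'm) bimon \<Rightarrow> ('o, 'm) bimon \<Rightarrow> 'm \<Rightarrow> ('o, 'm) bimon \<times> 'm" where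
  "cokernel_pair A B \<xi> = (SOME p. is_cokernel Hopf_bc A B \<xi> (fst p) (snd p))"

abbreviation "Ker A B \<xi> \<equiv> fst (kernel_pair A B \<xi>)"
abbreviation "ker A B \<xi> \<equiv> snd (kernel_pair A B \<xi>)"
abbreviation "Cok A B \<xi> \<equiv> fst (cokernel_pair A B \<xi>)"
abbreviation "cok A B \<xi> \<equiv> snd (cokernel_pair A B \<xi>)"

definition tensor_bimon :: "('o, 'm) bimon \<Rightarrow> ('o, 'm) bimon \<Rightarrow> ('o, 'm) bimon" where
  "tensor_bimon A B =
     \<lparr> und = und A \<odot> und B,
       mul = (\<nabla>\<^bsub>A\<^esub> \<otimes> \<nabla>\<^bsub>B\<^esub>) \<cdot> interchange (und A) (und B) (und A) (und B),
       uni = (\<eta>\<^bsub>A\<^esub> \<otimes> \<eta>\<^bsub>B\<^esub>) \<cdot> lunit_inv \<one>,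
       comul = interchange (und A) (und A) (und B) (und B) \<cdot> (\<Delta>\<^bsub>A\<^esub> \<otimes> \<Delta>\<^bsub>B\<^esub>),
       coun = \<l> \<one> \<cdot> (\<epsilon>\<^bsub>A\<^esub> \<otimes> \<epsilon>\<^bsub>B\<^esub>) \<rparr>"


section \<open>Actions and coactions\<close>

definition left_action :: "('o, 'm) bimon \<Rightarrow> 'm \<Rightarrow> 'o \<Rightarrow> bool" where
  "left_action A \<alpha> X \<longleftrightarrow> bimonoid A \<and> X \<in> ob \<C> \<and> \<alpha> \<in> Hom (und A \<odot> X) X \<and>
     \<alpha> \<cdot> (\<nabla>\<^bsub>A\<^esub> \<otimes> ide X) = \<alpha> \<cdot> (ide (und A) \<otimes> \<alpha>) \<cdot> \<a> (und A) (und A) X \<and>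
     \<alpha> \<cdot> (\<eta>\<^bsub>A\<^esub> \<otimes> ide X) = \<l> X"

definition right_action :: "('o, 'm) bimon \<Rightarrow> 'm \<Rightarrow> 'o \<Rightarrow> bool" where
  "right_action A \<alpha> X \<longleftrightarrow> bimonoid A \<and> X \<in> ob \<C> \<and> \<alpha> \<in> Hom (X \<odot> und A) X \<and>
     \<alpha> \<cdot> (\<alpha> \<otimes> ide (und A)) = \<alpha> \<cdot> (ide X \<otimes> \<nabla>\<^bsub>A\<^esub>) \<cdot> \<a> X (und A) (und A) \<and>
     \<alpha> \<cdot> (ide X \<otimes> \<eta>\<^bsub>A\<^esub>) = \<r> X"

definition left_coaction :: "('o, 'm) bimon \<Rightarrow> 'm \<Rightarrow> 'o \<Rightarrow> bool" where
  "left_coaction A \<beta> Y \<longleftrightarrow> bimonoid A \<and> Y \<in> ob \<C> \<and> \<beta> \<in> Hom Y (und A \<odot> Y) \<and>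
     \<a> (und A) (und A) Y \<cdot> (\<Delta>\<^bsub>A\<^esub> \<otimes> ide Y) \<cdot> \<beta> = (ide (und A) \<otimes> \<beta>) \<cdot> \<beta> \<and>
     \<l> Y \<cdot> (\<epsilon>\<^bsub>A\<^esub> \<otimes> ide Y) \<cdot> \<beta> = ide Y"

definition right_coaction :: "('o, 'm) bimon \<Rightarrow> 'm \<Rightarrow> 'o \<Rightarrow> bool" where
  "right_coaction A \<beta> Y \<longleftrightarrow> bimonoid A \<and> Y \<in> ob \<C> \<and> \<beta> \<in> Hom Y (Y \<odot> und A) \<and>
     \<a> Y (und A) (und A) \<cdot> (\<beta> \<otimes> ide (und A)) \<cdot> \<beta> = (ide Y \<otimes> \<Delta>\<^bsub>A\<^esub>) \<cdot> \<beta> \<and>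
     \<r> Y \<cdot> (ide Y \<otimes> \<epsilon>\<^bsub>A\<^esub>) \<cdot> \<beta> = ide Y"

definition trivial_left_action :: "('o, 'm) bimon \<Rightarrow> 'o \<Rightarrow> 'm" where
  "trivial_left_action A X = \<l> X \<cdot> (\<epsilon>\<^bsub>A\<^esub> \<otimes> ide X)"

definition trivial_right_action :: "('o, 'm) bimon \<Rightarrow> 'o \<Rightarrow> 'm" where
  "trivial_right_action A X = \<r> X \<cdot> (ide X \<otimes> \<epsilon>\<^bsub>A\<^esub>)"

definition trivial_left_coaction :: "('o, 'm) bimon \<Rightarrow> 'o \<Rightarrow> 'm" where
  "trivial_left_coaction A Y = (\<eta>\<^bsub>A\<^esub> \<otimes> ide Y) \<cdot> lunit_inv Y"

definition trivial_right_coaction :: "('o, 'm) bimon \<Rightarrow> 'o \<Rightarrow> 'm" where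
  "trivial_right_coaction A Y = (ide Y \<otimes> \<eta>\<^bsub>A\<^esub>) \<cdot> runit_inv Y"

definition left_stabilized :: "('o, 'm) bimon \<Rightarrow> 'm \<Rightarrow> 'o \<Rightarrow> 'o \<Rightarrow> 'm \<Rightarrow> bool" where
  "left_stabilized A \<alpha> X Q p \<longleftrightarrow>
     is_coequalizer \<C> (und A \<odot> X) X \<alpha> (trivial_left_action A X) Q p"

definition right_stabilized :: "('o, 'm) bimon \<Rightarrow> 'm \<Rightarrow> 'o \<Rightarrow> 'o \<Rightarrow> 'm \<Rightarrow> bool" where
  "right_stabilized A \<alpha> X Q p \<longleftrightarrow>
     is_coequalizer \<C> (X \<odot> und A) X \<alpha> (trivial_right_action A X) Q p"

definition left_costabilized :: "('o, 'm) bimon \<Rightarrow> 'm \<Rightarrow> 'o \<Rightarrow> 'o \<Rightarrow> 'm \<Rightarrow> bool" where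
  "left_costabilized A \<beta> Y E e \<longleftrightarrow>
     is_equalizer \<C> Y (und A \<odot> Y) \<beta> (trivial_left_coaction A Y) E e"

definition right_costabilized :: "('o, 'm) bimon \<Rightarrow> 'm \<Rightarrow> 'o \<Rightarrow> 'o \<Rightarrow> 'm \<Rightarrow> bool" where
  "right_costabilized A \<beta> Y E e \<longleftrightarrow>
     is_equalizer \<C> Y (Y \<odot> und A) \<beta> (trivial_right_coaction A Y) E e"

definition left_invariant_arr :: "('o, 'm) bimon \<Rightarrow> 'm \<Rightarrow> 'o \<Rightarrow> 'o \<Rightarrow> 'm \<Rightarrow> bool" where
  "left_invariant_arr A \<alpha> X I i \<longleftrightarrow> i \<in> Hom I X \<and>
     \<alpha> \<cdot> (ide (und A) \<otimes> i) = \<l> X \<cdot> (\<epsilon>\<^bsub>A\<^esub> \<otimes> i)"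

definition right_invariant_arr :: "('o, 'm) bimon \<Rightarrow> 'm \<Rightarrow> 'o \<Rightarrow> 'o \<Rightarrow> 'm \<Rightarrow> bool" where
  "right_invariant_arr A \<alpha> X I i \<longleftrightarrow> i \<in> Hom I X \<and>
     \<alpha> \<cdot> (i \<otimes> ide (und A)) = \<r> X \<cdot> (i \<otimes> \<epsilon>\<^bsub>A\<^esub>)"

definition left_coinvariant_arr :: "('o, 'm) bimon \<Rightarrow> 'm \<Rightarrow> 'o \<Rightarrow> 'o \<Rightarrow> 'm \<Rightarrow> bool" where
  "left_coinvariant_arr A \<beta> Y Q q \<longleftrightarrow> q \<in> Hom Y Q \<and>
     (ide (und A) \<otimes> q) \<cdot> \<beta> = (\<eta>\<^bsub>A\<^esub> \<otimes> q) \<cdot> lunit_inv Y"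

definition right_coinvariant_arr :: "('o, 'm) bimon \<Rightarrow> 'm \<Rightarrow> 'o \<Rightarrow> 'o \<Rightarrow> 'm \<Rightarrow> bool" where
  "right_coinvariant_arr A \<beta> Y Q q \<longleftrightarrow> q \<in> Hom Y Q \<and>
     (q \<otimes> ide (und A)) \<cdot> \<beta> = (q \<otimes> \<eta>\<^bsub>A\<^esub>) \<cdot> runit_inv Y"

definition left_invariant :: "('o, 'm) bimon \<Rightarrow> 'm \<Rightarrow> 'o \<Rightarrow> 'o \<Rightarrow> 'm \<Rightarrow> bool" where
  "left_invariant A \<alpha> X I i \<longleftrightarrow> left_invariant_arr A \<alpha> X I i \<and>
     (\<forall>W j. left_invariant_arr A \<alpha> X W j \<longrightarrow> (\<exists>!k. k \<in> Hom W I \<and> i \<cdot> k = j))"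

definition right_invariant :: "('o, 'm) bimon \<Rightarrow> 'm \<Rightarrow> 'o \<Rightarrow> 'o \<Rightarrow> 'm \<Rightarrow> bool" where
  "right_invariant A \<alpha> X I i \<longleftrightarrow> right_invariant_arr A \<alpha> X I i \<and>
     (\<forall>W j. right_invariant_arr A \<alpha> X W j \<longrightarrow> (\<exists>!k. k \<in> Hom W I \<and> i \<cdot> k = j))"

definition left_coinvariant :: "('o, 'm) bimon \<Rightarrow> 'm \<Rightarrow> 'o \<Rightarrow> 'o \<Rightarrow> 'm \<Rightarrow> bool" where
  "left_coinvariant A \<beta> Y Q q \<longleftrightarrow> left_coinvariant_arr A \<beta> Y Q q \<and>
     (\<forall>Z r. left_coinvariant_arr A \<beta> Y Z r \<longrightarrow> (\<exists>!k. k \<in> Hom Q Z \<and> k \<cdot> q = r))"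

definition right_coinvariant :: "('o, 'm) bimon \<Rightarrow> 'm \<Rightarrow> 'o \<Rightarrow> 'o \<Rightarrow> 'm \<Rightarrow> bool" where
  "right_coinvariant A \<beta> Y Q q \<longleftrightarrow> right_coinvariant_arr A \<beta> Y Q q \<and>
     (\<forall>Z r. right_coinvariant_arr A \<beta> Y Z r \<longrightarrow> (\<exists>!k. k \<in> Hom Q Z \<and> k \<cdot> q = r))"

text \<open>
  Invariant and (co)stabilized objects are unique up to unique isomorphism, so in the following
  definitions it does not matter that all choices of them are considered.
\<close>

definition small :: "('o, 'm) bimon \<Rightarrow> bool" where
  "small A \<longleftrightarrow> bimonoid A \<and>
     (\<forall>\<alpha> X. left_action A \<alpha> X \<longrightarrow>
        (\<exists>I i. left_invariant A \<alpha> X I i) \<and> (\<exists>Q p. left_stabilized A \<alpha> X Q p) \<and>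
        (\<forall>I i Q p. left_invariant A \<alpha> X I i \<and> left_stabilized A \<alpha> X Q p
           \<longrightarrow> iso_arr \<C> I Q (p \<cdot> i))) \<and>
     (\<forall>\<alpha> X. right_action A \<alpha> X \<longrightarrow>
        (\<exists>I i. right_invariant A \<alpha> X I i) \<and> (\<exists>Q p. right_stabilized A \<alpha> X Q p) \<and>
        (\<forall>I i Q p. right_invariant A \<alpha> X I i \<and> right_stabilized A \<alpha> X Q p
           \<longrightarrow> iso_arr \<C> I Q (p \<cdot> i)))"

definition cosmall :: "('o, 'm) bimon \<Rightarrow> bool" where
  "cosmall A \<longleftrightarrow> bimonoid A \<and>
     (\<forall>\<beta> Y. left_coaction A \<beta> Y \<longrightarrow>
        (\<exists>Q q. left_coinvariant A \<beta> Y Q q) \<and> (\<exists>E e. left_costabilized A \<beta> Y E e) \<and>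
        (\<forall>Q q E e. left_coinvariant A \<beta> Y Q q \<and> left_costabilized A \<beta> Y E e
           \<longrightarrow> iso_arr \<C> E Q (q \<cdot> e))) \<and>
     (\<forall>\<beta> Y. right_coaction A \<beta> Y \<longrightarrow>
        (\<exists>Q q. right_coinvariant A \<beta> Y Q q) \<and> (\<exists>E e. right_costabilized A \<beta> Y E e) \<and>
        (\<forall>Q q E e. right_coinvariant A \<beta> Y Q q \<and> right_costabilized A \<beta> Y E e
           \<longrightarrow> iso_arr \<C> E Q (q \<cdot> e)))"

definition bismall :: "('o, 'm) bimon \<Rightarrow> bool" where
  "bismall A \<longleftrightarrow> small A \<and> cosmall A"


section \<open>Bistability\<close>

definition tensor_left_action ::
    "('o, 'm) bimon \<Rightarrow> 'm \<Rightarrow> 'o \<Rightarrow> ('o, 'm) bimon \<Rightarrow> 'm \<Rightarrow> 'o \<Rightarrow> 'm" where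
  "tensor_left_action A \<alpha> X A' \<alpha>' X' = (\<alpha> \<otimes> \<alpha>') \<cdot> interchange (und A) (und A') X X'"

definition tensor_right_action ::
    "('o, 'm) bimon \<Rightarrow> 'm \<Rightarrow> 'o \<Rightarrow> ('o, 'm) bimon \<Rightarrow> 'm \<Rightarrow> 'o \<Rightarrow> 'm" where
  "tensor_right_action A \<alpha> X A' \<alpha>' X' = (\<alpha> \<otimes> \<alpha>') \<cdot> interchange X X' (und A) (und A')"

definition tensor_left_coaction ::
    "('o, 'm) bimon \<Rightarrow> 'm \<Rightarrow> 'o \<Rightarrow> ('o, 'm) bimon \<Rightarrow> 'm \<Rightarrow> 'o \<Rightarrow> 'm" where
  "tensor_left_coaction A \<beta> Y A' \<beta>' Y' = interchange (und A) Y (und A') Y' \<cdot> (\<beta> \<otimes> \<beta>')"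

definition tensor_right_coaction ::
    "('o, 'm) bimon \<Rightarrow> 'm \<Rightarrow> 'o \<Rightarrow> ('o, 'm) bimon \<Rightarrow> 'm \<Rightarrow> 'o \<Rightarrow> 'm" where
  "tensor_right_coaction A \<beta> Y A' \<beta>' Y' = interchange Y (und A) Y' (und A') \<cdot> (\<beta> \<otimes> \<beta>')"

text \<open>
  The canonical comparison morphism is the unique \<open>c\<close> with \<open>c \<cdot> t = p \<otimes> p'\<close> (dually, with
  \<open>t \<cdot> c = e \<otimes> e'\<close>).  The comparison of units is always an isomorphism, since any action of the
  unit bimonoid is trivial.
\<close>

definition stable :: bool where
  "stable \<longleftrightarrow>
     (\<forall>A \<alpha> X A' \<alpha>' X' Q p Q' p' T t.
        left_action A \<alpha> X \<and> left_action A' \<alpha>' X' \<and>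
        left_stabilized A \<alpha> X Q p \<and> left_stabilized A' \<alpha>' X' Q' p' \<and>
        left_stabilized (tensor_bimon A A') (tensor_left_action A \<alpha> X A' \<alpha>' X') (X \<odot> X') T t
        \<longrightarrow> (\<exists>c. iso_arr \<C> T (Q \<odot> Q') c \<and> c \<cdot> t = p \<otimes> p')) \<and>
     (\<forall>A \<alpha> X A' \<alpha>' X' Q p Q' p' T t.
        right_action A \<alpha> X \<and> right_action A' \<alpha>' X' \<and>
        right_stabilized A \<alpha> X Q p \<and> right_stabilized A' \<alpha>' X' Q' p' \<and>
        right_stabilized (tensor_bimon A A') (tensor_right_action A \<alpha> X A' \<alpha>' X') (X \<odot> X') T t
        \<longrightarrow> (\<exists>c. iso_arr \<C> T (Q \<odot> Q') c \<and> c \<cdot> t = p \<otimes> p'))"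

definition costable :: bool where
  "costable \<longleftrightarrow>
     (\<forall>A \<beta> Y A' \<beta>' Y' E e E' e' T t.
        left_coaction A \<beta> Y \<and> left_coaction A' \<beta>' Y' \<and>
        left_costabilized A \<beta> Y E e \<and> left_costabilized A' \<beta>' Y' E' e' \<and>
        left_costabilized (tensor_bimon A A') (tensor_left_coaction A \<beta> Y A' \<beta>' Y') (Y \<odot> Y') T t
        \<longrightarrow> (\<exists>c. iso_arr \<C> (E \<odot> E') T c \<and> t \<cdot> c = e \<otimes> e')) \<and>
     (\<forall>A \<beta> Y A' \<beta>' Y' E e E' e' T t.
        right_coaction A \<beta> Y \<and> right_coaction A' \<beta>' Y' \<and>
        right_costabilized A \<beta> Y E e \<and> right_costabilized A' \<beta>' Y' E' e' \<and>
        right_costabilized (tensor_bimon A A') (tensor_right_coaction A \<beta> Y A' \<beta>' Y') (Y \<odot> Y') T t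
        \<longrightarrow> (\<exists>c. iso_arr \<C> (E \<odot> E') T c \<and> t \<cdot> c = e \<otimes> e'))"

definition bistable :: bool where
  "bistable \<longleftrightarrow> stable \<and> costable"


section \<open>Integrals, inverse volume and Fredholm homomorphisms\<close>

definition is_integral :: "('o, 'm) bimon \<Rightarrow> 'm \<Rightarrow> bool" where
  "is_integral A \<phi> \<longleftrightarrow> \<phi> \<in> Hom \<one> (und A) \<and>
     \<nabla>\<^bsub>A\<^esub> \<cdot> (\<phi> \<otimes> ide (und A)) = \<r> (und A) \<cdot> (\<phi> \<otimes> \<epsilon>\<^bsub>A\<^esub>) \<and>
     \<nabla>\<^bsub>A\<^esub> \<cdot> (ide (und A) \<otimes> \<phi>) = \<l> (und A) \<cdot> (\<epsilon>\<^bsub>A\<^esub> \<otimes> \<phi>)"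

definition is_cointegral :: "('o, 'm) bimon \<Rightarrow> 'm \<Rightarrow> bool" where
  "is_cointegral A \<phi> \<longleftrightarrow> \<phi> \<in> Hom (und A) \<one> \<and>
     \<l> (und A) \<cdot> (\<phi> \<otimes> ide (und A)) \<cdot> \<Delta>\<^bsub>A\<^esub> = \<eta>\<^bsub>A\<^esub> \<cdot> \<phi> \<and>
     \<r> (und A) \<cdot> (ide (und A) \<otimes> \<phi>) \<cdot> \<Delta>\<^bsub>A\<^esub> = \<eta>\<^bsub>A\<^esub> \<cdot> \<phi>"

definition integral_of :: "('o, 'm) bimon \<Rightarrow> 'm" where
  "integral_of A = (THE \<phi>. is_integral A \<phi> \<and> \<epsilon>\<^bsub>A\<^esub> \<cdot> \<phi> = ide \<one>)"

definition cointegral_of :: "('o, 'm) bimon \<Rightarrow> 'm" where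
  "cointegral_of A = (THE \<phi>. is_cointegral A \<phi> \<and> \<phi> \<cdot> \<eta>\<^bsub>A\<^esub> = ide \<one>)"

definition inv_vol :: "('o, 'm) bimon \<Rightarrow> 'm" where
  "inv_vol A = cointegral_of A \<cdot> integral_of A"

definition bracket :: "('o, 'm) bimon \<Rightarrow> ('o, 'm) bimon \<Rightarrow> 'm \<Rightarrow> 'm" where
  "bracket A B f = cointegral_of B \<cdot> f \<cdot> integral_of A"

definition Fredholm :: "('o, 'm) bimon \<Rightarrow> ('o, 'm) bimon \<Rightarrow> 'm \<Rightarrow> bool" where
  "Fredholm A B \<xi> \<longleftrightarrow>
     bc_hopf_monoid A \<and> bc_hopf_monoid B \<and> bimonoid_hom A B \<xi> \<and>
     bismall (Ker A B \<xi>) \<and> bismall (Cok A B \<xi>) \<and>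
     inv_vol (Ker A B \<xi>) \<in> Aut \<C> \<one> \<and> inv_vol (Cok A B \<xi>) \<in> Aut \<C> \<one>"

definition right_integral_along :: "('o, 'm) bimon \<Rightarrow> ('o, 'm) bimon \<Rightarrow> 'm \<Rightarrow> 'm \<Rightarrow> bool" where
  "right_integral_along A B \<xi> \<mu> \<longleftrightarrow> \<mu> \<in> Hom (und B) (und A) \<and>
     \<nabla>\<^bsub>A\<^esub> \<cdot> (\<mu> \<otimes> ide (und A)) = \<mu> \<cdot> \<nabla>\<^bsub>B\<^esub> \<cdot> (ide (und B) \<otimes> \<xi>) \<and>
     (\<mu> \<otimes> ide (und B)) \<cdot> \<Delta>\<^bsub>B\<^esub> = (ide (und A) \<otimes> \<xi>) \<cdot> \<Delta>\<^bsub>A\<^esub> \<cdot> \<mu>"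

definition left_integral_along :: "('o, 'm) bimon \<Rightarrow> ('o, 'm) bimon \<Rightarrow> 'm \<Rightarrow> 'm \<Rightarrow> bool" where
  "left_integral_along A B \<xi> \<mu> \<longleftrightarrow> \<mu> \<in> Hom (und B) (und A) \<and>
     \<nabla>\<^bsub>A\<^esub> \<cdot> (ide (und A) \<otimes> \<mu>) = \<mu> \<cdot> \<nabla>\<^bsub>B\<^esub> \<cdot> (\<xi> \<otimes> ide (und B)) \<and>
     (ide (und B) \<otimes> \<mu>) \<cdot> \<Delta>\<^bsub>B\<^esub> = (\<xi> \<otimes> ide (und A)) \<cdot> \<Delta>\<^bsub>A\<^esub> \<cdot> \<mu>"

definition integral_along :: "('o, 'm) bimon \<Rightarrow> ('o, 'm) bimon \<Rightarrow> 'm \<Rightarrow> 'm \<Rightarrow> bool" where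
  "integral_along A B \<xi> \<mu> \<longleftrightarrow> left_integral_along A B \<xi> \<mu> \<and> right_integral_along A B \<xi> \<mu>"

definition normalized_along :: "'m \<Rightarrow> 'm \<Rightarrow> bool" where
  "normalized_along \<xi> \<mu> \<longleftrightarrow> \<xi> \<cdot> \<mu> \<cdot> \<xi> = \<xi>"

definition generator_along :: "('o, 'm) bimon \<Rightarrow> ('o, 'm) bimon \<Rightarrow> 'm \<Rightarrow> 'm \<Rightarrow> bool" where
  "generator_along A B \<xi> \<mu> \<longleftrightarrow> integral_along A B \<xi> \<mu> \<and>
     (\<forall>\<mu>'. left_integral_along A B \<xi> \<mu>' \<or> right_integral_along A B \<xi> \<mu>'
        \<longrightarrow> \<mu> \<cdot> \<xi> \<cdot> \<mu>' = \<mu>' \<and> \<mu>' \<cdot> \<xi> \<cdot> \<mu> = \<mu>')"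

definition normalized_generator :: "('o, 'm) bimon \<Rightarrow> ('o, 'm) bimon \<Rightarrow> 'm \<Rightarrow> 'm" where
  "normalized_generator A B \<xi> = (THE \<mu>. generator_along A B \<xi> \<mu> \<and> normalized_along \<xi> \<mu>)"


section \<open>Cochains and the pushforward\<close>

definition omega ::
    "('o, 'm) bimon \<Rightarrow> ('o, 'm) bimon \<Rightarrow> ('o, 'm) bimon \<Rightarrow> 'm \<Rightarrow> 'm \<Rightarrow> 'm" where
  "omega A B C \<xi> \<xi>' = bracket (Ker B C \<xi>') (Cok A B \<xi>) (cok A B \<xi> \<cdot> ker B C \<xi>')"

text \<open>
  An arrow does not determine the bimonoids between which it is a homomorphism, so a cochain takes
  source, target and arrow.  Its values off the Fredholm homomorphisms are irrelevant.
\<close>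

definition normalized_1_cochain ::
    "(('o, 'm) bimon \<Rightarrow> ('o, 'm) bimon \<Rightarrow> 'm \<Rightarrow> 'm) \<Rightarrow> bool" where
  "normalized_1_cochain \<upsilon> \<longleftrightarrow>
     (\<forall>A B \<xi>. Fredholm A B \<xi> \<longrightarrow> \<upsilon> A B \<xi> \<in> Aut \<C> \<one>) \<and>
     (\<forall>A. bc_hopf_monoid A \<longrightarrow> \<upsilon> A A (ide (und A)) = ide \<one>)"

definition coboundary_is_omega ::
    "(('o, 'm) bimon \<Rightarrow> ('o, 'm) bimon \<Rightarrow> 'm \<Rightarrow> 'm) \<Rightarrow> bool" where
  "coboundary_is_omega \<upsilon> \<longleftrightarrow>
     (\<forall>A B C \<xi> \<xi>'. Fredholm A B \<xi> \<and> Fredholm B C \<xi>' \<longrightarrow>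
        \<upsilon> A B \<xi> \<cdot> \<upsilon> B C \<xi>' = omega A B C \<xi> \<xi>' \<cdot> \<upsilon> A C (\<xi>' \<cdot> \<xi>))"

definition pushforward ::
    "(('o, 'm) bimon \<Rightarrow> ('o, 'm) bimon \<Rightarrow> 'm \<Rightarrow> 'm) \<Rightarrow> ('o, 'm) bimon \<Rightarrow> ('o, 'm) bimon \<Rightarrow> 'm \<Rightarrow> 'm" where
  "pushforward \<upsilon> A B \<xi> =
     scale (und B) (und A) (inv_arr \<C> \<one> \<one> (\<upsilon> A B \<xi>)) (normalized_generator A B \<xi>)"

end

end

theory Submission
  imports Defs
begin

text \<open>
  Write \<open>\<zeta> = \<xi>' \<circ> \<xi>\<close>, and \<open>k, q\<close> (resp. \<open>k', q'\<close>) for the kernel and cokernel of \<open>\<xi> : A \<rightarrow> B\<close> (resp. of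
  \<open>\<xi>' : B \<rightarrow> C\<close>).

  The generator \<open>\<mu>\<^sub>\<xi>\<close> is explicit.  In the abelian category of bicommutative Hopf monoids \<open>\<xi> = m \<circ> x\<close>, where \<open>x\<close> is
  the cokernel of \<open>k\<close> and \<open>m\<close> the kernel of \<open>q\<close>.  By stability \<open>x\<close> is also a coequalizer in \<open>\<C>\<close>
  (\<open>cokernel_action_quotient\<close>), so translation by \<open>k \<circ> \<sigma>\<close>, for the normalized integral \<open>\<sigma>\<close> of \<open>Ker \<xi>\<close>, factors as
  \<open>s \<circ> x\<close>, and \<open>s\<close> is a section of \<open>x\<close> (\<open>integral_section\<close>).  Dually, the normalized cointegral \<open>\<phi>\<close> of \<open>Cok \<xi>\<close> yields a
  retraction \<open>r\<close> of \<open>m\<close>.  Then \<open>\<mu>\<^sub>\<xi> = s \<circ> r\<close>: both \<open>\<mu>\<^sub>\<xi> \<circ> \<xi>\<close>, which is translation by \<open>k \<circ> \<sigma>\<close>, and \<open>\<xi> \<circ> \<mu>\<^sub>\<xi>\<close>, which is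
  contraction with \<open>\<phi> \<circ> q\<close>, are absorbed by every integral along \<open>\<xi>\<close> (\<open>gen_int_exists\<close>, \<open>gen_int_absorb\<close>).

  The composite \<open>\<mu>\<^sub>\<xi> \<circ> \<mu>\<^sub>\<xi>\<^sub>'\<close> is an integral along \<open>\<zeta>\<close>, hence equal to
  \<open>\<mu>\<^sub>\<zeta> \<circ> (\<zeta> \<circ> \<mu>\<^sub>\<xi> \<circ> \<mu>\<^sub>\<xi>\<^sub>' \<circ> \<zeta>) \<circ> \<mu>\<^sub>\<zeta>\<close>.  Between \<open>\<xi>'\<close> and \<open>\<xi>\<close> the middle factor is a contraction after a translation, and
  pushing the contraction through the translation gives \<open>\<zeta> \<circ> \<mu>\<^sub>\<xi> \<circ> \<mu>\<^sub>\<xi>\<^sub>' \<circ> \<zeta> = \<omega>(\<xi>, \<xi>') \<cdot> \<zeta>\<close>.  So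
  \<open>\<mu>\<^sub>\<xi> \<circ> \<mu>\<^sub>\<xi>\<^sub>' = \<omega>(\<xi>, \<xi>') \<cdot> \<mu>\<^sub>\<zeta>\<close> (\<open>gen_int_comp\<close>), and the cochain \<open>\<upsilon>\<close> is made to remove this scalar.

  It remains to see that \<open>\<zeta>\<close> is Fredholm.  The kernel of \<open>\<zeta>\<close> is an extension of \<open>I = Ker(q \<circ> k')\<close> by \<open>Ker \<xi>\<close>
  (\<open>kernel_of_composite\<close>), and normalized integrals, normalized cointegrals and inverse volumes are multiplicative in
  extensions (\<open>unit_volume_extension\<close>).  On \<open>I\<close> there is an integral whose counit is the scalar \<open>\<langle>q \<circ> k'\<rangle>\<close>, so everything
  depends on the invertibility of this scalar (\<open>bracket_invertible\<close>).

  That is the main point: if \<open>f : A \<rightarrow> Q\<close> is a homomorphism between Hopf monoids of invertible volume, then \<open>\<langle>f\<rangle>\<close> is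
  invertible.  For group algebras \<open>\<langle>f\<rangle>\<close> is the inverse of the order of the image of \<open>f\<close>, that is, of the dimension of the
  group algebra \<open>J\<close> of the image, which suggests exhibiting the inverse as a trace.  Invertible volume makes \<open>A\<close> and \<open>Q\<close>
  Frobenius objects, hence self-dual (\<open>hopf_frobenius\<close>).  As a quotient of \<open>A\<close> and a subobject of \<open>Q\<close>, the image \<open>J\<close> is
  paired with the object \<open>V\<close> of elements of \<open>A\<close> that are invariant under \<open>Ker f\<close>, and the composite
  \<open>\<one> \<rightarrow> J \<otimes> V \<rightarrow> \<one>\<close> of a coevaluation and an evaluation inverts \<open>\<langle>f\<rangle>\<close> up to the two volumes.

  The statement about cokernels is the statement about kernels in the opposite category, with multiplication and
  comultiplication exchanged (\<open>op_hopf_setting\<close>).  Smallness enters only through its equivalence with the existence of a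
  normalized integral (\<open>small_imp_integral\<close>, \<open>integral_imp_small\<close>).
\<close>


section \<open>Arrows that know their source and target\<close>

text \<open>
  A morphism of \<open>\<C>\<close> does not determine its source and target, so that every equation between composites carries membership
  conditions.  Equational reasoning therefore uses triples of source, morphism and target.  Ill-typed composites and
  tensor products are the extra element \<open>None\<close>, which makes composition associative without side conditions and leaves
  the bookkeeping of sources and targets to the simplifier.
\<close>

type_synonym ('o, 'm) arrow = "('o \<times> 'm \<times> 'o) option"

definition mk :: "'o \<Rightarrow> 'm \<Rightarrow> 'o \<Rightarrow> ('o, 'm) arrow" where
  "mk X f Y = Some (X, f, Y)"

definition dm :: "('o, 'm) arrow \<Rightarrow> 'o" where "dm a = fst (the a)"
definition mor :: "('o, 'm) arrow \<Rightarrow> 'm" where "mor a = fst (snd (the a))"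
definition cd :: "('o, 'm) arrow \<Rightarrow> 'o" where "cd a = snd (snd (the a))"

lemma mk_sel [simp]: "dm (mk X f Y) = X" "mor (mk X f Y) = f" "cd (mk X f Y) = Y"
  by (auto simp: mk_def dm_def mor_def cd_def)

lemma mk_inject [simp]: "mk X f Y = mk X' g Y' \<longleftrightarrow> X = X' \<and> f = g \<and> Y = Y'"
  by (auto simp: mk_def)

context category
begin

lemma is_inverse_unique:
  assumes "f \<in> Hom X Y" "is_inverse \<C> X Y f g" "is_inverse \<C> X Y f h"
  shows "g = h"
proof -
  have g: "g \<in> Hom Y X" "g \<cdot> f = ide X" and h: "h \<in> Hom Y X" "f \<cdot> h = ide Y"
    using assms unfolding is_inverse_def by auto
  have "g = g \<cdot> (f \<cdot> h)" using g h by (simp add: comp_ide_right)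
  also have "\<dots> = (g \<cdot> f) \<cdot> h" using comp_assoc[OF h(1) assms(1) g(1)] by simp
  also have "\<dots> = h" using g h by (simp add: comp_ide_left)
  finally show ?thesis .
qed

lemma inv_arr_is_inverse:
  assumes "iso_arr \<C> X Y f"
  shows "is_inverse \<C> X Y f (inv_arr \<C> X Y f)"
proof -
  have "f \<in> Hom X Y" and "\<exists>g. is_inverse \<C> X Y f g" using assms unfolding iso_arr_def by auto
  then have "\<exists>!g. is_inverse \<C> X Y f g" using is_inverse_unique by blast
  then show ?thesis unfolding inv_arr_def by (rule theI')
qed

lemma inv_arr_eqI:
  assumes "f \<in> Hom X Y" "is_inverse \<C> X Y f g"
  shows "inv_arr \<C> X Y f = g"
  using inv_arr_is_inverse[of X Y f] is_inverse_unique[OF assms(1)] assms unfolding iso_arr_def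
  by blast

end

context symmetric_monoidal_category
begin

definition arr :: "('o, 'm) arrow \<Rightarrow> bool" where
  "arr a \<longleftrightarrow> a \<noteq> None \<and> mor a \<in> Hom (dm a) (cd a)"

definition cmp :: "('o, 'm) arrow \<Rightarrow> ('o, 'm) arrow \<Rightarrow> ('o, 'm) arrow" (infixr "\<bullet>" 55) where
  "b \<bullet> a = (if arr a \<and> arr b \<and> dm b = cd a then mk (dm a) (mor b \<cdot> mor a) (cd b) else None)"

definition tns :: "('o, 'm) arrow \<Rightarrow> ('o, 'm) arrow \<Rightarrow> ('o, 'm) arrow" (infixr "\<star>" 70) where
  "a \<star> b = (if arr a \<and> arr b then mk (dm a \<odot> dm b) (mor a \<otimes> mor b) (cd a \<odot> cd b) else None)"

lemma arr_mk [simp]: "arr (mk X f Y) \<longleftrightarrow> f \<in> Hom X Y"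
  unfolding arr_def by (simp add: mk_def dm_def mor_def cd_def)

lemma not_arr_None [simp]: "\<not> arr None" by (simp add: arr_def)

lemma mk_mor [simp]: "arr a \<Longrightarrow> mk (dm a) (mor a) (cd a) = a"
  by (cases a) (auto simp: arr_def mk_def dm_def mor_def cd_def)

lemma mor_hom: "arr a \<Longrightarrow> mor a \<in> Hom (dm a) (cd a)" by (simp add: arr_def)

lemma mor_hom' [simp]: "arr a \<Longrightarrow> dm a = X \<Longrightarrow> cd a = Y \<Longrightarrow> mor a \<in> Hom X Y"
  by (simp add: arr_def)

lemma dm_ob [simp]: "arr a \<Longrightarrow> dm a \<in> ob \<C>" and cd_ob [simp]: "arr a \<Longrightarrow> cd a \<in> ob \<C>"
  using hom_ob unfolding arr_def by blast+

lemma arr_cmp [simp]: "arr (b \<bullet> a) \<longleftrightarrow> arr a \<and> arr b \<and> dm b = cd a"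
  using comp_hom[OF mor_hom[of a], of "mor b" "cd b"] by (auto simp: cmp_def mor_hom dest: mor_hom)

lemma cmp_sel [simp]:
  assumes "arr a" "arr b" "dm b = cd a"
  shows "dm (b \<bullet> a) = dm a" "cd (b \<bullet> a) = cd b" "mor (b \<bullet> a) = mor b \<cdot> mor a"
  using assms by (auto simp: cmp_def)

lemma arr_tns [simp]: "arr (a \<star> b) \<longleftrightarrow> arr a \<and> arr b"
  by (auto simp: tns_def tensor_hom mor_hom)

lemma tns_sel [simp]:
  assumes "arr a" "arr b"
  shows "dm (a \<star> b) = dm a \<odot> dm b" "cd (a \<star> b) = cd a \<odot> cd b" "mor (a \<star> b) = mor a \<otimes> mor b"
  using assms by (auto simp: tns_def)

lemma arr_eqI:
  "arr a \<Longrightarrow> arr b \<Longrightarrow> dm a = dm b \<Longrightarrow> cd a = cd b \<Longrightarrow> mor a = mor b \<Longrightarrow> a = b"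
  by (metis mk_mor)

lemma cmp_None: "\<not> arr (b \<bullet> a) \<Longrightarrow> b \<bullet> a = None"
  unfolding arr_cmp by (auto simp: cmp_def)

lemma tns_None: "\<not> arr (b \<star> a) \<Longrightarrow> b \<star> a = None"
  unfolding arr_tns by (auto simp: tns_def)

lemma cmp_assoc: "(c \<bullet> b) \<bullet> a = c \<bullet> (b \<bullet> a)"
proof (cases "arr a \<and> arr b \<and> arr c \<and> dm b = cd a \<and> dm c = cd b")
  case True
  then show ?thesis
    by (intro arr_eqI) (auto intro!: comp_assoc mor_hom')
next
  case False
  then have "\<not> arr ((c \<bullet> b) \<bullet> a)" "\<not> arr (c \<bullet> (b \<bullet> a))" by auto
  then show ?thesis by (metis cmp_None)
qed

text \<open>
  Since composites are bracketed to the right, an equation \<open>b \<bullet> a = c\<close> has to be applied in this form in the middle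
  of a longer composite.
\<close>

lemma cmp_eq_assoc: "b \<bullet> a = c \<Longrightarrow> b \<bullet> (a \<bullet> x) = c \<bullet> x"
  by (metis cmp_assoc)

definition Id :: "'o \<Rightarrow> ('o, 'm) arrow" where "Id X = mk X (ide X) X"
definition As :: "'o \<Rightarrow> 'o \<Rightarrow> 'o \<Rightarrow> ('o, 'm) arrow" where
  "As X Y Z = mk ((X \<odot> Y) \<odot> Z) (\<a> X Y Z) (X \<odot> Y \<odot> Z)"
definition As' :: "'o \<Rightarrow> 'o \<Rightarrow> 'o \<Rightarrow> ('o, 'm) arrow" where
  "As' X Y Z = mk (X \<odot> Y \<odot> Z) (assoc_inv \<C> X Y Z) ((X \<odot> Y) \<odot> Z)"
definition Lu :: "'o \<Rightarrow> ('o, 'm) arrow" where "Lu X = mk (\<one> \<odot> X) (\<l> X) X"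
definition Lu' :: "'o \<Rightarrow> ('o, 'm) arrow" where "Lu' X = mk X (lunit_inv \<C> X) (\<one> \<odot> X)"
definition Ru :: "'o \<Rightarrow> ('o, 'm) arrow" where "Ru X = mk (X \<odot> \<one>) (\<r> X) X"
definition Ru' :: "'o \<Rightarrow> ('o, 'm) arrow" where "Ru' X = mk X (runit_inv \<C> X) (X \<odot> \<one>)"
definition Sy :: "'o \<Rightarrow> 'o \<Rightarrow> ('o, 'm) arrow" where "Sy X Y = mk (X \<odot> Y) (\<s> X Y) (Y \<odot> X)"

lemma struct_sel [simp]:
  "dm (Id X) = X" "cd (Id X) = X" "mor (Id X) = ide X"
  "dm (As X Y Z) = (X \<odot> Y) \<odot> Z" "cd (As X Y Z) = X \<odot> Y \<odot> Z" "mor (As X Y Z) = \<a> X Y Z"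
  "dm (As' X Y Z) = X \<odot> Y \<odot> Z" "cd (As' X Y Z) = (X \<odot> Y) \<odot> Z" "mor (As' X Y Z) = assoc_inv \<C> X Y Z"
  "dm (Lu X) = \<one> \<odot> X" "cd (Lu X) = X" "mor (Lu X) = \<l> X"
  "dm (Lu' X) = X" "cd (Lu' X) = \<one> \<odot> X" "mor (Lu' X) = lunit_inv \<C> X"
  "dm (Ru X) = X \<odot> \<one>" "cd (Ru X) = X" "mor (Ru X) = \<r> X"
  "dm (Ru' X) = X" "cd (Ru' X) = X \<odot> \<one>" "mor (Ru' X) = runit_inv \<C> X"
  "dm (Sy X Y) = X \<odot> Y" "cd (Sy X Y) = Y \<odot> X" "mor (Sy X Y) = \<s> X Y"
  by (auto simp: Id_def As_def As'_def Lu_def Lu'_def Ru_def Ru'_def Sy_def)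

lemma assoc_inv_is_inverse:
  "X \<in> ob \<C> \<Longrightarrow> Y \<in> ob \<C> \<Longrightarrow> Z \<in> ob \<C> \<Longrightarrow>
     is_inverse \<C> ((X \<odot> Y) \<odot> Z) (X \<odot> Y \<odot> Z) (\<a> X Y Z) (assoc_inv \<C> X Y Z)"
  unfolding assoc_inv_def by (intro inv_arr_is_inverse assoc_iso)

lemma lunit_inv_is_inverse:
  "X \<in> ob \<C> \<Longrightarrow> is_inverse \<C> (\<one> \<odot> X) X (\<l> X) (lunit_inv \<C> X)"
  unfolding lunit_inv_def by (intro inv_arr_is_inverse lunit_iso)

lemma runit_inv_is_inverse:
  "X \<in> ob \<C> \<Longrightarrow> is_inverse \<C> (X \<odot> \<one>) X (\<r> X) (runit_inv \<C> X)"
  unfolding runit_inv_def by (intro inv_arr_is_inverse runit_iso)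

lemma tensor_ob [simp]: "X \<in> ob \<C> \<Longrightarrow> Y \<in> ob \<C> \<Longrightarrow> X \<odot> Y \<in> ob \<C>"
  by (rule tensor_ob_closed)

lemma unit_ob [simp]: "\<one> \<in> ob \<C>" by (rule unit_ob_closed)

lemma struct_arr [simp]:
  "X \<in> ob \<C> \<Longrightarrow> arr (Id X)"
  "X \<in> ob \<C> \<Longrightarrow> Y \<in> ob \<C> \<Longrightarrow> Z \<in> ob \<C> \<Longrightarrow> arr (As X Y Z)"
  "X \<in> ob \<C> \<Longrightarrow> Y \<in> ob \<C> \<Longrightarrow> Z \<in> ob \<C> \<Longrightarrow> arr (As' X Y Z)"
  "X \<in> ob \<C> \<Longrightarrow> arr (Lu X)"
  "X \<in> ob \<C> \<Longrightarrow> arr (Lu' X)"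
  "X \<in> ob \<C> \<Longrightarrow> arr (Ru X)"
  "X \<in> ob \<C> \<Longrightarrow> arr (Ru' X)"
  "X \<in> ob \<C> \<Longrightarrow> Y \<in> ob \<C> \<Longrightarrow> arr (Sy X Y)"
  using assoc_iso lunit_iso runit_iso assoc_inv_is_inverse lunit_inv_is_inverse runit_inv_is_inverse
  unfolding Id_def As_def As'_def Lu_def Lu'_def Ru_def Ru'_def Sy_def
  by (auto simp: ide_hom symm_hom iso_arr_def is_inverse_def)

lemma Id_cmp [simp]: "cd a = X \<Longrightarrow> Id X \<bullet> a = a" if "arr a"
  using that by (intro arr_eqI) (auto intro!: comp_ide_left mor_hom')

lemma cmp_Id [simp]: "dm a = X \<Longrightarrow> a \<bullet> Id X = a" if "arr a"
  using that by (intro arr_eqI) (auto intro!: comp_ide_right mor_hom')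

lemma Id_cmp2 [simp]: "arr a \<Longrightarrow> cd a = X \<Longrightarrow> arr b \<Longrightarrow> Id X \<bullet> (a \<bullet> b) = a \<bullet> b"
  by (metis Id_cmp cmp_assoc)

lemma Id_tns_Id [simp]: "X \<in> ob \<C> \<Longrightarrow> Y \<in> ob \<C> \<Longrightarrow> Id X \<star> Id Y = Id (X \<odot> Y)"
  by (intro arr_eqI) (auto intro!: tensor_ide)

lemma struct_inv [simp]:
  "X \<in> ob \<C> \<Longrightarrow> Y \<in> ob \<C> \<Longrightarrow> Z \<in> ob \<C> \<Longrightarrow> As' X Y Z \<bullet> As X Y Z = Id ((X \<odot> Y) \<odot> Z)"
  "X \<in> ob \<C> \<Longrightarrow> Y \<in> ob \<C> \<Longrightarrow> Z \<in> ob \<C> \<Longrightarrow> As X Y Z \<bullet> As' X Y Z = Id (X \<odot> Y \<odot> Z)"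
  "X \<in> ob \<C> \<Longrightarrow> Lu' X \<bullet> Lu X = Id (\<one> \<odot> X)"
  "X \<in> ob \<C> \<Longrightarrow> Lu X \<bullet> Lu' X = Id X"
  "X \<in> ob \<C> \<Longrightarrow> Ru' X \<bullet> Ru X = Id (X \<odot> \<one>)"
  "X \<in> ob \<C> \<Longrightarrow> Ru X \<bullet> Ru' X = Id X"
  "X \<in> ob \<C> \<Longrightarrow> Y \<in> ob \<C> \<Longrightarrow> Sy Y X \<bullet> Sy X Y = Id (X \<odot> Y)"
  using assoc_inv_is_inverse[of X Y Z] lunit_inv_is_inverse[of X] runit_inv_is_inverse[of X]
  by (auto intro!: arr_eqI symm_symm simp: is_inverse_def)

lemmas struct_inv2 [simp] = struct_inv [THEN cmp_eq_assoc]

lemma tns_cmp: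
  assumes "dm a = cd b" "dm c = cd d"
  shows "(a \<star> c) \<bullet> (b \<star> d) = (a \<bullet> b) \<star> (c \<bullet> d)"
proof (cases "arr a \<and> arr b \<and> arr c \<and> arr d")
  case True
  then show ?thesis using assms
    by (intro arr_eqI) (auto intro!: tensor_comp[symmetric] mor_hom')
next
  case False
  then have "\<not> arr ((a \<star> c) \<bullet> (b \<star> d))" "\<not> arr ((a \<bullet> b) \<star> (c \<bullet> d))" by auto
  then show ?thesis by (metis cmp_None tns_None)
qed

lemma tns_cmp2:
  "dm a = cd b \<Longrightarrow> dm c = cd d \<Longrightarrow> (a \<star> c) \<bullet> ((b \<star> d) \<bullet> x) = ((a \<bullet> b) \<star> (c \<bullet> d)) \<bullet> x"
  by (metis tns_cmp cmp_assoc)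

lemma As_nat:
  assumes "arr a" "arr b" "arr c" "cd a = X" "cd b = Y" "cd c = Z"
  shows "As X Y Z \<bullet> ((a \<star> b) \<star> c) = (a \<star> (b \<star> c)) \<bullet> As (dm a) (dm b) (dm c)"
  using assms by (intro arr_eqI) (auto intro!: assoc_natural mor_hom')

lemma As'_nat:
  assumes "arr a" "arr b" "arr c" "cd a = X" "cd b = Y" "cd c = Z"
  shows "As' X Y Z \<bullet> (a \<star> (b \<star> c)) = ((a \<star> b) \<star> c) \<bullet> As' (dm a) (dm b) (dm c)"
proof -
  have ob: "X \<in> ob \<C>" "Y \<in> ob \<C>" "Z \<in> ob \<C>" using assms by auto
  have "As' X Y Z \<bullet> (a \<star> (b \<star> c))
      = As' X Y Z \<bullet> (As X Y Z \<bullet> ((a \<star> b) \<star> c)) \<bullet> As' (dm a) (dm b) (dm c)"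
    using assms ob by (simp add: As_nat cmp_assoc)
  then show ?thesis using assms ob by (simp add: cmp_assoc)
qed

lemma Lu_nat: "arr a \<Longrightarrow> cd a = X \<Longrightarrow> Lu X \<bullet> (Id \<one> \<star> a) = a \<bullet> Lu (dm a)"
  by (intro arr_eqI) (auto intro!: lunit_natural mor_hom')

lemma Ru_nat: "arr a \<Longrightarrow> cd a = X \<Longrightarrow> Ru X \<bullet> (a \<star> Id \<one>) = a \<bullet> Ru (dm a)"
  by (intro arr_eqI) (auto intro!: runit_natural mor_hom')

lemma Lu'_nat: assumes "arr a" "cd a = X" shows "Lu' X \<bullet> a = (Id \<one> \<star> a) \<bullet> Lu' (dm a)"
proof -
  have "Lu X \<bullet> ((Id \<one> \<star> a) \<bullet> Lu' (dm a)) = a"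
    using assms by (simp add: cmp_eq_assoc[OF Lu_nat[OF assms]] cmp_assoc)
  then have "Lu' X \<bullet> a = Lu' X \<bullet> (Lu X \<bullet> ((Id \<one> \<star> a) \<bullet> Lu' (dm a)))" by simp
  then show ?thesis using assms cd_ob[OF assms(1)] by simp
qed

lemma Ru'_nat: assumes "arr a" "cd a = X" shows "Ru' X \<bullet> a = (a \<star> Id \<one>) \<bullet> Ru' (dm a)"
proof -
  have "Ru X \<bullet> ((a \<star> Id \<one>) \<bullet> Ru' (dm a)) = a"
    using assms by (simp add: cmp_eq_assoc[OF Ru_nat[OF assms]] cmp_assoc)
  then have "Ru' X \<bullet> a = Ru' X \<bullet> (Ru X \<bullet> ((a \<star> Id \<one>) \<bullet> Ru' (dm a)))" by simp
  then show ?thesis using assms cd_ob[OF assms(1)] by simp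
qed

lemma Sy_nat:
  "arr a \<Longrightarrow> arr b \<Longrightarrow> cd a = X \<Longrightarrow> cd b = Y \<Longrightarrow> Sy X Y \<bullet> (a \<star> b) = (b \<star> a) \<bullet> Sy (dm a) (dm b)"
  by (intro arr_eqI) (auto intro!: symm_natural mor_hom')

lemma triangle': "X \<in> ob \<C> \<Longrightarrow> Y \<in> ob \<C> \<Longrightarrow> (Id X \<star> Lu Y) \<bullet> As X \<one> Y = Ru X \<star> Id Y"
  by (intro arr_eqI) (auto intro!: triangle)

lemma pentagon':
  "X \<in> ob \<C> \<Longrightarrow> Y \<in> ob \<C> \<Longrightarrow> Z \<in> ob \<C> \<Longrightarrow> W \<in> ob \<C> \<Longrightarrow>
    As X Y (Z \<odot> W) \<bullet> As (X \<odot> Y) Z W = (Id X \<star> As Y Z W) \<bullet> As X (Y \<odot> Z) W \<bullet> (As X Y Z \<star> Id W)"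
  by (intro arr_eqI) (auto intro!: pentagon)

lemma hexagon':
  "X \<in> ob \<C> \<Longrightarrow> Y \<in> ob \<C> \<Longrightarrow> Z \<in> ob \<C> \<Longrightarrow>
    As Y Z X \<bullet> Sy X (Y \<odot> Z) \<bullet> As X Y Z = (Id Y \<star> Sy X Z) \<bullet> As Y X Z \<bullet> (Sy X Y \<star> Id Z)"
  by (intro arr_eqI) (auto intro!: hexagon)

end


context symmetric_monoidal_category
begin

section \<open>Coherence\<close>

lemma cancel_unit_tns:
  assumes "arr a" "arr b" "dm a = dm b" "Id \<one> \<star> a = Id \<one> \<star> b" "cd a = cd b"
  shows "a = b"
proof -
  have "a \<bullet> Lu (dm a) = Lu (cd a) \<bullet> (Id \<one> \<star> a)" by (rule Lu_nat[symmetric]) (rule assms refl)+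
  also have "\<dots> = Lu (cd a) \<bullet> (Id \<one> \<star> b)" using assms(4) by (rule arg_cong)
  also have "\<dots> = b \<bullet> Lu (dm b)" using assms(2) assms(5)[symmetric] by (rule Lu_nat)
  finally have "a \<bullet> Lu (dm a) = b \<bullet> Lu (dm a)" unfolding assms(3) .
  then have "(a \<bullet> Lu (dm a)) \<bullet> Lu' (dm a) = (b \<bullet> Lu (dm a)) \<bullet> Lu' (dm a)" by simp
  then show ?thesis using assms dm_ob[OF assms(1)] dm_ob[OF assms(2)] by (simp add: cmp_assoc)
qed

lemma cancel_tns_unit:
  assumes "arr a" "arr b" "dm a = dm b" "a \<star> Id \<one> = b \<star> Id \<one>" "cd a = cd b"
  shows "a = b"
proof -
  have "a \<bullet> Ru (dm a) = Ru (cd a) \<bullet> (a \<star> Id \<one>)" by (rule Ru_nat[symmetric]) (rule assms refl)+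
  also have "\<dots> = Ru (cd a) \<bullet> (b \<star> Id \<one>)" using assms(4) by (rule arg_cong)
  also have "\<dots> = b \<bullet> Ru (dm b)" using assms(2) assms(5)[symmetric] by (rule Ru_nat)
  finally have "a \<bullet> Ru (dm a) = b \<bullet> Ru (dm a)" unfolding assms(3) .
  then have "(a \<bullet> Ru (dm a)) \<bullet> Ru' (dm a) = (b \<bullet> Ru (dm a)) \<bullet> Ru' (dm a)" by simp
  then show ?thesis using assms dm_ob[OF assms(1)] dm_ob[OF assms(2)] by (simp add: cmp_assoc)
qed

text \<open>
  The unit laws that do not occur among the axioms are obtained by Kelly's argument: the two sides agree after tensoring
  with \<open>\<one>\<close>, by the pentagon and the triangle, and tensoring with \<open>\<one>\<close> is faithful.
\<close>

lemma Lu_tns: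
  assumes [simp]: "X \<in> ob \<C>" "Y \<in> ob \<C>"
  shows "Lu (X \<odot> Y) \<bullet> As \<one> X Y = Lu X \<star> Id Y"
proof -
  let ?p = "As \<one> \<one> (X \<odot> Y) \<bullet> As (\<one> \<odot> \<one>) X Y"
  have p: "?p = (Id \<one> \<star> As \<one> X Y) \<bullet> As \<one> (\<one> \<odot> X) Y \<bullet> (As \<one> \<one> X \<star> Id Y)"
    by (rule pentagon') auto
  have "(Id \<one> \<star> (Lu (X \<odot> Y) \<bullet> As \<one> X Y)) \<bullet> As \<one> (\<one> \<odot> X) Y \<bullet> (As \<one> \<one> X \<star> Id Y)
      = (Id \<one> \<star> Lu (X \<odot> Y)) \<bullet> ?p"
    unfolding p by (simp add: tns_cmp2)
  also have "\<dots> = (Ru \<one> \<star> Id (X \<odot> Y)) \<bullet> As (\<one> \<odot> \<one>) X Y"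
    by (simp add: cmp_eq_assoc[OF triangle'])
  also have "\<dots> = As \<one> X Y \<bullet> ((Ru \<one> \<star> Id X) \<star> Id Y)"
    by (simp add: As_nat)
  also have "\<dots> = As \<one> X Y \<bullet> (((Id \<one> \<star> Lu X) \<bullet> As \<one> \<one> X) \<star> Id Y)"
    by (simp add: triangle')
  also have "\<dots> = As \<one> X Y \<bullet> ((Id \<one> \<star> Lu X) \<star> Id Y) \<bullet> (As \<one> \<one> X \<star> Id Y)"
    by (simp add: tns_cmp)
  also have "\<dots> = (Id \<one> \<star> (Lu X \<star> Id Y)) \<bullet> As \<one> (\<one> \<odot> X) Y \<bullet> (As \<one> \<one> X \<star> Id Y)"
    by (simp add: cmp_eq_assoc[OF As_nat] cmp_assoc)
  finally have "((Id \<one> \<star> (Lu (X \<odot> Y) \<bullet> As \<one> X Y)) \<bullet> As \<one> (\<one> \<odot> X) Y \<bullet> (As \<one> \<one> X \<star> Id Y))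
        \<bullet> (As' \<one> \<one> X \<star> Id Y) \<bullet> As' \<one> (\<one> \<odot> X) Y
      = ((Id \<one> \<star> (Lu X \<star> Id Y)) \<bullet> As \<one> (\<one> \<odot> X) Y \<bullet> (As \<one> \<one> X \<star> Id Y))
        \<bullet> (As' \<one> \<one> X \<star> Id Y) \<bullet> As' \<one> (\<one> \<odot> X) Y" by simp
  then have "Id \<one> \<star> (Lu (X \<odot> Y) \<bullet> As \<one> X Y) = Id \<one> \<star> (Lu X \<star> Id Y)"
    by (simp add: cmp_assoc tns_cmp tns_cmp2)
  then show ?thesis by (rule cancel_unit_tns[rotated 3]) simp_all
qed

lemma Ru_tns:
  assumes [simp]: "X \<in> ob \<C>" "Y \<in> ob \<C>"
  shows "(Id X \<star> Ru Y) \<bullet> As X Y \<one> = Ru (X \<odot> Y)"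
proof -
  have "As X Y \<one> \<bullet> (((Id X \<star> Ru Y) \<bullet> As X Y \<one>) \<star> Id \<one>)
      = As X Y \<one> \<bullet> ((Id X \<star> Ru Y) \<star> Id \<one>) \<bullet> (As X Y \<one> \<star> Id \<one>)"
    by (simp add: tns_cmp)
  also have "\<dots> = (Id X \<star> (Ru Y \<star> Id \<one>)) \<bullet> As X (Y \<odot> \<one>) \<one> \<bullet> (As X Y \<one> \<star> Id \<one>)"
    by (simp add: cmp_eq_assoc[OF As_nat] cmp_assoc)
  also have "\<dots> = (Id X \<star> ((Id Y \<star> Lu \<one>) \<bullet> As Y \<one> \<one>)) \<bullet> As X (Y \<odot> \<one>) \<one> \<bullet> (As X Y \<one> \<star> Id \<one>)"
    by (simp add: triangle')
  also have "\<dots> = (Id X \<star> (Id Y \<star> Lu \<one>)) \<bullet> (Id X \<star> As Y \<one> \<one>) \<bullet> As X (Y \<odot> \<one>) \<one> \<bullet> (As X Y \<one> \<star> Id \<one>)"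
    by (simp add: tns_cmp2)
  also have "\<dots> = (Id X \<star> (Id Y \<star> Lu \<one>)) \<bullet> As X Y (\<one> \<odot> \<one>) \<bullet> As (X \<odot> Y) \<one> \<one>"
    by (subst pentagon'[symmetric]) auto
  also have "\<dots> = As X Y \<one> \<bullet> (Id (X \<odot> Y) \<star> Lu \<one>) \<bullet> As (X \<odot> Y) \<one> \<one>"
    using As_nat[of "Id X" "Id Y" "Lu \<one>" X Y \<one>] by (simp add: cmp_assoc[symmetric])
  also have "\<dots> = As X Y \<one> \<bullet> (Ru (X \<odot> Y) \<star> Id \<one>)"
    by (simp add: triangle')
  finally have "As' X Y \<one> \<bullet> As X Y \<one> \<bullet> (((Id X \<star> Ru Y) \<bullet> As X Y \<one>) \<star> Id \<one>)
      = As' X Y \<one> \<bullet> As X Y \<one> \<bullet> (Ru (X \<odot> Y) \<star> Id \<one>)" by simp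
  then have "((Id X \<star> Ru Y) \<bullet> As X Y \<one>) \<star> Id \<one> = Ru (X \<odot> Y) \<star> Id \<one>" by simp
  then show ?thesis by (rule cancel_tns_unit[rotated 3]) simp_all
qed

lemma Lu_unit_tns: "X \<in> ob \<C> \<Longrightarrow> Lu (\<one> \<odot> X) = Id \<one> \<star> Lu X"
proof -
  assume [simp]: "X \<in> ob \<C>"
  have "Lu X \<bullet> Lu (\<one> \<odot> X) = Lu X \<bullet> (Id \<one> \<star> Lu X)" by (simp add: Lu_nat)
  then have "Lu' X \<bullet> Lu X \<bullet> Lu (\<one> \<odot> X) = Lu' X \<bullet> Lu X \<bullet> (Id \<one> \<star> Lu X)" by simp
  then show ?thesis by simp
qed

lemma Lu_Ru: "Lu \<one> = Ru \<one>"
proof -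
  have "Lu \<one> \<star> Id \<one> = (Id \<one> \<star> Lu \<one>) \<bullet> As \<one> \<one> \<one>"
    using Lu_tns[of \<one> \<one>] Lu_unit_tns[of \<one>] by simp
  also have "\<dots> = Ru \<one> \<star> Id \<one>" by (simp add: triangle')
  finally show ?thesis by (rule cancel_tns_unit[rotated 3]) simp_all
qed

lemma Lu_Sy: assumes [simp]: "X \<in> ob \<C>" shows "Lu X \<bullet> Sy X \<one> = Ru X"
proof -
  have "Sy X \<one> \<bullet> (Ru X \<star> Id \<one>) = Sy X \<one> \<bullet> (Id X \<star> Lu \<one>) \<bullet> As X \<one> \<one>"
    by (simp add: triangle')
  also have "\<dots> = (Lu \<one> \<star> Id X) \<bullet> Sy X (\<one> \<odot> \<one>) \<bullet> As X \<one> \<one>"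
    using Sy_nat[of "Id X" "Lu \<one>" X \<one>] by (simp add: cmp_assoc[symmetric])
  also have "\<dots> = Lu (\<one> \<odot> X) \<bullet> As \<one> \<one> X \<bullet> Sy X (\<one> \<odot> \<one>) \<bullet> As X \<one> \<one>"
    by (simp add: Lu_tns[symmetric] cmp_assoc)
  also have "\<dots> = Lu (\<one> \<odot> X) \<bullet> (Id \<one> \<star> Sy X \<one>) \<bullet> As \<one> X \<one> \<bullet> (Sy X \<one> \<star> Id \<one>)"
    by (simp add: hexagon')
  also have "\<dots> = Sy X \<one> \<bullet> Lu (X \<odot> \<one>) \<bullet> As \<one> X \<one> \<bullet> (Sy X \<one> \<star> Id \<one>)"
    by (simp add: cmp_eq_assoc[OF Lu_nat] cmp_assoc)
  also have "\<dots> = Sy X \<one> \<bullet> ((Lu X \<bullet> Sy X \<one>) \<star> Id \<one>)"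
    by (simp add: cmp_eq_assoc[OF Lu_tns] tns_cmp)
  finally have "Sy \<one> X \<bullet> Sy X \<one> \<bullet> (Ru X \<star> Id \<one>) = Sy \<one> X \<bullet> Sy X \<one> \<bullet> ((Lu X \<bullet> Sy X \<one>) \<star> Id \<one>)" by simp
  then have "(Lu X \<bullet> Sy X \<one>) \<star> Id \<one> = Ru X \<star> Id \<one>" by simp
  then show ?thesis by (rule cancel_tns_unit[rotated 3]) simp_all
qed

lemma Ru_Sy: assumes [simp]: "X \<in> ob \<C>" shows "Ru X \<bullet> Sy \<one> X = Lu X"
  by (simp add: Lu_Sy[symmetric] cmp_assoc)

lemma Sy_Lu': assumes [simp]: "X \<in> ob \<C>" shows "Sy \<one> X \<bullet> Lu' X = Ru' X"
proof -
  have "Ru' X = Ru' X \<bullet> (Ru X \<bullet> Sy \<one> X) \<bullet> Lu' X" by (simp add: Ru_Sy cmp_assoc del: struct_inv2) 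
  then show ?thesis by (simp add: cmp_assoc)
qed

lemma As'_Lu': assumes [simp]: "X \<in> ob \<C>" "Y \<in> ob \<C>"
  shows "As \<one> X Y \<bullet> (Lu' X \<star> Id Y) = Lu' (X \<odot> Y)"
proof -
  have "Lu' (X \<odot> Y) = Lu' (X \<odot> Y) \<bullet> (Lu X \<star> Id Y) \<bullet> (Lu' X \<star> Id Y)" by (simp add: tns_cmp)
  then show ?thesis by (simp add: Lu_tns[symmetric] cmp_assoc)
qed

lemma Lu_As': assumes [simp]: "X \<in> ob \<C>" "Y \<in> ob \<C>"
  shows "(Lu X \<star> Id Y) \<bullet> As' \<one> X Y = Lu (X \<odot> Y)"
  by (simp add: Lu_tns[symmetric] cmp_assoc)

lemma Ru_As': assumes [simp]: "X \<in> ob \<C>" "Y \<in> ob \<C>"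
  shows "Ru (X \<odot> Y) \<bullet> As' X Y \<one> = Id X \<star> Ru Y"
  by (simp add: Ru_tns[symmetric] cmp_assoc)

lemma As'_Ru': assumes [simp]: "X \<in> ob \<C>" "Y \<in> ob \<C>"
  shows "As' X Y \<one> \<bullet> (Id X \<star> Ru' Y) = Ru' (X \<odot> Y)"
proof -
  have "Ru' (X \<odot> Y) = Ru' (X \<odot> Y) \<bullet> (Id X \<star> Ru Y) \<bullet> (Id X \<star> Ru' Y)" by (simp add: tns_cmp)
  then show ?thesis by (simp add: Ru_As'[symmetric] cmp_assoc)
qed

lemma triangle_inv: assumes [simp]: "X \<in> ob \<C>" "Y \<in> ob \<C>"
  shows "As X \<one> Y \<bullet> (Ru' X \<star> Id Y) = Id X \<star> Lu' Y"
proof -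
  have "Id X \<star> Lu' Y = (Id X \<star> Lu' Y) \<bullet> (Ru X \<star> Id Y) \<bullet> (Ru' X \<star> Id Y)" by (simp add: tns_cmp)
  then show ?thesis by (simp add: triangle'[symmetric] cmp_assoc tns_cmp2)
qed

text \<open>The middle-four interchange.\<close>

definition Mf :: "'o \<Rightarrow> 'o \<Rightarrow> 'o \<Rightarrow> 'o \<Rightarrow> ('o, 'm) arrow" where
  "Mf X Y Z W = As' X Z (Y \<odot> W) \<bullet> (Id X \<star> (As Z Y W \<bullet> (Sy Y Z \<star> Id W) \<bullet> As' Y Z W)) \<bullet> As X Y (Z \<odot> W)"

lemma Mf_sel [simp]:
  assumes [simp]: "X \<in> ob \<C>" "Y \<in> ob \<C>" "Z \<in> ob \<C>" "W \<in> ob \<C>"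
  shows "arr (Mf X Y Z W)" "dm (Mf X Y Z W) = (X \<odot> Y) \<odot> (Z \<odot> W)"
    "cd (Mf X Y Z W) = (X \<odot> Z) \<odot> (Y \<odot> W)" "mor (Mf X Y Z W) = interchange \<C> X Y Z W"
  unfolding Mf_def by (auto simp: interchange_def)

lemma Mf_nat:
  assumes "arr a" "arr b" "arr c" "arr d" "cd a = X" "cd b = Y" "cd c = Z" "cd d = W"
  shows "Mf X Y Z W \<bullet> ((a \<star> b) \<star> (c \<star> d))
       = ((a \<star> c) \<star> (b \<star> d)) \<bullet> Mf (dm a) (dm b) (dm c) (dm d)"
proof -
  note [simp] = assms
  have [simp]: "X \<in> ob \<C>" "Y \<in> ob \<C>" "Z \<in> ob \<C>" "W \<in> ob \<C>" using assms cd_ob by metis+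
  have "(As Z Y W \<bullet> (Sy Y Z \<star> Id W) \<bullet> As' Y Z W) \<bullet> (b \<star> (c \<star> d))
      = As Z Y W \<bullet> (Sy Y Z \<star> Id W) \<bullet> ((b \<star> c) \<star> d) \<bullet> As' (dm b) (dm c) (dm d)"
    by (simp add: As'_nat cmp_assoc)
  also have "\<dots> = As Z Y W \<bullet> ((c \<star> b) \<star> d) \<bullet> (Sy (dm b) (dm c) \<star> Id (dm d)) \<bullet> As' (dm b) (dm c) (dm d)"
    by (simp add: tns_cmp2 Sy_nat)
  also have "\<dots> = (c \<star> (b \<star> d)) \<bullet> As (dm c) (dm b) (dm d) \<bullet> (Sy (dm b) (dm c) \<star> Id (dm d)) \<bullet> As' (dm b) (dm c) (dm d)"
    by (simp add: cmp_eq_assoc[OF As_nat] cmp_assoc)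
  finally have 1: "(As Z Y W \<bullet> (Sy Y Z \<star> Id W) \<bullet> As' Y Z W) \<bullet> (b \<star> (c \<star> d))
     = (c \<star> (b \<star> d)) \<bullet> As (dm c) (dm b) (dm d) \<bullet> (Sy (dm b) (dm c) \<star> Id (dm d)) \<bullet> As' (dm b) (dm c) (dm d)" .
  have "Mf X Y Z W \<bullet> ((a \<star> b) \<star> (c \<star> d))
     = As' X Z (Y \<odot> W) \<bullet> (a \<star> ((As Z Y W \<bullet> (Sy Y Z \<star> Id W) \<bullet> As' Y Z W) \<bullet> (b \<star> (c \<star> d))))
       \<bullet> As (dm a) (dm b) (dm c \<odot> dm d)"
    unfolding Mf_def by (simp add: cmp_assoc As_nat tns_cmp2)
  also have "\<dots> = As' X Z (Y \<odot> W) \<bullet> (a \<star> (c \<star> (b \<star> d)))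
     \<bullet> (Id (dm a) \<star> (As (dm c) (dm b) (dm d) \<bullet> (Sy (dm b) (dm c) \<star> Id (dm d)) \<bullet> As' (dm b) (dm c) (dm d)))
       \<bullet> As (dm a) (dm b) (dm c \<odot> dm d)"
    unfolding 1 by (simp add: tns_cmp2)
  also have "\<dots> = ((a \<star> c) \<star> (b \<star> d)) \<bullet> Mf (dm a) (dm b) (dm c) (dm d)"
    unfolding Mf_def by (simp add: cmp_eq_assoc[OF As'_nat] cmp_assoc)
  finally show ?thesis .
qed

lemma Mf_unit:
  assumes [simp]: "X \<in> ob \<C>" "Y \<in> ob \<C>" "W \<in> ob \<C>"
  shows "(Id (X \<odot> Y) \<star> Lu W) \<bullet> Mf X \<one> Y W = As' X Y W \<bullet> (Ru X \<star> Id (Y \<odot> W))"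
proof -
  have "(Id (X \<odot> Y) \<star> Lu W) \<bullet> Mf X \<one> Y W
      = (((Id X \<star> Id Y) \<star> Lu W) \<bullet> As' X Y (\<one> \<odot> W))
        \<bullet> (Id X \<star> (As Y \<one> W \<bullet> (Sy \<one> Y \<star> Id W) \<bullet> As' \<one> Y W)) \<bullet> As X \<one> (Y \<odot> W)"
    unfolding Mf_def by (simp add: cmp_assoc)
  also have "((Id X \<star> Id Y) \<star> Lu W) \<bullet> As' X Y (\<one> \<odot> W) = As' X Y W \<bullet> (Id X \<star> (Id Y \<star> Lu W))"
    by (subst As'_nat) auto
  also have "(As' X Y W \<bullet> (Id X \<star> (Id Y \<star> Lu W)))
        \<bullet> (Id X \<star> (As Y \<one> W \<bullet> (Sy \<one> Y \<star> Id W) \<bullet> As' \<one> Y W)) \<bullet> As X \<one> (Y \<odot> W)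
     = As' X Y W \<bullet> (Id X \<star> (((Id Y \<star> Lu W) \<bullet> As Y \<one> W) \<bullet> (Sy \<one> Y \<star> Id W) \<bullet> As' \<one> Y W)) \<bullet> As X \<one> (Y \<odot> W)"
    by (simp add: cmp_assoc tns_cmp2)
  also have "((Id Y \<star> Lu W) \<bullet> As Y \<one> W) \<bullet> (Sy \<one> Y \<star> Id W) \<bullet> As' \<one> Y W = Lu (Y \<odot> W)"
    by (simp add: triangle' tns_cmp2 Ru_Sy Lu_As')
  also have "As' X Y W \<bullet> (Id X \<star> Lu (Y \<odot> W)) \<bullet> As X \<one> (Y \<odot> W) = As' X Y W \<bullet> (Ru X \<star> Id (Y \<odot> W))"
    by (simp add: triangle')
  finally show ?thesis .
qed

end


context symmetric_monoidal_category
begin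

section \<open>Scalars\<close>

lemma Lu'_Ru': "Lu' \<one> = Ru' \<one>"
proof -
  have "Ru' \<one> = Lu' \<one> \<bullet> Lu \<one> \<bullet> Ru' \<one>" by simp
  also have "\<dots> = Lu' \<one>" unfolding Lu_Ru by (simp del: struct_inv2)
  finally show ?thesis ..
qed

definition scal :: "('o, 'm) arrow \<Rightarrow> bool" where
  "scal s \<longleftrightarrow> arr s \<and> dm s = \<one> \<and> cd s = \<one>"

definition sc :: "('o, 'm) arrow \<Rightarrow> ('o, 'm) arrow \<Rightarrow> ('o, 'm) arrow" where
  "sc s f = Lu (cd f) \<bullet> (s \<star> f) \<bullet> Lu' (dm f)"

lemma scal_simps [simp]: "scal s \<Longrightarrow> arr s" "scal s \<Longrightarrow> dm s = \<one>" "scal s \<Longrightarrow> cd s = \<one>"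
  by (auto simp: scal_def)

lemma scal_cmp [simp]: "scal s \<Longrightarrow> scal t \<Longrightarrow> scal (s \<bullet> t)" "scal (Id \<one>)"
  unfolding scal_def by auto

lemma sc_sel [simp]:
  assumes [simp]: "scal s" "arr f"
  shows "arr (sc s f)" "dm (sc s f) = dm f" "cd (sc s f) = cd f"
    "mor (sc s f) = scale \<C> (dm f) (cd f) (mor s) (mor f)"
  by (auto simp: sc_def scale_def)

lemma sc_cmp:
  assumes [simp]: "scal s" "arr f" "arr g" "dm f = cd g"
  shows "sc s f \<bullet> g = sc s (f \<bullet> g)"
  using cd_ob[of g] by (simp add: sc_def cmp_assoc Lu'_nat tns_cmp2)

lemma cmp_sc:
  assumes [simp]: "scal s" "arr f" "arr g" "dm f = cd g"
  shows "f \<bullet> sc s g = sc s (f \<bullet> g)"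
proof -
  have "f \<bullet> Lu (cd g) = Lu (cd f) \<bullet> (Id \<one> \<star> f)" by (simp add: Lu_nat)
  then have "f \<bullet> sc s g = (Lu (cd f) \<bullet> (Id \<one> \<star> f)) \<bullet> (s \<star> g) \<bullet> Lu' (dm g)"
    unfolding sc_def by (metis cmp_assoc)
  then show ?thesis using cd_ob[of g] by (simp add: sc_def cmp_assoc tns_cmp2)
qed

lemma sc_tns:
  assumes [simp]: "scal s" "arr f" "arr g"
  shows "sc s f \<star> g = sc s (f \<star> g)"
proof -
  have "sc s f \<star> g = (Lu (cd f) \<star> Id (cd g)) \<bullet> ((s \<star> f) \<star> g) \<bullet> (Lu' (dm f) \<star> Id (dm g))"
    by (simp add: sc_def tns_cmp)
  also have "\<dots> = Lu (cd f \<odot> cd g) \<bullet> (As \<one> (cd f) (cd g) \<bullet> ((s \<star> f) \<star> g)) \<bullet> (Lu' (dm f) \<star> Id (dm g))"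
    by (simp add: Lu_tns[symmetric] cmp_assoc)
  also have "\<dots> = sc s (f \<star> g)"
    by (simp add: sc_def As_nat cmp_assoc As'_Lu')
  finally show ?thesis .
qed

lemma tns_sc:
  assumes [simp]: "scal s" "arr f" "arr g"
  shows "f \<star> sc s g = sc s (f \<star> g)"
proof -
  have "f \<star> sc s g = Sy (cd g) (cd f) \<bullet> Sy (cd f) (cd g) \<bullet> (f \<star> sc s g)" by simp
  also have "\<dots> = Sy (cd g) (cd f) \<bullet> sc s (g \<star> f) \<bullet> Sy (dm f) (dm g)"
    by (simp add: Sy_nat sc_tns)
  also have "\<dots> = sc s (Sy (cd g) (cd f) \<bullet> (g \<star> f) \<bullet> Sy (dm f) (dm g))"
    by (simp add: sc_cmp cmp_sc)
  also have "\<dots> = sc s (f \<star> g)" by (simp add: cmp_eq_assoc[OF Sy_nat] cmp_assoc)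
  finally show ?thesis .
qed

lemma sc_scal:
  assumes [simp]: "scal s" "scal t"
  shows "sc s t = s \<bullet> t"
proof -
  have "sc s t = Ru \<one> \<bullet> (s \<star> Id \<one>) \<bullet> (Id \<one> \<star> t) \<bullet> Lu' \<one>" by (simp add: sc_def tns_cmp2 Lu_Ru)
  also have "\<dots> = s \<bullet> Ru \<one> \<bullet> Lu' \<one> \<bullet> t" by (simp add: Lu'_nat cmp_eq_assoc[OF Ru_nat] cmp_assoc)
  also have "\<dots> = s \<bullet> t" by (simp add: Lu_Ru[symmetric])
  finally show ?thesis .
qed

lemma scal_comm:
  assumes [simp]: "scal s" "scal t"
  shows "s \<bullet> t = t \<bullet> s"
proof -
  have "s \<bullet> t = Lu \<one> \<bullet> (Id \<one> \<star> t) \<bullet> (s \<star> Id \<one>) \<bullet> Ru' \<one>"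
    using sc_scal[of s t] by (simp add: sc_def tns_cmp2 Lu'_Ru')
  also have "\<dots> = t \<bullet> Lu \<one> \<bullet> Ru' \<one> \<bullet> s" by (simp add: Ru'_nat cmp_eq_assoc[OF Lu_nat] cmp_assoc)
  also have "\<dots> = t \<bullet> s" by (simp add: Lu_Ru)
  finally show ?thesis .
qed

lemma sc_sc:
  assumes [simp]: "scal s" "scal t" "arr f"
  shows "sc s (sc t f) = sc (s \<bullet> t) f"
proof -
  have "sc s (sc t f) = Lu (cd f) \<bullet> sc s (t \<star> f) \<bullet> Lu' (dm f)"
    by (simp add: sc_def[of t] sc_cmp cmp_sc)
  also have "\<dots> = sc (s \<bullet> t) f" by (simp add: sc_tns[symmetric] sc_scal sc_def[of "s \<bullet> t"])
  finally show ?thesis .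
qed

lemma sc_Id [simp]: "arr f \<Longrightarrow> sc (Id \<one>) f = f"
  by (simp add: sc_def cmp_eq_assoc[OF Lu_nat] cmp_assoc)

definition inv_scal :: "('o, 'm) arrow \<Rightarrow> bool" where
  "inv_scal s \<longleftrightarrow> scal s \<and> (\<exists>t. scal t \<and> t \<bullet> s = Id \<one>)"

lemma inv_scalE:
  assumes "inv_scal s" obtains t where "scal s" "scal t" "t \<bullet> s = Id \<one>"
  using assms unfolding inv_scal_def by blast

lemma inv_scalI: "scal s \<Longrightarrow> scal t \<Longrightarrow> t \<bullet> s = Id \<one> \<Longrightarrow> inv_scal s"
  unfolding inv_scal_def by blast

lemma inv_scal_Aut: "inv_scal s \<longleftrightarrow> arr s \<and> dm s = \<one> \<and> cd s = \<one> \<and> mor s \<in> Aut \<C> \<one>"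
proof
  assume s: "inv_scal s"
  then obtain t where t: "scal t" "t \<bullet> s = Id \<one>" "scal s" by (rule inv_scalE)
  have "mor t \<cdot> mor s = ide \<one>" using arg_cong[OF t(2), of mor] t(1,3) by simp
  moreover have "mor s \<cdot> mor t = ide \<one>"
    using arg_cong[OF t(2), of mor] t(1,3) unfolding scal_comm[OF t(1,3)] by simp
  ultimately have "is_inverse \<C> \<one> \<one> (mor s) (mor t)" using t by (simp add: is_inverse_def)
  then show "arr s \<and> dm s = \<one> \<and> cd s = \<one> \<and> mor s \<in> Aut \<C> \<one>"
    using t by (auto simp: Aut_def iso_arr_def)
next
  assume s: "arr s \<and> dm s = \<one> \<and> cd s = \<one> \<and> mor s \<in> Aut \<C> \<one>"
  then obtain g where g: "is_inverse \<C> \<one> \<one> (mor s) g" by (auto simp: Aut_def iso_arr_def)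
  have "mk \<one> g \<one> \<bullet> s = Id \<one>" using s g by (intro arr_eqI) (auto simp: is_inverse_def)
  moreover have "scal (mk \<one> g \<one>)" using g unfolding scal_def is_inverse_def by simp
  ultimately show "inv_scal s" using s unfolding scal_def by (intro inv_scalI) (simp_all add: scal_def del: scal_simps)
qed

lemma inv_scal_scal: "inv_scal s \<Longrightarrow> scal s" by (simp add: inv_scal_def)

lemma sc_cancel:
  assumes "inv_scal s" and [simp]: "arr f" "arr g" and eq: "sc s f = sc s g" shows "f = g"
proof -
  obtain t where [simp]: "scal s" "scal t" "t \<bullet> s = Id \<one>" using assms(1) by (rule inv_scalE)
  have "sc t (sc s f) = sc t (sc s g)" using eq by simp
  then show ?thesis by (simp add: sc_sc)
qed

lemma inv_scal_cmp: assumes "inv_scal s" "inv_scal t" shows "inv_scal (s \<bullet> t)"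
proof -
  obtain s' t' where [simp]: "scal s" "scal t" "scal s'" "scal t'" and t: "s' \<bullet> s = Id \<one>" "t' \<bullet> t = Id \<one>"
    using assms by (metis inv_scalE)
  have "(t' \<bullet> s') \<bullet> (s \<bullet> t) = Id \<one>" by (simp add: cmp_assoc cmp_eq_assoc[OF t(1)] t(2))
  then show ?thesis by (intro inv_scalI[of _ "t' \<bullet> s'"]) simp_all
qed

lemma inv_scal_factor: assumes "inv_scal (s \<bullet> t)" and [simp]: "scal s" "scal t" shows "inv_scal s"
proof -
  obtain r where [simp]: "scal r" and r: "r \<bullet> (s \<bullet> t) = Id \<one>" using assms(1) by (rule inv_scalE)
  have "(r \<bullet> t) \<bullet> s = Id \<one>" using r scal_comm[of s t] by (simp add: cmp_assoc)
  then show ?thesis by (intro inv_scalI[of _ "r \<bullet> t"]) simp_all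
qed

section \<open>Bimonoids\<close>

definition Mu :: "('o, 'm) bimon \<Rightarrow> ('o, 'm) arrow" where
  "Mu A = mk (und A \<odot> und A) \<nabla>\<^bsub>A\<^esub> (und A)"
definition Et :: "('o, 'm) bimon \<Rightarrow> ('o, 'm) arrow" where "Et A = mk \<one> \<eta>\<^bsub>A\<^esub> (und A)"
definition De :: "('o, 'm) bimon \<Rightarrow> ('o, 'm) arrow" where
  "De A = mk (und A) \<Delta>\<^bsub>A\<^esub> (und A \<odot> und A)"
definition Ep :: "('o, 'm) bimon \<Rightarrow> ('o, 'm) arrow" where "Ep A = mk (und A) \<epsilon>\<^bsub>A\<^esub> \<one>"

lemma bim_sel [simp]:
  "dm (Mu A) = und A \<odot> und A" "cd (Mu A) = und A" "mor (Mu A) = \<nabla>\<^bsub>A\<^esub>"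
  "dm (Et A) = \<one>" "cd (Et A) = und A" "mor (Et A) = \<eta>\<^bsub>A\<^esub>"
  "dm (De A) = und A" "cd (De A) = und A \<odot> und A" "mor (De A) = \<Delta>\<^bsub>A\<^esub>"
  "dm (Ep A) = und A" "cd (Ep A) = \<one>" "mor (Ep A) = \<epsilon>\<^bsub>A\<^esub>"
  by (auto simp: Mu_def Et_def De_def Ep_def)

lemma bim_arr [simp]:
  assumes "bimonoid \<C> A"
  shows "und A \<in> ob \<C>" "arr (Mu A)" "arr (Et A)" "arr (De A)" "arr (Ep A)"
  using assms unfolding bimonoid_def Mu_def Et_def De_def Ep_def by auto

lemma bim_eqs:
  assumes "bimonoid \<C> A"
  shows "Mu A \<bullet> (Mu A \<star> Id (und A)) = Mu A \<bullet> (Id (und A) \<star> Mu A) \<bullet> As (und A) (und A) (und A)"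
    "Mu A \<bullet> (Et A \<star> Id (und A)) = Lu (und A)"
    "Mu A \<bullet> (Id (und A) \<star> Et A) = Ru (und A)"
    "As (und A) (und A) (und A) \<bullet> (De A \<star> Id (und A)) \<bullet> De A = (Id (und A) \<star> De A) \<bullet> De A"
    "Lu (und A) \<bullet> (Ep A \<star> Id (und A)) \<bullet> De A = Id (und A)"
    "Ru (und A) \<bullet> (Id (und A) \<star> Ep A) \<bullet> De A = Id (und A)"
    "De A \<bullet> Mu A = (Mu A \<star> Mu A) \<bullet> Mf (und A) (und A) (und A) (und A) \<bullet> (De A \<star> De A)"
    "Ep A \<bullet> Mu A = Lu \<one> \<bullet> (Ep A \<star> Ep A)"
    "De A \<bullet> Et A = (Et A \<star> Et A) \<bullet> Lu' \<one>"
    "Ep A \<bullet> Et A = Id \<one>"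
proof -
  note [simp] = assms
  note D = assms[unfolded bimonoid_def]
  show "Mu A \<bullet> (Mu A \<star> Id (und A)) = Mu A \<bullet> (Id (und A) \<star> Mu A) \<bullet> As (und A) (und A) (und A)"
    by (rule arr_eqI) (use D in simp_all)
  show "Mu A \<bullet> (Et A \<star> Id (und A)) = Lu (und A)"
    by (rule arr_eqI) (use D in simp_all)
  show "Mu A \<bullet> (Id (und A) \<star> Et A) = Ru (und A)"
    by (rule arr_eqI) (use D in simp_all)
  show "As (und A) (und A) (und A) \<bullet> (De A \<star> Id (und A)) \<bullet> De A = (Id (und A) \<star> De A) \<bullet> De A"
    by (rule arr_eqI) (use D in simp_all)
  show "Lu (und A) \<bullet> (Ep A \<star> Id (und A)) \<bullet> De A = Id (und A)"
    by (rule arr_eqI) (use D in simp_all)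
  show "Ru (und A) \<bullet> (Id (und A) \<star> Ep A) \<bullet> De A = Id (und A)"
    by (rule arr_eqI) (use D in simp_all)
  show "De A \<bullet> Mu A = (Mu A \<star> Mu A) \<bullet> Mf (und A) (und A) (und A) (und A) \<bullet> (De A \<star> De A)"
    by (rule arr_eqI) (use D in simp_all)
  show "Ep A \<bullet> Mu A = Lu \<one> \<bullet> (Ep A \<star> Ep A)"
    by (rule arr_eqI) (use D in simp_all)
  show "De A \<bullet> Et A = (Et A \<star> Et A) \<bullet> Lu' \<one>"
    by (rule arr_eqI) (use D in simp_all)
  show "Ep A \<bullet> Et A = Id \<one>"
    by (rule arr_eqI) (use D in simp_all)
qed

lemmas Mu_assoc = bim_eqs(1) and Mu_Et = bim_eqs(2,3) and De_assoc = bim_eqs(4)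
  and De_Ep = bim_eqs(5,6) and De_Mu = bim_eqs(7) and Ep_Mu = bim_eqs(8)
  and De_Et = bim_eqs(9) and Ep_Et = bim_eqs(10)

lemma bimonoidI:
  fixes A :: "('o, 'm) bimon"
  assumes [simp]: "und A \<in> ob \<C>" "arr (Mu A)" "arr (Et A)" "arr (De A)" "arr (Ep A)"
  and 1: "Mu A \<bullet> (Mu A \<star> Id (und A)) = Mu A \<bullet> (Id (und A) \<star> Mu A) \<bullet> As (und A) (und A) (und A)"
    "Mu A \<bullet> (Et A \<star> Id (und A)) = Lu (und A)"
    "Mu A \<bullet> (Id (und A) \<star> Et A) = Ru (und A)"
    "As (und A) (und A) (und A) \<bullet> (De A \<star> Id (und A)) \<bullet> De A = (Id (und A) \<star> De A) \<bullet> De A"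
    "Lu (und A) \<bullet> (Ep A \<star> Id (und A)) \<bullet> De A = Id (und A)"
    "Ru (und A) \<bullet> (Id (und A) \<star> Ep A) \<bullet> De A = Id (und A)"
    "De A \<bullet> Mu A = (Mu A \<star> Mu A) \<bullet> Mf (und A) (und A) (und A) (und A) \<bullet> (De A \<star> De A)"
    "Ep A \<bullet> Mu A = Lu \<one> \<bullet> (Ep A \<star> Ep A)"
    "De A \<bullet> Et A = (Et A \<star> Et A) \<bullet> Lu' \<one>"
    "Ep A \<bullet> Et A = Id \<one>"
  shows "bimonoid \<C> A"
proof -
  note M = 1[THEN arg_cong[where f = mor]]
  have "\<nabla>\<^bsub>A\<^esub> \<in> Hom (und A \<odot> und A) (und A)" "\<eta>\<^bsub>A\<^esub> \<in> Hom \<one> (und A)"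
     "\<Delta>\<^bsub>A\<^esub> \<in> Hom (und A) (und A \<odot> und A)" "\<epsilon>\<^bsub>A\<^esub> \<in> Hom (und A) \<one>"
    using assms(2-5) unfolding Mu_def Et_def De_def Ep_def by auto
  then show ?thesis unfolding bimonoid_def using M by simp
qed

definition bhom :: "('o, 'm) bimon \<Rightarrow> ('o, 'm) bimon \<Rightarrow> ('o, 'm) arrow \<Rightarrow> bool" where
  "bhom A B f \<longleftrightarrow> bimonoid \<C> A \<and> bimonoid \<C> B \<and> arr f \<and> dm f = und A \<and> cd f = und B \<and>
     f \<bullet> Mu A = Mu B \<bullet> (f \<star> f) \<and> f \<bullet> Et A = Et B \<and> De B \<bullet> f = (f \<star> f) \<bullet> De A \<and> Ep B \<bullet> f = Ep A"

lemma bhom_mk: "bhom A B (mk (und A) f (und B)) \<longleftrightarrow> bimonoid_hom \<C> A B f"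
proof (cases "bimonoid \<C> A \<and> bimonoid \<C> B \<and> f \<in> Hom (und A) (und B)")
  case True
  let ?f = "mk (und A) f (und B)"
  have [simp]: "bimonoid \<C> A" "bimonoid \<C> B" "f \<in> Hom (und A) (und B)" using True by blast+
  have 1: "?f \<bullet> Mu A = Mu B \<bullet> (?f \<star> ?f) \<longleftrightarrow> f \<cdot> \<nabla>\<^bsub>A\<^esub> = \<nabla>\<^bsub>B\<^esub> \<cdot> (f \<otimes> f)"
    by (auto dest: arg_cong[where f = mor] intro!: arr_eqI)
  have 2: "?f \<bullet> Et A = Et B \<longleftrightarrow> f \<cdot> \<eta>\<^bsub>A\<^esub> = \<eta>\<^bsub>B\<^esub>"
    by (auto dest: arg_cong[where f = mor] intro!: arr_eqI)
  have 3: "De B \<bullet> ?f = (?f \<star> ?f) \<bullet> De A \<longleftrightarrow> \<Delta>\<^bsub>B\<^esub> \<cdot> f = (f \<otimes> f) \<cdot> \<Delta>\<^bsub>A\<^esub>"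
    by (auto dest: arg_cong[where f = mor] intro!: arr_eqI)
  have 4: "Ep B \<bullet> ?f = Ep A \<longleftrightarrow> \<epsilon>\<^bsub>B\<^esub> \<cdot> f = \<epsilon>\<^bsub>A\<^esub>"
    by (auto dest: arg_cong[where f = mor] intro!: arr_eqI)
  show ?thesis unfolding bhom_def bimonoid_hom_def 1 2 3 4 using True by simp
next
  case False
  then show ?thesis unfolding bhom_def bimonoid_hom_def arr_mk by blast
qed

lemma bhom_mor: "bhom A B f \<Longrightarrow> bimonoid_hom \<C> A B (mor f)"
  by (metis bhom_def bhom_mk mk_mor)

lemma bhom_simps [simp]:
  "bhom A B f \<Longrightarrow> bimonoid \<C> A" "bhom A B f \<Longrightarrow> bimonoid \<C> B"
  "bhom A B f \<Longrightarrow> arr f" "bhom A B f \<Longrightarrow> dm f = und A" "bhom A B f \<Longrightarrow> cd f = und B"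
  by (auto simp: bhom_def)

lemma bhom_eqs:
  assumes "bhom A B f"
  shows "f \<bullet> Mu A = Mu B \<bullet> (f \<star> f)" "f \<bullet> Et A = Et B" "De B \<bullet> f = (f \<star> f) \<bullet> De A" "Ep B \<bullet> f = Ep A"
  using assms unfolding bhom_def by blast+

lemma bhom_cmp:
  assumes "bhom A B f" "bhom B C g" shows "bhom A C (g \<bullet> f)"
proof -
  note [simp] = assms bhom_simps[OF assms(1)] bhom_simps[OF assms(2)]
  show ?thesis unfolding bhom_def
    by (simp add: cmp_assoc bhom_eqs[OF assms(1)] bhom_eqs[OF assms(2)]
        bhom_eqs(1,3)[OF assms(2), THEN cmp_eq_assoc] bhom_eqs(4)[OF assms(2), THEN cmp_eq_assoc] tns_cmp tns_cmp2)
qed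

lemma bhom_Id: "bimonoid \<C> A \<Longrightarrow> bhom A A (Id (und A))"
  unfolding bhom_def by simp

lemma bhom_zero:
  assumes [simp]: "bimonoid \<C> A" "bimonoid \<C> B" shows "bhom A B (Et B \<bullet> Ep A)"
proof -
  have "Mu B \<bullet> (Et B \<star> Et B) = (Mu B \<bullet> (Et B \<star> Id (und B))) \<bullet> (Id \<one> \<star> Et B)"
    by (simp add: cmp_assoc tns_cmp)
  also have "\<dots> = Et B \<bullet> Lu \<one>" by (simp add: Mu_Et Lu_nat)
  finally have 0: "Mu B \<bullet> (Et B \<star> Et B) = Et B \<bullet> Lu \<one>" .
  have "Mu B \<bullet> ((Et B \<bullet> Ep A) \<star> (Et B \<bullet> Ep A)) = Mu B \<bullet> (Et B \<star> Et B) \<bullet> (Ep A \<star> Ep A)"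
    by (simp add: tns_cmp)
  also have "\<dots> = Et B \<bullet> Lu \<one> \<bullet> (Ep A \<star> Ep A)" unfolding cmp_eq_assoc[OF 0] cmp_assoc ..
  finally have 1: "(Et B \<bullet> Ep A) \<bullet> Mu A = Mu B \<bullet> ((Et B \<bullet> Ep A) \<star> (Et B \<bullet> Ep A))"
    by (simp add: cmp_assoc Ep_Mu)
  have "(Ep A \<star> Ep A) \<bullet> De A = Lu' \<one> \<bullet> Ep A"
  proof -
    have "Lu' \<one> \<bullet> Ep A = Lu' \<one> \<bullet> Ep A \<bullet> Lu (und A) \<bullet> (Ep A \<star> Id (und A)) \<bullet> De A" by (simp add: De_Ep)
    also have "\<dots> = Lu' \<one> \<bullet> (Lu \<one> \<bullet> (Id \<one> \<star> Ep A)) \<bullet> (Ep A \<star> Id (und A)) \<bullet> De A"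
      by (simp add: Lu_nat cmp_assoc)
    also have "\<dots> = (Ep A \<star> Ep A) \<bullet> De A" by (simp add: cmp_assoc tns_cmp2)
    finally show ?thesis ..
  qed
  then have "((Et B \<bullet> Ep A) \<star> (Et B \<bullet> Ep A)) \<bullet> De A = (Et B \<star> Et B) \<bullet> Lu' \<one> \<bullet> Ep A"
    by (simp add: tns_cmp[symmetric] cmp_assoc)
  then have 2: "De B \<bullet> Et B \<bullet> Ep A = ((Et B \<bullet> Ep A) \<star> (Et B \<bullet> Ep A)) \<bullet> De A"
    by (simp add: cmp_eq_assoc[OF De_Et] cmp_assoc)
  show ?thesis unfolding bhom_def using 1 2 by (simp add: cmp_assoc Ep_Et cmp_eq_assoc[OF Ep_Et])
qed

end


section \<open>Quotients by the action of a homomorphism\<close>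

text \<open>
  Tensoring with an arbitrary object \<open>V\<close> is part of the definition: it is what makes the quotient of
  a bimonoid a bimonoid again.
\<close>

definition action_quotient ::
    "('o, 'm) smcat \<Rightarrow> ('o, 'm) bimon \<Rightarrow> ('o, 'm) bimon \<Rightarrow> 'm \<Rightarrow> 'o \<Rightarrow> 'm \<Rightarrow> bool" where
  "action_quotient \<C> K A \<kappa> P p \<longleftrightarrow>
     p \<in> hom \<C> (und A) P \<and>
     comp \<C> p (comp \<C> (mul A) (tensor \<C> \<kappa> (ident \<C> (und A))))
       = comp \<C> p (comp \<C> (lunit \<C> (und A)) (tensor \<C> (coun K) (ident \<C> (und A)))) \<and>
     (\<forall>V W h. V \<in> ob \<C> \<and> h \<in> hom \<C> (tensor_ob \<C> (und A) V) W \<and>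
        comp \<C> h (tensor \<C> (comp \<C> (mul A) (tensor \<C> \<kappa> (ident \<C> (und A)))) (ident \<C> V))
          = comp \<C> h (tensor \<C> (comp \<C> (lunit \<C> (und A)) (tensor \<C> (coun K) (ident \<C> (und A)))) (ident \<C> V))
        \<longrightarrow> (\<exists>!k. k \<in> hom \<C> (tensor_ob \<C> P V) W \<and> comp \<C> k (tensor \<C> p (ident \<C> V)) = h))"

context symmetric_monoidal_category
begin

lemma pentagon_inv:
  assumes [simp]: "X \<in> ob \<C>" "Y \<in> ob \<C>" "Z \<in> ob \<C>" "W \<in> ob \<C>"
  shows "As (X \<odot> Y) Z W \<bullet> (As' X Y Z \<star> Id W) \<bullet> As' X (Y \<odot> Z) W = As' X Y (Z \<odot> W) \<bullet> (Id X \<star> As Y Z W)"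
proof -
  have "As' X Y (Z \<odot> W) \<bullet> (Id X \<star> As Y Z W)
    = As' X Y (Z \<odot> W) \<bullet> ((Id X \<star> As Y Z W) \<bullet> As X (Y \<odot> Z) W \<bullet> (As X Y Z \<star> Id W))
       \<bullet> (As' X Y Z \<star> Id W) \<bullet> As' X (Y \<odot> Z) W"
    by (simp add: cmp_assoc tns_cmp2)
  also have "\<dots> = As (X \<odot> Y) Z W \<bullet> (As' X Y Z \<star> Id W) \<bullet> As' X (Y \<odot> Z) W"
    by (simp add: pentagon'[symmetric] cmp_assoc)
  finally show ?thesis ..
qed

definition act :: "('o, 'm) bimon \<Rightarrow> ('o, 'm) arrow \<Rightarrow> ('o, 'm) arrow" where
  "act A k = Mu A \<bullet> (k \<star> Id (und A))"

definition triv :: "('o, 'm) bimon \<Rightarrow> 'o \<Rightarrow> ('o, 'm) arrow" where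
  "triv K X = Lu X \<bullet> (Ep K \<star> Id X)"

lemma act_sel [simp]:
  assumes "bimonoid \<C> A" "arr k" "cd k = und A"
  shows "arr (act A k)" "dm (act A k) = dm k \<odot> und A" "cd (act A k) = und A"
    "mor (act A k) = \<nabla>\<^bsub>A\<^esub> \<cdot> (mor k \<otimes> ide (und A))"
  using assms unfolding act_def by auto

lemma triv_sel [simp]:
  assumes "bimonoid \<C> K" "X \<in> ob \<C>"
  shows "arr (triv K X)" "dm (triv K X) = und K \<odot> X" "cd (triv K X) = X"
    "mor (triv K X) = \<l> X \<cdot> (\<epsilon>\<^bsub>K\<^esub> \<otimes> ide X)"
  using assms unfolding triv_def by auto

lemma triv_nat:
  assumes [simp]: "bimonoid \<C> K" "arr f"
  shows "f \<bullet> triv K (dm f) = Lu (cd f) \<bullet> (Ep K \<star> f)"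
proof -
  have "f \<bullet> triv K (dm f) = (f \<bullet> Lu (dm f)) \<bullet> (Ep K \<star> Id (dm f))"
    by (simp add: triv_def cmp_assoc)
  also have "f \<bullet> Lu (dm f) = Lu (cd f) \<bullet> (Id \<one> \<star> f)" by (simp add: Lu_nat)
  finally show ?thesis by (simp add: cmp_assoc tns_cmp)
qed

lemma De_act:
  assumes "bhom K A k"
  shows "De A \<bullet> act A k = (act A k \<star> act A k) \<bullet> Mf (und K) (und K) (und A) (und A) \<bullet> (De K \<star> De A)"
proof -
  note [simp] = assms bhom_simps[OF assms]
  have "De A \<bullet> act A k
    = (Mu A \<star> Mu A) \<bullet> Mf (und A) (und A) (und A) (und A) \<bullet> ((De A \<bullet> k) \<star> De A)"
    by (simp add: act_def cmp_eq_assoc[OF De_Mu] cmp_assoc tns_cmp)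
  also have "(De A \<bullet> k) \<star> De A = ((k \<star> k) \<star> (Id (und A) \<star> Id (und A))) \<bullet> (De K \<star> De A)"
    by (simp add: bhom_eqs(3)[OF assms] tns_cmp)
  also have "(Mu A \<star> Mu A) \<bullet> Mf (und A) (und A) (und A) (und A) \<bullet> \<dots>
     = (Mu A \<star> Mu A) \<bullet> ((k \<star> Id (und A)) \<star> (k \<star> Id (und A))) \<bullet> Mf (und K) (und K) (und A) (und A) \<bullet> (De K \<star> De A)"
    by (simp del: Id_tns_Id add: cmp_eq_assoc[OF Mf_nat] cmp_assoc)
  also have "\<dots> = (act A k \<star> act A k) \<bullet> Mf (und K) (und K) (und A) (und A) \<bullet> (De K \<star> De A)"
    by (simp add: act_def tns_cmp2)
  finally show ?thesis .
qed

text \<open>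
  If \<open>h\<close> cannot see the action of \<open>K\<close>, then \<open>K\<close> acts on \<open>A\<close> through the first tensor factor only of
  \<open>(id \<otimes> h) \<circ> \<Delta>\<close>: in Sweedler notation \<open>kx \<mapsto> k\<^sub>1x\<^sub>1 \<otimes> h(k\<^sub>2x\<^sub>2) = kx\<^sub>1 \<otimes> h(x\<^sub>2)\<close>.
\<close>

lemma comul_act_invariant:
  assumes k: "bhom K A k" and [simp]: "arr h" "dm h = und A"
    and inv: "h \<bullet> act A k = h \<bullet> triv K (und A)"
  shows "(Id (und A) \<star> h) \<bullet> De A \<bullet> act A k = (act A k \<star> h) \<bullet> As' (und K) (und A) (und A) \<bullet> (Id (und K) \<star> De A)"
proof -
  let ?K = "und K" and ?A = "und A"
  note [simp] = k bhom_simps[OF k]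
  have "(Id ?A \<star> h) \<bullet> De A \<bullet> act A k
      = (act A k \<star> (h \<bullet> act A k)) \<bullet> Mf ?K ?K ?A ?A \<bullet> (De K \<star> De A)"
    by (simp add: De_act[OF k] tns_cmp2)
  also have "act A k \<star> (h \<bullet> act A k) = (act A k \<star> h) \<bullet> (Id (?K \<odot> ?A) \<star> Lu ?A) \<bullet> ((Id ?K \<star> Id ?A) \<star> (Ep K \<star> Id ?A))"
    unfolding inv by (simp add: triv_def tns_cmp)
  also have "((act A k \<star> h) \<bullet> (Id (?K \<odot> ?A) \<star> Lu ?A) \<bullet> ((Id ?K \<star> Id ?A) \<star> (Ep K \<star> Id ?A))) \<bullet> Mf ?K ?K ?A ?A \<bullet> (De K \<star> De A)
     = (act A k \<star> h) \<bullet> ((Id (?K \<odot> ?A) \<star> Lu ?A) \<bullet> Mf ?K \<one> ?A ?A) \<bullet> ((Id ?K \<star> Ep K) \<star> (Id ?A \<star> Id ?A)) \<bullet> (De K \<star> De A)"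
    using Mf_nat[of "Id ?K" "Ep K" "Id ?A" "Id ?A" ?K \<one> ?A ?A, THEN cmp_eq_assoc, of "De K \<star> De A"]
    by (simp del: Id_tns_Id add: cmp_assoc)
  also have "\<dots> = (act A k \<star> h) \<bullet> As' ?K ?A ?A \<bullet> ((Ru ?K \<bullet> (Id ?K \<star> Ep K) \<bullet> De K) \<star> De A)"
    by (simp add: Mf_unit cmp_assoc tns_cmp)
  finally show ?thesis by (simp add: De_Ep)
qed

section \<open>Epimorphisms preserved by the tensor product\<close>

text \<open>
  Epimorphisms that stay epimorphisms beside every object.  They form a class closed under tensor products, which is what
  allows axioms to be checked on a quotient.
\<close>

definition tepi :: "('o, 'm) arrow \<Rightarrow> bool" where
  "tepi f \<longleftrightarrow> arr f \<and> (\<forall>V x y. V \<in> ob \<C> \<longrightarrow> arr x \<longrightarrow> arr y \<longrightarrow> dm x = cd f \<odot> V \<longrightarrow> dm y = cd f \<odot> V \<longrightarrow>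
     x \<bullet> (f \<star> Id V) = y \<bullet> (f \<star> Id V) \<longrightarrow> x = y)"

lemma tepi_arr: "tepi f \<Longrightarrow> arr f" unfolding tepi_def by blast

lemma tepi_cancel:
  "x \<bullet> (f \<star> Id V) = y \<bullet> (f \<star> Id V) \<Longrightarrow> tepi f \<Longrightarrow> V \<in> ob \<C> \<Longrightarrow> arr x \<Longrightarrow> arr y \<Longrightarrow> dm x = cd f \<odot> V \<Longrightarrow> dm y = cd f \<odot> V \<Longrightarrow> x = y"
  unfolding tepi_def by blast

lemma tepi_epi:
  assumes eq: "x \<bullet> f = y \<bullet> f" and f: "tepi f" and [simp]: "arr x" "arr y" "dm x = cd f" "dm y = cd f"
  shows "x = y"
proof -
  note [simp] = tepi_arr[OF f]
  have "(x \<bullet> Ru (cd f)) \<bullet> (f \<star> Id \<one>) = (x \<bullet> f) \<bullet> Ru (dm f)"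
    by (simp add: cmp_assoc Ru_nat)
  also have "\<dots> = (y \<bullet> Ru (cd f)) \<bullet> (f \<star> Id \<one>)"
    unfolding eq by (simp add: cmp_assoc Ru_nat)
  finally have "(x \<bullet> Ru (cd f)) \<bullet> (f \<star> Id \<one>) = (y \<bullet> Ru (cd f)) \<bullet> (f \<star> Id \<one>)" .
  then have "x \<bullet> Ru (cd f) = y \<bullet> Ru (cd f)" by (rule tepi_cancel) (auto simp: f)
  then have "(x \<bullet> Ru (cd f)) \<bullet> Ru' (cd f) = (y \<bullet> Ru (cd f)) \<bullet> Ru' (cd f)" by simp
  then show ?thesis by (simp add: cmp_assoc)
qed

lemma tepi_cmp:
  assumes f: "tepi f" and g: "tepi g" and [simp]: "dm g = cd f" shows "tepi (g \<bullet> f)"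
proof -
  note [simp] = tepi_arr[OF f] tepi_arr[OF g]
  show ?thesis unfolding tepi_def
  proof (intro conjI allI impI)
    fix V x y
    assume [simp]: "V \<in> ob \<C>" "arr x" "arr y"
      and d: "dm x = cd (g \<bullet> f) \<odot> V" "dm y = cd (g \<bullet> f) \<odot> V"
      and eq: "x \<bullet> ((g \<bullet> f) \<star> Id V) = y \<bullet> ((g \<bullet> f) \<star> Id V)"
    have [simp]: "dm x = cd g \<odot> V" "dm y = cd g \<odot> V" using d by auto
    have "(x \<bullet> (g \<star> Id V)) \<bullet> (f \<star> Id V) = (y \<bullet> (g \<star> Id V)) \<bullet> (f \<star> Id V)"
      using eq by (simp add: cmp_assoc tns_cmp)
    then have "x \<bullet> (g \<star> Id V) = y \<bullet> (g \<star> Id V)" by (rule tepi_cancel) (auto simp: f)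
    then show "x = y" by (rule tepi_cancel) (auto simp: g)
  qed simp
qed

lemma tepi_retraction:
  assumes [simp]: "arr f" "arr g" "cd g = dm f" "dm g = cd f" and fg: "f \<bullet> g = Id (cd f)"
  shows "tepi f"
  unfolding tepi_def
proof (intro conjI allI impI)
  fix V x y
  assume [simp]: "V \<in> ob \<C>" "arr x" "arr y" "dm x = cd f \<odot> V" "dm y = cd f \<odot> V"
    and eq: "x \<bullet> (f \<star> Id V) = y \<bullet> (f \<star> Id V)"
  have "(x \<bullet> (f \<star> Id V)) \<bullet> (g \<star> Id V) = (y \<bullet> (f \<star> Id V)) \<bullet> (g \<star> Id V)" unfolding eq ..
  then show "x = y" by (simp add: cmp_assoc tns_cmp fg)
qed simp

lemma tepi_Sy: "X \<in> ob \<C> \<Longrightarrow> Y \<in> ob \<C> \<Longrightarrow> tepi (Sy X Y)"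
  by (rule tepi_retraction[of _ "Sy Y X"]) auto

lemma tepi_tns_Id: assumes f: "tepi f" and [simp]: "X \<in> ob \<C>" shows "tepi (f \<star> Id X)"
proof -
  note [simp] = tepi_arr[OF f]
  show ?thesis unfolding tepi_def
  proof (intro conjI allI impI)
    fix V x y
    assume [simp]: "V \<in> ob \<C>" "arr x" "arr y"
      and d: "dm x = cd (f \<star> Id X) \<odot> V" "dm y = cd (f \<star> Id X) \<odot> V"
      and eq: "x \<bullet> ((f \<star> Id X) \<star> Id V) = y \<bullet> ((f \<star> Id X) \<star> Id V)"
    have [simp]: "dm x = (cd f \<odot> X) \<odot> V" "dm y = (cd f \<odot> X) \<odot> V" using d by auto
    have *: "((f \<star> Id X) \<star> Id V) \<bullet> As' (dm f) X V = As' (cd f) X V \<bullet> (f \<star> Id (X \<odot> V))"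
      using As'_nat[of f "Id X" "Id V" "cd f" X V] by simp
    have "(x \<bullet> ((f \<star> Id X) \<star> Id V)) \<bullet> As' (dm f) X V = (y \<bullet> ((f \<star> Id X) \<star> Id V)) \<bullet> As' (dm f) X V"
      unfolding eq ..
    then have "(x \<bullet> As' (cd f) X V) \<bullet> (f \<star> Id (X \<odot> V)) = (y \<bullet> As' (cd f) X V) \<bullet> (f \<star> Id (X \<odot> V))"
      by (simp add: cmp_assoc *)
    then have "x \<bullet> As' (cd f) X V = y \<bullet> As' (cd f) X V" by (rule tepi_cancel) (auto simp: f)
    then have "(x \<bullet> As' (cd f) X V) \<bullet> As (cd f) X V = (y \<bullet> As' (cd f) X V) \<bullet> As (cd f) X V" by simp
    then show "x = y" by (simp add: cmp_assoc)
  qed simp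
qed

lemma tepi_Id_tns: assumes f: "tepi f" and [simp]: "X \<in> ob \<C>" shows "tepi (Id X \<star> f)"
proof -
  note [simp] = tepi_arr[OF f]
  have "Id X \<star> f = Sy (cd f) X \<bullet> (f \<star> Id X) \<bullet> Sy X (dm f)"
    by (simp add: cmp_eq_assoc[OF Sy_nat] cmp_assoc)
  moreover have "tepi (Sy (cd f) X \<bullet> (f \<star> Id X) \<bullet> Sy X (dm f))"
    by (intro tepi_cmp tepi_tns_Id[OF f] tepi_Sy) auto
  ultimately show ?thesis by simp
qed

lemma tepi_tns: assumes f: "tepi f" and g: "tepi g" shows "tepi (f \<star> g)"
proof -
  note [simp] = tepi_arr[OF f] tepi_arr[OF g]
  have "f \<star> g = (f \<star> Id (cd g)) \<bullet> (Id (dm f) \<star> g)" by (simp add: tns_cmp)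
  moreover have "tepi ((f \<star> Id (cd g)) \<bullet> (Id (dm f) \<star> g))"
    by (intro tepi_cmp tepi_tns_Id[OF f] tepi_Id_tns[OF g]) auto
  ultimately show ?thesis by simp
qed

section \<open>Existence of quotients\<close>

lemma action_quotientD:
  assumes k: "bhom K A k" and q: "action_quotient \<C> K A (mor k) P (mor p)"
    and p: "arr p" "dm p = und A" "cd p = P"
  shows "p \<bullet> act A k = p \<bullet> triv K (und A)" "tepi p"
    "\<And>V h. V \<in> ob \<C> \<Longrightarrow> arr h \<Longrightarrow> dm h = und A \<odot> V \<Longrightarrow> h \<bullet> (act A k \<star> Id V) = h \<bullet> (triv K (und A) \<star> Id V) \<Longrightarrow>
       \<exists>h'. arr h' \<and> dm h' = P \<odot> V \<and> cd h' = cd h \<and> h' \<bullet> (p \<star> Id V) = h"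
proof -
  note [simp] = k bhom_simps[OF k] p
  have P [simp]: "P \<in> ob \<C>" using p cd_ob by blast
  show i: "p \<bullet> act A k = p \<bullet> triv K (und A)"
    by (rule arr_eqI) (use q[unfolded action_quotient_def] in simp_all)
  have U: "\<exists>!k. k \<in> Hom (P \<odot> V) (cd h) \<and> k \<cdot> (mor p \<otimes> ide V) = mor h"
    if "V \<in> ob \<C>" "arr h" "dm h = und A \<odot> V" "h \<bullet> (act A k \<star> Id V) = h \<bullet> (triv K (und A) \<star> Id V)" for V h
  proof -
    have "mor h \<in> Hom (und A \<odot> V) (cd h)" using that by simp
    moreover have "mor h \<cdot> ((\<nabla>\<^bsub>A\<^esub> \<cdot> (mor k \<otimes> ide (und A))) \<otimes> ide V) = mor h \<cdot> ((\<l> (und A) \<cdot> (\<epsilon>\<^bsub>K\<^esub> \<otimes> ide (und A))) \<otimes> ide V)"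
      using arg_cong[OF that(4), of mor] that(1-3) by simp
    ultimately show ?thesis using q that(1) unfolding action_quotient_def by blast
  qed
  show "\<exists>h'. arr h' \<and> dm h' = P \<odot> V \<and> cd h' = cd h \<and> h' \<bullet> (p \<star> Id V) = h"
    if h [simp]: "V \<in> ob \<C>" "arr h" "dm h = und A \<odot> V"
      and e: "h \<bullet> (act A k \<star> Id V) = h \<bullet> (triv K (und A) \<star> Id V)" for V h
  proof -
    obtain m where m: "m \<in> Hom (P \<odot> V) (cd h)" "m \<cdot> (mor p \<otimes> ide V) = mor h" using U[OF h e] by blast
    show ?thesis
      by (rule exI[of _ "mk (P \<odot> V) m (cd h)"]) (use m in \<open>auto intro!: arr_eqI\<close>)
  qed
  show "tepi p" unfolding tepi_def
  proof (intro conjI allI impI)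
    fix V x y
    assume V [simp]: "V \<in> ob \<C>" "arr x" "arr y" and d: "dm x = cd p \<odot> V" "dm y = cd p \<odot> V"
      and eq: "x \<bullet> (p \<star> Id V) = y \<bullet> (p \<star> Id V)"
    have [simp]: "dm x = P \<odot> V" "dm y = P \<odot> V" using d by auto
    have [simp]: "cd x = cd y" using arg_cong[OF eq, of cd] by simp
    have "(x \<bullet> (p \<star> Id V)) \<bullet> (act A k \<star> Id V) = (x \<bullet> (p \<star> Id V)) \<bullet> (triv K (und A) \<star> Id V)"
      by (simp add: cmp_assoc tns_cmp i)
    then have "\<exists>!k. k \<in> Hom (P \<odot> V) (cd y) \<and> k \<cdot> (mor p \<otimes> ide V) = mor (x \<bullet> (p \<star> Id V))"
      using U[of V "x \<bullet> (p \<star> Id V)"] by simp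
    moreover have "mor y \<cdot> (mor p \<otimes> ide V) = mor (x \<bullet> (p \<star> Id V))" using arg_cong[OF eq, of mor] by simp
    moreover have "mor x \<cdot> (mor p \<otimes> ide V) = mor (x \<bullet> (p \<star> Id V))" by simp
    moreover have "mor x \<in> Hom (P \<odot> V) (cd y)" "mor y \<in> Hom (P \<odot> V) (cd y)" by simp_all
    ultimately have "mor x = mor y" by blast
    then show "x = y" by (intro arr_eqI) auto
  qed simp
qed

lemma left_action_act:
  assumes "bhom K A k" shows "left_action \<C> K (mor (act A k)) (und A)"
proof -
  note [simp] = assms bhom_simps[OF assms]
  have 1: "act A k \<bullet> (Mu K \<star> Id (und A)) = act A k \<bullet> (Id (und K) \<star> act A k) \<bullet> As (und K) (und K) (und A)"
  proof -
    have "act A k \<bullet> (Mu K \<star> Id (und A)) = (Mu A \<bullet> (Mu A \<star> Id (und A))) \<bullet> ((k \<star> k) \<star> Id (und A))"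
      by (simp add: act_def cmp_assoc tns_cmp bhom_eqs[OF assms])
    also have "\<dots> = Mu A \<bullet> (Id (und A) \<star> Mu A) \<bullet> (k \<star> (k \<star> Id (und A))) \<bullet> As (und K) (und K) (und A)"
      by (simp add: Mu_assoc cmp_assoc As_nat)
    also have "\<dots> = act A k \<bullet> (Id (und K) \<star> act A k) \<bullet> As (und K) (und K) (und A)"
      by (simp add: act_def cmp_assoc tns_cmp2)
    finally show ?thesis .
  qed
  have 2: "act A k \<bullet> (Et K \<star> Id (und A)) = Lu (und A)"
    by (simp add: act_def cmp_assoc tns_cmp bhom_eqs[OF assms] Mu_Et)
  show ?thesis unfolding left_action_def
    using 1[THEN arg_cong, of mor] 2[THEN arg_cong, of mor] mor_hom[of "act A k"] by simp
qed

lemma left_action_triv: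
  assumes [simp]: "bimonoid \<C> K" "X \<in> ob \<C>" shows "left_action \<C> K (mor (triv K X)) X"
proof -
  have "triv K X \<bullet> (Id (und K) \<star> triv K X) \<bullet> As (und K) (und K) X
      = Lu X \<bullet> (Id \<one> \<star> Lu X) \<bullet> (Ep K \<star> (Ep K \<star> Id X)) \<bullet> As (und K) (und K) X"
    by (simp add: triv_def cmp_assoc tns_cmp2)
  also have "\<dots> = Lu X \<bullet> (Id \<one> \<star> Lu X) \<bullet> As \<one> \<one> X \<bullet> ((Ep K \<star> Ep K) \<star> Id X)"
    by (simp add: cmp_assoc As_nat)
  also have "\<dots> = Lu X \<bullet> (Lu \<one> \<star> Id X) \<bullet> ((Ep K \<star> Ep K) \<star> Id X)"
    by (simp add: cmp_eq_assoc[OF triangle'] Lu_Ru)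
  also have "\<dots> = triv K X \<bullet> (Mu K \<star> Id X)"
    by (simp add: triv_def cmp_assoc tns_cmp Ep_Mu)
  finally have 1: "triv K X \<bullet> (Mu K \<star> Id X) = triv K X \<bullet> (Id (und K) \<star> triv K X) \<bullet> As (und K) (und K) X" ..
  have 2: "triv K X \<bullet> (Et K \<star> Id X) = Lu X"
    by (simp add: triv_def cmp_assoc tns_cmp Ep_Et)
  show ?thesis unfolding left_action_def
    using 1[THEN arg_cong, of mor] 2[THEN arg_cong, of mor] mor_hom[of "triv K X"] by simp
qed

text \<open>
  The coequalizer of the action of \<open>K\<close> on \<open>A\<close> is a stabilized object.  Tensoring this action with the trivial action of
  \<open>K\<close> on \<open>V\<close> and applying stability shows that it remains a coequalizer after tensoring with \<open>V\<close>.
\<close>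

lemma stable_action_quotient:
  assumes coeq: "has_coequalizers \<C>" and st: "stable \<C>" and k: "bhom K A k"
  shows "\<exists>P p. action_quotient \<C> K A (mor k) P p"
proof -
  note [simp] = k bhom_simps[OF k]
  let ?A = "und A" and ?K = "und K"
  let ?a = "act A k" and ?t = "triv K ?A"
  have "\<exists>Q q. is_coequalizer \<C> (?K \<odot> ?A) ?A (mor ?a) (mor ?t) Q q"
  proof -
    have "mor ?a \<in> Hom (?K \<odot> ?A) ?A" "mor ?t \<in> Hom (?K \<odot> ?A) ?A"
      using mor_hom[of ?a] mor_hom[of ?t] by simp_all
    then show ?thesis using coeq unfolding has_coequalizers_def by blast
  qed
  then obtain P p0 where P: "is_coequalizer \<C> (?K \<odot> ?A) ?A (mor ?a) (mor ?t) P p0" by blast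
  have st1: "left_stabilized \<C> K (mor ?a) ?A P p0"
    using P unfolding left_stabilized_def trivial_left_action_def by simp
  have p0: "p0 \<in> Hom ?A P" "p0 \<cdot> mor ?a = p0 \<cdot> mor ?t" using P unfolding is_coequalizer_def by auto
  let ?p = "mk ?A p0 P"
  have [simp]: "P \<in> ob \<C>" using p0 hom_ob by blast
  have U: "\<exists>!m. m \<in> Hom (P \<odot> V) W \<and> m \<cdot> (p0 \<otimes> ide V) = mor h"
    if [simp]: "V \<in> ob \<C>" "arr h" "dm h = ?A \<odot> V" "cd h = W" and inv: "h \<bullet> (?a \<star> Id V) = h \<bullet> (?t \<star> Id V)" for V W h
  proof -
    \<comment> \<open>The tensor product of the two actions differs from the action on the first factor by \<open>?e\<close>, which forgets the second
      copy of \<open>K\<close>.\<close>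
    let ?e = "(Ru ?K \<bullet> (Id ?K \<star> Ep K)) \<star> Id (?A \<odot> V)"
    let ?TA = "(?a \<star> triv K V) \<bullet> Mf ?K ?K ?A V"
    let ?TT = "Lu (?A \<odot> V) \<bullet> ((Lu \<one> \<bullet> (Ep K \<star> Ep K)) \<star> Id (?A \<odot> V))"
    have "?TA = (?a \<star> Id V) \<bullet> (Id (?K \<odot> ?A) \<star> Lu V) \<bullet> ((Id ?K \<star> Id ?A) \<star> (Ep K \<star> Id V)) \<bullet> Mf ?K ?K ?A V"
      by (simp add: triv_def tns_cmp tns_cmp2)
    also have "\<dots> = (?a \<star> Id V) \<bullet> ((Id (?K \<odot> ?A) \<star> Lu V) \<bullet> Mf ?K \<one> ?A V) \<bullet> ((Id ?K \<star> Ep K) \<star> (Id ?A \<star> Id V))"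
      using Mf_nat[of "Id ?K" "Ep K" "Id ?A" "Id V" ?K \<one> ?A V]
      by (simp del: Id_tns_Id add: cmp_assoc)
    also have "\<dots> = (?a \<star> Id V) \<bullet> As' ?K ?A V \<bullet> ?e"
      by (simp add: Mf_unit cmp_assoc tns_cmp)
    finally have TA: "?TA = (?a \<star> Id V) \<bullet> As' ?K ?A V \<bullet> ?e" .
    have "(?t \<star> Id V) \<bullet> As' ?K ?A V \<bullet> ?e = (Lu ?A \<star> Id V) \<bullet> (((Ep K \<star> Id ?A) \<star> Id V) \<bullet> As' ?K ?A V) \<bullet> ?e"
      by (simp add: triv_def tns_cmp2 cmp_assoc)
    also have "((Ep K \<star> Id ?A) \<star> Id V) \<bullet> As' ?K ?A V = As' \<one> ?A V \<bullet> (Ep K \<star> (Id ?A \<star> Id V))"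
      using As'_nat[of "Ep K" "Id ?A" "Id V" \<one> ?A V] by simp
    also have "(Lu ?A \<star> Id V) \<bullet> (As' \<one> ?A V \<bullet> (Ep K \<star> (Id ?A \<star> Id V))) \<bullet> ?e
       = Lu (?A \<odot> V) \<bullet> (Ep K \<star> Id (?A \<odot> V)) \<bullet> ?e"
      by (simp add: cmp_eq_assoc[OF Lu_As'] cmp_assoc)
    also have "\<dots> = Lu (?A \<odot> V) \<bullet> (((Ep K \<bullet> Ru ?K) \<bullet> (Id ?K \<star> Ep K)) \<star> Id (?A \<odot> V))"
      by (simp add: tns_cmp cmp_assoc)
    also have "Ep K \<bullet> Ru ?K = Ru \<one> \<bullet> (Ep K \<star> Id \<one>)" by (simp add: Ru_nat)
    also have "Lu (?A \<odot> V) \<bullet> (((Ru \<one> \<bullet> (Ep K \<star> Id \<one>)) \<bullet> (Id ?K \<star> Ep K)) \<star> Id (?A \<odot> V)) = ?TT"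
      by (simp add: cmp_assoc tns_cmp Lu_Ru)
    finally have TT: "(?t \<star> Id V) \<bullet> As' ?K ?A V \<bullet> ?e = ?TT" .
    have hT: "h \<bullet> ?TA = h \<bullet> ?TT"
      unfolding TA TT[symmetric] using cmp_eq_assoc[OF inv] by (simp add: cmp_assoc)
    have "mor ?TA \<in> Hom ((?K \<odot> ?K) \<odot> (?A \<odot> V)) (?A \<odot> V)" "mor ?TT \<in> Hom ((?K \<odot> ?K) \<odot> (?A \<odot> V)) (?A \<odot> V)"
      using mor_hom[of ?TA] mor_hom[of ?TT] by simp_all
    then obtain T t where T: "is_coequalizer \<C> ((?K \<odot> ?K) \<odot> (?A \<odot> V)) (?A \<odot> V) (mor ?TA) (mor ?TT) T t"
      using coeq unfolding has_coequalizers_def by blast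
    have "left_stabilized \<C> (tensor_bimon \<C> K K) (tensor_left_action \<C> K (mor ?a) ?A K (mor (triv K V)) V) (?A \<odot> V) T t"
      using T unfolding left_stabilized_def tensor_left_action_def trivial_left_action_def tensor_bimon_def by simp
    moreover have "left_stabilized \<C> K (mor (triv K V)) V V (ide V)"
    proof -
      have "mor (triv K V) \<in> Hom (?K \<odot> V) V" using mor_hom[of "triv K V"] by simp
      then show ?thesis unfolding left_stabilized_def is_coequalizer_def trivial_left_action_def
        using comp_ide_right by (auto simp: ide_hom)
    qed
    ultimately have "\<exists>c. iso_arr \<C> T (P \<odot> V) c \<and> c \<cdot> t = p0 \<otimes> ide V"
      using st st1 left_action_act[OF k] left_action_triv[of K V] unfolding stable_def by auto
    then obtain c d where c: "c \<in> Hom T (P \<odot> V)" "is_inverse \<C> T (P \<odot> V) c d" "c \<cdot> t = p0 \<otimes> ide V"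
      unfolding iso_arr_def by blast
    have d: "d \<in> Hom (P \<odot> V) T" "d \<cdot> c = ide T" "c \<cdot> d = ide (P \<odot> V)" using c unfolding is_inverse_def by auto
    have t: "t \<in> Hom (?A \<odot> V) T" using T unfolding is_coequalizer_def by auto
    have "mor h \<in> Hom (?A \<odot> V) W" "mor h \<cdot> mor ?TA = mor h \<cdot> mor ?TT"
      using arg_cong[OF hT, of mor] by simp_all
    then obtain m where m: "m \<in> Hom T W" "m \<cdot> t = mor h" and mu: "\<And>m'. m' \<in> Hom T W \<Longrightarrow> m' \<cdot> t = mor h \<Longrightarrow> m' = m"
      using T unfolding is_coequalizer_def by blast
    show ?thesis
    proof (rule ex1I[of _ "m \<cdot> d"])
      have "(m \<cdot> d) \<cdot> (c \<cdot> t) = m \<cdot> ((d \<cdot> c) \<cdot> t)"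
        using comp_assoc[OF comp_hom[OF t c(1)] d(1) m(1)] comp_assoc[OF t c(1) d(1)] by simp
      then show "m \<cdot> d \<in> Hom (P \<odot> V) W \<and> (m \<cdot> d) \<cdot> (p0 \<otimes> ide V) = mor h"
        using c d m t comp_ide_left[OF t] comp_hom[OF d(1) m(1)] by simp
    next
      fix n assume n: "n \<in> Hom (P \<odot> V) W \<and> n \<cdot> (p0 \<otimes> ide V) = mor h"
      then have "(n \<cdot> c) \<cdot> t = mor h" using c(3) comp_assoc[OF t c(1), of n W] by simp
      then have "n \<cdot> c = m" using n c comp_hom by (intro mu) blast+
      moreover have "n = (n \<cdot> c) \<cdot> d" using n d comp_assoc[OF d(1) c(1), of n W] comp_ide_right[of n "P \<odot> V" W] by simp
      ultimately show "n = m \<cdot> d" by simp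
    qed
  qed
  have "action_quotient \<C> K A (mor k) P p0" unfolding action_quotient_def
  proof (intro conjI allI impI)
    show "p0 \<in> Hom ?A P" by (rule p0)
    show "p0 \<cdot> \<nabla>\<^bsub>A\<^esub> \<cdot> (mor k \<otimes> ide ?A) = p0 \<cdot> \<l> ?A \<cdot> (\<epsilon>\<^bsub>K\<^esub> \<otimes> ide ?A)" using p0 by simp
    fix V W h
    assume h: "V \<in> ob \<C> \<and> h \<in> Hom (?A \<odot> V) W \<and>
      h \<cdot> ((\<nabla>\<^bsub>A\<^esub> \<cdot> (mor k \<otimes> ide ?A)) \<otimes> ide V) = h \<cdot> ((\<l> ?A \<cdot> (\<epsilon>\<^bsub>K\<^esub> \<otimes> ide ?A)) \<otimes> ide V)"
    then have "mk (?A \<odot> V) h W \<bullet> (?a \<star> Id V) = mk (?A \<odot> V) h W \<bullet> (?t \<star> Id V)"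
      by (intro arr_eqI) auto
    then show "\<exists>!m. m \<in> Hom (P \<odot> V) W \<and> m \<cdot> (p0 \<otimes> ide V) = h"
      using U[of V "mk (?A \<odot> V) h W" W] h by simp
  qed
  then show ?thesis by blast
qed

end


context symmetric_monoidal_category
begin

section \<open>The quotient Hopf monoid\<close>

definition antipode_arr :: "('o, 'm) bimon \<Rightarrow> ('o, 'm) arrow \<Rightarrow> bool" where
  "antipode_arr A S \<longleftrightarrow> arr S \<and> dm S = und A \<and> cd S = und A \<and>
     Mu A \<bullet> (S \<star> Id (und A)) \<bullet> De A = Et A \<bullet> Ep A \<and> Mu A \<bullet> (Id (und A) \<star> S) \<bullet> De A = Et A \<bullet> Ep A"

lemma is_antipode_antipode_arr:
  assumes [simp]: "bimonoid \<C> A"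
  shows "is_antipode \<C> A f \<longleftrightarrow> antipode_arr A (mk (und A) f (und A))"
proof (cases "f \<in> Hom (und A) (und A)")
  case True
  let ?S = "mk (und A) f (und A)"
  have [simp]: "f \<in> Hom (und A) (und A)" by (rule True)
  have "Mu A \<bullet> (?S \<star> Id (und A)) \<bullet> De A = Et A \<bullet> Ep A
     \<longleftrightarrow> \<nabla>\<^bsub>A\<^esub> \<cdot> (f \<otimes> ide (und A)) \<cdot> \<Delta>\<^bsub>A\<^esub> = \<eta>\<^bsub>A\<^esub> \<cdot> \<epsilon>\<^bsub>A\<^esub>"
    by (auto dest: arg_cong[where f = mor] intro!: arr_eqI)
  moreover have "Mu A \<bullet> (Id (und A) \<star> ?S) \<bullet> De A = Et A \<bullet> Ep A
     \<longleftrightarrow> \<nabla>\<^bsub>A\<^esub> \<cdot> (ide (und A) \<otimes> f) \<cdot> \<Delta>\<^bsub>A\<^esub> = \<eta>\<^bsub>A\<^esub> \<cdot> \<epsilon>\<^bsub>A\<^esub>"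
    by (auto dest: arg_cong[where f = mor] intro!: arr_eqI)
  ultimately show ?thesis unfolding is_antipode_def antipode_arr_def by simp
qed (simp add: is_antipode_def antipode_arr_def)

lemma bicommutative_iff:
  assumes [simp]: "bimonoid \<C> A"
  shows "bicommutative \<C> A \<longleftrightarrow> Mu A \<bullet> Sy (und A) (und A) = Mu A \<and> Sy (und A) (und A) \<bullet> De A = De A"
proof -
  have "Mu A \<bullet> Sy (und A) (und A) = Mu A \<longleftrightarrow> \<nabla>\<^bsub>A\<^esub> \<cdot> \<s> (und A) (und A) = \<nabla>\<^bsub>A\<^esub>"
    by (auto dest: arg_cong[where f = mor] intro!: arr_eqI)
  moreover have "Sy (und A) (und A) \<bullet> De A = De A \<longleftrightarrow> \<s> (und A) (und A) \<cdot> \<Delta>\<^bsub>A\<^esub> = \<Delta>\<^bsub>A\<^esub>"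
    by (auto dest: arg_cong[where f = mor] intro!: arr_eqI)
  ultimately show ?thesis unfolding bicommutative_def by simp
qed

lemma bc_hopf_monoid_iff:
  "bc_hopf_monoid \<C> A \<longleftrightarrow> bimonoid \<C> A \<and> (\<exists>S. antipode_arr A S) \<and>
     Mu A \<bullet> Sy (und A) (und A) = Mu A \<and> Sy (und A) (und A) \<bullet> De A = De A"
proof (cases "bimonoid \<C> A")
  case True
  have "(\<exists>f. antipode_arr A (mk (und A) f (und A))) \<longleftrightarrow> (\<exists>S. antipode_arr A S)"
    using mk_mor unfolding antipode_arr_def by metis
  then have "(\<exists>S. is_antipode \<C> A S) \<longleftrightarrow> (\<exists>S. antipode_arr A S)" unfolding is_antipode_antipode_arr[OF True] .
  then show ?thesis unfolding bc_hopf_monoid_def hopf_monoid_def bicommutative_iff[OF True]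
    using True by blast
qed (simp add: bc_hopf_monoid_def hopf_monoid_def)

lemma bc_bim [simp]: "bc_hopf_monoid \<C> A \<Longrightarrow> bimonoid \<C> A"
  by (simp add: bc_hopf_monoid_def hopf_monoid_def)

lemma Mu_Sy: "bc_hopf_monoid \<C> A \<Longrightarrow> Mu A \<bullet> Sy (und A) (und A) = Mu A"
  and Sy_De: "bc_hopf_monoid \<C> A \<Longrightarrow> Sy (und A) (und A) \<bullet> De A = De A"
  by (simp_all add: bc_hopf_monoid_iff)

lemma antipodeE:
  assumes "bc_hopf_monoid \<C> A"
  obtains S where "arr S" "dm S = und A" "cd S = und A"
    "Mu A \<bullet> (S \<star> Id (und A)) \<bullet> De A = Et A \<bullet> Ep A" "Mu A \<bullet> (Id (und A) \<star> S) \<bullet> De A = Et A \<bullet> Ep A"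
  using assms unfolding bc_hopf_monoid_iff antipode_arr_def by blast

lemma triv_tns:
  assumes [simp]: "bimonoid \<C> K" "X \<in> ob \<C>" "V \<in> ob \<C>"
  shows "(triv K X \<star> Id V) \<bullet> As' (und K) X V = triv K (X \<odot> V)"
proof -
  have "(triv K X \<star> Id V) \<bullet> As' (und K) X V = (Lu X \<star> Id V) \<bullet> ((Ep K \<star> Id X) \<star> Id V) \<bullet> As' (und K) X V"
    by (simp add: triv_def tns_cmp2)
  also have "((Ep K \<star> Id X) \<star> Id V) \<bullet> As' (und K) X V = As' \<one> X V \<bullet> (Ep K \<star> Id (X \<odot> V))"
    using As'_nat[of "Ep K" "Id X" "Id V" \<one> X V] by simp
  also have "(Lu X \<star> Id V) \<bullet> As' \<one> X V \<bullet> (Ep K \<star> Id (X \<odot> V)) = triv K (X \<odot> V)"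
    by (simp add: cmp_eq_assoc[OF Lu_As'] triv_def)
  finally show ?thesis .
qed

lemma act_Mu:
  assumes k: "bhom K A k"
  shows "Mu A \<bullet> (act A k \<star> Id (und A)) = act A k \<bullet> (Id (und K) \<star> Mu A) \<bullet> As (und K) (und A) (und A)"
proof -
  note [simp] = bhom_simps[OF k]
  have "Mu A \<bullet> (act A k \<star> Id (und A)) = (Mu A \<bullet> (Mu A \<star> Id (und A))) \<bullet> ((k \<star> Id (und A)) \<star> Id (und A))"
    by (simp add: act_def cmp_assoc tns_cmp)
  also have "\<dots> = Mu A \<bullet> (Id (und A) \<star> Mu A) \<bullet> (k \<star> (Id (und A) \<star> Id (und A))) \<bullet> As (und K) (und A) (und A)"
    by (simp add: Mu_assoc cmp_assoc As_nat del: Id_tns_Id)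
  finally show ?thesis by (simp add: act_def cmp_assoc tns_cmp2)
qed

lemma triv_Mu:
  assumes [simp]: "bimonoid \<C> K" "bimonoid \<C> A"
  shows "Mu A \<bullet> (triv K (und A) \<star> Id (und A)) = triv K (und A) \<bullet> (Id (und K) \<star> Mu A) \<bullet> As (und K) (und A) (und A)"
proof -
  have "triv K (und A) \<star> Id (und A) = triv K (und A \<odot> und A) \<bullet> As (und K) (und A) (und A)"
    by (simp add: triv_tns[symmetric] cmp_assoc)
  then have "Mu A \<bullet> (triv K (und A) \<star> Id (und A)) = (Mu A \<bullet> triv K (und A \<odot> und A)) \<bullet> As (und K) (und A) (und A)"
    by (simp add: cmp_assoc)
  also have "Mu A \<bullet> triv K (und A \<odot> und A) = triv K (und A) \<bullet> (Id (und K) \<star> Mu A)"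
    using triv_nat[of K "Mu A"] by (simp add: triv_def[of K "und A"] cmp_assoc tns_cmp)
  finally show ?thesis by (simp add: cmp_assoc)
qed

lemma action_quotient_factor:
  assumes k: "bhom K A k" and q: "action_quotient \<C> K A (mor k) P (mor p)"
    and p: "arr p" "dm p = und A" "cd p = P"
    and [simp]: "arr h" "dm h = und A" and inv: "h \<bullet> act A k = h \<bullet> triv K (und A)"
  shows "\<exists>h'. arr h' \<and> dm h' = P \<and> cd h' = cd h \<and> h' \<bullet> p = h"
proof -
  note [simp] = bhom_simps[OF k] p
  have P [simp]: "P \<in> ob \<C>" using p cd_ob by blast
  have "(h \<bullet> Ru (und A)) \<bullet> (act A k \<star> Id \<one>) = (h \<bullet> act A k) \<bullet> Ru (und K \<odot> und A)"
    by (simp add: cmp_assoc Ru_nat)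
  also have "\<dots> = (h \<bullet> Ru (und A)) \<bullet> (triv K (und A) \<star> Id \<one>)"
    by (simp add: cmp_assoc Ru_nat inv)
  finally have "(h \<bullet> Ru (und A)) \<bullet> (act A k \<star> Id \<one>) = (h \<bullet> Ru (und A)) \<bullet> (triv K (und A) \<star> Id \<one>)" .
  from action_quotientD(3)[OF k q p _ _ _ this] obtain h' where [simp]: "arr h'" "dm h' = P \<odot> \<one>" "cd h' = cd h"
    and h': "h' \<bullet> (p \<star> Id \<one>) = h \<bullet> Ru (und A)" by auto
  have "(h' \<bullet> Ru' P) \<bullet> p = (h' \<bullet> (p \<star> Id \<one>)) \<bullet> Ru' (und A)" by (simp add: cmp_assoc Ru'_nat)
  also have "\<dots> = h" unfolding h' by (simp add: cmp_assoc)
  finally show ?thesis by (intro exI[of _ "h' \<bullet> Ru' P"]) simp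
qed

text \<open>
  By \<open>comul_act_invariant\<close> the action arrives at the first tensor factor only, where \<open>p\<close> cannot see it.  So the
  comultiplication of \<open>A\<close> descends to the quotient.
\<close>

lemma comul_quotient_invariant:
  assumes k: "bhom K A k" and [simp]: "arr p" "dm p = und A"
    and inv: "p \<bullet> act A k = p \<bullet> triv K (und A)"
  shows "((p \<star> p) \<bullet> De A) \<bullet> act A k = ((p \<star> p) \<bullet> De A) \<bullet> triv K (und A)"
proof -
  let ?A = "und A" and ?K = "und K"
  note [simp] = bhom_simps[OF k]
  have "((p \<star> p) \<bullet> De A) \<bullet> act A k = (p \<star> Id (cd p)) \<bullet> ((Id ?A \<star> p) \<bullet> De A \<bullet> act A k)"
    by (simp add: cmp_assoc tns_cmp2)
  also have "\<dots> = ((p \<bullet> act A k) \<star> p) \<bullet> As' ?K ?A ?A \<bullet> (Id ?K \<star> De A)"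
    by (simp add: comul_act_invariant[OF k _ _ inv] tns_cmp2)
  also have "\<dots> = (p \<star> p) \<bullet> ((triv K ?A \<star> Id ?A) \<bullet> As' ?K ?A ?A) \<bullet> (Id ?K \<star> De A)"
    unfolding inv by (simp add: tns_cmp2 cmp_assoc)
  also have "\<dots> = (p \<star> p) \<bullet> De A \<bullet> triv K ?A"
    using triv_nat[of K "De A"] by (simp add: triv_tns) (simp add: triv_def cmp_assoc tns_cmp)
  finally show ?thesis by (simp add: cmp_assoc)
qed

text \<open>
  The multiplication descends in one variable at a time; each time the other variable is an object \<open>V\<close> beside the
  quotient, and commutativity brings the second variable to the front.
\<close>

lemma mul_quotient:
  assumes hA: "bc_hopf_monoid \<C> A" and k: "bhom K A k" and q: "action_quotient \<C> K A (mor k) P (mor p)"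
    and p: "arr p" "dm p = und A" "cd p = P"
  shows "\<exists>m. arr m \<and> dm m = P \<odot> P \<and> cd m = P \<and> m \<bullet> (p \<star> p) = p \<bullet> Mu A"
proof -
  let ?A = "und A" and ?K = "und K"
  note [simp] = bhom_simps[OF k] p
  note i = action_quotientD(1)[OF k q p]
  have P [simp]: "P \<in> ob \<C>" using p cd_ob by blast
  have inv: "(p \<bullet> Mu A) \<bullet> (act A k \<star> Id ?A) = (p \<bullet> Mu A) \<bullet> (triv K ?A \<star> Id ?A)"
    by (simp add: cmp_assoc act_Mu[OF k] triv_Mu cmp_eq_assoc[OF i])
  from action_quotientD(3)[OF k q p _ _ _ inv] obtain h where [simp]: "arr h" "dm h = P \<odot> ?A" "cd h = P"
    and h: "h \<bullet> (p \<star> Id ?A) = p \<bullet> Mu A" by auto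
  \<comment> \<open>To descend in the second variable, compare after the epimorphism \<open>p\<close> in the first one.\<close>
  have "((h \<bullet> Sy ?A P) \<bullet> (act A k \<star> Id P)) \<bullet> (Id (?K \<odot> ?A) \<star> p)
      = (h \<bullet> (p \<star> Id ?A)) \<bullet> Sy ?A ?A \<bullet> (act A k \<star> Id ?A)"
    by (simp add: cmp_assoc tns_cmp tns_cmp2 Sy_nat)
  also have "\<dots> = (p \<bullet> Mu A) \<bullet> (act A k \<star> Id ?A)"
    unfolding h by (simp add: cmp_assoc cmp_eq_assoc[OF Mu_Sy[OF hA]])
  also note inv
  also have "(p \<bullet> Mu A) \<bullet> (triv K ?A \<star> Id ?A) = (h \<bullet> (p \<star> Id ?A)) \<bullet> Sy ?A ?A \<bullet> (triv K ?A \<star> Id ?A)"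
    unfolding h by (simp add: cmp_assoc cmp_eq_assoc[OF Mu_Sy[OF hA]])
  also have "\<dots> = ((h \<bullet> Sy ?A P) \<bullet> (triv K ?A \<star> Id P)) \<bullet> (Id (?K \<odot> ?A) \<star> p)"
    by (simp add: cmp_assoc tns_cmp tns_cmp2 Sy_nat)
  finally have "(h \<bullet> Sy ?A P) \<bullet> (act A k \<star> Id P) = (h \<bullet> Sy ?A P) \<bullet> (triv K ?A \<star> Id P)"
    by (rule tepi_epi) (use tepi_Id_tns[OF action_quotientD(2)[OF k q p]] in simp_all)
  from action_quotientD(3)[OF k q p _ _ _ this] obtain m where [simp]: "arr m" "dm m = P \<odot> P" "cd m = P"
    and m: "m \<bullet> (p \<star> Id P) = h \<bullet> Sy ?A P" by auto
  have "m \<bullet> (p \<star> p) = (m \<bullet> (p \<star> Id P)) \<bullet> (Id ?A \<star> p)" by (simp add: cmp_assoc tns_cmp)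
  also have "\<dots> = (h \<bullet> (p \<star> Id ?A)) \<bullet> Sy ?A ?A" unfolding m by (simp add: cmp_assoc Sy_nat)
  also have "\<dots> = p \<bullet> Mu A" unfolding h by (simp add: cmp_assoc Mu_Sy[OF hA])
  finally show ?thesis by (intro exI[of _ m]) simp
qed

lemma comul_assoc_beside:
  assumes [simp]: "bimonoid \<C> A" "X \<in> ob \<C>"
  shows "As (X \<odot> und A) (und A) (und A) \<bullet> (As' X (und A) (und A) \<star> Id (und A)) \<bullet> ((Id X \<star> De A) \<star> Id (und A))
           \<bullet> As' X (und A) (und A) \<bullet> (Id X \<star> De A)
       = (Id (X \<odot> und A) \<star> De A) \<bullet> As' X (und A) (und A) \<bullet> (Id X \<star> De A)"
proof -
  let ?A = "und A"
  have e: "((Id X \<star> De A) \<star> Id ?A) \<bullet> As' X ?A ?A = As' X (?A \<odot> ?A) ?A \<bullet> (Id X \<star> (De A \<star> Id ?A))"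
    by (simp add: As'_nat)
  have "As (X \<odot> ?A) ?A ?A \<bullet> (As' X ?A ?A \<star> Id ?A) \<bullet> ((Id X \<star> De A) \<star> Id ?A) \<bullet> As' X ?A ?A \<bullet> (Id X \<star> De A)
    = (As (X \<odot> ?A) ?A ?A \<bullet> (As' X ?A ?A \<star> Id ?A) \<bullet> As' X (?A \<odot> ?A) ?A) \<bullet> (Id X \<star> (De A \<star> Id ?A)) \<bullet> (Id X \<star> De A)"
    by (simp add: cmp_assoc cmp_eq_assoc[OF e])
  also have "\<dots> = As' X ?A (?A \<odot> ?A) \<bullet> (Id X \<star> (As ?A ?A ?A \<bullet> (De A \<star> Id ?A) \<bullet> De A))"
    by (simp add: pentagon_inv cmp_assoc tns_cmp)
  also have "\<dots> = As' X ?A (?A \<odot> ?A) \<bullet> (Id X \<star> (Id ?A \<star> De A)) \<bullet> (Id X \<star> De A)"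
    by (simp add: De_assoc tns_cmp)
  also have "\<dots> = (Id (X \<odot> ?A) \<star> De A) \<bullet> As' X ?A ?A \<bullet> (Id X \<star> De A)"
    using As'_nat[of "Id X" "Id ?A" "De A" X ?A "?A \<odot> ?A", THEN cmp_eq_assoc, of "Id X \<star> De A"]
    by (simp add: cmp_assoc)
  finally show ?thesis .
qed

text \<open>
  The antipode descends because convolution inverses are unique:
  \<open>pS(kx) = pS(kx\<^sub>1) p(x\<^sub>2) pS(x\<^sub>3) = pS(kx\<^sub>1) p(kx\<^sub>2) pS(x\<^sub>3)\<close>, where the first two factors cancel.
\<close>

lemma antipode_invariant:
  assumes k: "bhom K A k" and f: "bhom A Z p" and S: "antipode_arr A S"
    and inv: "p \<bullet> act A k = p \<bullet> triv K (und A)"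
  shows "(p \<bullet> S) \<bullet> act A k = (p \<bullet> S) \<bullet> triv K (und A)"
proof -
  let ?A = "und A" and ?K = "und K" and ?Z = "und Z" and ?g = "p \<bullet> S" and ?a = "act A k" and ?t = "triv K (und A)"
  note [simp] = bhom_simps[OF k] bhom_simps[OF f]
  have [simp]: "arr S" "dm S = ?A" "cd S = ?A" using S unfolding antipode_arr_def by auto
  have S1: "Mu A \<bullet> (S \<star> Id ?A) \<bullet> De A = Et A \<bullet> Ep A" and S2: "Mu A \<bullet> (Id ?A \<star> S) \<bullet> De A = Et A \<bullet> Ep A"
    using S unfolding antipode_arr_def by auto
  have pM: "Mu Z \<bullet> (p \<star> p) = p \<bullet> Mu A" and pE: "p \<bullet> Et A = Et Z" using bhom_eqs[OF f] by auto
  have g1: "Mu Z \<bullet> (?g \<star> p) \<bullet> De A = Et Z \<bullet> Ep A"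
  proof -
    have "Mu Z \<bullet> (?g \<star> p) \<bullet> De A = (Mu Z \<bullet> (p \<star> p)) \<bullet> (S \<star> Id ?A) \<bullet> De A" by (simp add: cmp_assoc tns_cmp2)
    also have "\<dots> = p \<bullet> Et A \<bullet> Ep A" unfolding pM by (simp add: cmp_assoc S1)
    finally show ?thesis by (simp add: cmp_eq_assoc[OF pE])
  qed
  have g2: "Mu Z \<bullet> (p \<star> ?g) \<bullet> De A = Et Z \<bullet> Ep A"
  proof -
    have "Mu Z \<bullet> (p \<star> ?g) \<bullet> De A = (Mu Z \<bullet> (p \<star> p)) \<bullet> (Id ?A \<star> S) \<bullet> De A" by (simp add: cmp_assoc tns_cmp2)
    also have "\<dots> = p \<bullet> Et A \<bullet> Ep A" unfolding pM by (simp add: cmp_assoc S2)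
    finally show ?thesis by (simp add: cmp_eq_assoc[OF pE])
  qed
  have Epa: "Ep A \<bullet> ?a = Lu \<one> \<bullet> (Ep K \<star> Ep A)"
    by (simp add: act_def cmp_eq_assoc[OF Ep_Mu] cmp_assoc tns_cmp bhom_eqs(4)[OF k])
  have E1: "Mu Z \<bullet> ((?g \<bullet> ?a) \<star> p) \<bullet> As' ?K ?A ?A \<bullet> (Id ?K \<star> De A) = Et Z \<bullet> Lu \<one> \<bullet> (Ep K \<star> Ep A)"
  proof -
    have "Mu Z \<bullet> ((?g \<bullet> ?a) \<star> p) \<bullet> As' ?K ?A ?A \<bullet> (Id ?K \<star> De A)
       = Mu Z \<bullet> (?g \<star> Id ?Z) \<bullet> ((?a \<star> p) \<bullet> As' ?K ?A ?A \<bullet> (Id ?K \<star> De A))"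
      by (simp add: tns_cmp2)
    also have "\<dots> = Mu Z \<bullet> (?g \<star> Id ?Z) \<bullet> (Id ?A \<star> p) \<bullet> De A \<bullet> ?a"
      by (simp add: comul_act_invariant[OF k _ _ inv])
    also have "\<dots> = (Mu Z \<bullet> (?g \<star> p) \<bullet> De A) \<bullet> ?a" by (simp add: tns_cmp2 cmp_assoc)
    finally show ?thesis by (simp add: g1 cmp_assoc Epa)
  qed
  let ?R = "Mu Z \<bullet> ((Mu Z \<bullet> ((?g \<bullet> ?a) \<star> p) \<bullet> As' ?K ?A ?A \<bullet> (Id ?K \<star> De A)) \<star> ?g) \<bullet> As' ?K ?A ?A \<bullet> (Id ?K \<star> De A)"
  have "?R = (Mu Z \<bullet> (Et Z \<star> Id ?Z)) \<bullet> (Lu \<one> \<star> Id ?Z) \<bullet> (((Ep K \<star> Ep A) \<star> ?g) \<bullet> As' ?K ?A ?A) \<bullet> (Id ?K \<star> De A)"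
    unfolding E1 by (simp add: cmp_assoc tns_cmp2)
  also have "((Ep K \<star> Ep A) \<star> ?g) \<bullet> As' ?K ?A ?A = As' \<one> \<one> ?Z \<bullet> (Ep K \<star> (Ep A \<star> ?g))"
    by (simp add: As'_nat)
  also have "(Mu Z \<bullet> (Et Z \<star> Id ?Z)) \<bullet> (Lu \<one> \<star> Id ?Z) \<bullet> (As' \<one> \<one> ?Z \<bullet> (Ep K \<star> (Ep A \<star> ?g))) \<bullet> (Id ?K \<star> De A)
     = Lu ?Z \<bullet> Lu (\<one> \<odot> ?Z) \<bullet> (Ep K \<star> ((Ep A \<star> ?g) \<bullet> De A))"
    by (simp add: Mu_Et cmp_eq_assoc[OF Lu_As'] cmp_assoc tns_cmp)
  also have "\<dots> = Lu ?Z \<bullet> (Ep K \<star> (Lu ?Z \<bullet> (Ep A \<star> ?g) \<bullet> De A))"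
    by (simp add: Lu_unit_tns tns_cmp)
  also have "Lu ?Z \<bullet> (Ep A \<star> ?g) \<bullet> De A = ?g"
  proof -
    have "Lu ?Z \<bullet> (Ep A \<star> ?g) \<bullet> De A = (Lu ?Z \<bullet> (Id \<one> \<star> ?g)) \<bullet> (Ep A \<star> Id ?A) \<bullet> De A"
      by (simp add: cmp_assoc tns_cmp2)
    also have "\<dots> = ?g \<bullet> (Lu ?A \<bullet> (Ep A \<star> Id ?A) \<bullet> De A)" by (simp add: Lu_nat cmp_assoc)
    finally show ?thesis by (simp add: De_Ep)
  qed
  also have "Lu ?Z \<bullet> (Ep K \<star> ?g) = ?g \<bullet> ?t" using triv_nat[of K ?g] by simp
  finally have R1: "?R = ?g \<bullet> ?t" .
  have "?R = (Mu Z \<bullet> (Mu Z \<star> Id ?Z)) \<bullet> (((?g \<bullet> ?a) \<star> p) \<star> ?g) \<bullet> (As' ?K ?A ?A \<star> Id ?A) \<bullet> ((Id ?K \<star> De A) \<star> Id ?A)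
       \<bullet> As' ?K ?A ?A \<bullet> (Id ?K \<star> De A)"
    by (simp add: cmp_assoc tns_cmp2)
  also have "\<dots> = Mu Z \<bullet> (Id ?Z \<star> Mu Z) \<bullet> (As ?Z ?Z ?Z \<bullet> (((?g \<bullet> ?a) \<star> p) \<star> ?g)) \<bullet> (As' ?K ?A ?A \<star> Id ?A) \<bullet> ((Id ?K \<star> De A) \<star> Id ?A)
       \<bullet> As' ?K ?A ?A \<bullet> (Id ?K \<star> De A)"
    by (simp add: Mu_assoc cmp_assoc)
  also have "As ?Z ?Z ?Z \<bullet> (((?g \<bullet> ?a) \<star> p) \<star> ?g) = ((?g \<bullet> ?a) \<star> (p \<star> ?g)) \<bullet> As (?K \<odot> ?A) ?A ?A"
    by (simp add: As_nat)
  also have "Mu Z \<bullet> (Id ?Z \<star> Mu Z) \<bullet> (((?g \<bullet> ?a) \<star> (p \<star> ?g)) \<bullet> As (?K \<odot> ?A) ?A ?A) \<bullet> (As' ?K ?A ?A \<star> Id ?A) \<bullet> ((Id ?K \<star> De A) \<star> Id ?A)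
       \<bullet> As' ?K ?A ?A \<bullet> (Id ?K \<star> De A)
     = Mu Z \<bullet> ((?g \<bullet> ?a) \<star> (Mu Z \<bullet> (p \<star> ?g))) \<bullet> (Id (?K \<odot> ?A) \<star> De A) \<bullet> As' ?K ?A ?A \<bullet> (Id ?K \<star> De A)"
    using comul_assoc_beside[of A ?K] by (simp add: cmp_assoc tns_cmp2)
  also have "\<dots> = Mu Z \<bullet> ((?g \<bullet> ?a) \<star> (Mu Z \<bullet> (p \<star> ?g) \<bullet> De A)) \<bullet> As' ?K ?A ?A \<bullet> (Id ?K \<star> De A)"
    by (simp add: tns_cmp2 cmp_assoc)
  also have "\<dots> = (Mu Z \<bullet> (Id ?Z \<star> Et Z)) \<bullet> ((?g \<bullet> ?a) \<star> Id \<one>) \<bullet> ((Id ?K \<star> Id ?A) \<star> Ep A) \<bullet> As' ?K ?A ?A \<bullet> (Id ?K \<star> De A)"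
    unfolding g2 by (simp add: tns_cmp2 cmp_assoc)
  also have "\<dots> = Ru ?Z \<bullet> ((?g \<bullet> ?a) \<star> Id \<one>) \<bullet> (((Id ?K \<star> Id ?A) \<star> Ep A) \<bullet> As' ?K ?A ?A) \<bullet> (Id ?K \<star> De A)"
    by (simp add: Mu_Et cmp_assoc)
  also have "((Id ?K \<star> Id ?A) \<star> Ep A) \<bullet> As' ?K ?A ?A = As' ?K ?A \<one> \<bullet> (Id ?K \<star> (Id ?A \<star> Ep A))"
    by (subst As'_nat) auto
  also have "Ru ?Z \<bullet> ((?g \<bullet> ?a) \<star> Id \<one>) \<bullet> (As' ?K ?A \<one> \<bullet> (Id ?K \<star> (Id ?A \<star> Ep A))) \<bullet> (Id ?K \<star> De A)
     = (?g \<bullet> ?a) \<bullet> (Ru (?K \<odot> ?A) \<bullet> As' ?K ?A \<one>) \<bullet> (Id ?K \<star> (Id ?A \<star> Ep A)) \<bullet> (Id ?K \<star> De A)"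
    by (simp add: cmp_eq_assoc[OF Ru_nat] cmp_assoc)
  also have "\<dots> = ?g \<bullet> ?a"
    by (simp add: Ru_As' tns_cmp tns_cmp2 De_Ep cmp_assoc)
  finally show ?thesis unfolding R1 ..
qed

text \<open>Every axiom holds for the quotient because it holds after composition with tensor powers of \<open>p\<close>.\<close>

lemma quotient_hopf:
  assumes hA: "bc_hopf_monoid \<C> A" and k: "bhom K A k" and q: "action_quotient \<C> K A (mor k) P (mor p)"
    and p: "arr p" "dm p = und A" "cd p = P"
  shows "\<exists>Z. und Z = P \<and> bc_hopf_monoid \<C> Z \<and> bhom A Z p"
proof -
  let ?A = "und A" and ?K = "und K"
  note [simp] = bhom_simps[OF k] p
  note i = action_quotientD(1)[OF k q p]
  have P [simp]: "P \<in> ob \<C>" using p cd_ob by blast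
  obtain m where [simp]: "arr m" "dm m = P \<odot> P" "cd m = P" and m: "m \<bullet> (p \<star> p) = p \<bullet> Mu A"
    using mul_quotient[OF hA k q p] by blast
  obtain d where [simp]: "arr d" "dm d = P" "cd d = P \<odot> P" and d: "d \<bullet> p = (p \<star> p) \<bullet> De A"
    using action_quotient_factor[OF k q p _ _ comul_quotient_invariant[OF k p(1,2) i]] by auto
  \<comment> \<open>The counit ignores translations, so it descends as well.\<close>
  have "Ep A \<bullet> act A k = Ep A \<bullet> triv K ?A"
    using triv_nat[of K "Ep A"] by (simp add: act_def cmp_eq_assoc[OF Ep_Mu] cmp_assoc tns_cmp bhom_eqs(4)[OF k])
  then obtain e where [simp]: "arr e" "dm e = P" "cd e = \<one>" and e: "e \<bullet> p = Ep A"
    using action_quotient_factor[OF k q p, of "Ep A"] by auto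
  define n where "n = p \<bullet> Et A"
  have [simp]: "arr n" "dm n = \<one>" "cd n = P" unfolding n_def by simp_all
  define Z where "Z = \<lparr> und = P, mul = mor m, uni = mor n, comul = mor d, coun = mor e \<rparr>"
  have [simp]: "und Z = P" by (simp add: Z_def)
  have [simp]: "Mu Z = m" "Et Z = n" "De Z = d" "Ep Z = e"
    unfolding Mu_def Et_def De_def Ep_def Z_def by (auto intro!: arr_eqI)
  note md = m d e
  note md2 = md[THEN cmp_eq_assoc]
  note t1 = action_quotientD(2)[OF k q p]
  note t2 = tepi_tns[OF t1 t1]
  note t3 = tepi_tns[OF t2 t1]
  note [simp] = t1 t2 t3
  have Z: "bimonoid \<C> Z"
  proof (rule bimonoidI, simp_all)
    have "(m \<bullet> (m \<star> Id P)) \<bullet> ((p \<star> p) \<star> p) = p \<bullet> Mu A \<bullet> (Mu A \<star> Id ?A)"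
      using md2(1)[of "Mu A \<star> Id ?A"] by (simp add: cmp_assoc tns_cmp m)
    also have "\<dots> = p \<bullet> Mu A \<bullet> (Id ?A \<star> Mu A) \<bullet> As ?A ?A ?A" by (simp add: Mu_assoc)
    also have "\<dots> = (m \<bullet> (Id P \<star> m) \<bullet> As P P P) \<bullet> ((p \<star> p) \<star> p)"
      using md2(1)[of "(Id ?A \<star> Mu A) \<bullet> As ?A ?A ?A"] by (simp add: cmp_assoc As_nat tns_cmp2 m)
    finally show "m \<bullet> (m \<star> Id P) = m \<bullet> (Id P \<star> m) \<bullet> As P P P" by (rule tepi_epi) simp_all
    have "(m \<bullet> (n \<star> Id P)) \<bullet> (Id \<one> \<star> p) = (m \<bullet> (p \<star> p)) \<bullet> (Et A \<star> Id ?A)"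
      by (simp add: cmp_assoc tns_cmp n_def)
    also have "\<dots> = Lu P \<bullet> (Id \<one> \<star> p)" unfolding m by (simp add: cmp_assoc Mu_Et Lu_nat)
    finally show "m \<bullet> (n \<star> Id P) = Lu P" by (rule tepi_epi) (simp_all add: tepi_Id_tns)
    have "(m \<bullet> (Id P \<star> n)) \<bullet> (p \<star> Id \<one>) = (m \<bullet> (p \<star> p)) \<bullet> (Id ?A \<star> Et A)"
      by (simp add: cmp_assoc tns_cmp n_def)
    also have "\<dots> = Ru P \<bullet> (p \<star> Id \<one>)" unfolding m by (simp add: cmp_assoc Mu_Et Ru_nat)
    finally show "m \<bullet> (Id P \<star> n) = Ru P" by (rule tepi_epi) (simp_all add: tepi_tns_Id)
    have "(As P P P \<bullet> (d \<star> Id P) \<bullet> d) \<bullet> p = (As P P P \<bullet> ((p \<star> p) \<star> p)) \<bullet> (De A \<star> Id ?A) \<bullet> De A"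
      by (simp add: cmp_assoc d tns_cmp2)
    also have "\<dots> = (p \<star> (p \<star> p)) \<bullet> (Id ?A \<star> De A) \<bullet> De A" by (simp add: As_nat cmp_assoc De_assoc)
    also have "\<dots> = ((Id P \<star> d) \<bullet> d) \<bullet> p" by (simp add: cmp_assoc d tns_cmp2)
    finally show "As P P P \<bullet> (d \<star> Id P) \<bullet> d = (Id P \<star> d) \<bullet> d" by (rule tepi_epi) simp_all
    have "(Lu P \<bullet> (e \<star> Id P) \<bullet> d) \<bullet> p = (Lu P \<bullet> (Id \<one> \<star> p)) \<bullet> (Ep A \<star> Id ?A) \<bullet> De A"
      by (simp add: cmp_assoc d tns_cmp2 e)
    also have "\<dots> = Id P \<bullet> p" by (simp add: Lu_nat cmp_assoc De_Ep)
    finally show "Lu P \<bullet> (e \<star> Id P) \<bullet> d = Id P" by (rule tepi_epi) simp_all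
    have "(Ru P \<bullet> (Id P \<star> e) \<bullet> d) \<bullet> p = (Ru P \<bullet> (p \<star> Id \<one>)) \<bullet> (Id ?A \<star> Ep A) \<bullet> De A"
      by (simp add: cmp_assoc d tns_cmp2 e)
    also have "\<dots> = Id P \<bullet> p" by (simp add: Ru_nat cmp_assoc De_Ep)
    finally show "Ru P \<bullet> (Id P \<star> e) \<bullet> d = Id P" by (rule tepi_epi) simp_all
    have "(d \<bullet> m) \<bullet> (p \<star> p) = (p \<star> p) \<bullet> De A \<bullet> Mu A" by (simp add: cmp_assoc m md2(2))
    also have "\<dots> = ((p \<bullet> Mu A) \<star> (p \<bullet> Mu A)) \<bullet> Mf ?A ?A ?A ?A \<bullet> (De A \<star> De A)"
      by (simp add: De_Mu tns_cmp2)
    also have "\<dots> = (m \<star> m) \<bullet> ((p \<star> p) \<star> (p \<star> p)) \<bullet> Mf ?A ?A ?A ?A \<bullet> (De A \<star> De A)"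
      by (simp add: tns_cmp2 m)
    also have "\<dots> = (m \<star> m) \<bullet> (Mf P P P P \<bullet> ((p \<star> p) \<star> (p \<star> p))) \<bullet> (De A \<star> De A)"
      by (simp add: Mf_nat cmp_assoc)
    also have "\<dots> = ((m \<star> m) \<bullet> Mf P P P P \<bullet> (d \<star> d)) \<bullet> (p \<star> p)"
      by (simp add: cmp_assoc tns_cmp d)
    finally show "d \<bullet> m = (m \<star> m) \<bullet> Mf P P P P \<bullet> (d \<star> d)" by (rule tepi_epi) simp_all
    have "(e \<bullet> m) \<bullet> (p \<star> p) = Lu \<one> \<bullet> (Ep A \<star> Ep A)"
      by (simp add: cmp_assoc m md2(3) Ep_Mu)
    also have "\<dots> = (Lu \<one> \<bullet> (e \<star> e)) \<bullet> (p \<star> p)" by (simp add: cmp_assoc tns_cmp e)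
    finally show "e \<bullet> m = Lu \<one> \<bullet> (e \<star> e)" by (rule tepi_epi) simp_all
    show "d \<bullet> n = (n \<star> n) \<bullet> Lu' \<one>"
      by (simp add: n_def md2(2) cmp_assoc De_Et tns_cmp2)
    show "e \<bullet> n = Id \<one>" by (simp add: n_def md2(3) Ep_Et)
  qed
  have f: "bhom A Z p" unfolding bhom_def using Z m d e by (simp add: n_def)
  obtain S where S: "antipode_arr A S" using hA unfolding bc_hopf_monoid_iff by blast
  have [simp]: "arr S" "dm S = ?A" "cd S = ?A" and S1: "Mu A \<bullet> (S \<star> Id ?A) \<bullet> De A = Et A \<bullet> Ep A"
    and S2: "Mu A \<bullet> (Id ?A \<star> S) \<bullet> De A = Et A \<bullet> Ep A"
    using S unfolding antipode_arr_def by auto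
  obtain s where [simp]: "arr s" "dm s = P" "cd s = P" and s: "s \<bullet> p = p \<bullet> S"
    using action_quotient_factor[OF k q p _ _ antipode_invariant[OF k f S i]] by auto
  have "antipode_arr Z s" unfolding antipode_arr_def
  proof (intro conjI, simp_all)
    have "(m \<bullet> (s \<star> Id P) \<bullet> d) \<bullet> p = (m \<bullet> (p \<star> p)) \<bullet> (S \<star> Id ?A) \<bullet> De A"
      by (simp add: cmp_assoc d tns_cmp2 s)
    also have "\<dots> = (n \<bullet> e) \<bullet> p" unfolding m by (simp add: cmp_assoc S1 e n_def)
    finally show "m \<bullet> (s \<star> Id P) \<bullet> d = n \<bullet> e" by (rule tepi_epi) simp_all
    have "(m \<bullet> (Id P \<star> s) \<bullet> d) \<bullet> p = (m \<bullet> (p \<star> p)) \<bullet> (Id ?A \<star> S) \<bullet> De A"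
      by (simp add: cmp_assoc d tns_cmp2 s)
    also have "\<dots> = (n \<bullet> e) \<bullet> p" unfolding m by (simp add: cmp_assoc S2 e n_def)
    finally show "m \<bullet> (Id P \<star> s) \<bullet> d = n \<bullet> e" by (rule tepi_epi) simp_all
  qed
  moreover have "m \<bullet> Sy P P = m"
  proof -
    have "(m \<bullet> Sy P P) \<bullet> (p \<star> p) = (m \<bullet> (p \<star> p)) \<bullet> Sy ?A ?A" by (simp add: cmp_assoc Sy_nat)
    also have "\<dots> = m \<bullet> (p \<star> p)" unfolding m by (simp add: cmp_assoc Mu_Sy[OF hA])
    finally show ?thesis by (rule tepi_epi) simp_all
  qed
  moreover have "Sy P P \<bullet> d = d"
  proof -
    have "(Sy P P \<bullet> d) \<bullet> p = (p \<star> p) \<bullet> Sy ?A ?A \<bullet> De A" by (simp add: cmp_assoc d cmp_eq_assoc[OF Sy_nat])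
    also have "\<dots> = d \<bullet> p" by (simp add: Sy_De[OF hA] d)
    finally show ?thesis by (rule tepi_epi) simp_all
  qed
  ultimately have "bc_hopf_monoid \<C> Z" unfolding bc_hopf_monoid_iff using Z by auto
  then show ?thesis using f by (intro exI[of _ Z]) simp
qed

end


section \<open>Exactness in abelian categories\<close>

locale freyd_abelian =
  fixes \<D> :: "('o, 'm, 'x) cat_scheme" (structure)
  assumes abelian: "abelian_category \<D>"

sublocale freyd_abelian \<subseteq> category \<D>
  using abelian unfolding abelian_category_def by blast

context category
begin

lemma zero_arr_hom: "is_zero_arr \<C> X Y f \<Longrightarrow> f \<in> Hom X Y"
  unfolding is_zero_arr_def using comp_hom by blast

lemma zero_arr_unique:
  assumes "is_zero_arr \<C> X Y f" "is_zero_arr \<C> X Y f'" shows "f = f'"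
proof -
  obtain Z g h where Z: "is_zero_object \<C> Z" "g \<in> Hom X Z" "h \<in> Hom Z Y" "f = h \<cdot> g"
    using assms(1) unfolding is_zero_arr_def by blast
  obtain Z' g' h' where Z': "is_zero_object \<C> Z'" "g' \<in> Hom X Z'" "h' \<in> Hom Z' Y" "f' = h' \<cdot> g'"
    using assms(2) unfolding is_zero_arr_def by blast
  have ob: "X \<in> ob \<C>" "Y \<in> ob \<C>" "Z \<in> ob \<C>" using Z hom_ob by blast+
  obtain w where w: "w \<in> Hom Z Z'" using Z' ob(3) unfolding is_zero_object_def by blast
  have "w \<cdot> g = g'" using comp_hom[OF Z(2) w] Z' ob unfolding is_zero_object_def by blast
  moreover have "h' \<cdot> w = h" using comp_hom[OF w Z'(3)] Z ob unfolding is_zero_object_def by blast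
  ultimately show ?thesis using Z Z' w comp_assoc[OF Z(2) w Z'(3)] by simp
qed

lemma zero_arr_post: assumes "is_zero_arr \<C> X Y f" "t \<in> Hom Y W" shows "is_zero_arr \<C> X W (t \<cdot> f)"
proof -
  obtain Z g h where Z: "is_zero_object \<C> Z" "g \<in> Hom X Z" "h \<in> Hom Z Y" "f = h \<cdot> g"
    using assms(1) unfolding is_zero_arr_def by blast
  have "t \<cdot> f = (t \<cdot> h) \<cdot> g" using comp_assoc[OF Z(2,3) assms(2)] Z(4) by simp
  then show ?thesis unfolding is_zero_arr_def using Z comp_hom[OF Z(3) assms(2)] by blast
qed

lemma zero_arr_pre: assumes "is_zero_arr \<C> X Y f" "t \<in> Hom W X" shows "is_zero_arr \<C> W Y (f \<cdot> t)"
proof -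
  obtain Z g h where Z: "is_zero_object \<C> Z" "g \<in> Hom X Z" "h \<in> Hom Z Y" "f = h \<cdot> g"
    using assms(1) unfolding is_zero_arr_def by blast
  have "f \<cdot> t = h \<cdot> (g \<cdot> t)" using comp_assoc[OF assms(2) Z(2,3)] Z(4) by simp
  then show ?thesis unfolding is_zero_arr_def using Z comp_hom[OF assms(2) Z(2)] by blast
qed

lemma monoD: "mono_arr \<C> X Y f \<Longrightarrow> g \<in> Hom W X \<Longrightarrow> h \<in> Hom W X \<Longrightarrow> f \<cdot> g = f \<cdot> h \<Longrightarrow> g = h"
  unfolding mono_arr_def by blast

lemma epiD: "epi_arr \<C> X Y f \<Longrightarrow> g \<in> Hom Y Z \<Longrightarrow> h \<in> Hom Y Z \<Longrightarrow> g \<cdot> f = h \<cdot> f \<Longrightarrow> g = h"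
  unfolding epi_arr_def by blast

lemma kernel_mono: assumes "is_kernel \<C> X Y f K k" shows "mono_arr \<C> K X k"
  unfolding mono_arr_def
proof (intro conjI allI ballI impI)
  have k: "k \<in> Hom K X" "f \<in> Hom X Y" "is_zero_arr \<C> K Y (f \<cdot> k)" using assms unfolding is_kernel_def by auto
  show "k \<in> Hom K X" by (rule k)
  fix W g h assume g: "g \<in> Hom W K" and h: "h \<in> Hom W K" and eq: "k \<cdot> g = k \<cdot> h"
  have "is_zero_arr \<C> W Y (f \<cdot> (k \<cdot> g))"
    using zero_arr_pre[OF k(3) g] comp_assoc[OF g k(1,2)] by simp
  then have "\<exists>!u. u \<in> Hom W K \<and> k \<cdot> u = k \<cdot> g"
    using assms comp_hom[OF g k(1)] unfolding is_kernel_def by blast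
  then show "g = h" using g h eq by metis
qed

lemma cokernel_epi: assumes "is_cokernel \<C> X Y f Q q" shows "epi_arr \<C> Y Q q"
  unfolding epi_arr_def
proof (intro conjI allI ballI impI)
  have q: "q \<in> Hom Y Q" "f \<in> Hom X Y" "is_zero_arr \<C> X Q (q \<cdot> f)" using assms unfolding is_cokernel_def by auto
  show "q \<in> Hom Y Q" by (rule q)
  fix W g h assume g: "g \<in> Hom Q W" and h: "h \<in> Hom Q W" and eq: "g \<cdot> q = h \<cdot> q"
  have "is_zero_arr \<C> X W ((g \<cdot> q) \<cdot> f)"
    using zero_arr_post[OF q(3) g] comp_assoc[OF q(2,1) g] by simp
  then have "\<exists>!u. u \<in> Hom Q W \<and> u \<cdot> q = g \<cdot> q"
    using assms comp_hom[OF q(1) g] unfolding is_cokernel_def by blast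
  then show "g = h" using g h eq by metis
qed

lemma kernel_zero: "is_kernel \<C> X Y f K k \<Longrightarrow> is_zero_arr \<C> K Y (f \<cdot> k)"
  and kernel_hom: "is_kernel \<C> X Y f K k \<Longrightarrow> k \<in> Hom K X"
  and kernel_factor: "is_kernel \<C> X Y f K k \<Longrightarrow> h \<in> Hom W X \<Longrightarrow> is_zero_arr \<C> W Y (f \<cdot> h)
    \<Longrightarrow> \<exists>u. u \<in> Hom W K \<and> k \<cdot> u = h"
  and cokernel_zero: "is_cokernel \<C> X Y f Q q \<Longrightarrow> is_zero_arr \<C> X Q (q \<cdot> f)"
  and cokernel_hom: "is_cokernel \<C> X Y f Q q \<Longrightarrow> q \<in> Hom Y Q"
  and cokernel_factor: "is_cokernel \<C> X Y f Q q \<Longrightarrow> t \<in> Hom Y W \<Longrightarrow> is_zero_arr \<C> X W (t \<cdot> f)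
    \<Longrightarrow> \<exists>u. u \<in> Hom Q W \<and> u \<cdot> q = t"
  unfolding is_kernel_def is_cokernel_def by blast+

lemma kernelI:
  assumes "f \<in> Hom X Y" "is_zero_arr \<C> K Y (f \<cdot> k)" "mono_arr \<C> K X k"
    "\<And>W h. h \<in> Hom W X \<Longrightarrow> is_zero_arr \<C> W Y (f \<cdot> h) \<Longrightarrow> \<exists>u. u \<in> Hom W K \<and> k \<cdot> u = h"
  shows "is_kernel \<C> X Y f K k"
proof -
  have "k \<in> Hom K X" using assms(3) unfolding mono_arr_def by blast
  moreover have "\<exists>!u. u \<in> Hom W K \<and> k \<cdot> u = h" if "h \<in> Hom W X" "is_zero_arr \<C> W Y (f \<cdot> h)" for W h
    using assms(4)[OF that] monoD[OF assms(3)] by metis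
  ultimately show ?thesis unfolding is_kernel_def using assms(1,2) by blast
qed

lemma cokernelI:
  assumes "f \<in> Hom X Y" "is_zero_arr \<C> X Q (q \<cdot> f)" "epi_arr \<C> Y Q q"
    "\<And>W t. t \<in> Hom Y W \<Longrightarrow> is_zero_arr \<C> X W (t \<cdot> f) \<Longrightarrow> \<exists>u. u \<in> Hom Q W \<and> u \<cdot> q = t"
  shows "is_cokernel \<C> X Y f Q q"
proof -
  have "q \<in> Hom Y Q" using assms(3) unfolding epi_arr_def by blast
  moreover have "\<exists>!u. u \<in> Hom Q W \<and> u \<cdot> q = t" if "t \<in> Hom Y W" "is_zero_arr \<C> X W (t \<cdot> f)" for W t
    using assms(4)[OF that] epiD[OF assms(3)] by metis
  ultimately show ?thesis unfolding is_cokernel_def using assms(1,2) by blast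
qed

lemma mono_comp:
  assumes "mono_arr \<C> X Y f" "mono_arr \<C> Y Z g" shows "mono_arr \<C> X Z (g \<cdot> f)"
proof -
  have f: "f \<in> Hom X Y" "g \<in> Hom Y Z" using assms unfolding mono_arr_def by auto
  show ?thesis unfolding mono_arr_def
  proof (intro conjI allI ballI impI)
    show "g \<cdot> f \<in> Hom X Z" using comp_hom f by blast
    fix W a b assume ab: "a \<in> Hom W X" "b \<in> Hom W X" "(g \<cdot> f) \<cdot> a = (g \<cdot> f) \<cdot> b"
    then have "g \<cdot> (f \<cdot> a) = g \<cdot> (f \<cdot> b)" using comp_assoc f by metis
    then have "f \<cdot> a = f \<cdot> b" using monoD[OF assms(2)] ab f comp_hom by blast
    then show "a = b" using monoD[OF assms(1)] ab by blast
  qed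
qed

lemma epi_comp:
  assumes "epi_arr \<C> X Y f" "epi_arr \<C> Y Z g" shows "epi_arr \<C> X Z (g \<cdot> f)"
proof -
  have f: "f \<in> Hom X Y" "g \<in> Hom Y Z" using assms unfolding epi_arr_def by auto
  show ?thesis unfolding epi_arr_def
  proof (intro conjI allI ballI impI)
    show "g \<cdot> f \<in> Hom X Z" using comp_hom f by blast
    fix W a b assume ab: "a \<in> Hom Z W" "b \<in> Hom Z W" "a \<cdot> (g \<cdot> f) = b \<cdot> (g \<cdot> f)"
    then have "(a \<cdot> g) \<cdot> f = (b \<cdot> g) \<cdot> f" using comp_assoc f by metis
    then have "a \<cdot> g = b \<cdot> g" using epiD[OF assms(1)] ab f comp_hom by blast
    then show "a = b" using epiD[OF assms(2)] ab by blast
  qed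
qed

end

context freyd_abelian
begin

lemma zero_arr_exists: "X \<in> ob \<D> \<Longrightarrow> Y \<in> ob \<D> \<Longrightarrow> \<exists>f. is_zero_arr \<D> X Y f"
proof -
  assume ob: "X \<in> ob \<D>" "Y \<in> ob \<D>"
  obtain Z where Z: "is_zero_object \<D> Z" using abelian unfolding abelian_category_def by blast
  have u: "\<forall>X \<in> ob \<D>. (\<exists>!f. f \<in> Hom X Z) \<and> (\<exists>!f. f \<in> Hom Z X)"
    using Z unfolding is_zero_object_def by (elim conjE)
  obtain g where "g \<in> Hom X Z" using bspec[OF u ob(1)] by (elim conjE ex1E)
  moreover obtain h where "h \<in> Hom Z Y" using bspec[OF u ob(2)] by (elim conjE ex1E)
  ultimately have "is_zero_arr \<D> X Y (h \<cdot> g)" using Z unfolding is_zero_arr_def by blast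
  then show ?thesis by blast
qed

lemma abelian_props:
  "\<forall>X \<in> ob \<D>. \<forall>Y \<in> ob \<D>. \<exists>P p q. is_product \<D> X Y P p q"
  "\<forall>X Y. \<forall>f \<in> Hom X Y. \<exists>K k. is_kernel \<D> X Y f K k"
  "\<forall>X Y. \<forall>f \<in> Hom X Y. \<exists>Q q. is_cokernel \<D> X Y f Q q"
  "\<forall>X Y f. mono_arr \<D> X Y f \<longrightarrow> (\<exists>Z g. is_kernel \<D> Y Z g X f)"
  "\<forall>X Y f. epi_arr \<D> X Y f \<longrightarrow> (\<exists>W g. is_cokernel \<D> W X g Y f)"
proof -
  note ab = abelian[unfolded abelian_category_def]
  show "\<forall>X \<in> ob \<D>. \<forall>Y \<in> ob \<D>. \<exists>P p q. is_product \<D> X Y P p q" using ab by (elim conjE)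
  show "\<forall>X Y. \<forall>f \<in> Hom X Y. \<exists>K k. is_kernel \<D> X Y f K k" using ab by (elim conjE)
  show "\<forall>X Y. \<forall>f \<in> Hom X Y. \<exists>Q q. is_cokernel \<D> X Y f Q q" using ab by (elim conjE)
  show "\<forall>X Y f. mono_arr \<D> X Y f \<longrightarrow> (\<exists>Z g. is_kernel \<D> Y Z g X f)" using ab by (elim conjE)
  show "\<forall>X Y f. epi_arr \<D> X Y f \<longrightarrow> (\<exists>W g. is_cokernel \<D> W X g Y f)" using ab by (elim conjE)
qed

lemma kernel_exists: "f \<in> Hom X Y \<Longrightarrow> \<exists>K k. is_kernel \<D> X Y f K k"
  and cokernel_exists: "f \<in> Hom X Y \<Longrightarrow> \<exists>Q q. is_cokernel \<D> X Y f Q q"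
  and mono_is_kernel: "mono_arr \<D> X Y m \<Longrightarrow> \<exists>Z g. is_kernel \<D> Y Z g X m"
  and epi_is_cokernel: "epi_arr \<D> X Y e \<Longrightarrow> \<exists>W g. is_cokernel \<D> W X g Y e"
  and product_exists: "X \<in> ob \<D> \<Longrightarrow> Y \<in> ob \<D> \<Longrightarrow> \<exists>P p q. is_product \<D> X Y P p q"
  by (rule abelian_props(2)[rule_format] abelian_props(3)[rule_format] abelian_props(4)[rule_format]
      abelian_props(5)[rule_format] abelian_props(1)[rule_format]; assumption)+

lemma mono_zero:
  assumes m: "mono_arr \<D> X Y m" and f: "f \<in> Hom W X" and z: "is_zero_arr \<D> W Y (m \<cdot> f)"
  shows "is_zero_arr \<D> W X f"
proof -
  have mh: "m \<in> Hom X Y" using m unfolding mono_arr_def by blast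
  obtain o' where o: "is_zero_arr \<D> W X o'" using zero_arr_exists hom_ob[OF f] by blast
  have "m \<cdot> f = m \<cdot> o'" using zero_arr_unique[OF z zero_arr_post[OF o mh]] .
  then have "f = o'" using monoD[OF m f zero_arr_hom[OF o]] by blast
  then show ?thesis using o by simp
qed

lemma mono_kernel_of_cokernel:
  assumes m: "mono_arr \<D> X Y m" and q: "is_cokernel \<D> X Y m Q q"
  shows "is_kernel \<D> Y Q q X m"
proof -
  obtain Z g where g: "is_kernel \<D> Y Z g X m" using mono_is_kernel[OF m] by blast
  have gh: "g \<in> Hom Y Z" using g unfolding is_kernel_def by blast
  obtain w where w: "w \<in> Hom Q Z" "w \<cdot> q = g" using cokernel_factor[OF q gh kernel_zero[OF g]] by blast
  show ?thesis
  proof (rule kernelI[OF cokernel_hom[OF q] cokernel_zero[OF q] m])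
    fix W h assume h: "h \<in> Hom W Y" "is_zero_arr \<D> W Q (q \<cdot> h)"
    have "is_zero_arr \<D> W Z (g \<cdot> h)"
      using zero_arr_post[OF h(2) w(1)] comp_assoc[OF h(1) cokernel_hom[OF q] w(1)] w(2) by simp
    then show "\<exists>u. u \<in> Hom W X \<and> m \<cdot> u = h" using kernel_factor[OF g h(1)] by blast
  qed
qed

lemma epi_cokernel_of_kernel:
  assumes e: "epi_arr \<D> X Y e" and k: "is_kernel \<D> X Y e K k"
  shows "is_cokernel \<D> K X k Y e"
proof -
  obtain W g where g: "is_cokernel \<D> W X g Y e" using epi_is_cokernel[OF e] by blast
  have gh: "g \<in> Hom W X" using g unfolding is_cokernel_def by blast
  obtain w where w: "w \<in> Hom W K" "k \<cdot> w = g" using kernel_factor[OF k gh cokernel_zero[OF g]] by blast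
  show ?thesis
  proof (rule cokernelI[OF kernel_hom[OF k] kernel_zero[OF k] e])
    fix V t assume t: "t \<in> Hom X V" "is_zero_arr \<D> K V (t \<cdot> k)"
    have "is_zero_arr \<D> W V (t \<cdot> g)"
      using zero_arr_pre[OF t(2) w(1)] comp_assoc[OF w(1) kernel_hom[OF k] t(1)] w(2) by simp
    then show "\<exists>u. u \<in> Hom Y V \<and> u \<cdot> e = t" using cokernel_factor[OF g t(1)] by blast
  qed
qed

text \<open>
  In the absence of a subtraction, the equalizer of \<open>s\<close> and \<open>t\<close> is obtained as a kernel: the graph
  \<open>(id, t)\<close> is a monomorphism, hence the kernel of some \<open>g\<close>, and \<open>g \<circ> (id, s)\<close> vanishes where \<open>s\<close> and \<open>t\<close> agree.
\<close>

lemma epi_if_no_cokernel: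
  assumes p: "p \<in> Hom X Y"
    and z: "\<And>T t. t \<in> Hom Y T \<Longrightarrow> is_zero_arr \<D> X T (t \<cdot> p) \<Longrightarrow> is_zero_arr \<D> Y T t"
  shows "epi_arr \<D> X Y p"
  unfolding epi_arr_def
proof (intro conjI allI ballI impI)
  show "p \<in> Hom X Y" by (rule p)
  fix T s t assume s: "s \<in> Hom Y T" and t: "t \<in> Hom Y T" and eq: "s \<cdot> p = t \<cdot> p"
  have ob: "Y \<in> ob \<D>" "T \<in> ob \<D>" using hom_ob[OF s] by auto
  obtain P a b where P: "is_product \<D> Y T P a b" using product_exists[OF ob] by blast
  have ab: "a \<in> Hom P Y" "b \<in> Hom P T" using P unfolding is_product_def by auto
  obtain u where u: "u \<in> Hom Y P" "a \<cdot> u = ide Y" "b \<cdot> u = t"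
    using P t ide_hom[OF ob(1)] unfolding is_product_def by blast
  obtain v where v: "v \<in> Hom Y P" "a \<cdot> v = ide Y" "b \<cdot> v = s"
    using P s ide_hom[OF ob(1)] unfolding is_product_def by blast
  have "a \<cdot> (u \<cdot> p) = p" "a \<cdot> (v \<cdot> p) = p" "b \<cdot> (u \<cdot> p) = t \<cdot> p" "b \<cdot> (v \<cdot> p) = t \<cdot> p"
    using comp_assoc[OF p u(1) ab(1)] comp_assoc[OF p u(1) ab(2)] comp_assoc[OF p v(1) ab(1)]
      comp_assoc[OF p v(1) ab(2)] u v eq comp_ide_left[OF p] by auto
  moreover have "u \<cdot> p \<in> Hom X P" "v \<cdot> p \<in> Hom X P" using comp_hom[OF p] u v by auto
  moreover have "\<exists>!k. k \<in> Hom X P \<and> a \<cdot> k = p \<and> b \<cdot> k = t \<cdot> p"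
    using P p comp_hom[OF p t] unfolding is_product_def by blast
  ultimately have up: "u \<cdot> p = v \<cdot> p" by blast
  have "mono_arr \<D> Y P u" unfolding mono_arr_def
  proof (intro conjI allI ballI impI)
    show "u \<in> Hom Y P" by (rule u)
    fix W g h assume g: "g \<in> Hom W Y" and h: "h \<in> Hom W Y" and e: "u \<cdot> g = u \<cdot> h"
    have "(a \<cdot> u) \<cdot> g = (a \<cdot> u) \<cdot> h" using comp_assoc[OF g u(1) ab(1)] comp_assoc[OF h u(1) ab(1)] e by simp
    then show "g = h" using u(2) comp_ide_left[OF g] comp_ide_left[OF h] by simp
  qed
  then obtain G g where g: "is_kernel \<D> P G g Y u" using mono_is_kernel by blast
  have gh: "g \<in> Hom P G" using g unfolding is_kernel_def by blast
  have "is_zero_arr \<D> X G ((g \<cdot> u) \<cdot> p)" using zero_arr_pre[OF kernel_zero[OF g] p] .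
  then have "is_zero_arr \<D> X G ((g \<cdot> v) \<cdot> p)"
    using comp_assoc[OF p u(1) gh] comp_assoc[OF p v(1) gh] up by simp
  then have "is_zero_arr \<D> Y G (g \<cdot> v)" using z comp_hom[OF v(1) gh] by blast
  then obtain w where w: "w \<in> Hom Y Y" "u \<cdot> w = v" using kernel_factor[OF g v(1)] by blast
  have "w = (a \<cdot> u) \<cdot> w" using u(2) comp_ide_left[OF w(1)] by simp
  also have "\<dots> = ide Y" using comp_assoc[OF w(1) u(1) ab(1)] w(2) v(2) by simp
  finally have "v = u" using w(2) comp_ide_right[OF u(1)] by simp
  then show "s = t" using u v by simp
qed

text \<open>Test against the kernel \<open>n\<close> of a morphism \<open>t\<close> that annihilates \<open>x\<close>: a right inverse of \<open>n\<close> forces \<open>t\<close> to vanish.\<close>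

lemma epi_if_extremal:
  assumes x: "x \<in> Hom A J"
    and ext: "\<And>N n x'. mono_arr \<D> N J n \<Longrightarrow> x' \<in> Hom A N \<Longrightarrow> n \<cdot> x' = x \<Longrightarrow> \<exists>w. w \<in> Hom J N \<and> n \<cdot> w = ide J"
  shows "epi_arr \<D> A J x"
proof (rule epi_if_no_cokernel[OF x])
  fix T t assume t: "t \<in> Hom J T" "is_zero_arr \<D> A T (t \<cdot> x)"
  obtain N n where n: "is_kernel \<D> J T t N n" using kernel_exists[OF t(1)] by blast
  obtain x' where x': "x' \<in> Hom A N" "n \<cdot> x' = x" using kernel_factor[OF n x t(2)] by blast
  obtain w where w: "w \<in> Hom J N" "n \<cdot> w = ide J" using ext[OF kernel_mono[OF n] x'] by blast
  have "t = (t \<cdot> n) \<cdot> w" using comp_assoc[OF w(1) kernel_hom[OF n] t(1)] w(2) comp_ide_right[OF t(1)] by simp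
  then show "is_zero_arr \<D> J T t" using zero_arr_pre[OF kernel_zero[OF n] w(1)] by simp
qed

lemma mono_split:
  assumes m: "mono_arr \<D> J B m" and n: "n \<in> Hom N J" and w: "w \<in> Hom J N" "(m \<cdot> n) \<cdot> w = m"
  shows "n \<cdot> w = ide J"
proof -
  have mh: "m \<in> Hom J B" using m unfolding mono_arr_def by blast
  have "m \<cdot> (n \<cdot> w) = m \<cdot> ide J" using comp_assoc[OF w(1) n mh] w(2) comp_ide_right[OF mh] by simp
  then show ?thesis using monoD[OF m comp_hom[OF w(1) n] ide_hom] hom_ob[OF mh] by blast
qed

text \<open>
  The factor \<open>x\<close> is an epimorphism: if it factored through a subobject \<open>n\<close> of \<open>J\<close>, then \<open>m \<circ> n\<close> would be the kernel of
  some \<open>g\<close>, which annihilates \<open>f\<close>, hence factors through \<open>q\<close> and annihilates \<open>m\<close>.  So \<open>m\<close> factors through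
  \<open>m \<circ> n\<close>.
\<close>

lemma image_factorization:
  assumes f: "f \<in> Hom A B" and k: "is_kernel \<D> A B f K k" and q: "is_cokernel \<D> A B f Q q"
    and m: "is_kernel \<D> B Q q J m"
  shows "\<exists>x. x \<in> Hom A J \<and> m \<cdot> x = f \<and> is_cokernel \<D> K A k J x"
proof -
  obtain x where x: "x \<in> Hom A J" "m \<cdot> x = f" using kernel_factor[OF m f cokernel_zero[OF q]] by blast
  note mh = kernel_hom[OF m] and mm = kernel_mono[OF m]
  have epi: "epi_arr \<D> A J x"
  proof (rule epi_if_extremal[OF x(1)])
    fix N n x' assume n: "mono_arr \<D> N J n" and x': "x' \<in> Hom A N" "n \<cdot> x' = x"
    have nh: "n \<in> Hom N J" using n unfolding mono_arr_def by blast
    obtain G g where g: "is_kernel \<D> B G g N (m \<cdot> n)" using mono_is_kernel[OF mono_comp[OF n mm]] by blast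
    have gh: "g \<in> Hom B G" using g unfolding is_kernel_def by blast
    have "f = (m \<cdot> n) \<cdot> x'" using x x' comp_assoc[OF x'(1) nh mh] by simp
    then have "g \<cdot> f = (g \<cdot> (m \<cdot> n)) \<cdot> x'" using comp_assoc[OF x'(1) kernel_hom[OF g] gh] by simp
    then have "is_zero_arr \<D> A G (g \<cdot> f)" using zero_arr_pre[OF kernel_zero[OF g] x'(1)] by simp
    then obtain g' where g': "g' \<in> Hom Q G" "g' \<cdot> q = g" using cokernel_factor[OF q gh] by blast
    have "g \<cdot> m = g' \<cdot> (q \<cdot> m)" using comp_assoc[OF mh cokernel_hom[OF q] g'(1)] g'(2) by simp
    then have "is_zero_arr \<D> J G (g \<cdot> m)" using zero_arr_post[OF kernel_zero[OF m] g'(1)] by simp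
    then obtain w where w: "w \<in> Hom J N" "(m \<cdot> n) \<cdot> w = m" using kernel_factor[OF g mh] by blast
    then show "\<exists>w. w \<in> Hom J N \<and> n \<cdot> w = ide J" using mono_split[OF mm nh] by blast
  qed
  have "is_kernel \<D> A J x K k"
  proof (rule kernelI[OF x(1) _ kernel_mono[OF k]])
    have "is_zero_arr \<D> K B (m \<cdot> (x \<cdot> k))"
      using kernel_zero[OF k] comp_assoc[OF kernel_hom[OF k] x(1) mh] x(2) by simp
    then show "is_zero_arr \<D> K J (x \<cdot> k)" using mono_zero[OF mm comp_hom[OF kernel_hom[OF k] x(1)]] by blast
    fix W h assume h: "h \<in> Hom W A" "is_zero_arr \<D> W J (x \<cdot> h)"
    have "is_zero_arr \<D> W B (f \<cdot> h)" using zero_arr_post[OF h(2) mh] comp_assoc[OF h(1) x(1) mh] x(2) by simp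
    then show "\<exists>u. u \<in> Hom W K \<and> k \<cdot> u = h" using kernel_factor[OF k h(1)] by blast
  qed
  then show ?thesis using x epi_cokernel_of_kernel[OF epi] by blast
qed

text \<open>
  Let \<open>g\<close> be the cokernel of \<open>h\<close>.  If \<open>p\<close> factored through a smaller subobject \<open>n\<close>, then a morphism \<open>c\<close> with kernel
  \<open>h \<circ> n\<close> would annihilate \<open>e \<circ> k\<close>, where \<open>k\<close> is the kernel of the epimorphism \<open>g \<circ> e\<close>; so \<open>c\<close> would factor through
  \<open>g\<close> and annihilate \<open>h\<close> as well.
\<close>

lemma pullback_epi:
  assumes e: "epi_arr \<D> A J e" and h: "mono_arr \<D> I J h"
    and k: "mono_arr \<D> P A k" and p: "p \<in> Hom P I" and sq: "e \<cdot> k = h \<cdot> p"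
    and pb: "\<And>W t t'. t \<in> Hom W A \<Longrightarrow> t' \<in> Hom W I \<Longrightarrow> e \<cdot> t = h \<cdot> t' \<Longrightarrow> \<exists>u. u \<in> Hom W P \<and> k \<cdot> u = t"
  shows "epi_arr \<D> P I p"
proof (rule epi_if_extremal[OF p])
  fix N n p' assume n: "mono_arr \<D> N I n" and p': "p' \<in> Hom P N" "n \<cdot> p' = p"
  have eh: "e \<in> Hom A J" and hh: "h \<in> Hom I J" and kh: "k \<in> Hom P A" and nh: "n \<in> Hom N I"
    using e h k n unfolding epi_arr_def mono_arr_def by auto
  obtain G g where g: "is_cokernel \<D> I J h G g" using cokernel_exists[OF hh] by blast
  note gh = cokernel_hom[OF g] and hg = mono_kernel_of_cokernel[OF h g]
  have "is_kernel \<D> A G (g \<cdot> e) P k"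
  proof (rule kernelI[OF comp_hom[OF eh gh] _ k])
    have "(g \<cdot> e) \<cdot> k = (g \<cdot> h) \<cdot> p" using comp_assoc[OF kh eh gh] comp_assoc[OF p hh gh] sq by simp
    then show "is_zero_arr \<D> P G ((g \<cdot> e) \<cdot> k)" using zero_arr_pre[OF cokernel_zero[OF g] p] by simp
    fix W t assume t: "t \<in> Hom W A" "is_zero_arr \<D> W G ((g \<cdot> e) \<cdot> t)"
    then have "is_zero_arr \<D> W G (g \<cdot> (e \<cdot> t))" using comp_assoc[OF t(1) eh gh] by simp
    then obtain t' where "t' \<in> Hom W I" "h \<cdot> t' = e \<cdot> t" using kernel_factor[OF hg comp_hom[OF t(1) eh]] by blast
    then show "\<exists>u. u \<in> Hom W P \<and> k \<cdot> u = t" using pb[OF t(1)] by metis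
  qed
  then have ge: "is_cokernel \<D> P A k G (g \<cdot> e)"
    using epi_cokernel_of_kernel[OF epi_comp[OF e cokernel_epi[OF g]]] by blast
  obtain C c where c: "is_kernel \<D> J C c N (h \<cdot> n)" using mono_is_kernel[OF mono_comp[OF n h]] by blast
  have ch: "c \<in> Hom J C" using c unfolding is_kernel_def by blast
  have "(c \<cdot> e) \<cdot> k = (c \<cdot> (h \<cdot> n)) \<cdot> p'"
    using comp_assoc[OF kh eh ch] comp_assoc[OF p'(1) kernel_hom[OF c] ch] comp_assoc[OF p'(1) nh hh] sq p'(2) by simp
  then have "is_zero_arr \<D> P C ((c \<cdot> e) \<cdot> k)" using zero_arr_pre[OF kernel_zero[OF c] p'(1)] by simp
  then obtain w where w: "w \<in> Hom G C" "w \<cdot> (g \<cdot> e) = c \<cdot> e" using cokernel_factor[OF ge comp_hom[OF eh ch]] by blast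
  have "c = w \<cdot> g" using epiD[OF e ch comp_hom[OF gh w(1)]] comp_assoc[OF eh gh w(1)] w(2) by simp
  then have "c \<cdot> h = w \<cdot> (g \<cdot> h)" using comp_assoc[OF hh gh w(1)] by simp
  then have "is_zero_arr \<D> I C (c \<cdot> h)" using zero_arr_post[OF cokernel_zero[OF g] w(1)] by simp
  then obtain v where v: "v \<in> Hom I N" "(h \<cdot> n) \<cdot> v = h" using kernel_factor[OF c hh] by blast
  then show "\<exists>w. w \<in> Hom I N \<and> n \<cdot> w = ide I" using mono_split[OF h nh] by blast
qed

end

section \<open>The dual of an abelian category\<close>

text \<open>
  The objects are relabelled along an involution \<open>\<phi>\<close> because the bicommutative Hopf monoids in the opposite of \<open>\<C>\<close> are
  those of \<open>\<C>\<close> with multiplication and comultiplication exchanged.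
\<close>

definition dual_cat :: "('o \<Rightarrow> 'o) \<Rightarrow> ('o, 'm) cat \<Rightarrow> ('o, 'm) cat" where
  "dual_cat \<phi> D = \<lparr> ob = {X. \<phi> X \<in> ob D}, hom = (\<lambda>X Y. hom D (\<phi> Y) (\<phi> X)),
     ident = (\<lambda>X. ident D (\<phi> X)), comp = (\<lambda>g f. comp D f g) \<rparr>"

context
  fixes \<phi> :: "'o \<Rightarrow> 'o" and D :: "('o, 'm) cat"
  assumes inv: "\<And>X. \<phi> (\<phi> X) = X"
begin

lemma dual_cat_sel [simp]:
  "X \<in> ob (dual_cat \<phi> D) \<longleftrightarrow> \<phi> X \<in> ob D" "hom (dual_cat \<phi> D) X Y = hom D (\<phi> Y) (\<phi> X)"
  "ident (dual_cat \<phi> D) X = ident D (\<phi> X)" "comp (dual_cat \<phi> D) g f = comp D f g"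
  by (auto simp: dual_cat_def)

lemma all_dual: "(\<forall>X. P (\<phi> X)) \<longleftrightarrow> (\<forall>X. P X)" and ex_dual: "(\<exists>X. P (\<phi> X)) \<longleftrightarrow> (\<exists>X. P X)"
  by (metis inv)+

lemma dual_zero_object: "is_zero_object (dual_cat \<phi> D) Z \<longleftrightarrow> is_zero_object D (\<phi> Z)"
  unfolding is_zero_object_def Ball_def dual_cat_sel
  using all_dual[of "\<lambda>X. X \<in> ob D \<longrightarrow> (\<exists>!f. f \<in> hom D (\<phi> Z) X) \<and> (\<exists>!f. f \<in> hom D X (\<phi> Z))"] by auto

lemma dual_zero_arr: "is_zero_arr (dual_cat \<phi> D) X Y f \<longleftrightarrow> is_zero_arr D (\<phi> Y) (\<phi> X) f"
  unfolding is_zero_arr_def dual_cat_sel dual_zero_object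
  using ex_dual[of "\<lambda>Z. is_zero_object D Z \<and> (\<exists>g \<in> hom D (\<phi> Y) Z. \<exists>h \<in> hom D Z (\<phi> X). f = comp D h g)"]
  by blast

lemma dual_kernel: "is_kernel (dual_cat \<phi> D) X Y f K k \<longleftrightarrow> is_cokernel D (\<phi> Y) (\<phi> X) f (\<phi> K) k"
  unfolding is_kernel_def is_cokernel_def Ball_def dual_cat_sel dual_zero_arr
  using all_dual[of "\<lambda>W. \<forall>h. h \<in> hom D (\<phi> X) W \<longrightarrow> is_zero_arr D (\<phi> Y) W (comp D h f)
     \<longrightarrow> (\<exists>!u. u \<in> hom D (\<phi> K) W \<and> comp D u k = h)"] by simp

lemma dual_cokernel: "is_cokernel (dual_cat \<phi> D) X Y f K k \<longleftrightarrow> is_kernel D (\<phi> Y) (\<phi> X) f (\<phi> K) k"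
  unfolding is_kernel_def is_cokernel_def Ball_def dual_cat_sel dual_zero_arr
  using all_dual[of "\<lambda>W. \<forall>h. h \<in> hom D W (\<phi> Y) \<longrightarrow> is_zero_arr D W (\<phi> X) (comp D f h)
     \<longrightarrow> (\<exists>!u. u \<in> hom D W (\<phi> K) \<and> comp D k u = h)"] by simp

lemma dual_product: "is_product (dual_cat \<phi> D) X Y P p q \<longleftrightarrow> is_coproduct D (\<phi> X) (\<phi> Y) (\<phi> P) p q"
  unfolding is_product_def is_coproduct_def Ball_def dual_cat_sel
  using all_dual[of "\<lambda>W. \<forall>f. f \<in> hom D (\<phi> X) W \<longrightarrow> (\<forall>g. g \<in> hom D (\<phi> Y) W \<longrightarrow>
     (\<exists>!k. k \<in> hom D (\<phi> P) W \<and> comp D k p = f \<and> comp D k q = g))"] by simp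

lemma dual_coproduct: "is_coproduct (dual_cat \<phi> D) X Y P p q \<longleftrightarrow> is_product D (\<phi> X) (\<phi> Y) (\<phi> P) p q"
  unfolding is_product_def is_coproduct_def Ball_def dual_cat_sel
  using all_dual[of "\<lambda>W. \<forall>f. f \<in> hom D W (\<phi> X) \<longrightarrow> (\<forall>g. g \<in> hom D W (\<phi> Y) \<longrightarrow>
     (\<exists>!k. k \<in> hom D W (\<phi> P) \<and> comp D p k = f \<and> comp D q k = g))"] by simp

lemma dual_mono: "mono_arr (dual_cat \<phi> D) X Y f \<longleftrightarrow> epi_arr D (\<phi> Y) (\<phi> X) f"
  unfolding mono_arr_def epi_arr_def Ball_def dual_cat_sel
  using all_dual[of "\<lambda>W. \<forall>g. g \<in> hom D (\<phi> X) W \<longrightarrow> (\<forall>h. h \<in> hom D (\<phi> X) W \<longrightarrow> comp D g f = comp D h f \<longrightarrow> g = h)"]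
  by simp

lemma dual_epi: "epi_arr (dual_cat \<phi> D) X Y f \<longleftrightarrow> mono_arr D (\<phi> Y) (\<phi> X) f"
  unfolding mono_arr_def epi_arr_def Ball_def dual_cat_sel
  using all_dual[of "\<lambda>W. \<forall>g. g \<in> hom D W (\<phi> Y) \<longrightarrow> (\<forall>h. h \<in> hom D W (\<phi> Y) \<longrightarrow> comp D f g = comp D f h \<longrightarrow> g = h)"]
  by simp

lemma dual_category: assumes "category D" shows "category (dual_cat \<phi> D)"
proof -
  interpret category D by (rule assms)
  show ?thesis
    by unfold_locales (auto simp: hom_ob ide_hom comp_hom comp_ide_left comp_ide_right comp_assoc)
qed

lemma dual_abelian: assumes "abelian_category D" shows "abelian_category (dual_cat \<phi> D)"
  unfolding abelian_category_def
  unfolding Ball_def dual_zero_object dual_kernel dual_cokernel dual_product dual_coproduct dual_mono dual_epi dual_cat_sel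
proof (intro conjI allI impI)
  note ab = assms[unfolded abelian_category_def]
  show "category (dual_cat \<phi> D)" using ab dual_category by blast
  show "\<exists>Z. is_zero_object D (\<phi> Z)" using ab ex_dual[of "is_zero_object D"] by blast
  fix X Y f
  show "\<exists>P p q. is_coproduct D (\<phi> X) (\<phi> Y) (\<phi> P) p q" if XY: "\<phi> X \<in> ob D" "\<phi> Y \<in> ob D"
  proof -
    have c: "\<forall>X \<in> ob D. \<forall>Y \<in> ob D. \<exists>P p q. is_coproduct D X Y P p q" using ab by (elim conjE)
    obtain P p q where "is_coproduct D (\<phi> X) (\<phi> Y) P p q"
      using bspec[OF bspec[OF c XY(1)] XY(2)] by (elim exE)
    then have "is_coproduct D (\<phi> X) (\<phi> Y) (\<phi> (\<phi> P)) p q" unfolding inv .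
    then show ?thesis by blast
  qed
  show "\<exists>P p q. is_product D (\<phi> X) (\<phi> Y) (\<phi> P) p q" if XY: "\<phi> X \<in> ob D" "\<phi> Y \<in> ob D"
  proof -
    have c: "\<forall>X \<in> ob D. \<forall>Y \<in> ob D. \<exists>P p q. is_product D X Y P p q" using ab by (elim conjE)
    obtain P p q where "is_product D (\<phi> X) (\<phi> Y) P p q"
      using bspec[OF bspec[OF c XY(1)] XY(2)] by (elim exE)
    then have "is_product D (\<phi> X) (\<phi> Y) (\<phi> (\<phi> P)) p q" unfolding inv .
    then show ?thesis by blast
  qed
  show "\<exists>K k. is_cokernel D (\<phi> Y) (\<phi> X) f (\<phi> K) k" if "f \<in> hom D (\<phi> Y) (\<phi> X)"
    using ab that ex_dual[of "\<lambda>K. \<exists>k. is_cokernel D (\<phi> Y) (\<phi> X) f K k"] by blast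
  show "\<exists>K k. is_kernel D (\<phi> Y) (\<phi> X) f (\<phi> K) k" if "f \<in> hom D (\<phi> Y) (\<phi> X)"
    using ab that ex_dual[of "\<lambda>K. \<exists>k. is_kernel D (\<phi> Y) (\<phi> X) f K k"] by blast
  show "\<exists>Z g. is_cokernel D (\<phi> Z) (\<phi> Y) g (\<phi> X) f" if "epi_arr D (\<phi> Y) (\<phi> X) f"
    using ab that ex_dual[of "\<lambda>Z. \<exists>g. is_cokernel D Z (\<phi> Y) g (\<phi> X) f"] by blast
  show "\<exists>W g. is_kernel D (\<phi> X) (\<phi> W) g (\<phi> Y) f" if "mono_arr D (\<phi> Y) (\<phi> X) f"
    using ab that ex_dual[of "\<lambda>W. \<exists>g. is_kernel D (\<phi> X) W g (\<phi> Y) f"] by blast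
qed

end


section \<open>Kernels and cokernels of bicommutative Hopf monoids\<close>

lemma Hopf_bc_sel [simp]:
  "A \<in> ob (Hopf_bc \<C>) \<longleftrightarrow> bc_hopf_monoid \<C> A"
  "f \<in> hom (Hopf_bc \<C>) A B \<longleftrightarrow> bc_hopf_monoid \<C> A \<and> bc_hopf_monoid \<C> B \<and> bimonoid_hom \<C> A B f"
  "ident (Hopf_bc \<C>) A = ident \<C> (und A)"
  "comp (Hopf_bc \<C>) g f = comp \<C> g f"
  by (auto simp: Hopf_bc_def)

context symmetric_monoidal_category
begin

lemma action_quotientI:
  assumes k: "bhom K A k" and p: "arr p" "dm p = und A" "cd p = P" and i: "p \<bullet> act A k = p \<bullet> triv K (und A)"
    and t: "tepi p"
    and ex: "\<And>V h. V \<in> ob \<C> \<Longrightarrow> arr h \<Longrightarrow> dm h = und A \<odot> V \<Longrightarrow> h \<bullet> (act A k \<star> Id V) = h \<bullet> (triv K (und A) \<star> Id V) \<Longrightarrow>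
       \<exists>h'. arr h' \<and> dm h' = P \<odot> V \<and> cd h' = cd h \<and> h' \<bullet> (p \<star> Id V) = h"
  shows "action_quotient \<C> K A (mor k) P (mor p)"
  unfolding action_quotient_def
proof (intro conjI allI impI)
  note [simp] = bhom_simps[OF k] p
  have [simp]: "P \<in> ob \<C>" using p cd_ob by blast
  show "mor p \<in> Hom (und A) P" by simp
  show "mor p \<cdot> \<nabla>\<^bsub>A\<^esub> \<cdot> (mor k \<otimes> ide (und A)) = mor p \<cdot> \<l> (und A) \<cdot> (\<epsilon>\<^bsub>K\<^esub> \<otimes> ide (und A))"
    using arg_cong[OF i, of mor] by simp
  fix V W h
  assume h: "V \<in> ob \<C> \<and> h \<in> Hom (und A \<odot> V) W \<and>
    h \<cdot> ((\<nabla>\<^bsub>A\<^esub> \<cdot> (mor k \<otimes> ide (und A))) \<otimes> ide V) = h \<cdot> ((\<l> (und A) \<cdot> (\<epsilon>\<^bsub>K\<^esub> \<otimes> ide (und A))) \<otimes> ide V)"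
  have V [simp]: "V \<in> ob \<C>" using h by blast
  have "mk (und A \<odot> V) h W \<bullet> (act A k \<star> Id V) = mk (und A \<odot> V) h W \<bullet> (triv K (und A) \<star> Id V)"
    using h by (intro arr_eqI) auto
  with ex[of V "mk (und A \<odot> V) h W"] h obtain h' where h': "arr h'" "dm h' = P \<odot> V" "cd h' = W"
    "h' \<bullet> (p \<star> Id V) = mk (und A \<odot> V) h W" by auto
  have mh: "mor (h' \<bullet> (p \<star> Id V)) = h" unfolding h'(4) by simp
  show "\<exists>!m. m \<in> Hom (P \<odot> V) W \<and> m \<cdot> (mor p \<otimes> ide V) = h"
  proof (rule ex1I[of _ "mor h'"])
    show "mor h' \<in> Hom (P \<odot> V) W \<and> mor h' \<cdot> (mor p \<otimes> ide V) = h"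
      using mh h'(1-3) by simp
    fix n assume n: "n \<in> Hom (P \<odot> V) W \<and> n \<cdot> (mor p \<otimes> ide V) = h"
    have "mk (P \<odot> V) n W \<bullet> (p \<star> Id V) = mk (und A \<odot> V) h W"
      using n h by (intro arr_eqI) auto
    then have "mk (P \<odot> V) n W \<bullet> (p \<star> Id V) = h' \<bullet> (p \<star> Id V)" using h' by simp
    then have "mk (P \<odot> V) n W = h'" by (rule tepi_cancel) (use t h' n in simp_all)
    then show "n = mor h'" using mk_sel(2) by metis
  qed
qed

lemma hom_act:
  assumes k: "bhom K A k" and g: "bhom A B g" and gk: "g \<bullet> k = Et B \<bullet> Ep K"
  shows "g \<bullet> act A k = g \<bullet> triv K (und A)"
proof -
  note [simp] = bhom_simps[OF k] bhom_simps[OF g]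
  have "g \<bullet> act A k = Mu B \<bullet> ((Et B \<bullet> Ep K) \<star> g)"
    by (simp add: act_def cmp_eq_assoc[OF bhom_eqs(1)[OF g]] cmp_assoc tns_cmp gk)
  also have "\<dots> = (Mu B \<bullet> (Et B \<star> Id (und B))) \<bullet> (Ep K \<star> g)" by (simp add: cmp_assoc tns_cmp)
  also have "\<dots> = g \<bullet> triv K (und A)" using triv_nat[of K g] by (simp add: Mu_Et)
  finally show ?thesis .
qed

lemma act_unit:
  assumes k: "bhom K A k"
  shows "act A k \<bullet> (Id (und K) \<star> Et A) \<bullet> Ru' (und K) = k"
    "triv K (und A) \<bullet> (Id (und K) \<star> Et A) \<bullet> Ru' (und K) = Et A \<bullet> Ep K"
proof -
  note [simp] = bhom_simps[OF k]
  have "act A k \<bullet> (Id (und K) \<star> Et A) \<bullet> Ru' (und K) = (Mu A \<bullet> (Id (und A) \<star> Et A)) \<bullet> (k \<star> Id \<one>) \<bullet> Ru' (und K)"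
    by (simp add: act_def cmp_assoc tns_cmp2)
  also have "\<dots> = k" by (simp add: Mu_Et cmp_eq_assoc[OF Ru_nat] cmp_assoc)
  finally show "act A k \<bullet> (Id (und K) \<star> Et A) \<bullet> Ru' (und K) = k" .
  have "triv K (und A) \<bullet> (Id (und K) \<star> Et A) \<bullet> Ru' (und K) = (Lu (und A) \<bullet> (Id \<one> \<star> Et A)) \<bullet> (Ep K \<star> Id \<one>) \<bullet> Ru' (und K)"
    by (simp add: triv_def cmp_assoc tns_cmp2)
  also have "\<dots> = Et A \<bullet> Ru \<one> \<bullet> (Ep K \<star> Id \<one>) \<bullet> Ru' (und K)" by (simp add: Lu_nat cmp_assoc Lu_Ru)
  also have "\<dots> = Et A \<bullet> Ep K" by (simp add: cmp_eq_assoc[OF Ru_nat] cmp_assoc)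
  finally show "triv K (und A) \<bullet> (Id (und K) \<star> Et A) \<bullet> Ru' (und K) = Et A \<bullet> Ep K" .
qed

text \<open>The equations for \<open>h\<close> hold after composition with \<open>p\<close> and \<open>p \<otimes> p\<close>, which can be cancelled.\<close>

lemma bhom_through_quotient:
  assumes p: "bhom A Z p" and t: "tepi p" and g: "bhom A B g"
    and h [simp]: "arr h" "dm h = und Z" "cd h = und B" and hp: "h \<bullet> p = g"
  shows "bhom Z B h"
proof -
  note [simp] = bhom_simps[OF p] bhom_simps[OF g] t
  note pe = bhom_eqs[OF p] and ge = bhom_eqs[OF g]
  have "(h \<bullet> Mu Z) \<bullet> (p \<star> p) = (Mu B \<bullet> (h \<star> h)) \<bullet> (p \<star> p)"
    using ge(1) by (simp add: cmp_assoc pe(1)[symmetric] cmp_eq_assoc[OF hp] tns_cmp hp)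
  then have 1: "h \<bullet> Mu Z = Mu B \<bullet> (h \<star> h)" by (rule tepi_epi) (simp_all add: tepi_tns)
  have 2: "h \<bullet> Et Z = Et B" using ge(2) pe(2) hp by (metis cmp_assoc)
  have "(De B \<bullet> h) \<bullet> p = ((h \<star> h) \<bullet> De Z) \<bullet> p"
    using ge(3) by (simp add: cmp_assoc hp pe(3) tns_cmp2)
  then have 3: "De B \<bullet> h = (h \<star> h) \<bullet> De Z" by (rule tepi_epi) simp_all
  have "(Ep B \<bullet> h) \<bullet> p = Ep Z \<bullet> p" using ge(4) by (simp add: cmp_assoc hp pe(4))
  then have 4: "Ep B \<bullet> h = Ep Z" by (rule tepi_epi) simp_all
  show ?thesis unfolding bhom_def using 1 2 3 4 by simp
qed

end

locale hopf_setting = symmetric_monoidal_category \<C>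
  for \<C> :: "('o, 'm) smcat" (structure) +
  assumes equalizers: "has_equalizers \<C>" and coequalizers: "has_coequalizers \<C>"
    and bistability: "bistable \<C>" and Hopf_abelian: "abelian_category (Hopf_bc \<C>)"

sublocale hopf_setting \<subseteq> H: freyd_abelian "Hopf_bc \<C>"
  by unfold_locales (rule Hopf_abelian)

context hopf_setting
begin

lemma zero_arr_iff:
  assumes A: "bc_hopf_monoid \<C> A" and B: "bc_hopf_monoid \<C> B"
  shows "is_zero_arr (Hopf_bc \<C>) A B f \<longleftrightarrow> f = \<eta>\<^bsub>B\<^esub> \<cdot> \<epsilon>\<^bsub>A\<^esub>"
proof -
  obtain g where g: "is_zero_arr (Hopf_bc \<C>) A B g" using H.zero_arr_exists[of A B] A B by auto
  obtain Z where Z: "is_zero_object (Hopf_bc \<C>) Z"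
    using g unfolding is_zero_arr_def by blast
  have hZ: "bc_hopf_monoid \<C> Z" using Z unfolding is_zero_object_def by simp
  note [simp] = bc_bim[OF A] bc_bim[OF B] bc_bim[OF hZ]
  have z1: "mor (Et Z \<bullet> Ep A) \<in> hom (Hopf_bc \<C>) A Z" using bhom_mor[OF bhom_zero[of A Z]] A hZ by simp
  have z2: "mor (Et B \<bullet> Ep Z) \<in> hom (Hopf_bc \<C>) Z B" using bhom_mor[OF bhom_zero[of Z B]] B hZ by simp
  have "(Et B \<bullet> Ep Z) \<bullet> (Et Z \<bullet> Ep A) = Et B \<bullet> Ep A"
    by (simp add: cmp_assoc cmp_eq_assoc[OF Ep_Et])
  from arg_cong[OF this, of mor] have "mor (Et B \<bullet> Ep Z) \<cdot> mor (Et Z \<bullet> Ep A) = \<eta>\<^bsub>B\<^esub> \<cdot> \<epsilon>\<^bsub>A\<^esub>" by simp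
  then have "is_zero_arr (Hopf_bc \<C>) A B (\<eta>\<^bsub>B\<^esub> \<cdot> \<epsilon>\<^bsub>A\<^esub>)"
    unfolding is_zero_arr_def using Z z1 z2 by (metis Hopf_bc_sel(4))
  then show ?thesis using H.zero_arr_unique by blast
qed

definition bch :: "('o, 'm) bimon \<Rightarrow> ('o, 'm) bimon \<Rightarrow> ('o, 'm) arrow \<Rightarrow> bool" where
  "bch A B f \<longleftrightarrow> bc_hopf_monoid \<C> A \<and> bc_hopf_monoid \<C> B \<and> bhom A B f"

lemma bch_simps [simp]:
  assumes "bch A B f"
  shows "bc_hopf_monoid \<C> A" "bc_hopf_monoid \<C> B" "bhom A B f"
    "bimonoid \<C> A" "bimonoid \<C> B" "arr f" "dm f = und A" "cd f = und B" "und A \<in> ob \<C>" "und B \<in> ob \<C>"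
  using assms bhom_simps[of A B f] unfolding bch_def by auto

lemma bch_cmp: "bch A B f \<Longrightarrow> bch B C g \<Longrightarrow> bch A C (g \<bullet> f)"
  unfolding bch_def using bhom_cmp by blast

lemma bch_Id: "bc_hopf_monoid \<C> A \<Longrightarrow> bch A A (Id (und A))"
  unfolding bch_def using bhom_Id bc_bim by blast

lemma bch_mk: "f \<in> hom (Hopf_bc \<C>) A B \<longleftrightarrow> bch A B (mk (und A) f (und B))"
  unfolding bch_def bhom_mk by simp

lemma bch_mor: "bch A B f \<Longrightarrow> mor f \<in> hom (Hopf_bc \<C>) A B"
  unfolding bch_def using bhom_mor by simp

lemma zero_bch:
  assumes "bch A B f" shows "is_zero_arr (Hopf_bc \<C>) A B (mor f) \<longleftrightarrow> f = Et B \<bullet> Ep A"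
proof -
  note [simp] = bch_simps[OF assms]
  have "f = Et B \<bullet> Ep A \<longleftrightarrow> mor f = \<eta>\<^bsub>B\<^esub> \<cdot> \<epsilon>\<^bsub>A\<^esub>"
    by (auto intro!: arr_eqI)
  then show ?thesis using zero_arr_iff[of A B "mor f"] by simp
qed

definition kern :: "('o, 'm) bimon \<Rightarrow> ('o, 'm) bimon \<Rightarrow> ('o, 'm) arrow \<Rightarrow> ('o, 'm) bimon \<Rightarrow> ('o, 'm) arrow \<Rightarrow> bool" where
  "kern A B f K k \<longleftrightarrow> bch A B f \<and> bch K A k \<and> is_kernel (Hopf_bc \<C>) A B (mor f) K (mor k)"

definition coker :: "('o, 'm) bimon \<Rightarrow> ('o, 'm) bimon \<Rightarrow> ('o, 'm) arrow \<Rightarrow> ('o, 'm) bimon \<Rightarrow> ('o, 'm) arrow \<Rightarrow> bool" where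
  "coker A B f Q q \<longleftrightarrow> bch A B f \<and> bch B Q q \<and> is_cokernel (Hopf_bc \<C>) A B (mor f) Q (mor q)"

lemma mk_und: "bch A B f \<Longrightarrow> mk (und A) (mor f) (und B) = f"
  by (metis bch_simps(6-8) mk_mor)

lemma kern_mk:
  assumes "is_kernel (Hopf_bc \<C>) A B f K k"
  shows "kern A B (mk (und A) f (und B)) K (mk (und K) k (und A))"
proof -
  have "f \<in> hom (Hopf_bc \<C>) A B" "k \<in> hom (Hopf_bc \<C>) K A" using assms unfolding is_kernel_def by blast+
  then show ?thesis using assms unfolding kern_def bch_mk by simp
qed

lemma coker_mk:
  assumes "is_cokernel (Hopf_bc \<C>) A B f Q q"
  shows "coker A B (mk (und A) f (und B)) Q (mk (und B) q (und Q))"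
proof -
  have "f \<in> hom (Hopf_bc \<C>) A B" "q \<in> hom (Hopf_bc \<C>) B Q" using assms unfolding is_cokernel_def by blast+
  then show ?thesis using assms unfolding coker_def bch_mk by simp
qed

lemma kern_exists: assumes "bch A B f" shows "\<exists>K k. kern A B f K k"
proof -
  obtain K k where "is_kernel (Hopf_bc \<C>) A B (mor f) K k" using H.kernel_exists[OF bch_mor[OF assms]] by blast
  from kern_mk[OF this] show ?thesis unfolding mk_und[OF assms] by blast
qed

lemma coker_exists: assumes "bch A B f" shows "\<exists>Q q. coker A B f Q q"
proof -
  obtain Q q where "is_cokernel (Hopf_bc \<C>) A B (mor f) Q q" using H.cokernel_exists[OF bch_mor[OF assms]] by blast
  from coker_mk[OF this] show ?thesis unfolding mk_und[OF assms] by blast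
qed

lemma kern_bch: "kern A B f K k \<Longrightarrow> bch A B f" "kern A B f K k \<Longrightarrow> bch K A k"
  unfolding kern_def by blast+

lemma coker_bch: "coker A B f Q q \<Longrightarrow> bch A B f" "coker A B f Q q \<Longrightarrow> bch B Q q"
  unfolding coker_def by blast+

lemma mor_cmp_bch: "bch A B f \<Longrightarrow> bch B C g \<Longrightarrow> mor (g \<bullet> f) = mor g \<cdot> mor f"
  by simp

lemma kern_zero: assumes "kern A B f K k" shows "f \<bullet> k = Et B \<bullet> Ep K"
proof -
  note b = kern_bch[OF assms]
  have "is_zero_arr (Hopf_bc \<C>) K B (mor (f \<bullet> k))"
    using assms H.kernel_zero[of A B "mor f" K "mor k"] mor_cmp_bch[OF b(2,1)] unfolding kern_def by simp
  then show ?thesis using zero_bch[OF bch_cmp[OF b(2,1)]] by blast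
qed

lemma coker_zero: assumes "coker A B f Q q" shows "q \<bullet> f = Et Q \<bullet> Ep A"
proof -
  note b = coker_bch[OF assms]
  have "is_zero_arr (Hopf_bc \<C>) A Q (mor (q \<bullet> f))"
    using assms H.cokernel_zero[of A B "mor f" Q "mor q"] mor_cmp_bch[OF b] unfolding coker_def by simp
  then show ?thesis using zero_bch[OF bch_cmp[OF b]] by blast
qed

lemma kern_factor:
  assumes k: "kern A B f K k" and h: "bch W A h" and z: "f \<bullet> h = Et B \<bullet> Ep W"
  shows "\<exists>u. bch W K u \<and> k \<bullet> u = h"
proof -
  note b = kern_bch[OF k]
  have "is_zero_arr (Hopf_bc \<C>) W B (mor f \<cdot> mor h)"
    using zero_bch[OF bch_cmp[OF h b(1)]] z mor_cmp_bch[OF h b(1)] by simp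
  then obtain u where u: "u \<in> hom (Hopf_bc \<C>) W K" "mor k \<cdot> u = mor h"
    using H.kernel_factor[of A B "mor f" K "mor k" "mor h" W] k bch_mor[OF h] unfolding kern_def by auto
  let ?u = "mk (und W) u (und K)"
  have u': "bch W K ?u" using u(1) unfolding bch_mk .
  have "k \<bullet> ?u = h" by (rule arr_eqI) (use u(2) bch_simps[OF u'] bch_simps[OF b(2)] bch_simps[OF h] in simp_all)
  then show ?thesis using u' by blast
qed

lemma coker_factor:
  assumes q: "coker A B f Q q" and h: "bch B W h" and z: "h \<bullet> f = Et W \<bullet> Ep A"
  shows "\<exists>u. bch Q W u \<and> u \<bullet> q = h"
proof -
  note b = coker_bch[OF q]
  have "is_zero_arr (Hopf_bc \<C>) A W (mor h \<cdot> mor f)"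
    using zero_bch[OF bch_cmp[OF b(1) h]] z mor_cmp_bch[OF b(1) h] by simp
  then obtain u where u: "u \<in> hom (Hopf_bc \<C>) Q W" "u \<cdot> mor q = mor h"
    using H.cokernel_factor[of A B "mor f" Q "mor q" "mor h" W] q bch_mor[OF h] unfolding coker_def by auto
  let ?u = "mk (und Q) u (und W)"
  have u': "bch Q W ?u" using u(1) unfolding bch_mk .
  have "?u \<bullet> q = h" by (rule arr_eqI) (use u(2) bch_simps[OF u'] bch_simps[OF b(2)] bch_simps[OF h] in simp_all)
  then show ?thesis using u' by blast
qed

lemma kern_unique:
  assumes k: "kern A B f K k" and uv: "bch W K u" "bch W K v" "k \<bullet> u = k \<bullet> v" shows "u = v"
proof -
  have "mor k \<cdot> mor u = mor k \<cdot> mor v"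
    using mor_cmp_bch[OF uv(1) kern_bch(2)[OF k]] mor_cmp_bch[OF uv(2) kern_bch(2)[OF k]] uv(3) by metis
  then have "mor u = mor v"
    using H.monoD[OF H.kernel_mono[of A B "mor f" K "mor k"] bch_mor[OF uv(1)] bch_mor[OF uv(2)]] k
    unfolding kern_def by simp
  then show ?thesis using mk_und uv by metis
qed

lemma coker_unique:
  assumes q: "coker A B f Q q" and uv: "bch Q W u" "bch Q W v" "u \<bullet> q = v \<bullet> q" shows "u = v"
proof -
  have "mor u \<cdot> mor q = mor v \<cdot> mor q"
    using mor_cmp_bch[OF coker_bch(2)[OF q] uv(1)] mor_cmp_bch[OF coker_bch(2)[OF q] uv(2)] uv(3) by metis
  then have "mor u = mor v"
    using H.epiD[OF H.cokernel_epi[of A B "mor f" Q "mor q"] bch_mor[OF uv(1)] bch_mor[OF uv(2)]] q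
    unfolding coker_def by simp
  then show ?thesis using mk_und uv by metis
qed

text \<open>
  Stability makes the quotient in \<open>\<C>\<close> a bicommutative Hopf monoid, and as such it has the universal property of the
  cokernel.
\<close>

theorem cokernel_action_quotient:
  assumes c: "coker K A k P p"
  shows "action_quotient \<C> K A (mor k) (und P) (mor p)"
proof -
  note bk = coker_bch(1)[OF c] and bp = coker_bch(2)[OF c]
  note [simp] = bch_simps[OF bk] bch_simps[OF bp]
  have k: "bhom K A k" and hp: "bhom A P p" by simp_all
  obtain Q p0 where q0: "action_quotient \<C> K A (mor k) Q p0"
    using stable_action_quotient[OF coequalizers _ k] bistability unfolding bistable_def by blast
  define r where "r = mk (und A) p0 Q"
  have r [simp]: "arr r" "dm r = und A" "cd r = Q" using q0 unfolding r_def action_quotient_def by auto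
  have q: "action_quotient \<C> K A (mor k) Q (mor r)" using q0 by (simp add: r_def)
  have [simp]: "Q \<in> ob \<C>" using r cd_ob by blast
  obtain Z where Z [simp]: "und Z = Q" "bc_hopf_monoid \<C> Z" and rh: "bhom A Z r"
    using quotient_hopf[OF _ k q r] by auto
  note D = action_quotientD[OF k q r]
  have "r \<bullet> (act A k \<bullet> (Id (und K) \<star> Et A) \<bullet> Ru' (und K)) = r \<bullet> (triv K (und A) \<bullet> (Id (und K) \<star> Et A) \<bullet> Ru' (und K))"
    using cmp_eq_assoc[OF D(1)] by (simp add: cmp_assoc)
  then have rk: "r \<bullet> k = Et Z \<bullet> Ep K" unfolding act_unit[OF k] using cmp_eq_assoc[OF bhom_eqs(2)[OF rh]] by simp
  have br: "bch A Z r" unfolding bch_def using rh by simp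
  \<comment> \<open>\<open>P\<close> and the quotient in \<open>\<C>\<close> have the same universal property, once for homomorphisms and once for invariant arrows.\<close>
  obtain th where th: "bch P Z th" "th \<bullet> p = r" using coker_factor[OF c br rk] by blast
  have pa: "p \<bullet> act A k = p \<bullet> triv K (und A)" by (rule hom_act[OF k hp coker_zero[OF c]])
  obtain t where t [simp]: "arr t" "dm t = Q" "cd t = und P" and tr: "t \<bullet> r = p"
    using action_quotient_factor[OF k q r _ _ pa] by auto
  have bt: "bch Z P t" unfolding bch_def using bhom_through_quotient[OF rh D(2) hp] tr by simp
  note [simp] = bch_simps[OF th(1)]
  have "(th \<bullet> t) \<bullet> r = Id Q \<bullet> r" using th tr by (simp add: cmp_assoc)
  then have tht: "th \<bullet> t = Id Q" by (rule tepi_epi) (simp_all add: D(2))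
  have "(t \<bullet> th) \<bullet> p = Id (und P) \<bullet> p" using th tr by (simp add: cmp_assoc)
  then have tth: "t \<bullet> th = Id (und P)" using coker_unique[OF c bch_cmp[OF th(1) bt] bch_Id] by simp
  have "tepi (t \<bullet> r)" by (intro tepi_cmp D(2) tepi_retraction[of t th]) (simp_all add: tth)
  then have tp: "tepi p" unfolding tr .
  show ?thesis
  proof (rule action_quotientI[OF k _ _ _ pa tp])
    fix V h assume [simp]: "V \<in> ob \<C>" "arr h" "dm h = und A \<odot> V"
      and inv: "h \<bullet> (act A k \<star> Id V) = h \<bullet> (triv K (und A) \<star> Id V)"
    from D(3)[OF _ _ _ inv] obtain h' where [simp]: "arr h'" "dm h' = Q \<odot> V" "cd h' = cd h" and h': "h' \<bullet> (r \<star> Id V) = h" by auto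
    have "(h' \<bullet> (th \<star> Id V)) \<bullet> (p \<star> Id V) = h" using th(2) h' by (simp add: cmp_assoc tns_cmp)
    then show "\<exists>h'. arr h' \<and> dm h' = und P \<odot> V \<and> cd h' = cd h \<and> h' \<bullet> (p \<star> Id V) = h"
      by (intro exI[of _ "h' \<bullet> (th \<star> Id V)"]) simp
  qed simp_all
qed

lemma coker_tepi: assumes c: "coker K A k P p" shows "tepi p" "p \<bullet> act A k = p \<bullet> triv K (und A)"
proof -
  note [simp] = bch_simps[OF coker_bch(1)[OF c]] bch_simps[OF coker_bch(2)[OF c]]
  show "tepi p" "p \<bullet> act A k = p \<bullet> triv K (und A)"
    using action_quotientD(1,2)[OF _ cokernel_action_quotient[OF c]] by simp_all
qed

lemma coker_quotient_factor:
  assumes c: "coker K A k P p" and h: "arr h" "dm h = und A" "h \<bullet> act A k = h \<bullet> triv K (und A)"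
  shows "\<exists>h'. arr h' \<and> dm h' = und P \<and> cd h' = cd h \<and> h' \<bullet> p = h"
proof -
  note [simp] = bch_simps[OF coker_bch(1)[OF c]] bch_simps[OF coker_bch(2)[OF c]]
  show ?thesis by (rule action_quotient_factor[OF _ cokernel_action_quotient[OF c]]) (use h in simp_all)
qed

lemma coker_quotient_factor_tns:
  assumes c: "coker K A k P p" and h: "V \<in> ob \<C>" "arr h" "dm h = und A \<odot> V"
    "h \<bullet> (act A k \<star> Id V) = h \<bullet> (triv K (und A) \<star> Id V)"
  shows "\<exists>h'. arr h' \<and> dm h' = und P \<odot> V \<and> cd h' = cd h \<and> h' \<bullet> (p \<star> Id V) = h"
proof -
  note [simp] = bch_simps[OF coker_bch(1)[OF c]] bch_simps[OF coker_bch(2)[OF c]]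
  show ?thesis by (rule action_quotientD(3)[OF _ cokernel_action_quotient[OF c]]) (use h in simp_all)
qed

end


section \<open>The opposite symmetric monoidal category\<close>

definition op_smc :: "('o, 'm) smcat \<Rightarrow> ('o, 'm) smcat" where
  "op_smc \<C> = \<lparr> ob = ob \<C>, hom = (\<lambda>X Y. hom \<C> Y X), ident = ident \<C>, comp = (\<lambda>g f. comp \<C> f g),
     tensor_ob = tensor_ob \<C>, tensor = tensor \<C>, unit_ob = unit_ob \<C>,
     assoc = assoc_inv \<C>, lunit = lunit_inv \<C>, runit = runit_inv \<C>, symm = (\<lambda>X Y. symm \<C> Y X) \<rparr>"

definition op_bimon :: "('o, 'm) bimon \<Rightarrow> ('o, 'm) bimon" where
  "op_bimon A = \<lparr> und = und A, mul = comul A, uni = coun A, comul = mul A, coun = uni A \<rparr>"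

lemma op_smc_sel [simp]:
  "ob (op_smc \<C>) = ob \<C>" "hom (op_smc \<C>) X Y = hom \<C> Y X" "ident (op_smc \<C>) = ident \<C>"
  "comp (op_smc \<C>) g f = comp \<C> f g" "tensor_ob (op_smc \<C>) = tensor_ob \<C>" "tensor (op_smc \<C>) = tensor \<C>"
  "unit_ob (op_smc \<C>) = unit_ob \<C>" "assoc (op_smc \<C>) = assoc_inv \<C>" "lunit (op_smc \<C>) = lunit_inv \<C>"
  "runit (op_smc \<C>) = runit_inv \<C>" "symm (op_smc \<C>) X Y = symm \<C> Y X"
  by (auto simp: op_smc_def)

lemma op_bimon_sel [simp]:
  "und (op_bimon A) = und A" "mul (op_bimon A) = comul A" "uni (op_bimon A) = coun A"
  "comul (op_bimon A) = mul A" "coun (op_bimon A) = uni A"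
  by (auto simp: op_bimon_def)

lemma op_bimon_op_bimon [simp]: "op_bimon (op_bimon A) = A"
  by (simp add: op_bimon_def)

lemma op_is_inverse: "is_inverse (op_smc \<C>) X Y f g \<longleftrightarrow> is_inverse \<C> Y X f g"
  unfolding is_inverse_def by auto

lemma op_iso_arr: "iso_arr (op_smc \<C>) X Y f \<longleftrightarrow> iso_arr \<C> Y X f"
  unfolding iso_arr_def op_is_inverse by simp

lemma op_equalizer: "is_equalizer (op_smc \<C>) X Y f g E e \<longleftrightarrow> is_coequalizer \<C> Y X f g E e"
  and op_coequalizer: "is_coequalizer (op_smc \<C>) X Y f g E e \<longleftrightarrow> is_equalizer \<C> Y X f g E e"
  unfolding is_equalizer_def is_coequalizer_def by auto

definition rv :: "('o, 'm) arrow \<Rightarrow> ('o, 'm) arrow" where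
  "rv = map_option (\<lambda>(X, f, Y). (Y, f, X))"

lemma rv_rv [simp]: "rv (rv a) = a" by (cases a) (auto simp: rv_def)

context symmetric_monoidal_category
begin

lemma is_inverse_sym: "f \<in> Hom X Y \<Longrightarrow> is_inverse \<C> X Y f g \<Longrightarrow> is_inverse \<C> Y X g f"
  unfolding is_inverse_def by simp

lemma op_assoc_inv:
  assumes "X \<in> ob \<C>" "Y \<in> ob \<C>" "Z \<in> ob \<C>" shows "assoc_inv (op_smc \<C>) X Y Z = \<a> X Y Z"
proof -
  have a: "is_inverse \<C> (X \<odot> Y \<odot> Z) ((X \<odot> Y) \<odot> Z) (assoc_inv \<C> X Y Z) (\<a> X Y Z)"
    using is_inverse_sym[OF _ assoc_inv_is_inverse[OF assms]] assoc_iso[OF assms] unfolding iso_arr_def by blast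
  have "g = \<a> X Y Z" if "is_inverse \<C> (X \<odot> Y \<odot> Z) ((X \<odot> Y) \<odot> Z) (assoc_inv \<C> X Y Z) g" for g
    by (rule is_inverse_unique[OF _ that a]) (use assoc_inv_is_inverse[OF assms] in \<open>simp add: is_inverse_def\<close>)
  then show ?thesis unfolding assoc_inv_def[of "op_smc \<C>"] inv_arr_def[of "op_smc \<C>"] op_is_inverse op_smc_sel
    by (intro the_equality a)
qed

lemma op_lunit_inv: assumes "X \<in> ob \<C>" shows "lunit_inv (op_smc \<C>) X = \<l> X"
proof -
  have a: "is_inverse \<C> X (\<one> \<odot> X) (lunit_inv \<C> X) (\<l> X)"
    using is_inverse_sym[OF _ lunit_inv_is_inverse[OF assms]] lunit_iso[OF assms] unfolding iso_arr_def by blast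
  have "g = \<l> X" if "is_inverse \<C> X (\<one> \<odot> X) (lunit_inv \<C> X) g" for g
    by (rule is_inverse_unique[OF _ that a]) (use lunit_inv_is_inverse[OF assms] in \<open>simp add: is_inverse_def\<close>)
  then show ?thesis unfolding lunit_inv_def[of "op_smc \<C>"] inv_arr_def[of "op_smc \<C>"] op_is_inverse op_smc_sel
    by (intro the_equality a)
qed

lemma op_runit_inv: assumes "X \<in> ob \<C>" shows "runit_inv (op_smc \<C>) X = \<r> X"
proof -
  have a: "is_inverse \<C> X (X \<odot> \<one>) (runit_inv \<C> X) (\<r> X)"
    using is_inverse_sym[OF _ runit_inv_is_inverse[OF assms]] runit_iso[OF assms] unfolding iso_arr_def by blast
  have "g = \<r> X" if "is_inverse \<C> X (X \<odot> \<one>) (runit_inv \<C> X) g" for g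
    by (rule is_inverse_unique[OF _ that a]) (use runit_inv_is_inverse[OF assms] in \<open>simp add: is_inverse_def\<close>)
  then show ?thesis unfolding runit_inv_def[of "op_smc \<C>"] inv_arr_def[of "op_smc \<C>"] op_is_inverse op_smc_sel
    by (intro the_equality a)
qed

lemma mor_eq: "a = b \<Longrightarrow> mor a = mor b" by simp

lemma op_symmetric_monoidal_category: "symmetric_monoidal_category (op_smc \<C>)"
proof (unfold_locales, simp_all)
  fix f X Y assume "f \<in> Hom Y X" then show "X \<in> ob \<C> \<and> Y \<in> ob \<C>" using hom_ob by blast
next
  fix X assume "X \<in> ob \<C>" then show "ide X \<in> Hom X X" by (rule ide_hom)
next
  fix f X Y g Z assume "f \<in> Hom Y X" "g \<in> Hom Z Y" then show "f \<cdot> g \<in> Hom Z X" by (rule comp_hom[rotated])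
next
  fix f X Y g Z h W assume "f \<in> Hom Y X" "g \<in> Hom Z Y" "h \<in> Hom W Z"
  then show "f \<cdot> g \<cdot> h = (f \<cdot> g) \<cdot> h" using comp_assoc by simp
next
  fix f X Y assume "f \<in> Hom Y X" then show "f \<cdot> ide Y = f" "ide X \<cdot> f = f"
    by (simp_all add: comp_ide_left comp_ide_right)
next
  fix f X Y g Z W assume "f \<in> Hom Y X" "g \<in> Hom W Z" then show "f \<otimes> g \<in> Hom (Y \<odot> W) (X \<odot> Z)" by (rule tensor_hom)
next
  fix X Y assume "X \<in> ob \<C>" "Y \<in> ob \<C>" then show "ide X \<otimes> ide Y = ide (X \<odot> Y)" by (rule tensor_ide)
next
  fix f X Y f' Z g U V g' W assume "f \<in> Hom Y X" "f' \<in> Hom Z Y" "g \<in> Hom V U" "g' \<in> Hom W V"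
  then show "(f \<cdot> f') \<otimes> (g \<cdot> g') = (f \<otimes> g) \<cdot> (f' \<otimes> g')" using tensor_comp by blast
next
  fix X Y Z assume o [simp]: "X \<in> ob \<C>" "Y \<in> ob \<C>" "Z \<in> ob \<C>"
  show "iso_arr (op_smc \<C>) ((X \<odot> Y) \<odot> Z) (X \<odot> Y \<odot> Z) (assoc_inv \<C> X Y Z)"
    using is_inverse_sym[OF _ assoc_inv_is_inverse[OF o]] assoc_iso[OF o] assoc_inv_is_inverse[OF o]
    unfolding op_iso_arr unfolding iso_arr_def is_inverse_def by blast
  show "(assoc_inv \<C> X Y Z \<cdot> \<s> (Y \<odot> Z) X) \<cdot> assoc_inv \<C> Y Z X =
        ((\<s> Y X \<otimes> ide Z) \<cdot> assoc_inv \<C> Y X Z) \<cdot> (ide Y \<otimes> \<s> Z X)"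
  proof -
    let ?L = "(As' X Y Z \<bullet> Sy (Y \<odot> Z) X) \<bullet> As' Y Z X"
    let ?R = "((Sy Y X \<star> Id Z) \<bullet> As' Y X Z) \<bullet> (Id Y \<star> Sy Z X)"
    have "?R = ?R \<bullet> (As Y Z X \<bullet> Sy X (Y \<odot> Z) \<bullet> As X Y Z) \<bullet> ?L" by (simp add: cmp_assoc)
    also have "\<dots> = ?L" unfolding hexagon'[OF o] by (simp add: cmp_assoc tns_cmp tns_cmp2)
    finally have e: "?R = ?L" .
    show ?thesis using mor_eq[OF e] by simp
  qed
next
  fix f X X' g Y Y' h Z Z' assume f: "f \<in> Hom X' X" "g \<in> Hom Y' Y" "h \<in> Hom Z' Z"
  then have [simp]: "X \<in> ob \<C>" "Y \<in> ob \<C>" "Z \<in> ob \<C>" "X' \<in> ob \<C>" "Y' \<in> ob \<C>" "Z' \<in> ob \<C>" using hom_ob by blast+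
  show "((f \<otimes> g) \<otimes> h) \<cdot> assoc_inv \<C> X' Y' Z' = assoc_inv \<C> X Y Z \<cdot> (f \<otimes> g \<otimes> h)"
    using mor_eq[OF As'_nat[of "mk X' f X" "mk Y' g Y" "mk Z' h Z" X Y Z]] f by simp
next
  fix X assume o [simp]: "X \<in> ob \<C>"
  show "iso_arr (op_smc \<C>) (\<one> \<odot> X) X (lunit_inv \<C> X)"
    using is_inverse_sym[OF _ lunit_inv_is_inverse[OF o]] lunit_iso[OF o] lunit_inv_is_inverse[OF o]
    unfolding op_iso_arr unfolding iso_arr_def is_inverse_def by blast
  show "iso_arr (op_smc \<C>) (X \<odot> \<one>) X (runit_inv \<C> X)"
    using is_inverse_sym[OF _ runit_inv_is_inverse[OF o]] runit_iso[OF o] runit_inv_is_inverse[OF o]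
    unfolding op_iso_arr unfolding iso_arr_def is_inverse_def by blast
next
  fix f X Y assume f: "f \<in> Hom Y X"
  then have [simp]: "X \<in> ob \<C>" "Y \<in> ob \<C>" using hom_ob by blast+
  show "(ide \<one> \<otimes> f) \<cdot> lunit_inv \<C> Y = lunit_inv \<C> X \<cdot> f"
    using mor_eq[OF Lu'_nat[of "mk Y f X" X]] f by simp
  show "(f \<otimes> ide \<one>) \<cdot> runit_inv \<C> Y = runit_inv \<C> X \<cdot> f"
    using mor_eq[OF Ru'_nat[of "mk Y f X" X]] f by simp
next
  fix X Y Z W assume o [simp]: "X \<in> ob \<C>" "Y \<in> ob \<C>" "Z \<in> ob \<C>" "W \<in> ob \<C>"
  let ?L = "As' (X \<odot> Y) Z W \<bullet> As' X Y (Z \<odot> W)"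
  let ?R = "((As' X Y Z \<star> Id W) \<bullet> As' X (Y \<odot> Z) W) \<bullet> (Id X \<star> As' Y Z W)"
  have "?R = ?R \<bullet> (As X Y (Z \<odot> W) \<bullet> As (X \<odot> Y) Z W) \<bullet> ?L" by (simp add: cmp_assoc)
  also have "\<dots> = ?L" unfolding pentagon'[OF o] by (simp add: cmp_assoc tns_cmp tns_cmp2)
  finally have e: "?R = ?L" .
  show "assoc_inv \<C> (X \<odot> Y) Z W \<cdot> assoc_inv \<C> X Y (Z \<odot> W) =
     ((assoc_inv \<C> X Y Z \<otimes> ide W) \<cdot> assoc_inv \<C> X (Y \<odot> Z) W) \<cdot> (ide X \<otimes> assoc_inv \<C> Y Z W)"
    using mor_eq[OF e] by simp
next
  fix X Y assume o [simp]: "X \<in> ob \<C>" "Y \<in> ob \<C>"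
  have e: "As' X \<one> Y \<bullet> (Id X \<star> Lu' Y) = Ru' X \<star> Id Y"
    by (simp add: triangle_inv[symmetric])
  show "assoc_inv \<C> X \<one> Y \<cdot> (ide X \<otimes> lunit_inv \<C> Y) = runit_inv \<C> X \<otimes> ide Y"
    using mor_eq[OF e] by simp
next
  fix X Y assume o: "X \<in> ob \<C>" "Y \<in> ob \<C>"
  show "\<s> Y X \<in> Hom (Y \<odot> X) (X \<odot> Y)" using symm_hom o by blast
  show "\<s> Y X \<cdot> \<s> X Y = ide (X \<odot> Y)" using symm_symm o by blast
next
  fix f X X' g Y Y' assume "f \<in> Hom X' X" "g \<in> Hom Y' Y"
  then show "(f \<otimes> g) \<cdot> \<s> Y' X' = \<s> Y X \<cdot> (g \<otimes> f)" using symm_natural by metis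
qed

lemma op_interchange:
  assumes [simp]: "X \<in> ob \<C>" "Y \<in> ob \<C>" "Z \<in> ob \<C>" "W \<in> ob \<C>"
  shows "interchange (op_smc \<C>) X Y Z W = interchange \<C> X Z Y W"
proof -
  have "(As' X Y (Z \<odot> W) \<bullet> (Id X \<star> ((As Y Z W \<bullet> (Sy Z Y \<star> Id W)) \<bullet> As' Z Y W))) \<bullet> As X Z (Y \<odot> W) = Mf X Z Y W"
    by (simp add: Mf_def cmp_assoc)
  from mor_eq[OF this] show ?thesis unfolding interchange_def[of "op_smc \<C>"] by (simp add: op_assoc_inv)
qed

lemma op_bimonoid_imp: assumes "bimonoid \<C> A" shows "bimonoid (op_smc \<C>) (op_bimon A)"
proof -
  note [simp] = assms
  have h: "\<nabla>\<^bsub>A\<^esub> \<in> Hom (und A \<odot> und A) (und A)" "\<eta>\<^bsub>A\<^esub> \<in> Hom \<one> (und A)" "\<Delta>\<^bsub>A\<^esub> \<in> Hom (und A) (und A \<odot> und A)"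
    "\<epsilon>\<^bsub>A\<^esub> \<in> Hom (und A) \<one>"
    using assms unfolding bimonoid_def by auto
  have 1: "(De A \<star> Id (und A)) \<bullet> De A = (As' (und A) (und A) (und A) \<bullet> (Id (und A) \<star> De A)) \<bullet> De A"
    by (simp add: De_assoc[symmetric] cmp_assoc)
  have 2: "(Ep A \<star> Id (und A)) \<bullet> De A = Lu' (und A)"
  proof -
    have "Lu' (und A) = Lu' (und A) \<bullet> Lu (und A) \<bullet> (Ep A \<star> Id (und A)) \<bullet> De A" by (simp add: De_Ep del: struct_inv2)
    then show ?thesis by simp
  qed
  have 3: "(Id (und A) \<star> Ep A) \<bullet> De A = Ru' (und A)"
  proof -
    have "Ru' (und A) = Ru' (und A) \<bullet> Ru (und A) \<bullet> (Id (und A) \<star> Ep A) \<bullet> De A" by (simp add: De_Ep del: struct_inv2)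
    then show ?thesis by simp
  qed
  have 4: "(Mu A \<bullet> (Mu A \<star> Id (und A))) \<bullet> As' (und A) (und A) (und A) = Mu A \<bullet> (Id (und A) \<star> Mu A)"
    by (simp add: Mu_assoc cmp_assoc)
  have 5: "(Mu A \<bullet> (Et A \<star> Id (und A))) \<bullet> Lu' (und A) = Id (und A)" by (simp add: Mu_Et)
  have 6: "(Mu A \<bullet> (Id (und A) \<star> Et A)) \<bullet> Ru' (und A) = Id (und A)" by (simp add: Mu_Et)
  have 7: "De A \<bullet> Mu A = ((Mu A \<star> Mu A) \<bullet> Mf (und A) (und A) (und A) (und A)) \<bullet> (De A \<star> De A)"
    by (simp add: De_Mu cmp_assoc)
  note M = 1[THEN mor_eq] 2[THEN mor_eq] 3[THEN mor_eq] 4[THEN mor_eq] 5[THEN mor_eq] 6[THEN mor_eq] 7[THEN mor_eq]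
    Ep_Mu[OF assms, THEN mor_eq] De_Et[OF assms, THEN mor_eq] Ep_Et[OF assms, THEN mor_eq]
  show ?thesis unfolding bimonoid_def[of "op_smc \<C>"] using M h by (simp add: op_interchange op_lunit_inv)
qed

end

context symmetric_monoidal_category
begin

interpretation op: symmetric_monoidal_category "op_smc \<C>" by (rule op_symmetric_monoidal_category)

lemma rv_mk [simp]: "rv (mk X f Y) = mk Y f X" by (simp add: rv_def mk_def)

lemma op_arr: "op.arr a \<longleftrightarrow> arr (rv a)"
  by (cases a) (auto simp: rv_def op.arr_def arr_def dm_def cd_def mor_def)

lemma rv_sel [simp]: "arr a \<Longrightarrow> dm (rv a) = cd a" "arr a \<Longrightarrow> cd (rv a) = dm a" "arr a \<Longrightarrow> mor (rv a) = mor a"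
  by (cases a; auto simp: rv_def arr_def dm_def cd_def mor_def)+

lemma op_cmp: "op.cmp b a = rv (rv a \<bullet> rv b)"
  unfolding op.cmp_def cmp_def op_arr
  by (cases a; cases b) (auto simp: rv_def dm_def cd_def mor_def mk_def)

lemma op_tns: "op.tns b a = rv (rv b \<star> rv a)"
  unfolding op.tns_def tns_def op_arr
  by (cases a; cases b) (auto simp: rv_def dm_def cd_def mor_def mk_def)

lemma rv_inject [simp]: "rv a = rv b \<longleftrightarrow> a = b" by (metis rv_rv)

lemma op_struct:
  "op.Id X = rv (Id X)" "op.Lu X = rv (Lu' X)" "op.Ru X = rv (Ru' X)"
  "op.Mu A = rv (De (op_bimon A))" "op.Et A = rv (Ep (op_bimon A))"
  "op.De A = rv (Mu (op_bimon A))" "op.Ep A = rv (Et (op_bimon A))"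
  unfolding op.Id_def op.Lu_def op.Ru_def op.Mu_def op.Et_def op.De_def op.Ep_def
    Id_def Lu'_def Ru'_def Mu_def Et_def De_def Ep_def by simp_all

lemma op_struct':
  "X \<in> ob \<C> \<Longrightarrow> op.Lu' X = rv (Lu X)" "X \<in> ob \<C> \<Longrightarrow> op.Ru' X = rv (Ru X)"
  unfolding op.Lu'_def op.Ru'_def Lu_def Ru_def by (simp_all add: op_lunit_inv op_runit_inv)

lemma op_bimonoid: "bimonoid (op_smc \<C>) A \<longleftrightarrow> bimonoid \<C> (op_bimon A)"
proof
  assume A: "bimonoid \<C> (op_bimon A)"
  show "bimonoid (op_smc \<C>) A" using op_bimonoid_imp[OF A] by simp
next
  assume A: "bimonoid (op_smc \<C>) A"
  note [simp] = A
  have o: "und A \<in> ob \<C>" using op.bim_arr(1)[OF A] by simp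
  let ?B = "op_bimon A"
  have ar [simp]: "arr (Mu ?B)" "arr (Et ?B)" "arr (De ?B)" "arr (Ep ?B)"
    using op.bim_arr(2-5)[OF A] unfolding op_struct op_arr by simp_all
  note E = op.bim_eqs[OF A, unfolded op_struct op_cmp op_tns rv_rv rv_inject]
  have As: "op.As X Y Z = rv (As' X Y Z)" for X Y Z unfolding op.As_def As'_def by simp
  have Mf: "op.Mf (und A) (und A) (und A) (und A) = rv (Mf (und A) (und A) (und A) (und A))"
  proof -
    have "op.arr (op.Mf (und A) (und A) (und A) (und A))" using o by simp
    then have 1: "arr (rv (op.Mf (und A) (und A) (und A) (und A)))" by (simp add: op_arr)
    have "rv (op.Mf (und A) (und A) (und A) (und A)) = Mf (und A) (und A) (und A) (und A)"
    proof (rule arr_eqI[OF 1])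
      show "dm (rv (op.Mf (und A) (und A) (und A) (und A))) = dm (Mf (und A) (und A) (und A) (und A))"
        "cd (rv (op.Mf (und A) (und A) (und A) (und A))) = cd (Mf (und A) (und A) (und A) (und A))"
        "mor (rv (op.Mf (und A) (und A) (und A) (und A))) = mor (Mf (und A) (und A) (und A) (und A))"
        using rv_sel[OF 1] o by (simp_all add: op_interchange)
    qed (use o in simp)
    then show ?thesis by (metis rv_rv)
  qed
  note E2 = E[unfolded As Mf op_struct'(1)[OF unit_ob] rv_rv rv_inject]
  show "bimonoid \<C> ?B"
  proof (rule bimonoidI)
    show "und ?B \<in> ob \<C>" using o by simp
    show "arr (Mu ?B)" "arr (Et ?B)" "arr (De ?B)" "arr (Ep ?B)" by simp_all
    note [simp] = o
    show "Mu ?B \<bullet> (Mu ?B \<star> Id (und ?B)) = Mu ?B \<bullet> (Id (und ?B) \<star> Mu ?B) \<bullet> As (und ?B) (und ?B) (und ?B)"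
    proof -
      have "(Mu ?B \<bullet> (Mu ?B \<star> Id (und A))) \<bullet> As' (und A) (und A) (und A) \<bullet> As (und A) (und A) (und A)
         = (Mu ?B \<bullet> (Id (und A) \<star> Mu ?B)) \<bullet> As (und A) (und A) (und A)"
        using E2(4) by (simp add: cmp_assoc[symmetric] del: struct_inv struct_inv2)
      then show ?thesis by (simp add: cmp_assoc)
    qed
    show "Mu ?B \<bullet> (Et ?B \<star> Id (und ?B)) = Lu (und ?B)"
    proof -
      have "((Mu ?B \<bullet> (Et ?B \<star> Id (und A))) \<bullet> Lu' (und A)) \<bullet> Lu (und A) = Lu (und A)" using E2(5) by simp
      then show ?thesis by (simp add: cmp_assoc)
    qed
    show "Mu ?B \<bullet> (Id (und ?B) \<star> Et ?B) = Ru (und ?B)"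
    proof -
      have "((Mu ?B \<bullet> (Id (und A) \<star> Et ?B)) \<bullet> Ru' (und A)) \<bullet> Ru (und A) = Ru (und A)" using E2(6) by simp
      then show ?thesis by (simp add: cmp_assoc)
    qed
    show "As (und ?B) (und ?B) (und ?B) \<bullet> (De ?B \<star> Id (und ?B)) \<bullet> De ?B = (Id (und ?B) \<star> De ?B) \<bullet> De ?B"
      using E2(1) by (simp add: cmp_assoc)
    show "Lu (und ?B) \<bullet> (Ep ?B \<star> Id (und ?B)) \<bullet> De ?B = Id (und ?B)" using E2(2) by simp
    show "Ru (und ?B) \<bullet> (Id (und ?B) \<star> Ep ?B) \<bullet> De ?B = Id (und ?B)" using E2(3) by simp
    show "De ?B \<bullet> Mu ?B = (Mu ?B \<star> Mu ?B) \<bullet> Mf (und ?B) (und ?B) (und ?B) (und ?B) \<bullet> (De ?B \<star> De ?B)"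
      using E2(7) by (simp add: cmp_assoc)
    show "Ep ?B \<bullet> Mu ?B = Lu \<one> \<bullet> (Ep ?B \<star> Ep ?B)" using E2(9) by (simp add: op_struct'(1))
    show "De ?B \<bullet> Et ?B = (Et ?B \<star> Et ?B) \<bullet> Lu' \<one>" using E2(8) by simp
    show "Ep ?B \<bullet> Et ?B = Id \<one>" using E2(10) by simp
  qed
qed

end


section \<open>Smallness and normalized integrals\<close>

context symmetric_monoidal_category
begin

definition nint :: "('o, 'm) bimon \<Rightarrow> ('o, 'm) arrow \<Rightarrow> bool" where
  "nint A \<sigma> \<longleftrightarrow> arr \<sigma> \<and> dm \<sigma> = \<one> \<and> cd \<sigma> = und A \<and>
     Mu A \<bullet> (\<sigma> \<star> Id (und A)) = Ru (und A) \<bullet> (\<sigma> \<star> Ep A) \<and>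
     Mu A \<bullet> (Id (und A) \<star> \<sigma>) = Lu (und A) \<bullet> (Ep A \<star> \<sigma>) \<and> Ep A \<bullet> \<sigma> = Id \<one>"

definition ncoint :: "('o, 'm) bimon \<Rightarrow> ('o, 'm) arrow \<Rightarrow> bool" where
  "ncoint A \<phi> \<longleftrightarrow> arr \<phi> \<and> dm \<phi> = und A \<and> cd \<phi> = \<one> \<and>
     Lu (und A) \<bullet> (\<phi> \<star> Id (und A)) \<bullet> De A = Et A \<bullet> \<phi> \<and>
     Ru (und A) \<bullet> (Id (und A) \<star> \<phi>) \<bullet> De A = Et A \<bullet> \<phi> \<and> \<phi> \<bullet> Et A = Id \<one>"

lemma nint_simps [simp]:
  "nint A \<sigma> \<Longrightarrow> arr \<sigma>" "nint A \<sigma> \<Longrightarrow> dm \<sigma> = \<one>" "nint A \<sigma> \<Longrightarrow> cd \<sigma> = und A" "nint A \<sigma> \<Longrightarrow> Ep A \<bullet> \<sigma> = Id \<one>"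
  by (auto simp: nint_def)

lemma ncoint_simps [simp]:
  "ncoint A \<phi> \<Longrightarrow> arr \<phi>" "ncoint A \<phi> \<Longrightarrow> dm \<phi> = und A" "ncoint A \<phi> \<Longrightarrow> cd \<phi> = \<one>" "ncoint A \<phi> \<Longrightarrow> \<phi> \<bullet> Et A = Id \<one>"
  by (auto simp: ncoint_def)

lemma nint_eqs:
  assumes "nint A \<sigma>"
  shows "Mu A \<bullet> (\<sigma> \<star> Id (und A)) = Ru (und A) \<bullet> (\<sigma> \<star> Ep A)" "Mu A \<bullet> (Id (und A) \<star> \<sigma>) = Lu (und A) \<bullet> (Ep A \<star> \<sigma>)"
  using assms unfolding nint_def by blast+

lemma ncoint_eqs:
  assumes "ncoint A \<phi>"
  shows "Lu (und A) \<bullet> (\<phi> \<star> Id (und A)) \<bullet> De A = Et A \<bullet> \<phi>" "Ru (und A) \<bullet> (Id (und A) \<star> \<phi>) \<bullet> De A = Et A \<bullet> \<phi>"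
  using assms unfolding ncoint_def by blast+

lemma nint_mk:
  assumes [simp]: "bimonoid \<C> A"
  shows "is_integral \<C> A \<phi> \<and> \<epsilon>\<^bsub>A\<^esub> \<cdot> \<phi> = ide \<one> \<longleftrightarrow> nint A (mk \<one> \<phi> (und A))"
proof (cases "\<phi> \<in> Hom \<one> (und A)")
  case True
  let ?s = "mk \<one> \<phi> (und A)"
  note [simp] = True
  have 1: "Mu A \<bullet> (?s \<star> Id (und A)) = Ru (und A) \<bullet> (?s \<star> Ep A)
     \<longleftrightarrow> \<nabla>\<^bsub>A\<^esub> \<cdot> (\<phi> \<otimes> ide (und A)) = \<r> (und A) \<cdot> (\<phi> \<otimes> \<epsilon>\<^bsub>A\<^esub>)"
    by (auto dest: arg_cong[where f = mor] intro!: arr_eqI)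
  have 2: "Mu A \<bullet> (Id (und A) \<star> ?s) = Lu (und A) \<bullet> (Ep A \<star> ?s)
     \<longleftrightarrow> \<nabla>\<^bsub>A\<^esub> \<cdot> (ide (und A) \<otimes> \<phi>) = \<l> (und A) \<cdot> (\<epsilon>\<^bsub>A\<^esub> \<otimes> \<phi>)"
    by (auto dest: arg_cong[where f = mor] intro!: arr_eqI)
  have 3: "Ep A \<bullet> ?s = Id \<one> \<longleftrightarrow> \<epsilon>\<^bsub>A\<^esub> \<cdot> \<phi> = ide \<one>"
    by (auto dest: arg_cong[where f = mor] intro!: arr_eqI)
  show ?thesis unfolding is_integral_def nint_def 1 2 3 by simp
next
  case False
  then show ?thesis unfolding is_integral_def nint_def by simp
qed

lemma ncoint_mk:
  assumes [simp]: "bimonoid \<C> A"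
  shows "is_cointegral \<C> A \<phi> \<and> \<phi> \<cdot> \<eta>\<^bsub>A\<^esub> = ide \<one> \<longleftrightarrow> ncoint A (mk (und A) \<phi> \<one>)"
proof (cases "\<phi> \<in> Hom (und A) \<one>")
  case True
  let ?s = "mk (und A) \<phi> \<one>"
  note [simp] = True
  have 1: "Lu (und A) \<bullet> (?s \<star> Id (und A)) \<bullet> De A = Et A \<bullet> ?s
     \<longleftrightarrow> \<l> (und A) \<cdot> (\<phi> \<otimes> ide (und A)) \<cdot> \<Delta>\<^bsub>A\<^esub> = \<eta>\<^bsub>A\<^esub> \<cdot> \<phi>"
    by (auto dest: arg_cong[where f = mor] intro!: arr_eqI)
  have 2: "Ru (und A) \<bullet> (Id (und A) \<star> ?s) \<bullet> De A = Et A \<bullet> ?s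
     \<longleftrightarrow> \<r> (und A) \<cdot> (ide (und A) \<otimes> \<phi>) \<cdot> \<Delta>\<^bsub>A\<^esub> = \<eta>\<^bsub>A\<^esub> \<cdot> \<phi>"
    by (auto dest: arg_cong[where f = mor] intro!: arr_eqI)
  have 3: "?s \<bullet> Et A = Id \<one> \<longleftrightarrow> \<phi> \<cdot> \<eta>\<^bsub>A\<^esub> = ide \<one>"
    by (auto dest: arg_cong[where f = mor] intro!: arr_eqI)
  show ?thesis unfolding is_cointegral_def ncoint_def 1 2 3 by simp
next
  case False
  then show ?thesis unfolding is_cointegral_def ncoint_def by simp
qed

lemma nint_mk_mor: "nint A \<sigma> \<Longrightarrow> mk \<one> (mor \<sigma>) (und A) = \<sigma>"
  by (metis nint_simps(1-3) mk_mor)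

lemma ncoint_mk_mor: "ncoint A \<phi> \<Longrightarrow> mk (und A) (mor \<phi>) \<one> = \<phi>"
  by (metis ncoint_simps(1-3) mk_mor)

lemma nint_unique:
  assumes A [simp]: "bimonoid \<C> A" and s: "nint A \<sigma>" and t: "nint A \<tau>" shows "\<sigma> = \<tau>"
proof -
  note [simp] = nint_simps[OF s] nint_simps[OF t]
  have "\<sigma> \<bullet> Ru \<one> = Ru (und A) \<bullet> (\<sigma> \<star> Ep A) \<bullet> (Id \<one> \<star> \<tau>)" by (simp add: tns_cmp Ru_nat)
  also have "\<dots> = (Mu A \<bullet> (Id (und A) \<star> \<tau>)) \<bullet> (\<sigma> \<star> Id \<one>)"
    unfolding cmp_assoc[symmetric] nint_eqs(1)[OF s, symmetric] by (simp add: cmp_assoc tns_cmp)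
  also have "\<dots> = \<tau> \<bullet> Ru \<one>" unfolding nint_eqs(2)[OF t] by (simp add: cmp_assoc tns_cmp Lu_nat Lu_Ru)
  finally have "(\<sigma> \<bullet> Ru \<one>) \<bullet> Ru' \<one> = (\<tau> \<bullet> Ru \<one>) \<bullet> Ru' \<one>" by simp
  then show ?thesis by (simp add: cmp_assoc)
qed

lemma integral_of_eq:
  assumes A: "bimonoid \<C> A" and s: "nint A \<sigma>" shows "integral_of \<C> A = mor \<sigma>"
  unfolding integral_of_def
proof (rule the_equality)
  show "is_integral \<C> A (mor \<sigma>) \<and> \<epsilon>\<^bsub>A\<^esub> \<cdot> mor \<sigma> = ide \<one>"
    unfolding nint_mk[OF A] nint_mk_mor[OF s] by (rule s)
  fix \<phi> assume "is_integral \<C> A \<phi> \<and> \<epsilon>\<^bsub>A\<^esub> \<cdot> \<phi> = ide \<one>"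
  then have "mk \<one> \<phi> (und A) = \<sigma>" unfolding nint_mk[OF A] using nint_unique[OF A _ s] by blast
  then show "\<phi> = mor \<sigma>" by (metis mk_sel(2))
qed

lemma nintI:
  assumes A: "bc_hopf_monoid \<C> A" and s [simp]: "arr \<sigma>" "dm \<sigma> = \<one>" "cd \<sigma> = und A" "Ep A \<bullet> \<sigma> = Id \<one>"
    and eq: "Mu A \<bullet> (\<sigma> \<star> Id (und A)) = Ru (und A) \<bullet> (\<sigma> \<star> Ep A)"
  shows "nint A \<sigma>"
proof -
  note [simp] = bc_bim[OF A]
  have "Mu A \<bullet> (Id (und A) \<star> \<sigma>) = Mu A \<bullet> Sy (und A) (und A) \<bullet> (Id (und A) \<star> \<sigma>)"
    by (simp add: cmp_eq_assoc[OF Mu_Sy[OF A]])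
  also have "\<dots> = (Mu A \<bullet> (\<sigma> \<star> Id (und A))) \<bullet> Sy (und A) \<one>" by (simp add: Sy_nat cmp_assoc)
  also have "\<dots> = Ru (und A) \<bullet> Sy \<one> (und A) \<bullet> (Ep A \<star> \<sigma>)" unfolding eq by (simp add: Sy_nat cmp_assoc)
  also have "\<dots> = Lu (und A) \<bullet> (Ep A \<star> \<sigma>)" by (simp add: cmp_eq_assoc[OF Ru_Sy])
  finally show ?thesis unfolding nint_def using eq by simp
qed

lemma iso_arrI:
  assumes f: "arr f" "arr g" "dm g = cd f" "cd g = dm f" and e: "g \<bullet> f = Id (dm f)" "f \<bullet> g = Id (cd f)"
  shows "iso_arr \<C> (dm f) (cd f) (mor f)"
proof -
  have "mor g \<cdot> mor f = ide (dm f)" using mor_eq[OF e(1)] f by simp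
  moreover have "mor f \<cdot> mor g = ide (cd f)" using mor_eq[OF e(2)] f by simp
  ultimately show ?thesis using f unfolding iso_arr_def is_inverse_def by (auto intro!: exI[of _ "mor g"])
qed

lemma iso_arrE:
  assumes "iso_arr \<C> X Y f"
  obtains g where "arr (mk X f Y)" "arr g" "dm g = Y" "cd g = X" "g \<bullet> mk X f Y = Id X" "mk X f Y \<bullet> g = Id Y"
proof -
  obtain h where h: "f \<in> Hom X Y" "h \<in> Hom Y X" "h \<cdot> f = ide X" "f \<cdot> h = ide Y"
    using assms unfolding iso_arr_def is_inverse_def by blast
  have [simp]: "X \<in> ob \<C>" "Y \<in> ob \<C>" using h hom_ob by blast+
  show thesis by (rule that[of "mk Y h X"]) (use h in \<open>auto intro!: arr_eqI\<close>)
qed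

lemma coequalizerD:
  assumes c: "is_coequalizer \<C> X Y (mor f) (mor g) Q (mor q)"
    and [simp]: "arr f" "arr g" "arr q" "dm f = X" "dm g = X" "cd f = Y" "cd g = Y" "dm q = Y" "cd q = Q"
  shows "q \<bullet> f = q \<bullet> g"
    "\<And>h. arr h \<Longrightarrow> dm h = Y \<Longrightarrow> h \<bullet> f = h \<bullet> g \<Longrightarrow> \<exists>k. arr k \<and> dm k = Q \<and> cd k = cd h \<and> k \<bullet> q = h"
    "\<And>x y. x \<bullet> q = y \<bullet> q \<Longrightarrow> arr x \<Longrightarrow> arr y \<Longrightarrow> dm x = Q \<Longrightarrow> dm y = Q \<Longrightarrow> x = y"
proof -
  show e: "q \<bullet> f = q \<bullet> g" by (rule arr_eqI) (use c in \<open>simp_all add: is_coequalizer_def\<close>)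
  have U: "\<exists>!k. k \<in> Hom Q W \<and> k \<cdot> mor q = mor h" if "arr h" "dm h = Y" "cd h = W" "h \<bullet> f = h \<bullet> g" for h W
    using c mor_eq[OF that(4)] mor_hom[OF that(1)] that(1-3) unfolding is_coequalizer_def by simp
  show "\<exists>k. arr k \<and> dm k = Q \<and> cd k = cd h \<and> k \<bullet> q = h" if h: "arr h" "dm h = Y" "h \<bullet> f = h \<bullet> g" for h
  proof -
    obtain k where k: "k \<in> Hom Q (cd h)" "k \<cdot> mor q = mor h" using U[OF h(1,2) refl h(3)] by blast
    show ?thesis by (rule exI[of _ "mk Q k (cd h)"]) (use k h in \<open>auto intro!: arr_eqI\<close>)
  qed
  show "x = y" if xy: "x \<bullet> q = y \<bullet> q" "arr x" "arr y" "dm x = Q" "dm y = Q" for x y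
  proof -
    have cd: "cd x = cd y" using arg_cong[OF xy(1), of cd] xy(2-5) by simp
    have "(x \<bullet> q) \<bullet> f = (x \<bullet> q) \<bullet> g" using e by (simp add: cmp_assoc)
    then have "\<exists>!k. k \<in> Hom Q (cd y) \<and> k \<cdot> mor q = mor (x \<bullet> q)" using U[of "x \<bullet> q" "cd y"] xy(2-5) cd by simp
    moreover have "mor x \<in> Hom Q (cd y) \<and> mor x \<cdot> mor q = mor (x \<bullet> q)"
      "mor y \<in> Hom Q (cd y) \<and> mor y \<cdot> mor q = mor (x \<bullet> q)" using mor_eq[OF xy(1)] xy(2-5) cd by simp_all
    ultimately have "mor x = mor y" by (elim ex1E) blast
    then show ?thesis by (intro arr_eqI) (simp_all add: xy(2-5) cd)
  qed
qed

text \<open>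
  Acting with the integral is an idempotent \<open>e\<close> on \<open>X\<close>.  Its values are invariant, and it is the identity on invariant
  elements and on the quotient; so its splitting is the invariant and the stabilized object at once.
\<close>

lemma small_left:
  assumes coeq: "has_coequalizers \<C>" and s: "nint A \<sigma>" and la: "left_action \<C> A \<alpha> X"
  shows "(\<exists>I i. left_invariant \<C> A \<alpha> X I i) \<and> (\<exists>Q p. left_stabilized \<C> A \<alpha> X Q p) \<and>
    (\<forall>I i Q p. left_invariant \<C> A \<alpha> X I i \<and> left_stabilized \<C> A \<alpha> X Q p \<longrightarrow> iso_arr \<C> I Q (p \<cdot> i))"
proof -
  let ?A = "und A" and ?t = "triv A X"
  define al where "al = mk (?A \<odot> X) \<alpha> X"
  have [simp]: "bimonoid \<C> A" "X \<in> ob \<C>" using la unfolding left_action_def by auto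
  note [simp] = nint_simps[OF s]
  have [simp]: "arr al" "dm al = ?A \<odot> X" "cd al = X" "mor al = \<alpha>"
    using la unfolding al_def left_action_def by auto
  have tl: "trivial_left_action \<C> A X = mor ?t" unfolding trivial_left_action_def by simp
  have a1: "al \<bullet> (Mu A \<star> Id X) = al \<bullet> (Id ?A \<star> al) \<bullet> As ?A ?A X"
    by (rule arr_eqI) (use la in \<open>simp_all add: left_action_def\<close>)
  have inv_iff: "left_invariant_arr \<C> A \<alpha> X I i \<longleftrightarrow>
      arr (mk I i X) \<and> al \<bullet> (Id ?A \<star> mk I i X) = Lu X \<bullet> (Ep A \<star> mk I i X)" for I i
    unfolding left_invariant_arr_def
    by (cases "i \<in> Hom I X") (auto intro!: arr_eqI dest: arg_cong[where f = mor])
  define e where "e = al \<bullet> (\<sigma> \<star> Id X) \<bullet> Lu' X"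
  have [simp]: "arr e" "dm e = X" "cd e = X" unfolding e_def by simp_all
  have et: "al \<bullet> ((\<sigma> \<bullet> Ep A) \<star> Id X) = e \<bullet> ?t"
    by (simp add: e_def triv_def cmp_assoc tns_cmp)
  have L1: "(Ru ?A \<bullet> (\<sigma> \<star> Ep A)) \<bullet> Lu' ?A = \<sigma> \<bullet> Ep A"
  proof -
    have "(Ru ?A \<bullet> (\<sigma> \<star> Ep A)) \<bullet> Lu' ?A = (Ru ?A \<bullet> (\<sigma> \<star> Id \<one>)) \<bullet> (Id \<one> \<star> Ep A) \<bullet> Lu' ?A"
      by (simp add: cmp_assoc tns_cmp2)
    also have "\<dots> = \<sigma> \<bullet> Ru \<one> \<bullet> Lu' \<one> \<bullet> Ep A" by (simp add: Ru_nat Lu'_nat cmp_assoc)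
    finally show ?thesis by (simp add: Lu_Ru[symmetric])
  qed
  have L2: "(Lu ?A \<bullet> (Ep A \<star> \<sigma>)) \<bullet> Ru' ?A = \<sigma> \<bullet> Ep A"
  proof -
    have "(Lu ?A \<bullet> (Ep A \<star> \<sigma>)) \<bullet> Ru' ?A = (Lu ?A \<bullet> (Id \<one> \<star> \<sigma>)) \<bullet> (Ep A \<star> Id \<one>) \<bullet> Ru' ?A"
      by (simp add: cmp_assoc tns_cmp2)
    also have "\<dots> = \<sigma> \<bullet> Lu \<one> \<bullet> Ru' \<one> \<bullet> Ep A" by (simp add: Lu_nat Ru'_nat cmp_assoc)
    finally show ?thesis by (simp add: Lu'_Ru'[symmetric])
  qed
  have a2: "al \<bullet> (Id ?A \<star> al) = al \<bullet> (Mu A \<star> Id X) \<bullet> As' ?A ?A X"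
    using a1 by (simp add: cmp_eq_assoc[OF a1] cmp_assoc)
  have ea: "e \<bullet> al = e \<bullet> ?t"
  proof -
    have "e \<bullet> al = al \<bullet> (Id ?A \<star> al) \<bullet> (\<sigma> \<star> Id (?A \<odot> X)) \<bullet> Lu' (?A \<odot> X)"
      by (simp add: e_def cmp_assoc Lu'_nat tns_cmp2)
    also have "\<dots> = al \<bullet> (Mu A \<star> Id X) \<bullet> (As' ?A ?A X \<bullet> (\<sigma> \<star> (Id ?A \<star> Id X))) \<bullet> Lu' (?A \<odot> X)"
      by (simp add: cmp_eq_assoc[OF a2] cmp_assoc)
    also have "\<dots> = al \<bullet> (Mu A \<star> Id X) \<bullet> ((\<sigma> \<star> Id ?A) \<star> Id X) \<bullet> As' \<one> ?A X \<bullet> Lu' (?A \<odot> X)"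
      by (subst As'_nat) (simp_all add: cmp_assoc)
    also have "As' \<one> ?A X \<bullet> Lu' (?A \<odot> X) = Lu' ?A \<star> Id X" by (simp add: As'_Lu'[symmetric])
    also have "al \<bullet> (Mu A \<star> Id X) \<bullet> ((\<sigma> \<star> Id ?A) \<star> Id X) \<bullet> (Lu' ?A \<star> Id X)
       = al \<bullet> (((Mu A \<bullet> (\<sigma> \<star> Id ?A)) \<bullet> Lu' ?A) \<star> Id X)" by (simp add: tns_cmp cmp_assoc)
    finally show ?thesis unfolding nint_eqs(1)[OF s] L1 et .
  qed
  have ae: "al \<bullet> (Id ?A \<star> e) = e \<bullet> ?t"
  proof -
    have "al \<bullet> (Id ?A \<star> e) = (al \<bullet> (Id ?A \<star> al)) \<bullet> (Id ?A \<star> (\<sigma> \<star> Id X)) \<bullet> (Id ?A \<star> Lu' X)"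
      by (simp add: e_def cmp_assoc tns_cmp)
    also have "\<dots> = al \<bullet> (Mu A \<star> Id X) \<bullet> ((Id ?A \<star> \<sigma>) \<star> Id X) \<bullet> As' ?A \<one> X \<bullet> (Id ?A \<star> Lu' X)"
      unfolding a2 by (simp add: cmp_assoc cmp_eq_assoc[OF As'_nat])
    also have "As' ?A \<one> X \<bullet> (Id ?A \<star> Lu' X) = Ru' ?A \<star> Id X" by (simp add: triangle_inv[symmetric])
    also have "al \<bullet> (Mu A \<star> Id X) \<bullet> ((Id ?A \<star> \<sigma>) \<star> Id X) \<bullet> (Ru' ?A \<star> Id X)
       = al \<bullet> (((Mu A \<bullet> (Id ?A \<star> \<sigma>)) \<bullet> Ru' ?A) \<star> Id X)" by (simp add: tns_cmp cmp_assoc)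
    finally show ?thesis unfolding nint_eqs(2)[OF s] L2 et .
  qed
  have inv_e: "e \<bullet> j = j" if [simp]: "arr j" "cd j = X" and j: "al \<bullet> (Id ?A \<star> j) = Lu X \<bullet> (Ep A \<star> j)" for j
  proof -
    have "e \<bullet> j = (al \<bullet> (Id ?A \<star> j)) \<bullet> (\<sigma> \<star> Id (dm j)) \<bullet> Lu' (dm j)" by (simp add: e_def cmp_assoc Lu'_nat tns_cmp2)
    also have "\<dots> = Lu X \<bullet> (Id \<one> \<star> j) \<bullet> Lu' (dm j)" unfolding j by (simp add: cmp_assoc tns_cmp2)
    finally show ?thesis by (simp add: cmp_eq_assoc[OF Lu_nat] cmp_assoc)
  qed
  have "\<alpha> \<in> Hom (?A \<odot> X) X" "mor ?t \<in> Hom (?A \<odot> X) X" using mor_hom[of al] mor_hom[of ?t] by simp_all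
  then obtain Q0 p0 where c0: "is_coequalizer \<C> (?A \<odot> X) X \<alpha> (mor ?t) Q0 p0"
    using coeq unfolding has_coequalizers_def by blast
  text \<open>Averaging splits every stabilized object, by an invariant section.\<close>
  have split: "\<exists>s. arr s \<and> dm s = Q \<and> cd s = X \<and> s \<bullet> mk X p Q = e \<and> mk X p Q \<bullet> s = Id Q \<and> p \<in> Hom X Q"
    if st: "left_stabilized \<C> A \<alpha> X Q p" for Q p
  proof -
    let ?p = "mk X p Q"
    have p [simp]: "p \<in> Hom X Q" using st unfolding left_stabilized_def is_coequalizer_def by blast
    have [simp]: "Q \<in> ob \<C>" using p hom_ob by blast
    have c: "is_coequalizer \<C> (?A \<odot> X) X (mor al) (mor ?t) Q (mor ?p)"
      using st unfolding left_stabilized_def tl by simp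
    note C = coequalizerD[OF c]
    obtain s where [simp]: "arr s" "dm s = Q" "cd s = X" and sp: "s \<bullet> ?p = e"
      using C(2)[of e] ea by auto
    have "?p \<bullet> e = (?p \<bullet> al) \<bullet> (\<sigma> \<star> Id X) \<bullet> Lu' X" by (simp add: e_def cmp_assoc)
    also have "?p \<bullet> al = ?p \<bullet> ?t" by (rule C(1)) simp_all
    also have "(?p \<bullet> ?t) \<bullet> (\<sigma> \<star> Id X) \<bullet> Lu' X = ?p" by (simp add: triv_def cmp_assoc tns_cmp2)
    finally have pe: "?p \<bullet> e = ?p" .
    have "(?p \<bullet> s) \<bullet> ?p = Id Q \<bullet> ?p" by (simp add: cmp_assoc sp pe)
    then have "?p \<bullet> s = Id Q" by (rule C(3)[rotated 9]) simp_all
    then show ?thesis using sp p by (intro exI[of _ s]) simp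
  qed
  have st0: "left_stabilized \<C> A \<alpha> X Q0 p0" using c0 unfolding left_stabilized_def tl .
  obtain s where [simp]: "arr s" "dm s = Q0" "cd s = X" and s0: "s \<bullet> mk X p0 Q0 = e" "mk X p0 Q0 \<bullet> s = Id Q0"
    and [simp]: "p0 \<in> Hom X Q0" using split[OF st0] by blast
  let ?pr = "mk X p0 Q0"
  have si: "al \<bullet> (Id ?A \<star> s) = Lu X \<bullet> (Ep A \<star> s)"
  proof -
    have es: "e \<bullet> s = s" using s0 by (simp add: s0(1)[symmetric] cmp_assoc)
    have "al \<bullet> (Id ?A \<star> s) = (al \<bullet> (Id ?A \<star> e)) \<bullet> (Id ?A \<star> s)" by (simp add: cmp_assoc tns_cmp es)
    also have "\<dots> = (e \<bullet> ?t) \<bullet> (Id ?A \<star> s)" unfolding ae ..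
    also have "e \<bullet> ?t = Lu X \<bullet> (Ep A \<star> e)" using triv_nat[of A e] by simp
    also have "(Lu X \<bullet> (Ep A \<star> e)) \<bullet> (Id ?A \<star> s) = Lu X \<bullet> (Ep A \<star> s)" by (simp add: cmp_assoc tns_cmp es)
    finally show ?thesis .
  qed
  have ms: "mk Q0 (mor s) X = s" by (metis \<open>arr s\<close> \<open>dm s = Q0\<close> \<open>cd s = X\<close> mk_mor)
  have inv0: "left_invariant \<C> A \<alpha> X Q0 (mor s)" unfolding left_invariant_def
  proof (intro conjI allI impI)
    show "left_invariant_arr \<C> A \<alpha> X Q0 (mor s)" unfolding inv_iff ms using si by simp
    fix W j assume j: "left_invariant_arr \<C> A \<alpha> X W j"
    let ?j = "mk W j X"
    have j1 [simp]: "j \<in> Hom W X" and j2: "al \<bullet> (Id ?A \<star> ?j) = Lu X \<bullet> (Ep A \<star> ?j)" using j unfolding inv_iff by auto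
    have ej: "e \<bullet> ?j = ?j" by (rule inv_e) (simp_all add: j2)
    show "\<exists>!k. k \<in> Hom W Q0 \<and> mor s \<cdot> k = j"
    proof (rule ex1I[of _ "mor (?pr \<bullet> ?j)"])
      have "s \<bullet> (?pr \<bullet> ?j) = ?j" using s0(1) ej by (metis cmp_assoc)
      from mor_eq[OF this] show "mor (?pr \<bullet> ?j) \<in> Hom W Q0 \<and> mor s \<cdot> mor (?pr \<bullet> ?j) = j"
        using mor_hom[of "?pr \<bullet> ?j"] by simp
      fix k assume k: "k \<in> Hom W Q0 \<and> mor s \<cdot> k = j"
      have "?pr \<bullet> ?j = (?pr \<bullet> s) \<bullet> mk W k Q0" unfolding cmp_assoc
        by (rule arg_cong[of _ _ "\<lambda>x. ?pr \<bullet> x"], rule arr_eqI) (use k in simp_all)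
      then have "?pr \<bullet> ?j = mk W k Q0" using s0(2) k by simp
      from mor_eq[OF this] show "k = mor (?pr \<bullet> ?j)" by simp
    qed
  qed
  moreover have "iso_arr \<C> I Q (p \<cdot> i)" if st: "left_stabilized \<C> A \<alpha> X Q p" and I: "left_invariant \<C> A \<alpha> X I i" for I i Q p
  proof -
    obtain r where [simp]: "arr r" "dm r = Q" "cd r = X" and r: "r \<bullet> mk X p Q = e" "mk X p Q \<bullet> r = Id Q"
      and [simp]: "p \<in> Hom X Q" using split[OF st] by blast
    let ?p = "mk X p Q" and ?i = "mk I i X"
    have i1: "left_invariant_arr \<C> A \<alpha> X I i" using I unfolding left_invariant_def by blast
    have [simp]: "i \<in> Hom I X" and i2: "al \<bullet> (Id ?A \<star> ?i) = Lu X \<bullet> (Ep A \<star> ?i)" using i1 unfolding inv_iff by auto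
    have [simp]: "I \<in> ob \<C>" "Q \<in> ob \<C>" using hom_ob \<open>i \<in> Hom I X\<close> \<open>p \<in> Hom X Q\<close> by blast+
    have ei: "e \<bullet> ?i = ?i" by (rule inv_e) (simp_all add: i2)
    have "left_invariant_arr \<C> A \<alpha> X Q0 (mor s)" using inv0 unfolding left_invariant_def by blast
    then obtain d where d: "d \<in> Hom Q0 I" "i \<cdot> d = mor s" using I unfolding left_invariant_def by blast
    let ?d = "mk Q0 d I"
    have id: "?i \<bullet> ?d = s" by (rule arr_eqI) (use d in simp_all)
    have "?i \<bullet> (?d \<bullet> ?pr \<bullet> ?i) = (?i \<bullet> ?d) \<bullet> ?pr \<bullet> ?i" by (simp add: cmp_assoc)
    also have "\<dots> = ?i" unfolding id using s0(1) ei by (metis cmp_assoc)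
    finally have e1: "?i \<bullet> (?d \<bullet> ?pr \<bullet> ?i) = ?i" .
    have dpi: "?d \<bullet> ?pr \<bullet> ?i = Id I"
    proof -
      have "\<exists>!k. k \<in> Hom I I \<and> i \<cdot> k = i" using I i1 unfolding left_invariant_def by blast
      moreover have "mor (?d \<bullet> ?pr \<bullet> ?i) \<in> Hom I I \<and> i \<cdot> mor (?d \<bullet> ?pr \<bullet> ?i) = i"
        using mor_hom[of "?d \<bullet> ?pr \<bullet> ?i"] mor_eq[OF e1] d by simp
      moreover have "ide I \<in> Hom I I \<and> i \<cdot> ide I = i" using ide_hom comp_ide_right[of i I X] by simp
      ultimately have "mor (?d \<bullet> ?pr \<bullet> ?i) = ide I" by (elim ex1E) blast
      then show ?thesis by (intro arr_eqI) (use d in simp_all)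
    qed
    let ?g = "?d \<bullet> ?pr \<bullet> r"
    have "?g \<bullet> (?p \<bullet> ?i) = ?d \<bullet> ?pr \<bullet> (r \<bullet> ?p) \<bullet> ?i" by (simp add: cmp_assoc)
    also have "\<dots> = Id I" unfolding r(1) ei by (rule dpi)
    finally have g1: "?g \<bullet> (?p \<bullet> ?i) = Id I" .
    have "(?p \<bullet> ?i) \<bullet> ?g = ?p \<bullet> ((?i \<bullet> ?d) \<bullet> ?pr) \<bullet> r" by (simp add: cmp_assoc)
    also have "(?i \<bullet> ?d) \<bullet> ?pr = r \<bullet> ?p" unfolding id s0 r ..
    also have "?p \<bullet> (r \<bullet> ?p) \<bullet> r = (?p \<bullet> r) \<bullet> (?p \<bullet> r)" by (simp add: cmp_assoc)
    also have "\<dots> = Id Q" unfolding r(2) by simp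
    finally have g2: "(?p \<bullet> ?i) \<bullet> ?g = Id Q" .
    show ?thesis using iso_arrI[of "?p \<bullet> ?i" ?g] g1 g2 d by simp
  qed
  ultimately show ?thesis using st0 by blast
qed

text \<open>
  Let \<open>A\<close> act on itself by multiplication.  The stabilized object is \<open>\<epsilon> : A \<rightarrow> \<one>\<close>, and the inverse of the isomorphism
  from the invariants is an invariant element of counit one.
\<close>

lemma small_imp_integral:
  assumes A: "bc_hopf_monoid \<C> A" and small: "small \<C> A"
  shows "\<exists>\<sigma>. nint A \<sigma>"
proof -
  let ?A = "und A"
  note [simp] = bc_bim[OF A]
  have k: "bhom A A (Id ?A)" by (rule bhom_Id) simp
  have act: "act A (Id ?A) = Mu A" by (simp add: act_def)
  have la: "left_action \<C> A \<nabla>\<^bsub>A\<^esub> ?A" using left_action_act[OF k] unfolding act by simp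
  have st: "left_stabilized \<C> A \<nabla>\<^bsub>A\<^esub> ?A \<one> \<epsilon>\<^bsub>A\<^esub>"
    unfolding left_stabilized_def is_coequalizer_def
  proof (intro conjI allI ballI impI)
    have t: "trivial_left_action \<C> A ?A = mor (triv A ?A)" unfolding trivial_left_action_def by simp
    show "\<nabla>\<^bsub>A\<^esub> \<in> Hom (?A \<odot> ?A) ?A" "trivial_left_action \<C> A ?A \<in> Hom (?A \<odot> ?A) ?A" "\<epsilon>\<^bsub>A\<^esub> \<in> Hom ?A \<one>"
      unfolding t using mor_hom[of "triv A ?A"] mor_hom[of "Mu A"] mor_hom[of "Ep A"] by simp_all
    have "Ep A \<bullet> Mu A = Ep A \<bullet> triv A ?A" using triv_nat[of A "Ep A"] by (simp add: Ep_Mu)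
    from mor_eq[OF this] show "\<epsilon>\<^bsub>A\<^esub> \<cdot> \<nabla>\<^bsub>A\<^esub> = \<epsilon>\<^bsub>A\<^esub> \<cdot> trivial_left_action \<C> A ?A" unfolding t by simp
    fix Z h assume h: "h \<in> Hom ?A Z" and e: "h \<cdot> \<nabla>\<^bsub>A\<^esub> = h \<cdot> trivial_left_action \<C> A ?A"
    let ?h = "mk ?A h Z"
    note [simp] = h
    have [simp]: "Z \<in> ob \<C>" using h hom_ob by blast
    have "?h \<bullet> Mu A = ?h \<bullet> triv A ?A" by (rule arr_eqI) (use e in \<open>simp_all add: t\<close>)
    then have "?h \<bullet> (act A (Id ?A) \<bullet> (Id ?A \<star> Et A) \<bullet> Ru' ?A) = ?h \<bullet> (triv A ?A \<bullet> (Id ?A \<star> Et A) \<bullet> Ru' ?A)"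
      unfolding act by (metis cmp_assoc)
    then have hh: "?h = (?h \<bullet> Et A) \<bullet> Ep A" unfolding act_unit[OF k] by (simp add: cmp_assoc)
    show "\<exists>!m. m \<in> Hom \<one> Z \<and> m \<cdot> \<epsilon>\<^bsub>A\<^esub> = h"
    proof (rule ex1I[of _ "mor (?h \<bullet> Et A)"])
      have "mor (?h \<bullet> Et A) \<in> Hom \<one> Z" using mor_hom[of "?h \<bullet> Et A"] by simp
      then show "mor (?h \<bullet> Et A) \<in> Hom \<one> Z \<and> mor (?h \<bullet> Et A) \<cdot> \<epsilon>\<^bsub>A\<^esub> = h" using mor_eq[OF hh] by simp
      fix m assume m: "m \<in> Hom \<one> Z \<and> m \<cdot> \<epsilon>\<^bsub>A\<^esub> = h"
      have "?h = mk \<one> m Z \<bullet> Ep A" by (rule arr_eqI) (use m in simp_all)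
      then have "?h \<bullet> Et A = mk \<one> m Z" using m by (simp add: cmp_assoc Ep_Et)
      from mor_eq[OF this] show "m = mor (?h \<bullet> Et A)" by simp
    qed
  qed
  obtain I i where I: "left_invariant \<C> A \<nabla>\<^bsub>A\<^esub> ?A I i" and iso: "iso_arr \<C> I \<one> (\<epsilon>\<^bsub>A\<^esub> \<cdot> i)"
    using small la st unfolding small_def by blast
  have i1: "i \<in> Hom I ?A" "\<nabla>\<^bsub>A\<^esub> \<cdot> (ide ?A \<otimes> i) = \<l> ?A \<cdot> (\<epsilon>\<^bsub>A\<^esub> \<otimes> i)"
    using I unfolding left_invariant_def left_invariant_arr_def by auto
  let ?i = "mk I i ?A"
  have [simp]: "I \<in> ob \<C>" using i1 hom_ob by blast
  note [simp] = i1(1)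
  have i2: "Mu A \<bullet> (Id ?A \<star> ?i) = Lu ?A \<bullet> (Ep A \<star> ?i)" by (rule arr_eqI) (use i1 in simp_all)
  have ei: "mk I (\<epsilon>\<^bsub>A\<^esub> \<cdot> i) \<one> = Ep A \<bullet> ?i" by (rule arr_eqI[symmetric]) (use iso in \<open>simp_all add: iso_arr_def\<close>)
  obtain g where [simp]: "arr g" "dm g = \<one>" "cd g = I" and g: "(Ep A \<bullet> ?i) \<bullet> g = Id \<one>"
    using iso_arrE[OF iso] unfolding ei by blast
  let ?s = "?i \<bullet> g"
  have s2: "Mu A \<bullet> (Id ?A \<star> ?s) = Lu ?A \<bullet> (Ep A \<star> ?s)"
  proof -
    have "Mu A \<bullet> (Id ?A \<star> ?s) = (Mu A \<bullet> (Id ?A \<star> ?i)) \<bullet> (Id ?A \<star> g)" by (simp add: cmp_assoc tns_cmp)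
    also have "\<dots> = Lu ?A \<bullet> (Ep A \<star> ?s)" unfolding i2 by (simp add: cmp_assoc tns_cmp)
    finally show ?thesis .
  qed
  have "Mu A \<bullet> (?s \<star> Id ?A) = Mu A \<bullet> Sy ?A ?A \<bullet> (?s \<star> Id ?A)"
    by (simp add: cmp_eq_assoc[OF Mu_Sy[OF A]])
  also have "\<dots> = (Mu A \<bullet> (Id ?A \<star> ?s)) \<bullet> Sy \<one> ?A" by (simp add: Sy_nat cmp_assoc)
  also have "\<dots> = Lu ?A \<bullet> Sy ?A \<one> \<bullet> (?s \<star> Ep A)" unfolding s2 by (simp add: Sy_nat cmp_assoc)
  also have "\<dots> = Ru ?A \<bullet> (?s \<star> Ep A)" by (simp add: cmp_eq_assoc[OF Lu_Sy])
  finally have "Mu A \<bullet> (?s \<star> Id ?A) = Ru ?A \<bullet> (?s \<star> Ep A)" .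
  then have "nint A ?s" using g by (intro nintI[OF A]) (simp_all add: cmp_assoc)
  then show ?thesis by blast
qed

end


context symmetric_monoidal_category
begin

lemma Sy_tns_right:
  assumes o [simp]: "A \<in> ob \<C>" "B \<in> ob \<C>" "X \<in> ob \<C>"
  shows "As X B A \<bullet> Sy A (X \<odot> B) \<bullet> (Id A \<star> Sy B X) \<bullet> As A B X = (Id X \<star> Sy A B) \<bullet> Sy (A \<odot> B) X"
proof -
  have "As X B A \<bullet> Sy A (X \<odot> B) \<bullet> (Id A \<star> Sy B X) \<bullet> As A B X
    = (As X B A \<bullet> Sy A (X \<odot> B) \<bullet> As A X B) \<bullet> As' A X B \<bullet> (Id A \<star> Sy B X) \<bullet> As A B X"
    by (simp add: cmp_assoc)
  also have "\<dots> = (Id X \<star> Sy A B) \<bullet> As X A B \<bullet> (Sy A X \<star> Id B) \<bullet> As' A X B \<bullet> (Id A \<star> Sy B X) \<bullet> As A B X"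
    unfolding hexagon'[OF o(1,3,2)] by (simp add: cmp_assoc)
  also have "\<dots> = (Id X \<star> Sy A B) \<bullet> As X A B \<bullet> (Sy A X \<star> Id B) \<bullet> As' A X B \<bullet> (Id A \<star> Sy B X)
       \<bullet> (As A B X \<bullet> Sy X (A \<odot> B) \<bullet> As X A B) \<bullet> As' X A B \<bullet> Sy (A \<odot> B) X"
    by (simp add: cmp_assoc)
  also have "\<dots> = (Id X \<star> Sy A B) \<bullet> Sy (A \<odot> B) X"
    unfolding hexagon'[OF o(3,1,2)] by (simp add: cmp_assoc tns_cmp tns_cmp2)
  finally show ?thesis .
qed

text \<open>Precomposition with the symmetry is compatible with associativity because the multiplication is commutative.\<close>

lemma right_as_left:
  assumes A: "bc_hopf_monoid \<C> A" and ra: "right_action \<C> A \<alpha> X"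
  defines "\<beta> \<equiv> \<alpha> \<cdot> \<s> (und A) X"
  shows "left_action \<C> A \<beta> X"
    "left_invariant \<C> A \<beta> X I i \<longleftrightarrow> right_invariant \<C> A \<alpha> X I i"
    "left_stabilized \<C> A \<beta> X Q p \<longleftrightarrow> right_stabilized \<C> A \<alpha> X Q p"
proof -
  let ?A = "und A"
  note [simp] = bc_bim[OF A]
  have [simp]: "X \<in> ob \<C>" using ra unfolding right_action_def by auto
  define ar where "ar = mk (X \<odot> ?A) \<alpha> X"
  have h: "\<alpha> \<in> Hom (X \<odot> ?A) X" using ra unfolding right_action_def by auto
  have [simp]: "arr ar" "dm ar = X \<odot> ?A" "cd ar = X" "mor ar = \<alpha>" unfolding ar_def using h by auto
  have b: "\<beta> = mor (ar \<bullet> Sy ?A X)" unfolding \<beta>_def by simp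
  have a1: "ar \<bullet> (ar \<star> Id ?A) = ar \<bullet> (Id X \<star> Mu A) \<bullet> As X ?A ?A"
    by (rule arr_eqI) (use ra in \<open>simp_all add: right_action_def\<close>)
  have a2: "ar \<bullet> (Id X \<star> Et A) = Ru X"
    by (rule arr_eqI) (use ra in \<open>simp_all add: right_action_def\<close>)
  let ?al = "ar \<bullet> Sy ?A X"
  have "?al \<bullet> (Id ?A \<star> ?al) \<bullet> As ?A ?A X = (ar \<bullet> (ar \<star> Id ?A)) \<bullet> Sy ?A (X \<odot> ?A) \<bullet> (Id ?A \<star> Sy ?A X) \<bullet> As ?A ?A X"
  proof -
    have "?al \<bullet> (Id ?A \<star> ?al) \<bullet> As ?A ?A X = ar \<bullet> (Sy ?A X \<bullet> (Id ?A \<star> ar)) \<bullet> (Id ?A \<star> Sy ?A X) \<bullet> As ?A ?A X"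
      by (simp add: cmp_assoc tns_cmp2)
    also have "Sy ?A X \<bullet> (Id ?A \<star> ar) = (ar \<star> Id ?A) \<bullet> Sy ?A (X \<odot> ?A)" by (simp add: Sy_nat)
    finally show ?thesis by (simp add: cmp_assoc)
  qed
  also have "\<dots> = ar \<bullet> (Id X \<star> Mu A) \<bullet> (As X ?A ?A \<bullet> Sy ?A (X \<odot> ?A) \<bullet> (Id ?A \<star> Sy ?A X) \<bullet> As ?A ?A X)"
    unfolding a1 by (simp add: cmp_assoc)
  also have "\<dots> = ar \<bullet> (Id X \<star> Mu A) \<bullet> Sy (?A \<odot> ?A) X"
    by (simp add: Sy_tns_right tns_cmp2 Mu_Sy[OF A])
  also have "\<dots> = ?al \<bullet> (Mu A \<star> Id X)" by (simp add: cmp_assoc Sy_nat)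
  finally have 1: "?al \<bullet> (Mu A \<star> Id X) = ?al \<bullet> (Id ?A \<star> ?al) \<bullet> As ?A ?A X" ..
  have "?al \<bullet> (Et A \<star> Id X) = (ar \<bullet> (Id X \<star> Et A)) \<bullet> Sy \<one> X" by (simp add: cmp_assoc Sy_nat)
  then have 2: "?al \<bullet> (Et A \<star> Id X) = Lu X" unfolding a2 by (simp add: Ru_Sy)
  show "left_action \<C> A \<beta> X" unfolding left_action_def b
    using mor_eq[OF 1] mor_eq[OF 2] mor_hom[of ?al] by simp
  have ia: "left_invariant_arr \<C> A \<beta> X I i \<longleftrightarrow> right_invariant_arr \<C> A \<alpha> X I i" for I i
  proof (cases "i \<in> Hom I X")
    case True
    let ?i = "mk I i X"
    note [simp] = True
    have [simp]: "I \<in> ob \<C>" using hom_ob[OF True] by blast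
    have l: "left_invariant_arr \<C> A \<beta> X I i \<longleftrightarrow> ?al \<bullet> (Id ?A \<star> ?i) = Lu X \<bullet> (Ep A \<star> ?i)"
      unfolding left_invariant_arr_def b by (auto intro!: arr_eqI dest: arg_cong[where f = mor])
    have r: "right_invariant_arr \<C> A \<alpha> X I i \<longleftrightarrow> ar \<bullet> (?i \<star> Id ?A) = Ru X \<bullet> (?i \<star> Ep A)"
      unfolding right_invariant_arr_def by (auto intro!: arr_eqI dest: arg_cong[where f = mor])
    have 3: "?al \<bullet> (Id ?A \<star> ?i) = (ar \<bullet> (?i \<star> Id ?A)) \<bullet> Sy ?A I" by (simp add: cmp_assoc Sy_nat)
    have "(Ru X \<bullet> (?i \<star> Ep A)) \<bullet> Sy ?A I = Ru X \<bullet> Sy \<one> X \<bullet> (Ep A \<star> ?i)" by (simp add: cmp_assoc Sy_nat)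
    then have 4: "Lu X \<bullet> (Ep A \<star> ?i) = (Ru X \<bullet> (?i \<star> Ep A)) \<bullet> Sy ?A I" by (simp add: cmp_eq_assoc[OF Ru_Sy])
    have c: "x \<bullet> Sy ?A I = y \<bullet> Sy ?A I \<longleftrightarrow> x = y" if "arr x" "arr y" "dm x = I \<odot> ?A" "dm y = I \<odot> ?A" for x y
    proof
      assume "x \<bullet> Sy ?A I = y \<bullet> Sy ?A I"
      then have "(x \<bullet> Sy ?A I) \<bullet> Sy I ?A = (y \<bullet> Sy ?A I) \<bullet> Sy I ?A" by simp
      then show "x = y" using that by (simp add: cmp_assoc)
    qed simp
    show ?thesis unfolding l r 3 4 by (rule c) simp_all
  next
    case False
    then show ?thesis unfolding left_invariant_arr_def right_invariant_arr_def by simp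
  qed
  show "left_invariant \<C> A \<beta> X I i \<longleftrightarrow> right_invariant \<C> A \<alpha> X I i"
    unfolding left_invariant_def right_invariant_def ia ..
  let ?tr = "Ru X \<bullet> (Id X \<star> Ep A)"
  have tl: "trivial_left_action \<C> A X = mor (?tr \<bullet> Sy ?A X)"
  proof -
    have "?tr \<bullet> Sy ?A X = Ru X \<bullet> Sy \<one> X \<bullet> (Ep A \<star> Id X)" by (simp add: cmp_assoc Sy_nat)
    also have "\<dots> = triv A X" unfolding triv_def by (simp add: cmp_eq_assoc[OF Ru_Sy])
    finally show ?thesis unfolding trivial_left_action_def by simp
  qed
  have tr: "trivial_right_action \<C> A X = mor ?tr" unfolding trivial_right_action_def by simp
  have cc: "h \<cdot> mor (x \<bullet> Sy ?A X) = h \<cdot> mor (y \<bullet> Sy ?A X) \<longleftrightarrow> h \<cdot> mor x = h \<cdot> mor y"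
    if "h \<in> Hom X Z" and [simp]: "arr x" "arr y" "dm x = X \<odot> ?A" "dm y = X \<odot> ?A" "cd x = X" "cd y = X" for h Z x y
  proof -
    let ?h = "mk X h Z"
    note [simp] = that(1)
    have "h \<cdot> mor (x \<bullet> Sy ?A X) = h \<cdot> mor (y \<bullet> Sy ?A X) \<longleftrightarrow> (?h \<bullet> x) \<bullet> Sy ?A X = (?h \<bullet> y) \<bullet> Sy ?A X"
      unfolding cmp_assoc by (auto intro!: arr_eqI dest: arg_cong[where f = mor])
    also have "\<dots> \<longleftrightarrow> ?h \<bullet> x = ?h \<bullet> y"
    proof
      assume "(?h \<bullet> x) \<bullet> Sy ?A X = (?h \<bullet> y) \<bullet> Sy ?A X"
      then have "((?h \<bullet> x) \<bullet> Sy ?A X) \<bullet> Sy X ?A = ((?h \<bullet> y) \<bullet> Sy ?A X) \<bullet> Sy X ?A" by simp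
      then show "?h \<bullet> x = ?h \<bullet> y" by (simp add: cmp_assoc)
    qed simp
    also have "\<dots> \<longleftrightarrow> h \<cdot> mor x = h \<cdot> mor y" by (auto intro!: arr_eqI dest: arg_cong[where f = mor])
    finally show ?thesis .
  qed
  have hh: "mor (ar \<bullet> Sy ?A X) \<in> Hom (?A \<odot> X) X" "mor (?tr \<bullet> Sy ?A X) \<in> Hom (?A \<odot> X) X"
    "mor ar \<in> Hom (X \<odot> ?A) X" "mor ?tr \<in> Hom (X \<odot> ?A) X"
    using mor_hom[of "ar \<bullet> Sy ?A X"] mor_hom[of "?tr \<bullet> Sy ?A X"] mor_hom[of ar] mor_hom[of ?tr] by simp_all
  have ccs: "h \<cdot> mor (ar \<bullet> Sy ?A X) = h \<cdot> mor (?tr \<bullet> Sy ?A X) \<longleftrightarrow> h \<cdot> mor ar = h \<cdot> mor ?tr"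
    if "h \<in> Hom X Z" for h Z using cc[OF that, of ar ?tr] by simp
  have al: "\<alpha> = mor ar" by simp
  show "left_stabilized \<C> A \<beta> X Q p \<longleftrightarrow> right_stabilized \<C> A \<alpha> X Q p"
    unfolding left_stabilized_def right_stabilized_def is_coequalizer_def tl tr b unfolding al
    using hh ccs by blast
qed

lemma integral_imp_small:
  assumes coeq: "has_coequalizers \<C>" and A: "bc_hopf_monoid \<C> A" and s: "nint A \<sigma>"
  shows "small \<C> A"
  unfolding small_def
proof (intro conjI allI impI)
  show "bimonoid \<C> A" using A by simp
  fix \<alpha> X
  { assume la: "left_action \<C> A \<alpha> X"
    note L = small_left[OF coeq s la]
    show "\<exists>I i. left_invariant \<C> A \<alpha> X I i" "\<exists>Q p. left_stabilized \<C> A \<alpha> X Q p"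
      using L by blast+
    fix I i Q p
    show "left_invariant \<C> A \<alpha> X I i \<and> left_stabilized \<C> A \<alpha> X Q p \<Longrightarrow> iso_arr \<C> I Q (p \<cdot> i)" using L by blast }
  assume ra: "right_action \<C> A \<alpha> X"
  note L = small_left[OF coeq s right_as_left(1)[OF A ra], unfolded right_as_left(2,3)[OF A ra]]
  show "\<exists>I i. right_invariant \<C> A \<alpha> X I i" "\<exists>Q p. right_stabilized \<C> A \<alpha> X Q p"
    using L by blast+
  fix I i Q p
  show "right_invariant \<C> A \<alpha> X I i \<and> right_stabilized \<C> A \<alpha> X Q p \<Longrightarrow> iso_arr \<C> I Q (p \<cdot> i)" using L by blast
qed

section \<open>Duality\<close>

text \<open>
  The cointegral equations with the unit isomorphisms moved to the other side, which is the form dual to that of the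
  equations for integrals.
\<close>

lemma ncoint_alt:
  assumes [simp]: "bimonoid \<C> A" "arr \<phi>" "dm \<phi> = und A" "cd \<phi> = \<one>"
  shows "ncoint A \<phi> \<longleftrightarrow> (\<phi> \<star> Id (und A)) \<bullet> De A = (\<phi> \<star> Et A) \<bullet> Ru' (und A) \<and>
     (Id (und A) \<star> \<phi>) \<bullet> De A = (Et A \<star> \<phi>) \<bullet> Lu' (und A) \<and> \<phi> \<bullet> Et A = Id \<one>"
proof -
  let ?A = "und A"
  have "(\<phi> \<star> Et A) \<bullet> Ru' ?A = (Id \<one> \<star> Et A) \<bullet> (\<phi> \<star> Id \<one>) \<bullet> Ru' ?A" by (simp add: tns_cmp2)
  also have "\<dots> = (Id \<one> \<star> Et A) \<bullet> Ru' \<one> \<bullet> \<phi>" by (simp add: Ru'_nat)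
  also have "\<dots> = Lu' ?A \<bullet> Et A \<bullet> \<phi>" unfolding Lu'_Ru'[symmetric] using Lu'_nat[of "Et A" ?A, THEN cmp_eq_assoc, of \<phi>] by (simp add: cmp_assoc)
  finally have 1: "(\<phi> \<star> Et A) \<bullet> Ru' ?A = Lu' ?A \<bullet> Et A \<bullet> \<phi>" .
  have "(Et A \<star> \<phi>) \<bullet> Lu' ?A = (Et A \<star> Id \<one>) \<bullet> (Id \<one> \<star> \<phi>) \<bullet> Lu' ?A" by (simp add: tns_cmp2)
  also have "\<dots> = (Et A \<star> Id \<one>) \<bullet> Lu' \<one> \<bullet> \<phi>" by (simp add: Lu'_nat)
  also have "\<dots> = Ru' ?A \<bullet> Et A \<bullet> \<phi>" unfolding Lu'_Ru' using Ru'_nat[of "Et A" ?A, THEN cmp_eq_assoc, of \<phi>] by (simp add: cmp_assoc)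
  finally have 2: "(Et A \<star> \<phi>) \<bullet> Lu' ?A = Ru' ?A \<bullet> Et A \<bullet> \<phi>" .
  have l: "Lu ?A \<bullet> x = y \<longleftrightarrow> x = Lu' ?A \<bullet> y" if [simp]: "arr x" "arr y" "cd x = \<one> \<odot> ?A" "cd y = ?A" for x y
    by (metis struct_inv2(3,4) Id_cmp that bim_arr(1) assms(1))
  have r: "Ru ?A \<bullet> x = y \<longleftrightarrow> x = Ru' ?A \<bullet> y" if [simp]: "arr x" "arr y" "cd x = ?A \<odot> \<one>" "cd y = ?A" for x y
    by (metis struct_inv2(5,6) Id_cmp that bim_arr(1) assms(1))
  show ?thesis unfolding ncoint_def 1 2 by (simp add: l r)
qed

interpretation op: symmetric_monoidal_category "op_smc \<C>" by (rule op_symmetric_monoidal_category)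

lemma op_nint:
  assumes A: "bimonoid \<C> (op_bimon A)" shows "op.nint A s \<longleftrightarrow> ncoint (op_bimon A) (rv s)"
proof (cases "arr (rv s) \<and> dm (rv s) = und A \<and> cd (rv s) = \<one>")
  case True
  then have [simp]: "arr (rv s)" "dm (rv s) = und A" "cd (rv s) = \<one>" by auto
  have "dm s = \<one>" "cd s = und A" using rv_sel[of "rv s"] by simp_all
  then show ?thesis
    unfolding op.nint_def ncoint_alt[OF A \<open>arr (rv s)\<close> \<open>dm (rv s) = und A\<close>[folded op_bimon_sel(1)[of A]] \<open>cd (rv s) = \<one>\<close>]
      op_struct op_cmp op_tns op_arr rv_rv rv_inject by (auto simp: op_smc_sel)
next
  case False
  have "\<not> op.nint A s"
  proof
    assume "op.nint A s"
    then have "arr (rv s)" "dm s = \<one>" "cd s = und A" unfolding op.nint_def op_arr by auto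
    then show False using False rv_sel(1,2)[of "rv s"] by simp
  qed
  moreover have "\<not> ncoint (op_bimon A) (rv s)" using False unfolding ncoint_def by auto
  ultimately show ?thesis by blast
qed

lemma op_bimonoid_hom: "bimonoid_hom (op_smc \<C>) A B f \<longleftrightarrow> bimonoid_hom \<C> (op_bimon B) (op_bimon A) f"
  unfolding bimonoid_hom_def op_bimonoid by auto

lemma op_bc_hopf: "bc_hopf_monoid (op_smc \<C>) A \<longleftrightarrow> bc_hopf_monoid \<C> (op_bimon A)"
proof (cases "bimonoid \<C> (op_bimon A)")
  case True
  then have A: "bimonoid (op_smc \<C>) A" unfolding op_bimonoid .
  have "is_antipode (op_smc \<C>) A S \<longleftrightarrow> is_antipode \<C> (op_bimon A) S" for S
  proof (cases "S \<in> Hom (und A) (und A)")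
    case S: True
    have D: "\<Delta>\<^bsub>op_bimon A\<^esub> \<in> Hom (und A) (und A \<odot> und A)" "\<nabla>\<^bsub>op_bimon A\<^esub> \<in> Hom (und A \<odot> und A) (und A)"
      using True unfolding bimonoid_def by auto
    have i: "ide (und A) \<in> Hom (und A) (und A)" using True ide_hom unfolding bimonoid_def by simp
    show ?thesis unfolding is_antipode_def
      using comp_assoc[OF D(1) tensor_hom[OF S i] D(2)] comp_assoc[OF D(1) tensor_hom[OF i S] D(2)] by simp
  qed (simp add: is_antipode_def)
  then have "is_antipode (op_smc \<C>) A = is_antipode \<C> (op_bimon A)" by (intro ext)
  moreover have "bicommutative (op_smc \<C>) A \<longleftrightarrow> bicommutative \<C> (op_bimon A)"
    unfolding bicommutative_def by auto
  ultimately show ?thesis unfolding bc_hopf_monoid_def hopf_monoid_def op_bimonoid by simp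
next
  case False
  then show ?thesis unfolding bc_hopf_monoid_def hopf_monoid_def op_bimonoid by simp
qed

lemma op_Hopf_bc: "Hopf_bc (op_smc \<C>) = dual_cat op_bimon (Hopf_bc \<C>)"
  unfolding Hopf_bc_def dual_cat_def op_bc_hopf op_bimonoid_hom by (auto simp: fun_eq_iff)

lemma op_left_action: "left_action (op_smc \<C>) A \<alpha> X \<longleftrightarrow> left_coaction \<C> (op_bimon A) \<alpha> X"
proof (cases "bimonoid \<C> (op_bimon A) \<and> X \<in> ob \<C> \<and> \<alpha> \<in> Hom X (und A \<odot> X)")
  case True
  let ?A = "und A" and ?B = "op_bimon A"
  have [simp]: "bimonoid \<C> ?B" "X \<in> ob \<C>" "\<alpha> \<in> Hom X (?A \<odot> X)" using True by auto
  have [simp]: "und A \<in> ob \<C>" using bim_arr(1)[of ?B] by simp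
  let ?a = "mk X \<alpha> (?A \<odot> X)"
  have D: "comul ?B \<in> Hom ?A (?A \<odot> ?A)" "coun ?B \<in> Hom ?A \<one>" using True unfolding bimonoid_def by auto
  have "mul A \<otimes> ide X \<cdot> \<alpha> = (assoc_inv \<C> ?A ?A X \<cdot> (ide ?A \<otimes> \<alpha>)) \<cdot> \<alpha> \<longleftrightarrow>
    (De ?B \<star> Id X) \<bullet> ?a = (As' ?A ?A X \<bullet> (Id ?A \<star> ?a)) \<bullet> ?a"
    by (auto intro!: arr_eqI dest: arg_cong[where f = mor])
  also have "\<dots> \<longleftrightarrow> As ?A ?A X \<bullet> (De ?B \<star> Id X) \<bullet> ?a = (Id ?A \<star> ?a) \<bullet> ?a"
  proof
    assume e: "(De ?B \<star> Id X) \<bullet> ?a = (As' ?A ?A X \<bullet> (Id ?A \<star> ?a)) \<bullet> ?a"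
    show "As ?A ?A X \<bullet> (De ?B \<star> Id X) \<bullet> ?a = (Id ?A \<star> ?a) \<bullet> ?a" unfolding e by (simp add: cmp_assoc)
  next
    assume e: "As ?A ?A X \<bullet> (De ?B \<star> Id X) \<bullet> ?a = (Id ?A \<star> ?a) \<bullet> ?a"
    show "(De ?B \<star> Id X) \<bullet> ?a = (As' ?A ?A X \<bullet> (Id ?A \<star> ?a)) \<bullet> ?a" unfolding cmp_assoc e[symmetric] by simp
  qed
  also have "\<dots> \<longleftrightarrow> \<a> ?A ?A X \<cdot> (mul A \<otimes> ide X) \<cdot> \<alpha> = (ide ?A \<otimes> \<alpha>) \<cdot> \<alpha>"
    by (auto intro!: arr_eqI dest: arg_cong[where f = mor])
  finally have 1: "mul A \<otimes> ide X \<cdot> \<alpha> = (assoc_inv \<C> ?A ?A X \<cdot> (ide ?A \<otimes> \<alpha>)) \<cdot> \<alpha> \<longleftrightarrow>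
     \<a> ?A ?A X \<cdot> (mul A \<otimes> ide X) \<cdot> \<alpha> = (ide ?A \<otimes> \<alpha>) \<cdot> \<alpha>" .
  have "uni A \<otimes> ide X \<cdot> \<alpha> = lunit_inv \<C> X \<longleftrightarrow> (Ep ?B \<star> Id X) \<bullet> ?a = Lu' X"
    by (auto intro!: arr_eqI dest: arg_cong[where f = mor])
  also have "\<dots> \<longleftrightarrow> Lu X \<bullet> (Ep ?B \<star> Id X) \<bullet> ?a = Id X"
  proof
    assume e: "(Ep ?B \<star> Id X) \<bullet> ?a = Lu' X"
    show "Lu X \<bullet> (Ep ?B \<star> Id X) \<bullet> ?a = Id X" unfolding e by simp
  next
    assume "Lu X \<bullet> (Ep ?B \<star> Id X) \<bullet> ?a = Id X"
    then have "Lu' X \<bullet> Lu X \<bullet> (Ep ?B \<star> Id X) \<bullet> ?a = Lu' X \<bullet> Id X" by simp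
    then show "(Ep ?B \<star> Id X) \<bullet> ?a = Lu' X" by simp
  qed
  also have "\<dots> \<longleftrightarrow> \<l> X \<cdot> (uni A \<otimes> ide X) \<cdot> \<alpha> = ide X"
    by (auto intro!: arr_eqI dest: arg_cong[where f = mor])
  finally have 2: "uni A \<otimes> ide X \<cdot> \<alpha> = lunit_inv \<C> X \<longleftrightarrow> \<l> X \<cdot> (uni A \<otimes> ide X) \<cdot> \<alpha> = ide X" .
  show ?thesis unfolding left_action_def left_coaction_def op_bimonoid using True 1 2 by simp
next
  case False
  then show ?thesis unfolding left_action_def left_coaction_def op_bimonoid by auto
qed

lemma op_right_action: "right_action (op_smc \<C>) A \<alpha> X \<longleftrightarrow> right_coaction \<C> (op_bimon A) \<alpha> X"
proof (cases "bimonoid \<C> (op_bimon A) \<and> X \<in> ob \<C> \<and> \<alpha> \<in> Hom X (X \<odot> und A)")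
  case True
  let ?A = "und A" and ?B = "op_bimon A"
  have [simp]: "bimonoid \<C> ?B" "X \<in> ob \<C>" "\<alpha> \<in> Hom X (X \<odot> ?A)" using True by auto
  have [simp]: "und A \<in> ob \<C>" using bim_arr(1)[of ?B] by simp
  let ?a = "mk X \<alpha> (X \<odot> ?A)"
  have D: "comul ?B \<in> Hom ?A (?A \<odot> ?A)" "coun ?B \<in> Hom ?A \<one>" using True unfolding bimonoid_def by auto
  have "\<alpha> \<otimes> ide ?A \<cdot> \<alpha> = (assoc_inv \<C> X ?A ?A \<cdot> (ide X \<otimes> mul A)) \<cdot> \<alpha> \<longleftrightarrow>
    (?a \<star> Id ?A) \<bullet> ?a = (As' X ?A ?A \<bullet> (Id X \<star> De ?B)) \<bullet> ?a"
    by (auto intro!: arr_eqI dest: arg_cong[where f = mor])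
  also have "\<dots> \<longleftrightarrow> As X ?A ?A \<bullet> (?a \<star> Id ?A) \<bullet> ?a = (Id X \<star> De ?B) \<bullet> ?a"
  proof
    assume e: "(?a \<star> Id ?A) \<bullet> ?a = (As' X ?A ?A \<bullet> (Id X \<star> De ?B)) \<bullet> ?a"
    show "As X ?A ?A \<bullet> (?a \<star> Id ?A) \<bullet> ?a = (Id X \<star> De ?B) \<bullet> ?a" unfolding e by (simp add: cmp_assoc)
  next
    assume e: "As X ?A ?A \<bullet> (?a \<star> Id ?A) \<bullet> ?a = (Id X \<star> De ?B) \<bullet> ?a"
    show "(?a \<star> Id ?A) \<bullet> ?a = (As' X ?A ?A \<bullet> (Id X \<star> De ?B)) \<bullet> ?a" unfolding cmp_assoc e[symmetric] by simp
  qed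
  also have "\<dots> \<longleftrightarrow> \<a> X ?A ?A \<cdot> (\<alpha> \<otimes> ide ?A) \<cdot> \<alpha> = (ide X \<otimes> mul A) \<cdot> \<alpha>"
    by (auto intro!: arr_eqI dest: arg_cong[where f = mor])
  finally have 1: "\<alpha> \<otimes> ide ?A \<cdot> \<alpha> = (assoc_inv \<C> X ?A ?A \<cdot> (ide X \<otimes> mul A)) \<cdot> \<alpha> \<longleftrightarrow>
     \<a> X ?A ?A \<cdot> (\<alpha> \<otimes> ide ?A) \<cdot> \<alpha> = (ide X \<otimes> mul A) \<cdot> \<alpha>" .
  have "ide X \<otimes> uni A \<cdot> \<alpha> = runit_inv \<C> X \<longleftrightarrow> (Id X \<star> Ep ?B) \<bullet> ?a = Ru' X"
    by (auto intro!: arr_eqI dest: arg_cong[where f = mor])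
  also have "\<dots> \<longleftrightarrow> Ru X \<bullet> (Id X \<star> Ep ?B) \<bullet> ?a = Id X"
  proof
    assume e: "(Id X \<star> Ep ?B) \<bullet> ?a = Ru' X"
    show "Ru X \<bullet> (Id X \<star> Ep ?B) \<bullet> ?a = Id X" unfolding e by simp
  next
    assume "Ru X \<bullet> (Id X \<star> Ep ?B) \<bullet> ?a = Id X"
    then have "Ru' X \<bullet> Ru X \<bullet> (Id X \<star> Ep ?B) \<bullet> ?a = Ru' X \<bullet> Id X" by simp
    then show "(Id X \<star> Ep ?B) \<bullet> ?a = Ru' X" by simp
  qed
  also have "\<dots> \<longleftrightarrow> \<r> X \<cdot> (ide X \<otimes> uni A) \<cdot> \<alpha> = ide X"
    by (auto intro!: arr_eqI dest: arg_cong[where f = mor])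
  finally have 2: "ide X \<otimes> uni A \<cdot> \<alpha> = runit_inv \<C> X \<longleftrightarrow> \<r> X \<cdot> (ide X \<otimes> uni A) \<cdot> \<alpha> = ide X" .
  show ?thesis unfolding right_action_def right_coaction_def op_bimonoid using True 1 2 by simp
next
  case False
  then show ?thesis unfolding right_action_def right_coaction_def op_bimonoid by auto
qed

lemma op_stabilized:
  "left_stabilized (op_smc \<C>) A \<alpha> X Q p \<longleftrightarrow> left_costabilized \<C> (op_bimon A) \<alpha> X Q p"
  "right_stabilized (op_smc \<C>) A \<alpha> X Q p \<longleftrightarrow> right_costabilized \<C> (op_bimon A) \<alpha> X Q p"
  unfolding left_stabilized_def left_costabilized_def right_stabilized_def right_costabilized_def op_coequalizer
    trivial_left_action_def trivial_left_coaction_def trivial_right_action_def trivial_right_coaction_def by simp_all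

lemma op_invariant:
  "left_invariant (op_smc \<C>) A \<alpha> X Q p \<longleftrightarrow> left_coinvariant \<C> (op_bimon A) \<alpha> X Q p"
  "right_invariant (op_smc \<C>) A \<alpha> X Q p \<longleftrightarrow> right_coinvariant \<C> (op_bimon A) \<alpha> X Q p"
  unfolding left_invariant_def left_coinvariant_def right_invariant_def right_coinvariant_def
    left_invariant_arr_def left_coinvariant_arr_def right_invariant_arr_def right_coinvariant_arr_def by simp_all

lemma op_small: "small (op_smc \<C>) A \<longleftrightarrow> cosmall \<C> (op_bimon A)"
  unfolding small_def cosmall_def op_bimonoid op_left_action op_right_action op_stabilized op_invariant op_iso_arr
  by simp

lemma op_has_coequalizers: "has_coequalizers (op_smc \<C>) \<longleftrightarrow> has_equalizers \<C>"
  and op_has_equalizers: "has_equalizers (op_smc \<C>) \<longleftrightarrow> has_coequalizers \<C>"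
  unfolding has_coequalizers_def has_equalizers_def op_coequalizer op_equalizer by auto

end


context symmetric_monoidal_category
begin

interpretation op: symmetric_monoidal_category "op_smc \<C>" by (rule op_symmetric_monoidal_category)

lemma op_left_coaction: "left_coaction (op_smc \<C>) A \<beta> Y \<longleftrightarrow> left_action \<C> (op_bimon A) \<beta> Y"
proof (cases "bimonoid \<C> (op_bimon A) \<and> Y \<in> ob \<C> \<and> \<beta> \<in> Hom (und A \<odot> Y) Y")
  case True
  let ?A = "und A" and ?B = "op_bimon A"
  have [simp]: "bimonoid \<C> ?B" "Y \<in> ob \<C>" "\<beta> \<in> Hom (?A \<odot> Y) Y" using True by auto
  have [simp]: "und A \<in> ob \<C>" using bim_arr(1)[of ?B] by simp
  let ?b = "mk (?A \<odot> Y) \<beta> Y"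
  have D: "mul ?B \<in> Hom (?A \<odot> ?A) ?A" "uni ?B \<in> Hom \<one> ?A" using True unfolding bimonoid_def by auto
  have "(\<beta> \<cdot> (comul A \<otimes> ide Y)) \<cdot> assoc_inv \<C> ?A ?A Y = \<beta> \<cdot> (ide ?A \<otimes> \<beta>) \<longleftrightarrow>
    (?b \<bullet> (Mu ?B \<star> Id Y)) \<bullet> As' ?A ?A Y = ?b \<bullet> (Id ?A \<star> ?b)"
  proof
    assume "(?b \<bullet> (Mu ?B \<star> Id Y)) \<bullet> As' ?A ?A Y = ?b \<bullet> (Id ?A \<star> ?b)"
    from mor_eq[OF this] show "(\<beta> \<cdot> (comul A \<otimes> ide Y)) \<cdot> assoc_inv \<C> ?A ?A Y = \<beta> \<cdot> (ide ?A \<otimes> \<beta>)" by simp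
  qed (rule arr_eqI; simp)
  also have "\<dots> \<longleftrightarrow> ?b \<bullet> (Mu ?B \<star> Id Y) = ?b \<bullet> (Id ?A \<star> ?b) \<bullet> As ?A ?A Y"
  proof
    assume e: "(?b \<bullet> (Mu ?B \<star> Id Y)) \<bullet> As' ?A ?A Y = ?b \<bullet> (Id ?A \<star> ?b)"
    have "?b \<bullet> (Mu ?B \<star> Id Y) = ((?b \<bullet> (Mu ?B \<star> Id Y)) \<bullet> As' ?A ?A Y) \<bullet> As ?A ?A Y" by (simp add: cmp_assoc)
    then show "?b \<bullet> (Mu ?B \<star> Id Y) = ?b \<bullet> (Id ?A \<star> ?b) \<bullet> As ?A ?A Y" unfolding e by (simp add: cmp_assoc)
  next
    assume e: "?b \<bullet> (Mu ?B \<star> Id Y) = ?b \<bullet> (Id ?A \<star> ?b) \<bullet> As ?A ?A Y"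
    show "(?b \<bullet> (Mu ?B \<star> Id Y)) \<bullet> As' ?A ?A Y = ?b \<bullet> (Id ?A \<star> ?b)" unfolding e by (simp add: cmp_assoc)
  qed
  also have "\<dots> \<longleftrightarrow> \<beta> \<cdot> (comul A \<otimes> ide Y) = \<beta> \<cdot> (ide ?A \<otimes> \<beta>) \<cdot> \<a> ?A ?A Y"
    by (auto intro!: arr_eqI dest: arg_cong[where f = mor])
  finally have 1: "(\<beta> \<cdot> (comul A \<otimes> ide Y)) \<cdot> assoc_inv \<C> ?A ?A Y = \<beta> \<cdot> (ide ?A \<otimes> \<beta>) \<longleftrightarrow>
    \<beta> \<cdot> (comul A \<otimes> ide Y) = \<beta> \<cdot> (ide ?A \<otimes> \<beta>) \<cdot> \<a> ?A ?A Y" .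
  have "(\<beta> \<cdot> (coun A \<otimes> ide Y)) \<cdot> lunit_inv \<C> Y = ide Y \<longleftrightarrow> (?b \<bullet> (Et ?B \<star> Id Y)) \<bullet> Lu' Y = Id Y"
  proof
    assume "(?b \<bullet> (Et ?B \<star> Id Y)) \<bullet> Lu' Y = Id Y"
    from mor_eq[OF this] show "(\<beta> \<cdot> (coun A \<otimes> ide Y)) \<cdot> lunit_inv \<C> Y = ide Y" by simp
  qed (rule arr_eqI; simp)
  also have "\<dots> \<longleftrightarrow> ?b \<bullet> (Et ?B \<star> Id Y) = Lu Y"
  proof
    assume "(?b \<bullet> (Et ?B \<star> Id Y)) \<bullet> Lu' Y = Id Y"
    then have "((?b \<bullet> (Et ?B \<star> Id Y)) \<bullet> Lu' Y) \<bullet> Lu Y = Id Y \<bullet> Lu Y" by simp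
    then show "?b \<bullet> (Et ?B \<star> Id Y) = Lu Y" by (simp add: cmp_assoc)
  next
    assume e: "?b \<bullet> (Et ?B \<star> Id Y) = Lu Y"
    show "(?b \<bullet> (Et ?B \<star> Id Y)) \<bullet> Lu' Y = Id Y" unfolding e by simp
  qed
  also have "\<dots> \<longleftrightarrow> \<beta> \<cdot> (coun A \<otimes> ide Y) = \<l> Y"
    by (auto intro!: arr_eqI dest: arg_cong[where f = mor])
  finally have 2: "(\<beta> \<cdot> (coun A \<otimes> ide Y)) \<cdot> lunit_inv \<C> Y = ide Y \<longleftrightarrow> \<beta> \<cdot> (coun A \<otimes> ide Y) = \<l> Y" .
  show ?thesis unfolding left_action_def left_coaction_def op_bimonoid using True 1 2 by auto
next
  case False
  then show ?thesis unfolding left_action_def left_coaction_def op_bimonoid by auto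
qed

lemma op_right_coaction: "right_coaction (op_smc \<C>) A \<beta> Y \<longleftrightarrow> right_action \<C> (op_bimon A) \<beta> Y"
proof (cases "bimonoid \<C> (op_bimon A) \<and> Y \<in> ob \<C> \<and> \<beta> \<in> Hom (Y \<odot> und A) Y")
  case True
  let ?A = "und A" and ?B = "op_bimon A"
  have [simp]: "bimonoid \<C> ?B" "Y \<in> ob \<C>" "\<beta> \<in> Hom (Y \<odot> ?A) Y" using True by auto
  have [simp]: "und A \<in> ob \<C>" using bim_arr(1)[of ?B] by simp
  let ?b = "mk (Y \<odot> ?A) \<beta> Y"
  have D: "mul ?B \<in> Hom (?A \<odot> ?A) ?A" "uni ?B \<in> Hom \<one> ?A" using True unfolding bimonoid_def by auto
  have "(\<beta> \<cdot> (\<beta> \<otimes> ide ?A)) \<cdot> assoc_inv \<C> Y ?A ?A = \<beta> \<cdot> (ide Y \<otimes> comul A) \<longleftrightarrow>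
    (?b \<bullet> (?b \<star> Id ?A)) \<bullet> As' Y ?A ?A = ?b \<bullet> (Id Y \<star> Mu ?B)"
  proof
    assume "(?b \<bullet> (?b \<star> Id ?A)) \<bullet> As' Y ?A ?A = ?b \<bullet> (Id Y \<star> Mu ?B)"
    from mor_eq[OF this] show "(\<beta> \<cdot> (\<beta> \<otimes> ide ?A)) \<cdot> assoc_inv \<C> Y ?A ?A = \<beta> \<cdot> (ide Y \<otimes> comul A)" by simp
  qed (rule arr_eqI; simp)
  also have "\<dots> \<longleftrightarrow> ?b \<bullet> (?b \<star> Id ?A) = ?b \<bullet> (Id Y \<star> Mu ?B) \<bullet> As Y ?A ?A"
  proof
    assume e: "(?b \<bullet> (?b \<star> Id ?A)) \<bullet> As' Y ?A ?A = ?b \<bullet> (Id Y \<star> Mu ?B)"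
    have "?b \<bullet> (?b \<star> Id ?A) = ((?b \<bullet> (?b \<star> Id ?A)) \<bullet> As' Y ?A ?A) \<bullet> As Y ?A ?A" by (simp add: cmp_assoc)
    then show "?b \<bullet> (?b \<star> Id ?A) = ?b \<bullet> (Id Y \<star> Mu ?B) \<bullet> As Y ?A ?A" unfolding e by (simp add: cmp_assoc)
  next
    assume e: "?b \<bullet> (?b \<star> Id ?A) = ?b \<bullet> (Id Y \<star> Mu ?B) \<bullet> As Y ?A ?A"
    show "(?b \<bullet> (?b \<star> Id ?A)) \<bullet> As' Y ?A ?A = ?b \<bullet> (Id Y \<star> Mu ?B)" unfolding e by (simp add: cmp_assoc)
  qed
  also have "\<dots> \<longleftrightarrow> \<beta> \<cdot> (\<beta> \<otimes> ide ?A) = \<beta> \<cdot> (ide Y \<otimes> comul A) \<cdot> \<a> Y ?A ?A"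
    by (auto intro!: arr_eqI dest: arg_cong[where f = mor])
  finally have 1: "(\<beta> \<cdot> (\<beta> \<otimes> ide ?A)) \<cdot> assoc_inv \<C> Y ?A ?A = \<beta> \<cdot> (ide Y \<otimes> comul A) \<longleftrightarrow>
    \<beta> \<cdot> (\<beta> \<otimes> ide ?A) = \<beta> \<cdot> (ide Y \<otimes> comul A) \<cdot> \<a> Y ?A ?A" .
  have "(\<beta> \<cdot> (ide Y \<otimes> coun A)) \<cdot> runit_inv \<C> Y = ide Y \<longleftrightarrow> (?b \<bullet> (Id Y \<star> Et ?B)) \<bullet> Ru' Y = Id Y"
  proof
    assume "(?b \<bullet> (Id Y \<star> Et ?B)) \<bullet> Ru' Y = Id Y"
    from mor_eq[OF this] show "(\<beta> \<cdot> (ide Y \<otimes> coun A)) \<cdot> runit_inv \<C> Y = ide Y" by simp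
  qed (rule arr_eqI; simp)
  also have "\<dots> \<longleftrightarrow> ?b \<bullet> (Id Y \<star> Et ?B) = Ru Y"
  proof
    assume "(?b \<bullet> (Id Y \<star> Et ?B)) \<bullet> Ru' Y = Id Y"
    then have "((?b \<bullet> (Id Y \<star> Et ?B)) \<bullet> Ru' Y) \<bullet> Ru Y = Id Y \<bullet> Ru Y" by simp
    then show "?b \<bullet> (Id Y \<star> Et ?B) = Ru Y" by (simp add: cmp_assoc)
  next
    assume e: "?b \<bullet> (Id Y \<star> Et ?B) = Ru Y"
    show "(?b \<bullet> (Id Y \<star> Et ?B)) \<bullet> Ru' Y = Id Y" unfolding e by simp
  qed
  also have "\<dots> \<longleftrightarrow> \<beta> \<cdot> (ide Y \<otimes> coun A) = \<r> Y"
    by (auto intro!: arr_eqI dest: arg_cong[where f = mor])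
  finally have 2: "(\<beta> \<cdot> (ide Y \<otimes> coun A)) \<cdot> runit_inv \<C> Y = ide Y \<longleftrightarrow> \<beta> \<cdot> (ide Y \<otimes> coun A) = \<r> Y" .
  show ?thesis unfolding right_action_def right_coaction_def op_bimonoid using True 1 2 by auto
next
  case False
  then show ?thesis unfolding right_action_def right_coaction_def op_bimonoid by auto
qed

lemma op_costabilized:
  "Y \<in> ob \<C> \<Longrightarrow> left_costabilized (op_smc \<C>) A \<beta> Y Q p \<longleftrightarrow> left_stabilized \<C> (op_bimon A) \<beta> Y Q p"
  "Y \<in> ob \<C> \<Longrightarrow> right_costabilized (op_smc \<C>) A \<beta> Y Q p \<longleftrightarrow> right_stabilized \<C> (op_bimon A) \<beta> Y Q p"
  unfolding left_stabilized_def left_costabilized_def right_stabilized_def right_costabilized_def op_equalizer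
    trivial_left_action_def trivial_left_coaction_def trivial_right_action_def trivial_right_coaction_def
  by (simp_all add: op_lunit_inv op_runit_inv)

lemma stabilized_cong:
  "und A = und B \<Longrightarrow> coun A = coun B \<Longrightarrow> left_stabilized \<C> A = left_stabilized \<C> B"
  "und A = und B \<Longrightarrow> coun A = coun B \<Longrightarrow> right_stabilized \<C> A = right_stabilized \<C> B"
  "und A = und B \<Longrightarrow> uni A = uni B \<Longrightarrow> left_costabilized \<C> A = left_costabilized \<C> B"
  "und A = und B \<Longrightarrow> uni A = uni B \<Longrightarrow> right_costabilized \<C> A = right_costabilized \<C> B"
  by (intro ext, simp add: left_stabilized_def right_stabilized_def left_costabilized_def right_costabilized_def
    trivial_left_action_def trivial_right_action_def trivial_left_coaction_def trivial_right_coaction_def)+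

lemma op_tensor_bimon:
  "und (op_bimon (tensor_bimon (op_smc \<C>) A B)) = und (tensor_bimon \<C> (op_bimon A) (op_bimon B))"
  "uni (op_bimon (tensor_bimon (op_smc \<C>) A B)) = uni (tensor_bimon \<C> (op_bimon A) (op_bimon B))"
  "coun (op_bimon (tensor_bimon (op_smc \<C>) A B)) = coun (tensor_bimon \<C> (op_bimon A) (op_bimon B))"
  unfolding tensor_bimon_def by (simp_all add: op_lunit_inv)

lemma op_tensor_action:
  assumes "und A \<in> ob \<C>" "und A' \<in> ob \<C>" "X \<in> ob \<C>" "X' \<in> ob \<C>"
  shows "tensor_left_action (op_smc \<C>) A \<alpha> X A' \<alpha>' X' = tensor_left_coaction \<C> (op_bimon A) \<alpha> X (op_bimon A') \<alpha>' X'"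
    "tensor_right_action (op_smc \<C>) A \<alpha> X A' \<alpha>' X' = tensor_right_coaction \<C> (op_bimon A) \<alpha> X (op_bimon A') \<alpha>' X'"
    "tensor_left_coaction (op_smc \<C>) A \<alpha> X A' \<alpha>' X' = tensor_left_action \<C> (op_bimon A) \<alpha> X (op_bimon A') \<alpha>' X'"
    "tensor_right_coaction (op_smc \<C>) A \<alpha> X A' \<alpha>' X' = tensor_right_action \<C> (op_bimon A) \<alpha> X (op_bimon A') \<alpha>' X'"
  unfolding tensor_left_action_def tensor_left_coaction_def tensor_right_action_def tensor_right_coaction_def
  using assms by (simp_all add: op_interchange)

lemma op_stable: assumes "costable \<C>" shows "stable (op_smc \<C>)"
  unfolding stable_def
proof (intro conjI allI impI)
  fix A A' :: "('o, 'm) bimon" and \<alpha> X \<alpha>' X' Q p Q' p' T t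
  { assume h: "left_action (op_smc \<C>) A \<alpha> X \<and> left_action (op_smc \<C>) A' \<alpha>' X' \<and>
      left_stabilized (op_smc \<C>) A \<alpha> X Q p \<and> left_stabilized (op_smc \<C>) A' \<alpha>' X' Q' p' \<and>
      left_stabilized (op_smc \<C>) (tensor_bimon (op_smc \<C>) A A')
        (tensor_left_action (op_smc \<C>) A \<alpha> X A' \<alpha>' X') (tensor_ob (op_smc \<C>) X X') T t"
    have o: "und A \<in> ob \<C>" "und A' \<in> ob \<C>" "X \<in> ob \<C>" "X' \<in> ob \<C>"
      using h bim_arr(1)[of "op_bimon A"] bim_arr(1)[of "op_bimon A'"] unfolding left_action_def op_bimonoid by auto
    have "left_coaction \<C> (op_bimon A) \<alpha> X \<and> left_coaction \<C> (op_bimon A') \<alpha>' X' \<and>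
      left_costabilized \<C> (op_bimon A) \<alpha> X Q p \<and> left_costabilized \<C> (op_bimon A') \<alpha>' X' Q' p' \<and>
      left_costabilized \<C> (tensor_bimon \<C> (op_bimon A) (op_bimon A'))
        (tensor_left_coaction \<C> (op_bimon A) \<alpha> X (op_bimon A') \<alpha>' X') (X \<odot> X') T t"
      using h unfolding op_left_action op_stabilized op_tensor_action[OF o]
      unfolding stabilized_cong(3)[OF op_tensor_bimon(1,2)] by simp
    then show "\<exists>c. iso_arr (op_smc \<C>) T (tensor_ob (op_smc \<C>) Q Q') c \<and> comp (op_smc \<C>) c t = tensor (op_smc \<C>) p p'"
      using assms unfolding costable_def op_iso_arr by simp }
  assume h: "right_action (op_smc \<C>) A \<alpha> X \<and> right_action (op_smc \<C>) A' \<alpha>' X' \<and>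
      right_stabilized (op_smc \<C>) A \<alpha> X Q p \<and> right_stabilized (op_smc \<C>) A' \<alpha>' X' Q' p' \<and>
      right_stabilized (op_smc \<C>) (tensor_bimon (op_smc \<C>) A A')
        (tensor_right_action (op_smc \<C>) A \<alpha> X A' \<alpha>' X') (tensor_ob (op_smc \<C>) X X') T t"
  have o: "und A \<in> ob \<C>" "und A' \<in> ob \<C>" "X \<in> ob \<C>" "X' \<in> ob \<C>"
    using h bim_arr(1)[of "op_bimon A"] bim_arr(1)[of "op_bimon A'"] unfolding right_action_def op_bimonoid by auto
  have "right_coaction \<C> (op_bimon A) \<alpha> X \<and> right_coaction \<C> (op_bimon A') \<alpha>' X' \<and>
      right_costabilized \<C> (op_bimon A) \<alpha> X Q p \<and> right_costabilized \<C> (op_bimon A') \<alpha>' X' Q' p' \<and>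
      right_costabilized \<C> (tensor_bimon \<C> (op_bimon A) (op_bimon A'))
        (tensor_right_coaction \<C> (op_bimon A) \<alpha> X (op_bimon A') \<alpha>' X') (X \<odot> X') T t"
    using h unfolding op_right_action op_stabilized op_tensor_action[OF o]
    unfolding stabilized_cong(4)[OF op_tensor_bimon(1,2)] by simp
  then show "\<exists>c. iso_arr (op_smc \<C>) T (tensor_ob (op_smc \<C>) Q Q') c \<and> comp (op_smc \<C>) c t = tensor (op_smc \<C>) p p'"
    using assms unfolding costable_def op_iso_arr by simp
qed

lemma op_costable: assumes "stable \<C>" shows "costable (op_smc \<C>)"
  unfolding costable_def
proof (intro conjI allI impI)
  fix A A' :: "('o, 'm) bimon" and \<alpha> X \<alpha>' X' Q p Q' p' T t
  { assume h: "left_coaction (op_smc \<C>) A \<alpha> X \<and> left_coaction (op_smc \<C>) A' \<alpha>' X' \<and>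
      left_costabilized (op_smc \<C>) A \<alpha> X Q p \<and> left_costabilized (op_smc \<C>) A' \<alpha>' X' Q' p' \<and>
      left_costabilized (op_smc \<C>) (tensor_bimon (op_smc \<C>) A A')
        (tensor_left_coaction (op_smc \<C>) A \<alpha> X A' \<alpha>' X') (tensor_ob (op_smc \<C>) X X') T t"
    have o: "und A \<in> ob \<C>" "und A' \<in> ob \<C>" "X \<in> ob \<C>" "X' \<in> ob \<C>"
      using h bim_arr(1)[of "op_bimon A"] bim_arr(1)[of "op_bimon A'"] unfolding left_coaction_def op_bimonoid by auto
    have o2: "tensor_ob (op_smc \<C>) X X' \<in> ob \<C>" using o by simp
    have "left_action \<C> (op_bimon A) \<alpha> X \<and> left_action \<C> (op_bimon A') \<alpha>' X' \<and>
      left_stabilized \<C> (op_bimon A) \<alpha> X Q p \<and> left_stabilized \<C> (op_bimon A') \<alpha>' X' Q' p' \<and>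
      left_stabilized \<C> (tensor_bimon \<C> (op_bimon A) (op_bimon A'))
        (tensor_left_action \<C> (op_bimon A) \<alpha> X (op_bimon A') \<alpha>' X') (X \<odot> X') T t"
      using h unfolding op_left_coaction op_costabilized(1)[OF o(3)] op_costabilized(1)[OF o(4)] op_costabilized(1)[OF o2] op_tensor_action[OF o]
      unfolding stabilized_cong(1)[OF op_tensor_bimon(1,3)] by simp
    then show "\<exists>c. iso_arr (op_smc \<C>) (tensor_ob (op_smc \<C>) Q Q') T c \<and> comp (op_smc \<C>) t c = tensor (op_smc \<C>) p p'"
      using assms unfolding stable_def op_iso_arr by simp }
  assume h: "right_coaction (op_smc \<C>) A \<alpha> X \<and> right_coaction (op_smc \<C>) A' \<alpha>' X' \<and>
      right_costabilized (op_smc \<C>) A \<alpha> X Q p \<and> right_costabilized (op_smc \<C>) A' \<alpha>' X' Q' p' \<and>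
      right_costabilized (op_smc \<C>) (tensor_bimon (op_smc \<C>) A A')
        (tensor_right_coaction (op_smc \<C>) A \<alpha> X A' \<alpha>' X') (tensor_ob (op_smc \<C>) X X') T t"
  have o: "und A \<in> ob \<C>" "und A' \<in> ob \<C>" "X \<in> ob \<C>" "X' \<in> ob \<C>"
    using h bim_arr(1)[of "op_bimon A"] bim_arr(1)[of "op_bimon A'"] unfolding right_coaction_def op_bimonoid by auto
  have o2: "tensor_ob (op_smc \<C>) X X' \<in> ob \<C>" using o by simp
  have "right_action \<C> (op_bimon A) \<alpha> X \<and> right_action \<C> (op_bimon A') \<alpha>' X' \<and>
      right_stabilized \<C> (op_bimon A) \<alpha> X Q p \<and> right_stabilized \<C> (op_bimon A') \<alpha>' X' Q' p' \<and>
      right_stabilized \<C> (tensor_bimon \<C> (op_bimon A) (op_bimon A'))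
        (tensor_right_action \<C> (op_bimon A) \<alpha> X (op_bimon A') \<alpha>' X') (X \<odot> X') T t"
    using h unfolding op_right_coaction op_costabilized(2)[OF o(3)] op_costabilized(2)[OF o(4)] op_costabilized(2)[OF o2] op_tensor_action[OF o]
    unfolding stabilized_cong(2)[OF op_tensor_bimon(1,3)] by simp
  then show "\<exists>c. iso_arr (op_smc \<C>) (tensor_ob (op_smc \<C>) Q Q') T c \<and> comp (op_smc \<C>) t c = tensor (op_smc \<C>) p p'"
    using assms unfolding stable_def op_iso_arr by simp
qed

lemma op_bhom: "op.bhom A B f \<longleftrightarrow> bhom (op_bimon B) (op_bimon A) (rv f)"
proof -
  have 1: "op.bhom A B (mk (und A) g (und B)) \<longleftrightarrow> bhom (op_bimon B) (op_bimon A) (rv (mk (und A) g (und B)))" for g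
    unfolding op.bhom_mk op_bimonoid_hom rv_mk using bhom_mk[of "op_bimon B" "op_bimon A" g] by simp
  show ?thesis
  proof (cases "op.bhom A B f")
    case True
    then have "f = mk (und A) (mor f) (und B)" using op.mk_mor op.bhom_simps(3-5) by metis
    then show ?thesis using 1[of "mor f"] by simp
  next
    case False
    have "\<not> bhom (op_bimon B) (op_bimon A) (rv f)"
    proof
      assume b: "bhom (op_bimon B) (op_bimon A) (rv f)"
      then have "rv f = mk (und B) (mor (rv f)) (und A)" using mk_mor bhom_simps(3-5)[OF b] by (metis op_bimon_sel(1))
      then have "f = mk (und A) (mor (rv f)) (und B)" by (metis rv_mk rv_rv)
      then show False using 1[of "mor (rv f)"] b False by simp
    qed
    then show ?thesis using False by blast
  qed
qed

end

context hopf_setting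
begin

text \<open>
  The self-duality of the hypotheses turns results about cokernels, integrals and translations into results about
  kernels, cointegrals and contractions.
\<close>

lemma op_hopf_setting: "hopf_setting (op_smc \<C>)"
proof -
  interpret op: symmetric_monoidal_category "op_smc \<C>" by (rule op_symmetric_monoidal_category)
  show ?thesis
  proof unfold_locales
    show "has_equalizers (op_smc \<C>)" "has_coequalizers (op_smc \<C>)"
      unfolding op_has_equalizers op_has_coequalizers by (rule coequalizers equalizers)+
    show "bistable (op_smc \<C>)" using bistability op_stable op_costable unfolding bistable_def by blast
    show "abelian_category (Hopf_bc (op_smc \<C>))" unfolding op_Hopf_bc
      by (rule dual_abelian[OF op_bimon_op_bimon Hopf_abelian])
  qed
qed

end


section \<open>Integrals along homomorphisms\<close>

context symmetric_monoidal_category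
begin

definition ltrans :: "('o, 'm) bimon \<Rightarrow> ('o, 'm) arrow \<Rightarrow> ('o, 'm) arrow" where
  "ltrans A a = Mu A \<bullet> (a \<star> Id (und A)) \<bullet> Lu' (und A)"

text \<open>Contraction of the comultiplication with a functional, \<open>a \<mapsto> \<phi>(a\<^sub>1) a\<^sub>2\<close>; this is \<open>ltrans\<close> in the opposite category.\<close>

definition contr :: "('o, 'm) bimon \<Rightarrow> ('o, 'm) arrow \<Rightarrow> ('o, 'm) arrow" where
  "contr A \<phi> = Lu (und A) \<bullet> (\<phi> \<star> Id (und A)) \<bullet> De A"

lemma ltrans_sel [simp]:
  assumes "bimonoid \<C> A" "arr a" "dm a = \<one>" "cd a = und A"
  shows "arr (ltrans A a)" "dm (ltrans A a) = und A" "cd (ltrans A a) = und A"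
  using assms by (auto simp: ltrans_def)

lemma contr_sel [simp]:
  assumes "bimonoid \<C> A" "arr a" "dm a = und A" "cd a = \<one>"
  shows "arr (contr A a)" "dm (contr A a) = und A" "cd (contr A a) = und A"
  using assms by (auto simp: contr_def)

definition right_int :: "('o, 'm) bimon \<Rightarrow> ('o, 'm) bimon \<Rightarrow> ('o, 'm) arrow \<Rightarrow> ('o, 'm) arrow \<Rightarrow> bool" where
  "right_int A B \<xi> \<mu> \<longleftrightarrow> arr \<mu> \<and> dm \<mu> = und B \<and> cd \<mu> = und A \<and>
     Mu A \<bullet> (\<mu> \<star> Id (und A)) = \<mu> \<bullet> Mu B \<bullet> (Id (und B) \<star> \<xi>) \<and>
     (\<mu> \<star> Id (und B)) \<bullet> De B = (Id (und A) \<star> \<xi>) \<bullet> De A \<bullet> \<mu>"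

lemma right_int_simps [simp]:
  "right_int A B \<xi> \<mu> \<Longrightarrow> arr \<mu>" "right_int A B \<xi> \<mu> \<Longrightarrow> dm \<mu> = und B" "right_int A B \<xi> \<mu> \<Longrightarrow> cd \<mu> = und A"
  by (auto simp: right_int_def)

lemma right_int_eqs:
  assumes "right_int A B \<xi> \<mu>"
  shows "Mu A \<bullet> (\<mu> \<star> Id (und A)) = \<mu> \<bullet> Mu B \<bullet> (Id (und B) \<star> \<xi>)"
    "(\<mu> \<star> Id (und B)) \<bullet> De B = (Id (und A) \<star> \<xi>) \<bullet> De A \<bullet> \<mu>"
  using assms unfolding right_int_def by blast+

lemma right_int_cmp:
  assumes f: "bhom A J x" and g: "bhom J B m" and s: "right_int A J x s" and r: "right_int J B m r"
  shows "right_int A B (m \<bullet> x) (s \<bullet> r)"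
proof -
  note [simp] = bhom_simps[OF f] bhom_simps[OF g] right_int_simps[OF s] right_int_simps[OF r]
  have "Mu A \<bullet> ((s \<bullet> r) \<star> Id (und A)) = (Mu A \<bullet> (s \<star> Id (und A))) \<bullet> (r \<star> Id (und A))"
    by (simp add: cmp_assoc tns_cmp)
  also have "\<dots> = s \<bullet> (Mu J \<bullet> (r \<star> Id (und J))) \<bullet> (Id (und B) \<star> x)"
    unfolding right_int_eqs(1)[OF s] by (simp add: cmp_assoc tns_cmp)
  also have "\<dots> = (s \<bullet> r) \<bullet> Mu B \<bullet> (Id (und B) \<star> (m \<bullet> x))"
    unfolding right_int_eqs(1)[OF r] by (simp add: cmp_assoc tns_cmp)
  finally have 1: "Mu A \<bullet> ((s \<bullet> r) \<star> Id (und A)) = (s \<bullet> r) \<bullet> Mu B \<bullet> (Id (und B) \<star> (m \<bullet> x))" .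
  have "((s \<bullet> r) \<star> Id (und B)) \<bullet> De B = (s \<star> Id (und B)) \<bullet> (r \<star> Id (und B)) \<bullet> De B"
    by (simp add: tns_cmp2)
  also have "\<dots> = (Id (und A) \<star> m) \<bullet> ((s \<star> Id (und J)) \<bullet> De J) \<bullet> r"
    unfolding right_int_eqs(2)[OF r] by (simp add: cmp_assoc tns_cmp2)
  also have "\<dots> = (Id (und A) \<star> (m \<bullet> x)) \<bullet> De A \<bullet> (s \<bullet> r)"
    unfolding right_int_eqs(2)[OF s] by (simp add: cmp_assoc tns_cmp2)
  finally show ?thesis unfolding right_int_def using 1 by simp
qed

lemma ltrans_Mu:
  assumes [simp]: "bimonoid \<C> A" "arr a" "dm a = \<one>" "cd a = und A"
  shows "Mu A \<bullet> (ltrans A a \<star> Id (und A)) = ltrans A a \<bullet> Mu A"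
proof -
  let ?A = "und A"
  have "Mu A \<bullet> (ltrans A a \<star> Id ?A) = (Mu A \<bullet> (Mu A \<star> Id ?A)) \<bullet> ((a \<star> Id ?A) \<star> Id ?A) \<bullet> (Lu' ?A \<star> Id ?A)"
    by (simp add: ltrans_def cmp_assoc tns_cmp)
  also have "\<dots> = Mu A \<bullet> (Id ?A \<star> Mu A) \<bullet> (As ?A ?A ?A \<bullet> ((a \<star> Id ?A) \<star> Id ?A)) \<bullet> (Lu' ?A \<star> Id ?A)"
    by (simp add: Mu_assoc cmp_assoc)
  also have "\<dots> = Mu A \<bullet> (a \<star> Mu A) \<bullet> (As \<one> ?A ?A \<bullet> (Lu' ?A \<star> Id ?A))"
    by (simp add: As_nat cmp_assoc tns_cmp2)
  also have "\<dots> = Mu A \<bullet> (a \<star> Id ?A) \<bullet> (Id \<one> \<star> Mu A) \<bullet> Lu' (?A \<odot> ?A)"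
    unfolding As'_Lu'[OF bim_arr(1)[OF assms(1)] bim_arr(1)[OF assms(1)]] by (simp add: tns_cmp2)
  also have "\<dots> = ltrans A a \<bullet> Mu A" by (simp add: ltrans_def Lu'_nat cmp_assoc)
  finally show ?thesis .
qed

lemma act_Lu': "bhom K A k \<Longrightarrow> arr s \<Longrightarrow> dm s = \<one> \<Longrightarrow> cd s = und K \<Longrightarrow>
    act A k \<bullet> (s \<star> Id (und A)) \<bullet> Lu' (und A) = ltrans A (k \<bullet> s)"
  by (simp add: act_def ltrans_def cmp_assoc tns_cmp2)

lemma hom_ltrans: "bhom A B f \<Longrightarrow> arr a \<Longrightarrow> dm a = \<one> \<Longrightarrow> cd a = und A \<Longrightarrow> f \<bullet> ltrans A a = ltrans B (f \<bullet> a) \<bullet> f"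
  by (simp add: ltrans_def cmp_assoc cmp_eq_assoc[OF bhom_eqs(1)] tns_cmp2 Lu'_nat)

lemma ltrans_scalar: assumes [simp]: "bimonoid \<C> A" "scal c" shows "ltrans A (Et A \<bullet> c) = sc c (Id (und A))"
proof -
  have "ltrans A (Et A \<bullet> c) = (Mu A \<bullet> (Et A \<star> Id (und A))) \<bullet> (c \<star> Id (und A)) \<bullet> Lu' (und A)"
    by (simp add: ltrans_def cmp_assoc tns_cmp2)
  then show ?thesis by (simp add: Mu_Et sc_def)
qed

text \<open>
  In elements, \<open>k(\<sigma>) k(y) a = k(\<sigma> y) a = \<epsilon>(y) k(\<sigma>) a\<close>.  This will also
  be applied to an integral whose counit is a scalar yet to be inverted.
\<close>

lemma ltrans_act:
  assumes k: "bhom K A k" and [simp]: "arr \<sigma>" "dm \<sigma> = \<one>" "cd \<sigma> = und K"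
    and e: "Mu K \<bullet> (\<sigma> \<star> Id (und K)) = Ru (und K) \<bullet> (\<sigma> \<star> Ep K)"
  shows "ltrans A (k \<bullet> \<sigma>) \<bullet> act A k = ltrans A (k \<bullet> \<sigma>) \<bullet> triv K (und A)"
proof -
  let ?A = "und A" and ?K = "und K"
  note [simp] = k bhom_simps[OF k]
  have "ltrans A (k \<bullet> \<sigma>) \<bullet> act A k = (ltrans A (k \<bullet> \<sigma>) \<bullet> Mu A) \<bullet> (k \<star> Id ?A)" by (simp add: act_def cmp_assoc)
  also have "\<dots> = Mu A \<bullet> ((ltrans A (k \<bullet> \<sigma>) \<bullet> k) \<star> Id ?A)" by (simp add: ltrans_Mu[symmetric] cmp_assoc tns_cmp)
  also have "ltrans A (k \<bullet> \<sigma>) \<bullet> k = k \<bullet> ltrans K \<sigma>" by (simp add: hom_ltrans[OF k])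
  also have "ltrans K \<sigma> = (Mu K \<bullet> (\<sigma> \<star> Id ?K)) \<bullet> Lu' ?K" by (simp add: ltrans_def cmp_assoc)
  also have "\<dots> = Ru ?K \<bullet> (\<sigma> \<star> Id \<one>) \<bullet> (Id \<one> \<star> Ep K) \<bullet> Lu' ?K"
    unfolding e by (simp add: cmp_assoc tns_cmp2)
  also have "\<dots> = \<sigma> \<bullet> Ep K"
    by (simp add: cmp_eq_assoc[OF Ru_nat] cmp_eq_assoc[OF Lu_nat] cmp_assoc Lu_Ru[symmetric])
  also have "Mu A \<bullet> ((k \<bullet> \<sigma> \<bullet> Ep K) \<star> Id ?A) = Mu A \<bullet> ((k \<bullet> \<sigma>) \<star> Id ?A) \<bullet> Lu' ?A \<bullet> Lu ?A \<bullet> (Ep K \<star> Id ?A)"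
    by (simp add: tns_cmp cmp_assoc)
  finally show ?thesis by (simp add: ltrans_def triv_def cmp_assoc)
qed

text \<open>The evaluation of \<open>comul_act_invariant\<close> at an integral.\<close>

lemma comul_ltrans:
  assumes k: "bhom K A k" and s: "nint K \<sigma>" and [simp]: "arr h" "dm h = und A"
    and inv: "h \<bullet> act A k = h \<bullet> triv K (und A)"
  shows "(Id (und A) \<star> h) \<bullet> De A \<bullet> ltrans A (k \<bullet> \<sigma>) = (ltrans A (k \<bullet> \<sigma>) \<star> h) \<bullet> De A"
proof -
  let ?A = "und A" and ?K = "und K"
  note [simp] = k bhom_simps[OF k] nint_simps[OF s]
  have "(Id ?A \<star> h) \<bullet> De A \<bullet> ltrans A (k \<bullet> \<sigma>) = ((Id ?A \<star> h) \<bullet> De A \<bullet> act A k) \<bullet> (\<sigma> \<star> Id ?A) \<bullet> Lu' ?A"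
    by (simp add: act_Lu'[OF k, of \<sigma>, symmetric] cmp_assoc)
  also have "\<dots> = (act A k \<star> h) \<bullet> (As' ?K ?A ?A \<bullet> (\<sigma> \<star> (Id ?A \<star> Id ?A))) \<bullet> (Id \<one> \<star> De A) \<bullet> Lu' ?A"
    unfolding comul_act_invariant[OF k assms(3,4) inv] by (simp add: cmp_assoc tns_cmp tns_cmp2)
  also have "\<dots> = (act A k \<star> h) \<bullet> ((\<sigma> \<star> Id ?A) \<star> Id ?A) \<bullet> (As' \<one> ?A ?A \<bullet> Lu' (?A \<odot> ?A)) \<bullet> De A"
    by (simp add: As'_nat Lu'_nat cmp_assoc del: Id_tns_Id)
  also have "As' \<one> ?A ?A \<bullet> Lu' (?A \<odot> ?A) = Lu' ?A \<star> Id ?A"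
    unfolding As'_Lu'[OF bim_arr(1) bim_arr(1), of A A, simplified, symmetric] by simp
  also have "(act A k \<star> h) \<bullet> ((\<sigma> \<star> Id ?A) \<star> Id ?A) \<bullet> (Lu' ?A \<star> Id ?A) \<bullet> De A = (ltrans A (k \<bullet> \<sigma>) \<star> h) \<bullet> De A"
    by (simp add: act_Lu'[OF k, of \<sigma>, symmetric] tns_cmp2 cmp_assoc)
  finally show ?thesis .
qed

text \<open>In elements, \<open>k(\<sigma>) \<mu>(b) = \<mu>(b) k(\<sigma>) = \<mu>(b \<xi>k(\<sigma>)) = \<mu>(b)\<close>, as \<open>\<xi> \<circ> k\<close> is trivial.\<close>

lemma ltrans_right_int:
  assumes A: "bc_hopf_monoid \<C> A" and x: "bhom A B \<xi>" and k: "bhom K A k" and z: "\<xi> \<bullet> k = Et B \<bullet> Ep K"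
    and m: "right_int A B \<xi> \<mu>" and [simp]: "arr \<sigma>" "dm \<sigma> = \<one>" "cd \<sigma> = und K" "Ep K \<bullet> \<sigma> = Id \<one>"
  shows "ltrans A (k \<bullet> \<sigma>) \<bullet> \<mu> = \<mu>"
proof -
  let ?A = "und A" and ?B = "und B"
  note [simp] = bhom_simps[OF x] bhom_simps[OF k] right_int_simps[OF m]
  have xks: "\<xi> \<bullet> k \<bullet> \<sigma> = Et B" using cmp_eq_assoc[OF z, of \<sigma>] by (simp add: cmp_assoc)
  have "ltrans A (k \<bullet> \<sigma>) \<bullet> \<mu> = Mu A \<bullet> ((k \<bullet> \<sigma>) \<star> \<mu>) \<bullet> Lu' ?B"
    by (simp add: ltrans_def cmp_assoc Lu'_nat tns_cmp2)
  also have "\<dots> = (Mu A \<bullet> Sy ?A ?A) \<bullet> ((k \<bullet> \<sigma>) \<star> \<mu>) \<bullet> Lu' ?B" by (simp add: Mu_Sy[OF A])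
  also have "\<dots> = Mu A \<bullet> (\<mu> \<star> (k \<bullet> \<sigma>)) \<bullet> Sy \<one> ?B \<bullet> Lu' ?B"
    using Sy_nat[of "k \<bullet> \<sigma>" \<mu> ?A ?A, THEN cmp_eq_assoc, of "Lu' ?B"] by (simp add: cmp_assoc)
  also have "\<dots> = (Mu A \<bullet> (\<mu> \<star> Id ?A)) \<bullet> (Id ?B \<star> (k \<bullet> \<sigma>)) \<bullet> Ru' ?B" by (simp add: Sy_Lu' tns_cmp2 cmp_assoc)
  also have "\<dots> = \<mu> \<bullet> Mu B \<bullet> (Id ?B \<star> Et B) \<bullet> Ru' ?B"
    unfolding right_int_eqs(1)[OF m] by (simp add: cmp_assoc tns_cmp2 xks)
  also have "\<dots> = \<mu>" by (simp add: cmp_eq_assoc[OF Mu_Et(2)])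
  finally show ?thesis .
qed

lemma nint_image:
  assumes P: "bc_hopf_monoid \<C> P" and p: "bhom A P p" and t: "tepi p" and s: "nint A \<sigma>"
  shows "nint P (p \<bullet> \<sigma>)"
proof -
  let ?A = "und A" and ?P = "und P"
  note [simp] = bhom_simps[OF p] nint_simps[OF s]
  have "(Mu P \<bullet> ((p \<bullet> \<sigma>) \<star> Id ?P)) \<bullet> (Id \<one> \<star> p) = p \<bullet> Mu A \<bullet> (\<sigma> \<star> Id ?A)"
    using bhom_eqs(1)[OF p, THEN cmp_eq_assoc, of "\<sigma> \<star> Id ?A"] by (simp add: cmp_assoc tns_cmp tns_cmp2)
  also have "\<dots> = p \<bullet> Ru ?A \<bullet> (\<sigma> \<star> Id \<one>) \<bullet> (Id \<one> \<star> Ep A)" by (simp add: nint_eqs(1)[OF s] tns_cmp)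
  also have "\<dots> = (Ru ?P \<bullet> ((p \<bullet> \<sigma>) \<star> Ep P)) \<bullet> (Id \<one> \<star> p)"
    using Ru_nat[of p ?P, THEN cmp_eq_assoc, of "\<sigma> \<star> Ep A"] by (simp add: cmp_assoc tns_cmp bhom_eqs(4)[OF p])
  finally have "Mu P \<bullet> ((p \<bullet> \<sigma>) \<star> Id ?P) = Ru ?P \<bullet> ((p \<bullet> \<sigma>) \<star> Ep P)"
    by (rule tepi_epi) (simp_all add: tepi_Id_tns t)
  moreover have "Ep P \<bullet> p \<bullet> \<sigma> = Id \<one>" by (simp add: cmp_eq_assoc[OF bhom_eqs(4)[OF p]])
  ultimately show ?thesis by (intro nintI[OF P]) simp_all
qed

interpretation op: symmetric_monoidal_category "op_smc \<C>" by (rule op_symmetric_monoidal_category)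

lemma op_ltrans: "op.ltrans A a = rv (contr (op_bimon A) (rv a))" if "und A \<in> ob \<C>"
  using that by (simp add: op.ltrans_def contr_def op_cmp op_tns op_struct op_struct' cmp_assoc)

lemma op_right_int: "op.right_int A B \<xi> \<mu> \<longleftrightarrow> right_int (op_bimon B) (op_bimon A) (rv \<xi>) (rv \<mu>)"
proof (cases "arr (rv \<mu>)")
  case True
  have [simp]: "dm \<mu> = cd (rv \<mu>)" "cd \<mu> = dm (rv \<mu>)" using rv_sel[OF True] by simp_all
  show ?thesis unfolding op.right_int_def right_int_def op_cmp op_tns op_struct op_arr rv_rv rv_inject
    by (auto simp: cmp_assoc)
next
  case False
  then show ?thesis unfolding op.right_int_def right_int_def op_arr by blast
qed

end

context hopf_setting
begin

interpretation op: hopf_setting "op_smc \<C>" by (rule op_hopf_setting)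

lemma op_bch: "op.bch A B f \<longleftrightarrow> bch (op_bimon B) (op_bimon A) (rv f)"
  unfolding op.bch_def bch_def op_bhom op_bc_hopf by blast

lemma op_bch_mor: "op.bch A B f \<Longrightarrow> mor (rv f) = mor f"
  using op.bch_simps(6)[of A B f] op_arr rv_sel(3)[of "rv f"] by simp

lemma op_kern: "op.kern A B f K k \<longleftrightarrow> coker (op_bimon B) (op_bimon A) (rv f) (op_bimon K) (rv k)"
  and op_coker: "op.coker A B f K k \<longleftrightarrow> kern (op_bimon B) (op_bimon A) (rv f) (op_bimon K) (rv k)"
  using op_bch_mor[of A B f] op_bch_mor[of K A k] op_bch_mor[of B K k]
  unfolding op.kern_def coker_def op.coker_def kern_def op_bch[symmetric] op_Hopf_bc
    dual_kernel[OF op_bimon_op_bimon] dual_cokernel[OF op_bimon_op_bimon] by auto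

text \<open>
  Translation by \<open>k(\<sigma>)\<close> cannot see the action of \<open>K\<close>, so it factors through the quotient \<open>p\<close>; since \<open>p\<close> in turn cannot
  see this translation, the second factor is a section.
\<close>

lemma integral_section:
  assumes c: "coker K A k P p" and s: "nint K \<sigma>"
  obtains s where "right_int A P p s" "p \<bullet> s = Id (und P)" "s \<bullet> p = ltrans A (k \<bullet> \<sigma>)"
proof -
  note bk = coker_bch(1)[OF c] and bp = coker_bch(2)[OF c]
  note [simp] = bch_simps[OF bk] bch_simps[OF bp] nint_simps[OF s]
  let ?A = "und A" and ?P = "und P" and ?L = "ltrans A (k \<bullet> \<sigma>)"
  have k: "bhom K A k" and p: "bhom A P p" by simp_all
  note t = coker_tepi[OF c]
  obtain s where [simp]: "arr s" "dm s = ?P" "cd s = ?A" and sp: "s \<bullet> p = ?L"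
    using coker_quotient_factor[OF c _ _ ltrans_act[OF k nint_simps(1-3)[OF s] nint_eqs(1)[OF s]]] by auto
  have pks: "p \<bullet> k \<bullet> \<sigma> = Et P \<bullet> Id \<one>" using cmp_eq_assoc[OF coker_zero[OF c], of \<sigma>] by (simp add: cmp_assoc)
  have "(p \<bullet> s) \<bullet> p = p \<bullet> ?L" by (simp add: cmp_assoc sp)
  also have "\<dots> = Id ?P \<bullet> p" using ltrans_scalar[of P "Id \<one>"] by (simp add: hom_ltrans[OF p] pks)
  finally have ps: "p \<bullet> s = Id ?P" by (rule tepi_epi) (simp_all add: t)
  have "(Mu A \<bullet> (s \<star> Id ?A)) \<bullet> (p \<star> Id ?A) = ?L \<bullet> Mu A" by (simp add: cmp_assoc tns_cmp sp ltrans_Mu)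
  also have "\<dots> = s \<bullet> p \<bullet> Mu A" by (simp add: sp[symmetric] cmp_assoc)
  also have "\<dots> = (s \<bullet> Mu P \<bullet> (Id ?P \<star> p)) \<bullet> (p \<star> Id ?A)"
    by (simp add: bhom_eqs(1)[OF p] cmp_assoc tns_cmp)
  finally have 1: "Mu A \<bullet> (s \<star> Id ?A) = s \<bullet> Mu P \<bullet> (Id ?P \<star> p)"
    by (rule tepi_epi) (simp_all add: t tepi_tns_Id)
  have "((s \<star> Id ?P) \<bullet> De P) \<bullet> p = (?L \<star> p) \<bullet> De A"
    by (simp add: cmp_assoc bhom_eqs(3)[OF p] tns_cmp2 sp)
  also have "\<dots> = ((Id ?A \<star> p) \<bullet> De A \<bullet> s) \<bullet> p" by (simp add: comul_ltrans[OF k s _ _ t(2), symmetric] cmp_assoc sp)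
  finally have 2: "(s \<star> Id ?P) \<bullet> De P = (Id ?A \<star> p) \<bullet> De A \<bullet> s" by (rule tepi_epi) (simp_all add: t)
  show ?thesis by (rule that[of s]) (simp_all add: right_int_def 1 2 ps sp)
qed

end


context hopf_setting
begin

definition unit_volume :: "('o, 'm) bimon \<Rightarrow> ('o, 'm) arrow \<Rightarrow> ('o, 'm) arrow \<Rightarrow> bool" where
  "unit_volume A \<sigma> \<phi> \<longleftrightarrow> bc_hopf_monoid \<C> A \<and> nint A \<sigma> \<and> ncoint A \<phi> \<and> inv_scal (\<phi> \<bullet> \<sigma>)"

end

context hopf_setting
begin

interpretation op: hopf_setting "op_smc \<C>" by (rule op_hopf_setting)

lemma op_ncoint:
  assumes "bimonoid \<C> A" shows "op.nint (op_bimon A) (rv \<phi>) \<longleftrightarrow> ncoint A \<phi>"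
  using op_nint[of "op_bimon A" "rv \<phi>"] assms by simp

lemma ncoint_unique:
  assumes "bimonoid \<C> A" "ncoint A \<phi>" "ncoint A \<psi>" shows "\<phi> = \<psi>"
  using op.nint_unique[of "op_bimon A" "rv \<phi>" "rv \<psi>"] assms op_ncoint[OF assms(1)] unfolding op_bimonoid by simp

lemma cointegral_of_eq:
  assumes A: "bimonoid \<C> A" and s: "ncoint A \<phi>" shows "cointegral_of \<C> A = mor \<phi>"
  unfolding cointegral_of_def
proof (rule the_equality)
  show "is_cointegral \<C> A (mor \<phi>) \<and> mor \<phi> \<cdot> \<eta>\<^bsub>A\<^esub> = ide \<one>"
    unfolding ncoint_mk[OF A] ncoint_mk_mor[OF s] by (rule s)
  fix \<psi> assume "is_cointegral \<C> A \<psi> \<and> \<psi> \<cdot> \<eta>\<^bsub>A\<^esub> = ide \<one>"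
  then have "mk (und A) \<psi> \<one> = \<phi>" unfolding ncoint_mk[OF A] using ncoint_unique[OF A _ s] by blast
  then show "\<psi> = mor \<phi>" by (metis mk_sel(2))
qed

lemma cosmall_imp_cointegral: "bc_hopf_monoid \<C> A \<Longrightarrow> cosmall \<C> A \<Longrightarrow> \<exists>\<phi>. ncoint A \<phi>"
  using op.small_imp_integral[of "op_bimon A"] op_small[of "op_bimon A"] op_nint[of "op_bimon A"]
    op_bc_hopf[of "op_bimon A"] by auto

lemma cointegral_imp_cosmall: "bc_hopf_monoid \<C> A \<Longrightarrow> ncoint A \<phi> \<Longrightarrow> cosmall \<C> A"
  using op.integral_imp_small[of "op_bimon A" "rv \<phi>"] op_small[of "op_bimon A"] op_ncoint[of A \<phi>]
    op.coequalizers op_bc_hopf[of "op_bimon A"] by simp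


text \<open>
  Smallness amounts to the existence of a normalized integral and cosmallness to that of a normalized cointegral.  As
  these are unique, any choice of them computes the inverse volume.
\<close>

lemma unit_volume_iff:
  assumes A [simp]: "bc_hopf_monoid \<C> A"
  shows "bismall \<C> A \<and> inv_vol \<C> A \<in> Aut \<C> \<one> \<longleftrightarrow> (\<exists>\<sigma> \<phi>. unit_volume A \<sigma> \<phi>)"
proof -
  have *: "inv_vol \<C> A \<in> Aut \<C> \<one> \<longleftrightarrow> inv_scal (\<phi> \<bullet> \<sigma>)" if n: "nint A \<sigma>" "ncoint A \<phi>" for \<sigma> \<phi>
    unfolding inv_vol_def integral_of_eq[OF bc_bim[OF A] n(1)] cointegral_of_eq[OF bc_bim[OF A] n(2)] inv_scal_Aut
    using n by simp
  show ?thesis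
    using small_imp_integral[OF A] cosmall_imp_cointegral[OF A] integral_imp_small[OF coequalizers A]
      cointegral_imp_cosmall[OF A] * unfolding bismall_def unit_volume_def by (metis A)
qed

lemma op_nint':
  assumes A [simp]: "bimonoid \<C> A" shows "op.ncoint (op_bimon A) (rv \<sigma>) \<longleftrightarrow> nint A \<sigma>"
proof (cases "arr \<sigma> \<and> dm \<sigma> = \<one> \<and> cd \<sigma> = und A")
  case True
  then have [simp]: "arr \<sigma>" "dm \<sigma> = \<one>" "cd \<sigma> = und A" by auto
  have "op.ncoint (op_bimon A) (rv \<sigma>) \<longleftrightarrow> Mu A \<bullet> (\<sigma> \<star> Id (und A)) = Ru (und A) \<bullet> (\<sigma> \<star> Ep A) \<and>
     Mu A \<bullet> (Id (und A) \<star> \<sigma>) = Lu (und A) \<bullet> (Ep A \<star> \<sigma>) \<and> Ep A \<bullet> \<sigma> = Id \<one>"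
    by (subst op.ncoint_alt) (simp_all add: op_bimonoid op_arr op_cmp op_tns op_struct op_struct')
  then show ?thesis unfolding nint_def by simp
next
  case False
  have "\<not> op.ncoint (op_bimon A) (rv \<sigma>)"
  proof
    assume n: "op.ncoint (op_bimon A) (rv \<sigma>)"
    have a: "arr \<sigma>" using op.ncoint_simps(1)[OF n] by (simp add: op_arr)
    show False using False op.ncoint_simps(2,3)[OF n] a by simp
  qed
  then show ?thesis using False unfolding nint_def by blast
qed

lemma op_unit_volume: "op.unit_volume (op_bimon A) (rv \<phi>) (rv \<sigma>) \<longleftrightarrow> unit_volume A \<sigma> \<phi>"
proof (cases "bimonoid \<C> A \<and> nint A \<sigma> \<and> ncoint A \<phi>")
  case True
  then have [simp]: "bimonoid \<C> A" "nint A \<sigma>" "ncoint A \<phi>" by blast+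
  note [simp] = nint_simps[OF \<open>nint A \<sigma>\<close>] ncoint_simps[OF \<open>ncoint A \<phi>\<close>]
  have "Aut (op_smc \<C>) \<one> = Aut \<C> \<one>" by (simp add: Aut_def op_iso_arr)
  then have "op.inv_scal (op.cmp (rv \<sigma>) (rv \<phi>)) \<longleftrightarrow> inv_scal (\<phi> \<bullet> \<sigma>)"
    unfolding op.inv_scal_Aut inv_scal_Aut by (simp add: op_cmp op_arr)
  then show ?thesis unfolding op.unit_volume_def unit_volume_def by (simp add: op_bc_hopf op_ncoint op_nint')
next
  case False
  then show ?thesis unfolding op.unit_volume_def unit_volume_def op_bc_hopf op_bimon_op_bimon
    using op_ncoint op_nint' bc_bim by blast
qed

text \<open>The dual of \<open>integral_section\<close>.\<close>

lemma integral_retraction: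
  assumes c: "kern B Q q M m" and s: "ncoint Q \<phi>"
  obtains r where "right_int M B m r" "r \<bullet> m = Id (und M)" "m \<bullet> r = contr B (\<phi> \<bullet> q)"
proof -
  note [simp] = bch_simps[OF kern_bch(1)[OF c]] bch_simps[OF kern_bch(2)[OF c]] ncoint_simps[OF s]
  have "op.coker (op_bimon Q) (op_bimon B) (rv q) (op_bimon M) (rv m)" using c by (simp add: op_coker)
  moreover have "op.nint (op_bimon Q) (rv \<phi>)" using s by (simp add: op_ncoint)
  ultimately obtain s where "op.right_int (op_bimon B) (op_bimon M) (rv m) s" "op.cmp (rv m) s = op.Id (und (op_bimon M))"
    "op.cmp s (rv m) = op.ltrans (op_bimon B) (op.cmp (rv q) (rv \<phi>))"
    by (rule op.integral_section)
  then show ?thesis by (intro that[of "rv s"]) (simp_all add: op_right_int op_cmp op_struct op_ltrans)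
qed

text \<open>The dual of \<open>ltrans_right_int\<close>.\<close>

lemma right_int_contr:
  assumes B: "bc_hopf_monoid \<C> B" and x: "bhom A B \<xi>" and q: "bhom B Q q" and z: "q \<bullet> \<xi> = Et Q \<bullet> Ep A"
    and m: "right_int A B \<xi> \<mu>" and [simp]: "arr \<phi>" "dm \<phi> = und Q" "cd \<phi> = \<one>" "\<phi> \<bullet> Et Q = Id \<one>"
  shows "\<mu> \<bullet> contr B (\<phi> \<bullet> q) = \<mu>"
proof -
  note [simp] = bhom_simps[OF x] bhom_simps[OF q]
  have "op.cmp (op.ltrans (op_bimon B) (op.cmp (rv q) (rv \<phi>))) (rv \<mu>) = rv \<mu>"
    by (rule op.ltrans_right_int[of _ "op_bimon A" "rv \<xi>" "op_bimon Q"])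
      (use B x q m in \<open>simp_all add: op_bc_hopf op_bhom op_cmp op_struct op_right_int z op_arr rv_sel\<close>)
  then show ?thesis by (simp add: op_ltrans op_cmp)
qed

lemma ncoint_restrict:
  assumes c: "kern B Q q M m" and s: "ncoint B \<phi>" shows "ncoint M (\<phi> \<bullet> m)"
proof -
  note [simp] = bch_simps[OF kern_bch(1)[OF c]] bch_simps[OF kern_bch(2)[OF c]]
  have c': "op.coker (op_bimon Q) (op_bimon B) (rv q) (op_bimon M) (rv m)" using c by (simp add: op_coker)
  note [simp] = ncoint_simps[OF s]
  have "op.nint (op_bimon M) (op.cmp (rv m) (rv \<phi>))"
    by (rule op.nint_image[of _ "op_bimon B", OF _ _ op.coker_tepi(1)[OF c']]) (use s in \<open>simp_all add: op_bc_hopf op_bhom op_ncoint\<close>)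
  then show ?thesis using op_ncoint[of M "\<phi> \<bullet> m"] by (simp add: op_cmp)
qed

end


context symmetric_monoidal_category
begin

text \<open>The symmetry exchanges the two sets of equations, and bicommutative structure maps absorb it.\<close>

lemma left_right_integral:
  assumes A: "bc_hopf_monoid \<C> A" and B: "bc_hopf_monoid \<C> B"
    and [simp]: "arr \<xi>" "dm \<xi> = und A" "cd \<xi> = und B" "arr \<mu>" "dm \<mu> = und B" "cd \<mu> = und A"
  shows "Mu A \<bullet> (Id (und A) \<star> \<mu>) = \<mu> \<bullet> Mu B \<bullet> (\<xi> \<star> Id (und B)) \<and>
      (Id (und B) \<star> \<mu>) \<bullet> De B = (\<xi> \<star> Id (und A)) \<bullet> De A \<bullet> \<mu> \<longleftrightarrow> right_int A B \<xi> \<mu>"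
proof -
  let ?A = "und A" and ?B = "und B"
  note [simp] = bc_bim[OF A] bc_bim[OF B]
  have r: "x \<bullet> Sy ?A ?B = y \<bullet> Sy ?A ?B \<longleftrightarrow> x = y" if "dm x = ?B \<odot> ?A" "dm y = ?B \<odot> ?A" "arr x" "arr y" for x y
    using tepi_epi[of x "Sy ?A ?B" y] tepi_Sy[of ?A ?B] that by auto
  have l: "Sy ?A ?B \<bullet> x = Sy ?A ?B \<bullet> y \<longleftrightarrow> x = y" if "cd x = ?A \<odot> ?B" "cd y = ?A \<odot> ?B" "arr x" "arr y" for x y
  proof
    assume "Sy ?A ?B \<bullet> x = Sy ?A ?B \<bullet> y"
    then have "Sy ?B ?A \<bullet> Sy ?A ?B \<bullet> x = Sy ?B ?A \<bullet> Sy ?A ?B \<bullet> y" by simp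
    then show "x = y" using that by simp
  qed simp
  have "Mu A \<bullet> (Id ?A \<star> \<mu>) = (Mu A \<bullet> Sy ?A ?A) \<bullet> (Id ?A \<star> \<mu>)" by (simp add: Mu_Sy[OF A])
  also have "\<dots> = (Mu A \<bullet> (\<mu> \<star> Id ?A)) \<bullet> Sy ?A ?B" by (simp add: Sy_nat cmp_assoc)
  finally have 1: "Mu A \<bullet> (Id ?A \<star> \<mu>) = (Mu A \<bullet> (\<mu> \<star> Id ?A)) \<bullet> Sy ?A ?B" .
  have "\<mu> \<bullet> Mu B \<bullet> (\<xi> \<star> Id ?B) = \<mu> \<bullet> (Mu B \<bullet> Sy ?B ?B) \<bullet> (\<xi> \<star> Id ?B)" by (simp add: Mu_Sy[OF B])
  also have "\<dots> = (\<mu> \<bullet> Mu B \<bullet> (Id ?B \<star> \<xi>)) \<bullet> Sy ?A ?B" by (simp add: Sy_nat cmp_assoc)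
  finally have 2: "\<mu> \<bullet> Mu B \<bullet> (\<xi> \<star> Id ?B) = (\<mu> \<bullet> Mu B \<bullet> (Id ?B \<star> \<xi>)) \<bullet> Sy ?A ?B" .
  have "(Id ?B \<star> \<mu>) \<bullet> De B = (Id ?B \<star> \<mu>) \<bullet> (Sy ?B ?B \<bullet> De B)" by (simp add: Sy_De[OF B])
  also have "\<dots> = Sy ?A ?B \<bullet> (\<mu> \<star> Id ?B) \<bullet> De B"
    using Sy_nat[of \<mu> "Id ?B" ?A ?B, THEN cmp_eq_assoc, of "De B"] by (simp add: cmp_assoc)
  finally have 3: "(Id ?B \<star> \<mu>) \<bullet> De B = Sy ?A ?B \<bullet> (\<mu> \<star> Id ?B) \<bullet> De B" .
  have "(\<xi> \<star> Id ?A) \<bullet> De A \<bullet> \<mu> = (\<xi> \<star> Id ?A) \<bullet> (Sy ?A ?A \<bullet> De A) \<bullet> \<mu>" by (simp add: Sy_De[OF A])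
  also have "\<dots> = Sy ?A ?B \<bullet> (Id ?A \<star> \<xi>) \<bullet> De A \<bullet> \<mu>"
    using Sy_nat[of "Id ?A" \<xi> ?A ?B, THEN cmp_eq_assoc, of "De A \<bullet> \<mu>"] by (simp add: cmp_assoc)
  finally have 4: "(\<xi> \<star> Id ?A) \<bullet> De A \<bullet> \<mu> = Sy ?A ?B \<bullet> (Id ?A \<star> \<xi>) \<bullet> De A \<bullet> \<mu>" .
  show ?thesis unfolding 1 2 3 4 right_int_def
    using r[of "Mu A \<bullet> (\<mu> \<star> Id ?A)" "\<mu> \<bullet> Mu B \<bullet> (Id ?B \<star> \<xi>)"]
      l[of "(\<mu> \<star> Id ?B) \<bullet> De B" "(Id ?A \<star> \<xi>) \<bullet> De A \<bullet> \<mu>"] by auto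
qed

lemma integral_along_iff:
  assumes A: "bc_hopf_monoid \<C> A" and B: "bc_hopf_monoid \<C> B" and x: "bhom A B \<xi>"
  shows "right_integral_along \<C> A B (mor \<xi>) m \<longleftrightarrow> right_int A B \<xi> (mk (und B) m (und A))"
    "left_integral_along \<C> A B (mor \<xi>) m \<longleftrightarrow> right_int A B \<xi> (mk (und B) m (und A))"
proof -
  let ?m = "mk (und B) m (und A)"
  note [simp] = bhom_simps[OF x]
  have e: "a = b \<longleftrightarrow> mor a = mor b" if "arr a" "arr b" "dm a = dm b" "cd a = cd b" for a b :: "('o, 'm) arrow"
    using arr_eqI that by blast
  have "(right_integral_along \<C> A B (mor \<xi>) m \<longleftrightarrow> right_int A B \<xi> ?m) \<and>
    (left_integral_along \<C> A B (mor \<xi>) m \<longleftrightarrow> right_int A B \<xi> ?m)" if m: "m \<in> Hom (und B) (und A)"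
  proof -
    note [simp] = m
    show ?thesis
      using left_right_integral[OF A B bhom_simps(3-5)[OF x], of ?m]
      unfolding right_integral_along_def left_integral_along_def right_int_def by (simp add: e)
  qed
  then show "right_integral_along \<C> A B (mor \<xi>) m \<longleftrightarrow> right_int A B \<xi> ?m"
    "left_integral_along \<C> A B (mor \<xi>) m \<longleftrightarrow> right_int A B \<xi> ?m"
    unfolding right_integral_along_def left_integral_along_def right_int_def by auto
qed

end

context hopf_setting
begin

text \<open>
  The generator, together with the kernel, the cokernel and the (co)integrals from which it is built; these determine
  the scalar in the composition law.
\<close>

definition gen_int where
  "gen_int A B \<xi> K k \<sigma> Q q \<phi> \<mu> \<longleftrightarrow> kern A B \<xi> K k \<and> coker A B \<xi> Q q \<and> nint K \<sigma> \<and> ncoint Q \<phi> \<and>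
     right_int A B \<xi> \<mu> \<and> \<mu> \<bullet> \<xi> = ltrans A (k \<bullet> \<sigma>) \<and> \<xi> \<bullet> \<mu> = contr B (\<phi> \<bullet> q)"

lemma image_factor:
  assumes k: "kern A B \<xi> K k" and q: "coker A B \<xi> Q q"
  obtains J m x where "kern B Q q J m" "coker K A k J x" "m \<bullet> x = \<xi>"
proof -
  obtain J m where m: "kern B Q q J m" using kern_exists[OF coker_bch(2)[OF q]] by blast
  note [simp] = bch_simps[OF kern_bch(1)[OF k]] bch_simps[OF kern_bch(2)[OF k]]
    bch_simps[OF kern_bch(2)[OF m]] bch_simps[OF coker_bch(2)[OF q]]
  obtain x0 where x0: "x0 \<in> hom (Hopf_bc \<C>) A J" "mor m \<cdot> x0 = mor \<xi>" "is_cokernel (Hopf_bc \<C>) K A (mor k) J x0"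
    using H.image_factorization[of "mor \<xi>" A B K "mor k" Q "mor q" J "mor m"] bch_mor[OF kern_bch(1)[OF k]] k q m
    unfolding kern_def coker_def by auto
  define x where "x = mk (und A) x0 (und J)"
  have x: "coker K A k J x" using coker_mk[OF x0(3)] mk_und[OF kern_bch(2)[OF k]] unfolding x_def by simp
  note [simp] = bch_simps[OF coker_bch(2)[OF x]]
  have "mor x = x0" by (simp add: x_def)
  then have "m \<bullet> x = \<xi>" by (intro arr_eqI) (simp_all add: x0(2))
  then show ?thesis using that m x by blast
qed

text \<open>
  Compose a section \<open>s\<close> of the cokernel \<open>x\<close> of \<open>k\<close> with a retraction \<open>r\<close> of the kernel \<open>m\<close> of \<open>q\<close>, where
  \<open>\<xi> = m \<circ> x\<close>.
\<close>

lemma gen_int_exists: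
  assumes k: "kern A B \<xi> K k" and q: "coker A B \<xi> Q q" and s: "nint K \<sigma>" and f: "ncoint Q \<phi>"
  shows "\<exists>\<mu>. gen_int A B \<xi> K k \<sigma> Q q \<phi> \<mu>"
proof -
  obtain J m x where m: "kern B Q q J m" and x: "coker K A k J x" and mx: "m \<bullet> x = \<xi>" by (rule image_factor[OF k q])
  note [simp] = bch_simps[OF kern_bch(1)[OF k]] bch_simps[OF kern_bch(2)[OF k]] bch_simps[OF coker_bch(2)[OF x]]
    bch_simps[OF kern_bch(2)[OF m]] bch_simps[OF coker_bch(2)[OF q]]
  obtain s' where s': "right_int A J x s'" "x \<bullet> s' = Id (und J)" "s' \<bullet> x = ltrans A (k \<bullet> \<sigma>)" by (rule integral_section[OF x s])
  obtain r where r: "right_int J B m r" "r \<bullet> m = Id (und J)" "m \<bullet> r = contr B (\<phi> \<bullet> q)" by (rule integral_retraction[OF m f])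
  note [simp] = right_int_simps[OF s'(1)] right_int_simps[OF r(1)]
  have "right_int A B \<xi> (s' \<bullet> r)" unfolding mx[symmetric] by (rule right_int_cmp[of A J x B m]) (simp_all add: s' r)
  moreover have "(s' \<bullet> r) \<bullet> \<xi> = ltrans A (k \<bullet> \<sigma>)" "\<xi> \<bullet> (s' \<bullet> r) = contr B (\<phi> \<bullet> q)"
    unfolding mx[symmetric] by (simp_all add: cmp_assoc cmp_eq_assoc[OF r(2)] cmp_eq_assoc[OF s'(2)] s'(3) r(3))
  ultimately show ?thesis unfolding gen_int_def using assms by blast
qed

lemma gen_int_absorb:
  assumes g: "gen_int A B \<xi> K k \<sigma> Q q \<phi> \<mu>" and r: "right_int A B \<xi> \<nu>"
  shows "\<mu> \<bullet> \<xi> \<bullet> \<nu> = \<nu>" "\<nu> \<bullet> \<xi> \<bullet> \<mu> = \<nu>"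
proof -
  have k: "kern A B \<xi> K k" and q: "coker A B \<xi> Q q" and s: "nint K \<sigma>" and f: "ncoint Q \<phi>"
    and e: "\<mu> \<bullet> \<xi> = ltrans A (k \<bullet> \<sigma>)" "\<xi> \<bullet> \<mu> = contr B (\<phi> \<bullet> q)" using g unfolding gen_int_def by blast+
  note b = bch_simps[OF kern_bch(1)[OF k]] bch_simps[OF kern_bch(2)[OF k]] bch_simps[OF coker_bch(2)[OF q]]
  show "\<mu> \<bullet> \<xi> \<bullet> \<nu> = \<nu>" using cmp_eq_assoc[OF e(1)] ltrans_right_int[OF b(1,3,13) kern_zero[OF k] r nint_simps[OF s]] by simp
  show "\<nu> \<bullet> \<xi> \<bullet> \<mu> = \<nu>" unfolding e(2) by (rule right_int_contr[OF b(2,3,23) coker_zero[OF q] r ncoint_simps[OF f]])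
qed

text \<open>Two generators absorb each other, so that they coincide.\<close>

lemma gen_int_mor:
  assumes g: "gen_int A B \<xi> K k \<sigma> Q q \<phi> \<mu>"
  shows "normalized_generator \<C> A B (mor \<xi>) = mor \<mu>"
proof -
  have k: "kern A B \<xi> K k" and r: "right_int A B \<xi> \<mu>" and s: "nint K \<sigma>" and e: "\<mu> \<bullet> \<xi> = ltrans A (k \<bullet> \<sigma>)"
    using g unfolding gen_int_def by blast+
  note [simp] = bch_simps[OF kern_bch(1)[OF k]] bch_simps[OF kern_bch(2)[OF k]] right_int_simps[OF r] nint_simps[OF s]
  have i: "integral_along \<C> A B (mor \<xi>) m \<longleftrightarrow> right_int A B \<xi> (mk (und B) m (und A))"
    "left_integral_along \<C> A B (mor \<xi>) m \<or> right_integral_along \<C> A B (mor \<xi>) m \<longleftrightarrow> right_int A B \<xi> (mk (und B) m (und A))" for m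
    using integral_along_iff[of A B \<xi> m] unfolding integral_along_def by simp_all
  have mu: "mk (und B) (mor \<mu>) (und A) = \<mu>" using mk_mor[of \<mu>] by simp
  have ab: "mor \<mu> \<cdot> mor \<xi> \<cdot> m = m \<and> m \<cdot> mor \<xi> \<cdot> mor \<mu> = m" if rm: "right_int A B \<xi> (mk (und B) m (und A))" for m
    using mor_eq[OF gen_int_absorb(1)[OF g rm]] mor_eq[OF gen_int_absorb(2)[OF g rm]] right_int_simps(1)[OF rm] by simp
  have xks: "\<xi> \<bullet> k \<bullet> \<sigma> = Et B \<bullet> Id \<one>" using cmp_eq_assoc[OF kern_zero[OF k], of \<sigma>] by (simp add: cmp_assoc)
  have "\<xi> \<bullet> \<mu> \<bullet> \<xi> = \<xi>" unfolding e using ltrans_scalar[of B "Id \<one>"] by (simp add: hom_ltrans[of A B] xks)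
  from mor_eq[OF this] have n: "mor \<xi> \<cdot> mor \<mu> \<cdot> mor \<xi> = mor \<xi>" by simp
  show ?thesis unfolding normalized_generator_def generator_along_def normalized_along_def i
  proof (rule the_equality)
    show "(right_int A B \<xi> (mk (und B) (mor \<mu>) (und A)) \<and>
      (\<forall>\<mu>'. right_int A B \<xi> (mk (und B) \<mu>' (und A)) \<longrightarrow> mor \<mu> \<cdot> mor \<xi> \<cdot> \<mu>' = \<mu>' \<and> \<mu>' \<cdot> mor \<xi> \<cdot> mor \<mu> = \<mu>')) \<and>
      mor \<xi> \<cdot> mor \<mu> \<cdot> mor \<xi> = mor \<xi>" using ab n r unfolding mu by blast
    fix \<nu> assume h: "(right_int A B \<xi> (mk (und B) \<nu> (und A)) \<and>
      (\<forall>\<mu>'. right_int A B \<xi> (mk (und B) \<mu>' (und A)) \<longrightarrow> \<nu> \<cdot> mor \<xi> \<cdot> \<mu>' = \<mu>' \<and> \<mu>' \<cdot> mor \<xi> \<cdot> \<nu> = \<mu>')) \<and>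
      mor \<xi> \<cdot> \<nu> \<cdot> mor \<xi> = mor \<xi>"
    have "mor \<mu> \<cdot> mor \<xi> \<cdot> \<nu> = \<nu>" using ab h by blast
    moreover have "mor \<mu> \<cdot> mor \<xi> \<cdot> \<nu> = mor \<mu>" using h r mu by metis
    ultimately show "\<nu> = mor \<mu>" by simp
  qed
qed

lemma contr_kern:
  assumes q: "bhom B Q q" and k: "bhom K B k" and x: "bhom B C x" and z: "x \<bullet> k = Et C \<bullet> Ep K"
    and [simp]: "arr \<phi>" "dm \<phi> = und Q" "cd \<phi> = \<one>" "arr \<sigma>" "dm \<sigma> = \<one>" "cd \<sigma> = und K"
  shows "x \<bullet> contr B (\<phi> \<bullet> q) \<bullet> k \<bullet> \<sigma> = Et C \<bullet> (\<phi> \<bullet> q \<bullet> k \<bullet> \<sigma>)"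
proof -
  note [simp] = bhom_simps[OF q] bhom_simps[OF k] bhom_simps[OF x]
  have "x \<bullet> contr B (\<phi> \<bullet> q) \<bullet> k = Lu (und C) \<bullet> ((\<phi> \<bullet> q) \<star> x) \<bullet> De B \<bullet> k"
    using Lu_nat[of x "und C", THEN cmp_eq_assoc, of "((\<phi> \<bullet> q) \<star> Id (und B)) \<bullet> De B \<bullet> k", symmetric]
    by (simp add: contr_def cmp_assoc tns_cmp2)
  also have "\<dots> = Lu (und C) \<bullet> ((\<phi> \<bullet> q \<bullet> k) \<star> Et C) \<bullet> (Id (und K) \<star> Ep K) \<bullet> De K"
    by (simp add: bhom_eqs(3)[OF k] tns_cmp2 cmp_assoc z)
  also have "(Id (und K) \<star> Ep K) \<bullet> De K = Ru' (und K)"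
  proof -
    have "Ru' (und K) \<bullet> Ru (und K) \<bullet> (Id (und K) \<star> Ep K) \<bullet> De K = Ru' (und K)" by (simp add: De_Ep(2))
    then show ?thesis by simp
  qed
  also have "Lu (und C) \<bullet> ((\<phi> \<bullet> q \<bullet> k) \<star> Et C) \<bullet> Ru' (und K)
    = (Lu (und C) \<bullet> (Id \<one> \<star> Et C)) \<bullet> ((\<phi> \<bullet> q \<bullet> k) \<star> Id \<one>) \<bullet> Ru' (und K)" by (simp add: cmp_assoc tns_cmp2)
  also have "\<dots> = Et C \<bullet> Lu \<one> \<bullet> Ru' \<one> \<bullet> \<phi> \<bullet> q \<bullet> k"
    using Ru'_nat[of "\<phi> \<bullet> q \<bullet> k" \<one>] by (simp add: Lu_nat cmp_assoc)
  finally have "x \<bullet> contr B (\<phi> \<bullet> q) \<bullet> k = Et C \<bullet> \<phi> \<bullet> q \<bullet> k" by (simp add: Lu_Ru)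
  from cmp_eq_assoc[OF this[symmetric], of \<sigma>] show ?thesis by (simp add: cmp_assoc)
qed

text \<open>
  Integrals along \<open>\<zeta> = \<xi>' \<circ> \<xi>\<close> are determined by their composite with \<open>\<zeta>\<close> on both sides.  Here
  \<open>\<zeta> \<circ> \<mu> \<circ> \<mu>' \<circ> \<zeta> = \<xi>' \<circ> D \<circ> L \<circ> \<xi>\<close>, where \<open>D\<close> contracts with \<open>\<phi> \<circ> q\<close> and \<open>L\<close> translates by \<open>b = k'(\<sigma>')\<close>.  As \<open>D\<close>
  commutes with multiplication by values of \<open>\<xi>\<close>, this maps \<open>a\<close> to \<open>\<xi>'(D(b) \<xi>(a)) = \<xi>'(D(b)) \<zeta>(a)\<close>, and \<open>\<xi>'(D(b))\<close> is the
  scalar \<open>\<phi>qk'(\<sigma>')\<close> times the unit.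
\<close>

lemma gen_int_comp:
  assumes g: "gen_int A B \<xi> K k \<sigma> Q q \<phi> \<mu>" and g': "gen_int B C \<xi>' K' k' \<sigma>' Q' q' \<phi>' \<mu>'"
    and g'': "gen_int A C (\<xi>' \<bullet> \<xi>) K'' k'' \<sigma>'' Q'' q'' \<phi>'' \<mu>''"
  shows "\<mu> \<bullet> \<mu>' = sc (\<phi> \<bullet> q \<bullet> k' \<bullet> \<sigma>') \<mu>''"
proof -
  have k: "kern A B \<xi> K k" and q: "coker A B \<xi> Q q" and r: "right_int A B \<xi> \<mu>" and f: "ncoint Q \<phi>" and e: "\<xi> \<bullet> \<mu> = contr B (\<phi> \<bullet> q)"
    and k': "kern B C \<xi>' K' k'" and r': "right_int B C \<xi>' \<mu>'" and s': "nint K' \<sigma>'" and e': "\<mu>' \<bullet> \<xi>' = ltrans B (k' \<bullet> \<sigma>')"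
    and r'': "right_int A C (\<xi>' \<bullet> \<xi>) \<mu>''"
    using g g' g'' unfolding gen_int_def by blast+
  note [simp] = bch_simps[OF kern_bch(1)[OF k]] bch_simps[OF coker_bch(2)[OF q]] bch_simps[OF kern_bch(1)[OF k']]
    bch_simps[OF kern_bch(2)[OF k']] right_int_simps[OF r] right_int_simps[OF r'] right_int_simps[OF r''] nint_simps[OF s'] ncoint_simps[OF f]
  let ?D = "contr B (\<phi> \<bullet> q)" and ?c = "\<phi> \<bullet> q \<bullet> k' \<bullet> \<sigma>'" and ?b = "k' \<bullet> \<sigma>'"
  have c: "scal ?c" unfolding scal_def by simp
  \<comment> \<open>\<open>D = \<xi> \<circ> \<mu>\<close> commutes with multiplication by values of \<open>\<xi>\<close> because \<open>\<mu>\<close> is an integral along \<open>\<xi>\<close>.\<close>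
  have "?D \<bullet> Mu B \<bullet> (Id (und B) \<star> \<xi>) = \<xi> \<bullet> Mu A \<bullet> (\<mu> \<star> Id (und A))"
    by (simp add: e[symmetric] right_int_eqs(1)[OF r] cmp_assoc)
  also have "\<dots> = Mu B \<bullet> (?D \<star> \<xi>)"
    using bhom_eqs(1)[of A B \<xi>, THEN cmp_eq_assoc, of "\<mu> \<star> Id (und A)"] by (simp add: tns_cmp e cmp_assoc)
  finally have D: "?D \<bullet> Mu B \<bullet> (Id (und B) \<star> \<xi>) = Mu B \<bullet> (?D \<star> \<xi>)" .
  have "(\<xi>' \<bullet> \<xi>) \<bullet> (\<mu> \<bullet> \<mu>') \<bullet> (\<xi>' \<bullet> \<xi>) = \<xi>' \<bullet> (\<xi> \<bullet> \<mu>) \<bullet> (\<mu>' \<bullet> \<xi>') \<bullet> \<xi>" by (simp add: cmp_assoc)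
  also have "\<dots> = \<xi>' \<bullet> (?D \<bullet> Mu B \<bullet> (Id (und B) \<star> \<xi>)) \<bullet> (?b \<star> Id (und A)) \<bullet> Lu' (und A)"
    unfolding e e' by (simp add: ltrans_def cmp_assoc Lu'_nat tns_cmp2)
  also have "\<dots> = Mu C \<bullet> ((\<xi>' \<bullet> ?D \<bullet> ?b) \<star> (\<xi>' \<bullet> \<xi>)) \<bullet> Lu' (und A)"
    unfolding D using bhom_eqs(1)[of B C \<xi>', THEN cmp_eq_assoc, of "((?D \<bullet> ?b) \<star> \<xi>) \<bullet> Lu' (und A)"]
    by (simp add: tns_cmp2 cmp_assoc)
  also have "\<xi>' \<bullet> ?D \<bullet> ?b = Et C \<bullet> ?c"
    by (rule contr_kern) (simp_all add: kern_zero[OF k'])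
  also have "Mu C \<bullet> ((Et C \<bullet> ?c) \<star> (\<xi>' \<bullet> \<xi>)) \<bullet> Lu' (und A) = ltrans C (Et C \<bullet> ?c) \<bullet> \<xi>' \<bullet> \<xi>"
    by (simp add: ltrans_def cmp_assoc Lu'_nat tns_cmp2)
  also have "\<dots> = sc ?c (\<xi>' \<bullet> \<xi>)" using ltrans_scalar[of C ?c] sc_cmp[of ?c "Id (und C)" "\<xi>' \<bullet> \<xi>"] c by simp
  finally have main: "(\<xi>' \<bullet> \<xi>) \<bullet> (\<mu> \<bullet> \<mu>') \<bullet> (\<xi>' \<bullet> \<xi>) = sc ?c (\<xi>' \<bullet> \<xi>)" .
  have rr: "right_int A C (\<xi>' \<bullet> \<xi>) (\<mu> \<bullet> \<mu>')" by (rule right_int_cmp[of A B \<xi> C \<xi>']) (simp_all add: r r')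
  have "\<mu> \<bullet> \<mu>' = \<mu>'' \<bullet> ((\<xi>' \<bullet> \<xi>) \<bullet> (\<mu> \<bullet> \<mu>') \<bullet> (\<xi>' \<bullet> \<xi>)) \<bullet> \<mu>''"
    using gen_int_absorb[OF g'' rr] by (simp add: cmp_assoc)
  also have "\<dots> = sc ?c (\<mu>'' \<bullet> (\<xi>' \<bullet> \<xi>) \<bullet> \<mu>'')" unfolding main using c by (simp add: sc_cmp cmp_sc cmp_assoc)
  also have "\<dots> = sc ?c \<mu>''" using gen_int_absorb(1)[OF g'' r''] by simp
  finally show ?thesis .
qed

end


section \<open>Frobenius pairings\<close>

context symmetric_monoidal_category
begin

text \<open>
  \<open>E\<close> and \<open>b\<close> satisfy one zigzag identity of a duality of \<open>X\<close> with itself, up to the invertible scalar \<open>u\<close>: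
  \<open>E\<^sub>1 b(E\<^sub>2 \<otimes> x) = u x\<close>.
\<close>

definition frob :: "'o \<Rightarrow> ('o, 'm) arrow \<Rightarrow> ('o, 'm) arrow \<Rightarrow> ('o, 'm) arrow \<Rightarrow> bool" where
  "frob X E b u \<longleftrightarrow> X \<in> ob \<C> \<and> arr E \<and> dm E = \<one> \<and> cd E = X \<odot> X \<and> arr b \<and> dm b = X \<odot> X \<and> cd b = \<one> \<and> inv_scal u \<and>
     Ru X \<bullet> (Id X \<star> b) \<bullet> As X X X \<bullet> (E \<star> Id X) \<bullet> Lu' X = sc u (Id X)"

lemma frobD:
  assumes "frob X E b u"
  shows "X \<in> ob \<C>" "arr E" "dm E = \<one>" "cd E = X \<odot> X" "arr b" "dm b = X \<odot> X" "cd b = \<one>" "inv_scal u" "scal u"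
    "Ru X \<bullet> (Id X \<star> b) \<bullet> As X X X \<bullet> (E \<star> Id X) \<bullet> Lu' X = sc u (Id X)"
  using assms inv_scal_scal unfolding frob_def by blast+

lemma sc_right: assumes [simp]: "scal s" "arr f" shows "Ru (cd f) \<bullet> (f \<star> s) \<bullet> Ru' (dm f) = sc s f"
proof -
  have "s = sc s (Id \<one>)" by (simp add: sc_scal)
  then have "f \<star> s = sc s (f \<star> Id \<one>)" using tns_sc[of s f "Id \<one>"] by simp
  then show ?thesis by (simp add: sc_cmp cmp_sc Ru'_nat[symmetric])
qed

lemma pentagon_mid:
  assumes [simp]: "X \<in> ob \<C>" "Y \<in> ob \<C>" "Z \<in> ob \<C>" "W \<in> ob \<C>"
  shows "(Id X \<star> As' Y Z W) \<bullet> As X Y (Z \<odot> W) = As X (Y \<odot> Z) W \<bullet> (As X Y Z \<star> Id W) \<bullet> As' (X \<odot> Y) Z W"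
proof -
  have "(Id X \<star> As' Y Z W) \<bullet> As X Y (Z \<odot> W)
    = (Id X \<star> As' Y Z W) \<bullet> (As X Y (Z \<odot> W) \<bullet> As (X \<odot> Y) Z W) \<bullet> As' (X \<odot> Y) Z W" by (simp add: cmp_assoc)
  also have "\<dots> = As X (Y \<odot> Z) W \<bullet> (As X Y Z \<star> Id W) \<bullet> As' (X \<odot> Y) Z W"
    unfolding pentagon'[OF assms] by (simp add: cmp_assoc tns_cmp2)
  finally show ?thesis .
qed

text \<open>Pairing with the first tensor factor of \<open>x\<close> loses nothing, since \<open>x\<close> can be recovered with \<open>E\<close>.\<close>

lemma frob_transpose:
  assumes fr: "frob X E b u" and [simp]: "V \<in> ob \<C>" "arr x" "dm x = Y" "cd x = X \<odot> V"
  shows "(Id X \<star> (Lu V \<bullet> (b \<star> Id V) \<bullet> As' X X V \<bullet> (Id X \<star> x))) \<bullet> As X X Y \<bullet> (E \<star> Id Y) \<bullet> Lu' Y = sc u x"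
proof -
  note [simp] = frobD(1-9)[OF fr]
  have [simp]: "Y \<in> ob \<C>" using dm_ob[of x] by simp
  have "(Id X \<star> (Lu V \<bullet> (b \<star> Id V) \<bullet> As' X X V \<bullet> (Id X \<star> x))) \<bullet> As X X Y \<bullet> (E \<star> Id Y) \<bullet> Lu' Y
    = (Id X \<star> (Lu V \<bullet> (b \<star> Id V) \<bullet> As' X X V)) \<bullet> ((Id X \<star> (Id X \<star> x)) \<bullet> As X X Y) \<bullet> (E \<star> Id Y) \<bullet> Lu' Y"
    by (simp add: cmp_assoc tns_cmp2)
  also have "(Id X \<star> (Id X \<star> x)) \<bullet> As X X Y = As X X (X \<odot> V) \<bullet> (Id (X \<odot> X) \<star> x)"
    using As_nat[of "Id X" "Id X" x X X "X \<odot> V"] by simp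
  also have "(Id X \<star> (Lu V \<bullet> (b \<star> Id V) \<bullet> As' X X V)) \<bullet> (As X X (X \<odot> V) \<bullet> (Id (X \<odot> X) \<star> x)) \<bullet> (E \<star> Id Y) \<bullet> Lu' Y
    = (Id X \<star> Lu V) \<bullet> (Id X \<star> (b \<star> Id V)) \<bullet> ((Id X \<star> As' X X V) \<bullet> As X X (X \<odot> V)) \<bullet> (E \<star> Id (X \<odot> V)) \<bullet> Lu' (X \<odot> V) \<bullet> x"
    by (simp add: cmp_assoc tns_cmp2 Lu'_nat)
  also have "\<dots> = (Id X \<star> Lu V) \<bullet> ((Id X \<star> (b \<star> Id V)) \<bullet> As X (X \<odot> X) V) \<bullet> (As X X X \<star> Id V)
      \<bullet> (As' (X \<odot> X) X V \<bullet> (E \<star> (Id X \<star> Id V))) \<bullet> Lu' (X \<odot> V) \<bullet> x"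
    unfolding pentagon_mid[OF frobD(1)[OF fr] frobD(1)[OF fr] frobD(1)[OF fr] assms(2)] by (simp add: cmp_assoc)
  also have "(Id X \<star> (b \<star> Id V)) \<bullet> As X (X \<odot> X) V = As X \<one> V \<bullet> ((Id X \<star> b) \<star> Id V)"
    using As_nat[of "Id X" b "Id V" X \<one> V] by simp
  also have "As' (X \<odot> X) X V \<bullet> (E \<star> (Id X \<star> Id V)) = ((E \<star> Id X) \<star> Id V) \<bullet> As' \<one> X V"
    using As'_nat[of E "Id X" "Id V" "X \<odot> X" X V] by (simp del: Id_tns_Id)
  also have "(Id X \<star> Lu V) \<bullet> (As X \<one> V \<bullet> ((Id X \<star> b) \<star> Id V)) \<bullet> (As X X X \<star> Id V)
      \<bullet> (((E \<star> Id X) \<star> Id V) \<bullet> As' \<one> X V) \<bullet> Lu' (X \<odot> V) \<bullet> x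
    = ((Id X \<star> Lu V) \<bullet> As X \<one> V) \<bullet> ((Id X \<star> b) \<star> Id V) \<bullet> (As X X X \<star> Id V)
      \<bullet> ((E \<star> Id X) \<star> Id V) \<bullet> (As' \<one> X V \<bullet> Lu' (X \<odot> V)) \<bullet> x" by (simp add: cmp_assoc)
  also have "As' \<one> X V \<bullet> Lu' (X \<odot> V) = Lu' X \<star> Id V"
    unfolding As'_Lu'[OF frobD(1)[OF fr] assms(2), symmetric] by simp
  also have "((Id X \<star> Lu V) \<bullet> As X \<one> V) \<bullet> ((Id X \<star> b) \<star> Id V) \<bullet> (As X X X \<star> Id V)
      \<bullet> ((E \<star> Id X) \<star> Id V) \<bullet> (Lu' X \<star> Id V) \<bullet> x
    = ((Ru X \<bullet> (Id X \<star> b) \<bullet> As X X X \<bullet> (E \<star> Id X) \<bullet> Lu' X) \<star> Id V) \<bullet> x"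
    unfolding triangle'[OF frobD(1)[OF fr] assms(2)] by (simp add: tns_cmp2 cmp_assoc)
  finally show ?thesis unfolding frobD(10)[OF fr] by (simp add: sc_tns sc_cmp)
qed

lemma frob_inject:
  assumes fr: "frob X E b u" and [simp]: "V \<in> ob \<C>" "arr x" "dm x = Y" "cd x = X \<odot> V" "arr y" "dm y = Y" "cd y = X \<odot> V"
    and e: "Lu V \<bullet> (b \<star> Id V) \<bullet> As' X X V \<bullet> (Id X \<star> x) = Lu V \<bullet> (b \<star> Id V) \<bullet> As' X X V \<bullet> (Id X \<star> y)"
  shows "x = y"
  by (rule sc_cancel[OF frobD(8)[OF fr]])
    (simp_all add: frob_transpose[OF fr assms(2-5), symmetric] frob_transpose[OF fr assms(2,6-8), symmetric] e)

lemma frob_nondegenerate: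
  assumes fr: "frob X E b u" and [simp]: "arr x" "dm x = Y" "cd x = X" "arr y" "dm y = Y" "cd y = X"
    and e: "b \<bullet> (Id X \<star> x) = b \<bullet> (Id X \<star> y)"
  shows "x = y"
proof -
  note [simp] = frobD(1-9)[OF fr]
  have [simp]: "Y \<in> ob \<C>" using dm_ob[of x] by simp
  have *: "Lu \<one> \<bullet> (b \<star> Id \<one>) \<bullet> As' X X \<one> \<bullet> (Id X \<star> (Ru' X \<bullet> z)) = b \<bullet> (Id X \<star> z)"
    if [simp]: "arr z" "dm z = Y" "cd z = X" for z
  proof -
    have "Lu \<one> \<bullet> (b \<star> Id \<one>) \<bullet> As' X X \<one> \<bullet> (Id X \<star> (Ru' X \<bullet> z))
      = Lu \<one> \<bullet> (b \<star> Id \<one>) \<bullet> (As' X X \<one> \<bullet> (Id X \<star> Ru' X)) \<bullet> (Id X \<star> z)" by (simp add: cmp_assoc tns_cmp)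
    also have "\<dots> = Lu \<one> \<bullet> ((b \<star> Id \<one>) \<bullet> Ru' (X \<odot> X)) \<bullet> (Id X \<star> z)" by (simp add: As'_Ru' cmp_assoc)
    also have "(b \<star> Id \<one>) \<bullet> Ru' (X \<odot> X) = Ru' \<one> \<bullet> b" using Ru'_nat[of b \<one>] by simp
    finally show ?thesis by (simp add: Lu_Ru cmp_assoc)
  qed
  have "Ru' X \<bullet> x = Ru' X \<bullet> y" by (rule frob_inject[OF fr, of \<one> _ Y]) (simp_all add: * e)
  then have "Ru X \<bullet> Ru' X \<bullet> x = Ru X \<bullet> Ru' X \<bullet> y" by simp
  then show ?thesis by simp
qed

text \<open>Transposition turns arrows into \<open>X \<otimes> V\<close> injectively into arrows into \<open>V\<close>, naturally in \<open>V\<close>.\<close>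

lemma frob_mono:
  assumes fr: "frob X E b u" and [simp]: "arr m" "dm m = V"
    and mono: "\<And>Y x y. arr x \<Longrightarrow> arr y \<Longrightarrow> dm x = Y \<Longrightarrow> dm y = Y \<Longrightarrow> cd x = V \<Longrightarrow> cd y = V \<Longrightarrow> m \<bullet> x = m \<bullet> y \<Longrightarrow> x = y"
    and [simp]: "arr x" "dm x = Y" "cd x = X \<odot> V" "arr y" "dm y = Y" "cd y = X \<odot> V"
    and e: "(Id X \<star> m) \<bullet> x = (Id X \<star> m) \<bullet> y"
  shows "x = y"
proof -
  note [simp] = frobD(1-9)[OF fr]
  have [simp]: "V \<in> ob \<C>" "Y \<in> ob \<C>" using dm_ob[of m] dm_ob[of x] by simp_all
  have *: "m \<bullet> Lu V \<bullet> (b \<star> Id V) \<bullet> As' X X V \<bullet> (Id X \<star> z) = Lu (cd m) \<bullet> (b \<star> Id (cd m)) \<bullet> As' X X (cd m) \<bullet> (Id X \<star> ((Id X \<star> m) \<bullet> z))"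
    if [simp]: "arr z" "dm z = Y" "cd z = X \<odot> V" for z
  proof -
    have "Lu (cd m) \<bullet> (b \<star> Id (cd m)) \<bullet> As' X X (cd m) \<bullet> (Id X \<star> ((Id X \<star> m) \<bullet> z))
      = Lu (cd m) \<bullet> (b \<star> Id (cd m)) \<bullet> (As' X X (cd m) \<bullet> (Id X \<star> (Id X \<star> m))) \<bullet> (Id X \<star> z)" by (simp add: cmp_assoc tns_cmp)
    also have "As' X X (cd m) \<bullet> (Id X \<star> (Id X \<star> m)) = (Id (X \<odot> X) \<star> m) \<bullet> As' X X V"
      using As'_nat[of "Id X" "Id X" m X X "cd m"] by simp
    also have "Lu (cd m) \<bullet> (b \<star> Id (cd m)) \<bullet> ((Id (X \<odot> X) \<star> m) \<bullet> As' X X V) \<bullet> (Id X \<star> z)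
      = (Lu (cd m) \<bullet> (Id \<one> \<star> m)) \<bullet> (b \<star> Id V) \<bullet> As' X X V \<bullet> (Id X \<star> z)" by (simp add: cmp_assoc tns_cmp2)
    finally show ?thesis by (simp add: Lu_nat cmp_assoc)
  qed
  have "Lu V \<bullet> (b \<star> Id V) \<bullet> As' X X V \<bullet> (Id X \<star> x) = Lu V \<bullet> (b \<star> Id V) \<bullet> As' X X V \<bullet> (Id X \<star> y)"
    by (rule mono[of _ _ "X \<odot> Y"]) (simp_all add: * e)
  then show ?thesis by (intro frob_inject[OF fr, of V x Y y]) simp_all
qed

text \<open>Transposition in the second variable, \<open>t \<mapsto> t(- \<otimes> E\<^sub>1) \<otimes> E\<^sub>2\<close>, is undone up to the scalar by pairing with \<open>b\<close>.\<close>

lemma frob_recover: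
  assumes fr: "frob X E b u" and [simp]: "Z \<in> ob \<C>" "arr t" "dm t = Z \<odot> X"
  shows "Ru (cd t) \<bullet> (Id (cd t) \<star> b) \<bullet> As (cd t) X X \<bullet> (((t \<star> Id X) \<bullet> As' Z X X \<bullet> (Id Z \<star> E) \<bullet> Ru' Z) \<star> Id X) = sc u t"
proof -
  note [simp] = frobD(1-9)[OF fr]
  let ?Y = "cd t"
  have "Ru ?Y \<bullet> (Id ?Y \<star> b) \<bullet> As ?Y X X \<bullet> (((t \<star> Id X) \<bullet> As' Z X X \<bullet> (Id Z \<star> E) \<bullet> Ru' Z) \<star> Id X)
    = Ru ?Y \<bullet> (Id ?Y \<star> b) \<bullet> (As ?Y X X \<bullet> ((t \<star> Id X) \<star> Id X)) \<bullet> (As' Z X X \<star> Id X) \<bullet> ((Id Z \<star> E) \<star> Id X) \<bullet> (Ru' Z \<star> Id X)"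
    by (simp add: tns_cmp cmp_assoc)
  also have "As ?Y X X \<bullet> ((t \<star> Id X) \<star> Id X) = (t \<star> Id (X \<odot> X)) \<bullet> As (Z \<odot> X) X X"
    using As_nat[of t "Id X" "Id X" ?Y X X] by simp
  also have "Ru ?Y \<bullet> (Id ?Y \<star> b) \<bullet> ((t \<star> Id (X \<odot> X)) \<bullet> As (Z \<odot> X) X X) \<bullet> (As' Z X X \<star> Id X) \<bullet> ((Id Z \<star> E) \<star> Id X) \<bullet> (Ru' Z \<star> Id X)
    = (Ru ?Y \<bullet> (t \<star> Id \<one>)) \<bullet> (Id (Z \<odot> X) \<star> b) \<bullet> (As (Z \<odot> X) X X \<bullet> (As' Z X X \<star> Id X) \<bullet> As' Z (X \<odot> X) X)
       \<bullet> (As Z (X \<odot> X) X \<bullet> ((Id Z \<star> E) \<star> Id X)) \<bullet> (Ru' Z \<star> Id X)"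
    by (simp add: tns_cmp2 cmp_assoc)
  also have "Ru ?Y \<bullet> (t \<star> Id \<one>) = t \<bullet> Ru (Z \<odot> X)" by (simp add: Ru_nat)
  also have "As (Z \<odot> X) X X \<bullet> (As' Z X X \<star> Id X) \<bullet> As' Z (X \<odot> X) X = As' Z X (X \<odot> X) \<bullet> (Id Z \<star> As X X X)"
    by (rule pentagon_inv) simp_all
  also have "As Z (X \<odot> X) X \<bullet> ((Id Z \<star> E) \<star> Id X) = (Id Z \<star> (E \<star> Id X)) \<bullet> As Z \<one> X"
    using As_nat[of "Id Z" E "Id X" Z "X \<odot> X" X] by simp
  also have "(t \<bullet> Ru (Z \<odot> X)) \<bullet> (Id (Z \<odot> X) \<star> b) \<bullet> (As' Z X (X \<odot> X) \<bullet> (Id Z \<star> As X X X))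
       \<bullet> ((Id Z \<star> (E \<star> Id X)) \<bullet> As Z \<one> X) \<bullet> (Ru' Z \<star> Id X)
    = t \<bullet> Ru (Z \<odot> X) \<bullet> ((Id (Z \<odot> X) \<star> b) \<bullet> As' Z X (X \<odot> X)) \<bullet> (Id Z \<star> As X X X)
       \<bullet> (Id Z \<star> (E \<star> Id X)) \<bullet> (As Z \<one> X \<bullet> (Ru' Z \<star> Id X))" by (simp add: cmp_assoc)
  also have "(Id (Z \<odot> X) \<star> b) \<bullet> As' Z X (X \<odot> X) = As' Z X \<one> \<bullet> (Id Z \<star> (Id X \<star> b))"
    using As'_nat[of "Id Z" "Id X" b Z X \<one>] by simp
  also have "t \<bullet> Ru (Z \<odot> X) \<bullet> (As' Z X \<one> \<bullet> (Id Z \<star> (Id X \<star> b))) \<bullet> (Id Z \<star> As X X X)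
       \<bullet> (Id Z \<star> (E \<star> Id X)) \<bullet> (As Z \<one> X \<bullet> (Ru' Z \<star> Id X))
    = t \<bullet> (Id Z \<star> (Ru X \<bullet> (Id X \<star> b) \<bullet> As X X X \<bullet> (E \<star> Id X) \<bullet> Lu' X))"
    by (simp add: triangle_inv cmp_eq_assoc[OF Ru_As'] tns_cmp cmp_assoc)
  finally show ?thesis unfolding frobD(10)[OF fr] by (simp add: tns_sc cmp_sc)
qed

text \<open>
  Arrows \<open>v\<close> with \<open>t\<^sub>1 \<circ> (v \<otimes> X) = t\<^sub>2 \<circ> (v \<otimes> X)\<close> are classified by an equalizer, since a Frobenius pairing turns this
  into an equation between composites with \<open>v\<close>.
\<close>

lemma frob_equalizer:
  assumes eq: "has_equalizers \<C>" and fr: "frob X E b u" and t [simp]: "Z \<in> ob \<C>" "arr t1" "dm t1 = Z \<odot> X" "cd t1 = Y"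
    "arr t2" "dm t2 = Z \<odot> X" "cd t2 = Y"
  obtains V i where "arr i" "dm i = V" "cd i = Z" "t1 \<bullet> (i \<star> Id X) = t2 \<bullet> (i \<star> Id X)"
    "\<And>W x y. arr x \<Longrightarrow> arr y \<Longrightarrow> dm x = W \<Longrightarrow> dm y = W \<Longrightarrow> cd x = V \<Longrightarrow> cd y = V \<Longrightarrow> i \<bullet> x = i \<bullet> y \<Longrightarrow> x = y"
    "\<And>v. arr v \<Longrightarrow> cd v = Z \<Longrightarrow> t1 \<bullet> (v \<star> Id X) = t2 \<bullet> (v \<star> Id X) \<Longrightarrow> \<exists>w. arr w \<and> dm w = dm v \<and> cd w = V \<and> i \<bullet> w = v"
proof -
  note [simp] = frobD(1-9)[OF fr]
  have [simp]: "Y \<in> ob \<C>" using cd_ob[of t1] by simp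
  \<comment> \<open>The transposes \<open>?h t1\<close> and \<open>?h t2\<close> are arrows out of \<open>Z\<close>, of which the equalizer is taken.\<close>
  let ?h = "\<lambda>t. (t \<star> Id X) \<bullet> As' Z X X \<bullet> (Id Z \<star> E) \<bullet> Ru' Z"
  have nat: "?h t \<bullet> v = ((t \<bullet> (v \<star> Id X)) \<star> Id X) \<bullet> As' (dm v) X X \<bullet> (Id (dm v) \<star> E) \<bullet> Ru' (dm v)"
    if [simp]: "arr v" "cd v = Z" "arr t" "dm t = Z \<odot> X" for t v
  proof -
    have "?h t \<bullet> v = (t \<star> Id X) \<bullet> (As' Z X X \<bullet> (v \<star> (Id X \<star> Id X))) \<bullet> (Id (dm v) \<star> E) \<bullet> Ru' (dm v)"
      by (simp add: cmp_assoc Ru'_nat tns_cmp2)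
    also have "As' Z X X \<bullet> (v \<star> (Id X \<star> Id X)) = ((v \<star> Id X) \<star> Id X) \<bullet> As' (dm v) X X"
      using As'_nat[of v "Id X" "Id X" Z X X] by (simp del: Id_tns_Id)
    finally show ?thesis by (simp add: cmp_assoc tns_cmp2)
  qed
  have 1: "arr (?h t1)" "dm (?h t1) = Z" "cd (?h t1) = Y \<odot> X" "arr (?h t2)" "dm (?h t2) = Z" "cd (?h t2) = Y \<odot> X" by simp_all
  obtain V e where V: "is_equalizer \<C> Z (Y \<odot> X) (mor (?h t1)) (mor (?h t2)) V e"
    using eq mor_hom'[OF 1(1-3)] mor_hom'[OF 1(4-6)] unfolding has_equalizers_def by blast
  define i where "i = mk V e Z"
  have i [simp]: "arr i" "dm i = V" "cd i = Z" "mor i = e" using V unfolding is_equalizer_def i_def by auto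
  have [simp]: "V \<in> ob \<C>" using dm_ob[of i] by simp
  have U: "\<exists>!k. k \<in> Hom W V \<and> e \<cdot> k = mor v" if "arr v" "dm v = W" "cd v = Z" "?h t1 \<bullet> v = ?h t2 \<bullet> v" for W v
    using V mor_eq[OF that(4)] mor_hom'[OF that(1-3)] that(1-3) unfolding is_equalizer_def by simp
  have he: "?h t1 \<bullet> i = ?h t2 \<bullet> i" by (rule arr_eqI) (use V in \<open>simp_all add: is_equalizer_def\<close>)
  have r: "sc u (t \<bullet> (i \<star> Id X)) = Ru Y \<bullet> (Id Y \<star> b) \<bullet> As Y X X \<bullet> ((?h t \<bullet> i) \<star> Id X)"
    if [simp]: "arr t" "dm t = Z \<odot> X" "cd t = Y" for t
  proof -
    have n: "?h t \<bullet> i = ((t \<bullet> (i \<star> Id X)) \<star> Id X) \<bullet> As' V X X \<bullet> (Id V \<star> E) \<bullet> Ru' V" using nat[of i t] by simp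
    show ?thesis unfolding n by (subst frob_recover[OF fr, of V "t \<bullet> (i \<star> Id X)", symmetric]) simp_all
  qed
  have "sc u (t1 \<bullet> (i \<star> Id X)) = sc u (t2 \<bullet> (i \<star> Id X))" by (simp only: r[OF t(2-4)] r[OF t(5-7)] he)
  then have 2: "t1 \<bullet> (i \<star> Id X) = t2 \<bullet> (i \<star> Id X)" by (rule sc_cancel[OF frobD(8)[OF fr], rotated 2]) simp_all
  show ?thesis
  proof (rule that[OF i(1-3) 2])
    fix W x y assume [simp]: "arr x" "arr y" "dm x = W" "dm y = W" "cd x = V" "cd y = V" and e: "i \<bullet> x = i \<bullet> y"
    have "?h t1 \<bullet> (i \<bullet> x) = ?h t2 \<bullet> (i \<bullet> x)" using cmp_eq_assoc[OF he, of x] by (simp add: cmp_assoc)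
    from U[OF _ _ _ this, of W] have "\<exists>!k. k \<in> Hom W V \<and> e \<cdot> k = mor (i \<bullet> x)" by simp
    moreover have "mor x \<in> Hom W V \<and> e \<cdot> mor x = mor (i \<bullet> x)" "mor y \<in> Hom W V \<and> e \<cdot> mor y = mor (i \<bullet> x)"
      using mor_eq[OF e] by simp_all
    ultimately have "mor x = mor y" by (elim ex1E) blast
    then show "x = y" by (intro arr_eqI) simp_all
  next
    fix v assume v [simp]: "arr v" "cd v = Z" and tv: "t1 \<bullet> (v \<star> Id X) = t2 \<bullet> (v \<star> Id X)"
    have "?h t1 \<bullet> v = ?h t2 \<bullet> v" using nat[of v t1] nat[of v t2] tv by simp
    from U[OF v(1) refl v(2) this] obtain k where k: "k \<in> Hom (dm v) V" "e \<cdot> k = mor v" by blast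
    have "i \<bullet> mk (dm v) k V = v" by (rule arr_eqI) (use k in simp_all)
    then show "\<exists>w. arr w \<and> dm w = dm v \<and> cd w = V \<and> i \<bullet> w = v" using k by (intro exI[of _ "mk (dm v) k V"]) simp
  qed
qed

end


section \<open>Volumes\<close>

context symmetric_monoidal_category
begin

text \<open>
  The convolution action of endomorphisms \<open>s\<close> of \<open>A\<close> on operations \<open>T : A \<otimes> A \<rightarrow> A\<close>, in Sweedler notation
  \<open>y \<otimes> a \<mapsto> s(y\<^sub>1) T(y\<^sub>2 \<otimes> a)\<close>.
\<close>

definition dact :: "('o, 'm) bimon \<Rightarrow> ('o, 'm) arrow \<Rightarrow> ('o, 'm) arrow \<Rightarrow> ('o, 'm) arrow" where
  "dact A s T = Mu A \<bullet> (s \<star> T) \<bullet> As (und A) (und A) (und A) \<bullet> (De A \<star> Id (und A))"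

lemma dact_dact:
  assumes [simp]: "bimonoid \<C> A" and s [simp]: "arr s" "dm s = und A" "cd s = und A" "arr t" "dm t = und A" "cd t = und A"
    and [simp]: "arr T" "dm T = und A \<odot> und A" "cd T = und A"
  shows "dact A s (dact A t T) = dact A (Mu A \<bullet> (s \<star> t) \<bullet> De A) T"
proof -
  let ?A = "und A"
  have [simp]: "?A \<in> ob \<C>" by simp
  have "dact A s (dact A t T)
    = Mu A \<bullet> (Id ?A \<star> Mu A) \<bullet> (s \<star> (t \<star> T)) \<bullet> (Id ?A \<star> As ?A ?A ?A) \<bullet> (Id ?A \<star> (De A \<star> Id ?A)) \<bullet> As ?A ?A ?A \<bullet> (De A \<star> Id ?A)"
    by (simp add: dact_def cmp_assoc tns_cmp2)
  also have "\<dots> = Mu A \<bullet> (Id ?A \<star> Mu A) \<bullet> (s \<star> (t \<star> T)) \<bullet> (Id ?A \<star> As ?A ?A ?A) \<bullet> As ?A (?A \<odot> ?A) ?A \<bullet> (((Id ?A \<star> De A) \<bullet> De A) \<star> Id ?A)"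
    using As_nat[of "Id ?A" "De A" "Id ?A" ?A "?A \<odot> ?A" ?A, THEN cmp_eq_assoc, of "De A \<star> Id ?A"]
    by (simp add: cmp_assoc tns_cmp)
  also have "\<dots> = Mu A \<bullet> (Id ?A \<star> Mu A) \<bullet> (s \<star> (t \<star> T)) \<bullet> ((Id ?A \<star> As ?A ?A ?A) \<bullet> As ?A (?A \<odot> ?A) ?A \<bullet> (As ?A ?A ?A \<star> Id ?A))
      \<bullet> (((De A \<star> Id ?A) \<bullet> De A) \<star> Id ?A)"
    unfolding De_assoc[OF assms(1), symmetric] by (simp add: cmp_assoc tns_cmp)
  also have "\<dots> = Mu A \<bullet> (Id ?A \<star> Mu A) \<bullet> ((s \<star> (t \<star> T)) \<bullet> As ?A ?A (?A \<odot> ?A)) \<bullet> As (?A \<odot> ?A) ?A ?A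
      \<bullet> (((De A \<star> Id ?A) \<bullet> De A) \<star> Id ?A)" by (simp add: pentagon'[symmetric] cmp_assoc)
  also have "(s \<star> (t \<star> T)) \<bullet> As ?A ?A (?A \<odot> ?A) = As ?A ?A ?A \<bullet> ((s \<star> t) \<star> T)"
    using As_nat[of s t T ?A ?A ?A] by simp
  also have "Mu A \<bullet> (Id ?A \<star> Mu A) \<bullet> (As ?A ?A ?A \<bullet> ((s \<star> t) \<star> T)) \<bullet> As (?A \<odot> ?A) ?A ?A \<bullet> (((De A \<star> Id ?A) \<bullet> De A) \<star> Id ?A)
    = (Mu A \<bullet> (Id ?A \<star> Mu A) \<bullet> As ?A ?A ?A) \<bullet> ((s \<star> t) \<star> T) \<bullet> (As (?A \<odot> ?A) ?A ?A \<bullet> ((De A \<star> Id ?A) \<star> Id ?A)) \<bullet> (De A \<star> Id ?A)"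
    by (simp add: cmp_assoc tns_cmp)
  also have "As (?A \<odot> ?A) ?A ?A \<bullet> ((De A \<star> Id ?A) \<star> Id ?A) = (De A \<star> Id (?A \<odot> ?A)) \<bullet> As ?A ?A ?A"
    using As_nat[of "De A" "Id ?A" "Id ?A" "?A \<odot> ?A" ?A ?A] by simp
  also have "(Mu A \<bullet> (Id ?A \<star> Mu A) \<bullet> As ?A ?A ?A) \<bullet> ((s \<star> t) \<star> T) \<bullet> ((De A \<star> Id (?A \<odot> ?A)) \<bullet> As ?A ?A ?A) \<bullet> (De A \<star> Id ?A)
    = dact A (Mu A \<bullet> (s \<star> t) \<bullet> De A) T"
    unfolding Mu_assoc[OF assms(1), symmetric] by (simp add: dact_def cmp_assoc tns_cmp2 tns_cmp)
  finally show ?thesis .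
qed

lemma dact_unit:
  assumes [simp]: "bimonoid \<C> A" "arr T" "dm T = und A \<odot> und A" "cd T = und A"
  shows "dact A (Et A \<bullet> Ep A) T = T"
proof -
  let ?A = "und A"
  have [simp]: "?A \<in> ob \<C>" by simp
  have "dact A (Et A \<bullet> Ep A) T = (Mu A \<bullet> (Et A \<star> Id ?A)) \<bullet> (Ep A \<star> T) \<bullet> As ?A ?A ?A \<bullet> (De A \<star> Id ?A)"
    by (simp add: dact_def cmp_assoc tns_cmp2)
  also have "\<dots> = (Lu ?A \<bullet> (Id \<one> \<star> T)) \<bullet> (Ep A \<star> Id (?A \<odot> ?A)) \<bullet> As ?A ?A ?A \<bullet> (De A \<star> Id ?A)"
    by (simp add: Mu_Et cmp_assoc tns_cmp2)
  also have "\<dots> = T \<bullet> Lu (?A \<odot> ?A) \<bullet> (As \<one> ?A ?A \<bullet> ((Ep A \<star> Id ?A) \<star> Id ?A)) \<bullet> (De A \<star> Id ?A)"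
    using As_nat[of "Ep A" "Id ?A" "Id ?A" \<one> ?A ?A] by (simp add: Lu_nat cmp_assoc)
  also have "\<dots> = T \<bullet> ((Lu ?A \<bullet> (Ep A \<star> Id ?A) \<bullet> De A) \<star> Id ?A)"
    by (simp add: cmp_eq_assoc[OF Lu_tns] cmp_assoc tns_cmp)
  finally show ?thesis by (simp add: De_Ep)
qed

lemma nint_eqs':
  assumes "bimonoid \<C> A" and s: "nint A \<sigma>" shows "Mu A \<bullet> (\<sigma> \<star> Id (und A)) \<bullet> Lu' (und A) = \<sigma> \<bullet> Ep A"
proof -
  note [simp] = assms(1) nint_simps[OF s]
  have "Mu A \<bullet> (\<sigma> \<star> Id (und A)) \<bullet> Lu' (und A) = Ru (und A) \<bullet> (\<sigma> \<star> Id \<one>) \<bullet> (Id \<one> \<star> Ep A) \<bullet> Lu' (und A)"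
    using cmp_eq_assoc[OF nint_eqs(1)[OF s], of "Lu' (und A)"] by (simp add: cmp_assoc tns_cmp2)
  then show ?thesis by (simp add: cmp_eq_assoc[OF Ru_nat] cmp_eq_assoc[OF Lu_nat] cmp_assoc Lu_Ru[symmetric])
qed

text \<open>
  The pairing is \<open>\<phi>(y a)\<close> and the copairing is \<open>S(\<sigma>\<^sub>1) \<otimes> \<sigma>\<^sub>2\<close>.  The zigzag identity is the case \<open>y = \<sigma>\<close> of
  \<open>S(y\<^sub>1) \<phi>(y\<^sub>2 a) = a\<^sub>1 \<phi>(y a\<^sub>2)\<close>.  In this identity the convolution of the right-hand side, as an operation on
  \<open>y \<otimes> a\<close>, with the identity is \<open>y\<^sub>1 a\<^sub>1 \<phi>(y\<^sub>2 a\<^sub>2) = \<phi>(y a)\<close>, and convolution with \<open>S\<close> inverts convolution with the identity.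
\<close>

lemma hopf_frobenius:
  assumes A: "bc_hopf_monoid \<C> A" and s: "nint A \<sigma>" and f: "ncoint A \<phi>" and u: "inv_scal (\<phi> \<bullet> \<sigma>)"
    and S [simp]: "arr S" "dm S = und A" "cd S = und A" and SA: "Mu A \<bullet> (S \<star> Id (und A)) \<bullet> De A = Et A \<bullet> Ep A"
  shows "frob (und A) ((S \<star> Id (und A)) \<bullet> De A \<bullet> \<sigma>) (\<phi> \<bullet> Mu A) (\<phi> \<bullet> \<sigma>)"
proof -
  let ?A = "und A" and ?u = "\<phi> \<bullet> \<sigma>"
  let ?b = "\<phi> \<bullet> Mu A"
  note [simp] = bc_bim[OF A] nint_simps[OF s] ncoint_simps[OF f] inv_scal_scal[OF u]
  have [simp]: "?A \<in> ob \<C>" by simp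
  let ?M = "\<lambda>X. As ?A X ?A \<bullet> (Sy X ?A \<star> Id ?A) \<bullet> As' X ?A ?A"
  \<comment> \<open>\<open>T(y \<otimes> a) = a\<^sub>1 \<phi>(y a\<^sub>2)\<close>; \<open>?M\<close> exchanges \<open>y\<close> and \<open>a\<^sub>1\<close>.\<close>
  define T where "T = Ru ?A \<bullet> (Id ?A \<star> ?b) \<bullet> ?M ?A \<bullet> (Id ?A \<star> De A)"
  have T [simp]: "arr T" "dm T = ?A \<odot> ?A" "cd T = ?A" by (simp_all add: T_def)
  have "dact A (Id ?A) T = Mu A \<bullet> (Id ?A \<star> Ru ?A) \<bullet> (Id ?A \<star> (Id ?A \<star> ?b)) \<bullet> (Id ?A \<star> ?M ?A)
      \<bullet> ((Id ?A \<star> (Id ?A \<star> De A)) \<bullet> As ?A ?A ?A) \<bullet> (De A \<star> Id ?A)"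
    by (simp add: dact_def T_def cmp_assoc tns_cmp2)
  also have "(Id ?A \<star> (Id ?A \<star> De A)) \<bullet> As ?A ?A ?A = As ?A ?A (?A \<odot> ?A) \<bullet> (Id (?A \<odot> ?A) \<star> De A)"
    using As_nat[of "Id ?A" "Id ?A" "De A" ?A ?A "?A \<odot> ?A"] by simp
  also have "Mu A \<bullet> (Id ?A \<star> Ru ?A) \<bullet> (Id ?A \<star> (Id ?A \<star> ?b)) \<bullet> (Id ?A \<star> ?M ?A)
      \<bullet> (As ?A ?A (?A \<odot> ?A) \<bullet> (Id (?A \<odot> ?A) \<star> De A)) \<bullet> (De A \<star> Id ?A)
    = Mu A \<bullet> (Id ?A \<star> Ru ?A) \<bullet> ((Id ?A \<star> (Id ?A \<star> ?b)) \<bullet> As ?A ?A (?A \<odot> ?A)) \<bullet> Mf ?A ?A ?A ?A \<bullet> (De A \<star> De A)"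
    by (simp add: Mf_def cmp_assoc tns_cmp2 tns_cmp)
  also have "(Id ?A \<star> (Id ?A \<star> ?b)) \<bullet> As ?A ?A (?A \<odot> ?A) = As ?A ?A \<one> \<bullet> (Id (?A \<odot> ?A) \<star> ?b)"
    using As_nat[of "Id ?A" "Id ?A" ?b ?A ?A \<one>] by simp
  also have "Mu A \<bullet> (Id ?A \<star> Ru ?A) \<bullet> (As ?A ?A \<one> \<bullet> (Id (?A \<odot> ?A) \<star> ?b)) \<bullet> Mf ?A ?A ?A ?A \<bullet> (De A \<star> De A)
    = (Mu A \<bullet> Ru (?A \<odot> ?A)) \<bullet> (Id (?A \<odot> ?A) \<star> ?b) \<bullet> Mf ?A ?A ?A ?A \<bullet> (De A \<star> De A)"
    by (simp add: cmp_eq_assoc[OF Ru_tns] cmp_assoc)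
  also have "Mu A \<bullet> Ru (?A \<odot> ?A) = Ru ?A \<bullet> (Mu A \<star> Id \<one>)" by (simp add: Ru_nat)
  also have "(Ru ?A \<bullet> (Mu A \<star> Id \<one>)) \<bullet> (Id (?A \<odot> ?A) \<star> ?b) \<bullet> Mf ?A ?A ?A ?A \<bullet> (De A \<star> De A)
    = Ru ?A \<bullet> (Id ?A \<star> \<phi>) \<bullet> (De A \<bullet> Mu A)" by (simp add: De_Mu cmp_assoc tns_cmp2)
  also have "\<dots> = Et A \<bullet> ?b" using cmp_eq_assoc[OF ncoint_eqs(2)[OF f], of "Mu A"] by (simp add: cmp_assoc)
  finally have 1: "dact A (Id ?A) T = Et A \<bullet> ?b" .
  have "T = dact A S (dact A (Id ?A) T)" by (simp add: dact_dact dact_unit SA)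
  also have "\<dots> = (Mu A \<bullet> (Id ?A \<star> Et A)) \<bullet> (S \<star> ?b) \<bullet> As ?A ?A ?A \<bullet> (De A \<star> Id ?A)"
    unfolding 1 by (simp add: dact_def cmp_assoc tns_cmp2)
  finally have 2: "T = Ru ?A \<bullet> (S \<star> ?b) \<bullet> As ?A ?A ?A \<bullet> (De A \<star> Id ?A)" by (simp add: Mu_Et)
  \<comment> \<open>Both sides of the identity are now evaluated at \<open>y = \<sigma>\<close>, where \<open>a\<^sub>1 \<phi>(\<sigma> a\<^sub>2) = a\<^sub>1 \<epsilon>(a\<^sub>2) \<phi>(\<sigma>)\<close>.\<close>
  have "Ru ?A \<bullet> (Id ?A \<star> ?b) \<bullet> As ?A ?A ?A \<bullet> (((S \<star> Id ?A) \<bullet> De A \<bullet> \<sigma>) \<star> Id ?A) \<bullet> Lu' ?A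
    = Ru ?A \<bullet> (Id ?A \<star> ?b) \<bullet> (As ?A ?A ?A \<bullet> ((S \<star> Id ?A) \<star> Id ?A)) \<bullet> (De A \<star> Id ?A) \<bullet> (\<sigma> \<star> Id ?A) \<bullet> Lu' ?A"
    by (simp add: cmp_assoc tns_cmp2)
  also have "As ?A ?A ?A \<bullet> ((S \<star> Id ?A) \<star> Id ?A) = (S \<star> Id (?A \<odot> ?A)) \<bullet> As ?A ?A ?A"
    using As_nat[of S "Id ?A" "Id ?A" ?A ?A ?A] by simp
  also have "Ru ?A \<bullet> (Id ?A \<star> ?b) \<bullet> ((S \<star> Id (?A \<odot> ?A)) \<bullet> As ?A ?A ?A) \<bullet> (De A \<star> Id ?A) \<bullet> (\<sigma> \<star> Id ?A) \<bullet> Lu' ?A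
    = T \<bullet> (\<sigma> \<star> Id ?A) \<bullet> Lu' ?A" unfolding 2 by (simp add: cmp_assoc tns_cmp2)
  also have "\<dots> = Ru ?A \<bullet> (Id ?A \<star> ?b) \<bullet> (?M ?A \<bullet> (\<sigma> \<star> (Id ?A \<star> Id ?A))) \<bullet> (Id \<one> \<star> De A) \<bullet> Lu' ?A"
    by (simp add: T_def cmp_assoc tns_cmp2)
  also have "?M ?A \<bullet> (\<sigma> \<star> (Id ?A \<star> Id ?A)) = As ?A ?A ?A \<bullet> (Sy ?A ?A \<star> Id ?A) \<bullet> ((\<sigma> \<star> Id ?A) \<star> Id ?A) \<bullet> As' \<one> ?A ?A"
    using As'_nat[of \<sigma> "Id ?A" "Id ?A" ?A ?A ?A] by (simp del: Id_tns_Id add: cmp_assoc)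
  also have "\<dots> = (As ?A ?A ?A \<bullet> ((Id ?A \<star> \<sigma>) \<star> Id ?A)) \<bullet> (Sy \<one> ?A \<star> Id ?A) \<bullet> As' \<one> ?A ?A"
    by (simp add: tns_cmp2 Sy_nat cmp_assoc)
  also have "As ?A ?A ?A \<bullet> ((Id ?A \<star> \<sigma>) \<star> Id ?A) = (Id ?A \<star> (\<sigma> \<star> Id ?A)) \<bullet> As ?A \<one> ?A"
    using As_nat[of "Id ?A" \<sigma> "Id ?A" ?A ?A ?A] by simp
  also have "Ru ?A \<bullet> (Id ?A \<star> ?b) \<bullet> (((Id ?A \<star> (\<sigma> \<star> Id ?A)) \<bullet> As ?A \<one> ?A) \<bullet> (Sy \<one> ?A \<star> Id ?A) \<bullet> As' \<one> ?A ?A) \<bullet> (Id \<one> \<star> De A) \<bullet> Lu' ?A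
    = Ru ?A \<bullet> (Id ?A \<star> (?b \<bullet> (\<sigma> \<star> Id ?A))) \<bullet> As ?A \<one> ?A \<bullet> (Sy \<one> ?A \<star> Id ?A) \<bullet> (As' \<one> ?A ?A \<bullet> Lu' (?A \<odot> ?A)) \<bullet> De A"
    by (simp add: cmp_assoc tns_cmp2 Lu'_nat)
  also have "As' \<one> ?A ?A \<bullet> Lu' (?A \<odot> ?A) = Lu' ?A \<star> Id ?A"
    unfolding As'_Lu'[OF \<open>?A \<in> ob \<C>\<close> \<open>?A \<in> ob \<C>\<close>, symmetric] by simp
  also have "Ru ?A \<bullet> (Id ?A \<star> (?b \<bullet> (\<sigma> \<star> Id ?A))) \<bullet> As ?A \<one> ?A \<bullet> (Sy \<one> ?A \<star> Id ?A) \<bullet> (Lu' ?A \<star> Id ?A) \<bullet> De A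
    = Ru ?A \<bullet> (Id ?A \<star> (?b \<bullet> (\<sigma> \<star> Id ?A))) \<bullet> (As ?A \<one> ?A \<bullet> (Ru' ?A \<star> Id ?A)) \<bullet> De A"
    by (simp add: tns_cmp2 Sy_Lu' cmp_assoc)
  also have "\<dots> = Ru ?A \<bullet> (Id ?A \<star> (\<phi> \<bullet> (Mu A \<bullet> (\<sigma> \<star> Id ?A) \<bullet> Lu' ?A))) \<bullet> De A"
    by (simp add: triangle_inv tns_cmp2 cmp_assoc)
  also have "\<dots> = Ru ?A \<bullet> (Id ?A \<star> ?u) \<bullet> (Ru' ?A \<bullet> Ru ?A) \<bullet> (Id ?A \<star> Ep A) \<bullet> De A"
    unfolding nint_eqs'[OF bc_bim[OF A] s] by (simp add: tns_cmp2 cmp_assoc)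
  also have "\<dots> = (Ru ?A \<bullet> (Id ?A \<star> ?u) \<bullet> Ru' ?A) \<bullet> (Ru ?A \<bullet> (Id ?A \<star> Ep A) \<bullet> De A)" by (simp only: cmp_assoc)
  also have "\<dots> = sc ?u (Id ?A)" using sc_right[of ?u "Id ?A"] by (simp add: De_Ep)
  finally show ?thesis unfolding frob_def using u by simp
qed

end


context symmetric_monoidal_category
begin

text \<open>\<open>h\<close> is the adjoint of \<open>f\<close> with respect to the two pairings, up to scalars: \<open>h(y) = d(y \<otimes> f(E\<^sub>1)) E\<^sub>2\<close>.\<close>

lemma frob_dual_map:
  assumes E: "frob X E b u" and F: "frob Y F d v" and [simp]: "arr f" "dm f = X" "cd f = Y"
  defines "h \<equiv> Lu X \<bullet> (d \<star> Id X) \<bullet> As' Y Y X \<bullet> (Id Y \<star> ((f \<star> Id X) \<bullet> E)) \<bullet> Ru' Y"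
  shows "arr h" "dm h = Y" "cd h = X" "b \<bullet> (h \<star> Id X) = sc u (d \<bullet> (Id Y \<star> f))"
    "(Id Y \<star> h) \<bullet> F = sc v ((f \<star> Id X) \<bullet> E)"
proof -
  note [simp] = frobD(1-9)[OF E] frobD(1-9)[OF F]
  show [simp]: "arr h" "dm h = Y" "cd h = X" by (simp_all add: h_def)
  let ?t = "d \<bullet> (Id Y \<star> f)" and ?x = "(f \<star> Id X) \<bullet> E"
  have h: "h = Lu X \<bullet> (?t \<star> Id X) \<bullet> As' Y X X \<bullet> (Id Y \<star> E) \<bullet> Ru' Y"
  proof -
    have "h = Lu X \<bullet> (d \<star> Id X) \<bullet> (As' Y Y X \<bullet> (Id Y \<star> (f \<star> Id X))) \<bullet> (Id Y \<star> E) \<bullet> Ru' Y"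
      by (simp add: h_def cmp_assoc tns_cmp2)
    also have "As' Y Y X \<bullet> (Id Y \<star> (f \<star> Id X)) = ((Id Y \<star> f) \<star> Id X) \<bullet> As' Y X X"
      using As'_nat[of "Id Y" f "Id X" Y Y X] by simp
    finally show ?thesis by (simp add: cmp_assoc tns_cmp2)
  qed
  let ?s = "(?t \<star> Id X) \<bullet> As' Y X X \<bullet> (Id Y \<star> E) \<bullet> Ru' Y"
  have "b \<bullet> (h \<star> Id X) = b \<bullet> (Lu X \<star> Id X) \<bullet> (?s \<star> Id X)" unfolding h by (simp add: tns_cmp)
  also have "\<dots> = (b \<bullet> Lu (X \<odot> X)) \<bullet> As \<one> X X \<bullet> (?s \<star> Id X)" by (simp add: cmp_assoc cmp_eq_assoc[OF Lu_tns])
  also have "b \<bullet> Lu (X \<odot> X) = Ru \<one> \<bullet> (Id \<one> \<star> b)" by (simp add: Lu_Ru[symmetric] Lu_nat)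
  also have "(Ru \<one> \<bullet> (Id \<one> \<star> b)) \<bullet> As \<one> X X \<bullet> (?s \<star> Id X) = sc u ?t"
  proof -
    have [simp]: "cd ?t = \<one>" by simp
    show ?thesis unfolding cmp_assoc[of "Ru \<one>"] by (rule frob_recover[OF E, of Y ?t, unfolded \<open>cd ?t = \<one>\<close>]) simp_all
  qed
  finally show "b \<bullet> (h \<star> Id X) = sc u (d \<bullet> (Id Y \<star> f))" .
  have "sc v ?x = (Id Y \<star> (Lu X \<bullet> (d \<star> Id X) \<bullet> As' Y Y X \<bullet> (Id Y \<star> ?x))) \<bullet> As Y Y \<one> \<bullet> (F \<star> Id \<one>) \<bullet> Ru' \<one>"
    using frob_transpose[OF F, of X ?x \<one>] by (simp add: Lu'_Ru')
  also have "(F \<star> Id \<one>) \<bullet> Ru' \<one> = Ru' (Y \<odot> Y) \<bullet> F" using Ru'_nat[of F "Y \<odot> Y"] by simp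
  also have "As Y Y \<one> \<bullet> Ru' (Y \<odot> Y) \<bullet> F = (Id Y \<star> Ru' Y) \<bullet> F"
    unfolding As'_Ru'[OF frobD(1)[OF F] frobD(1)[OF F], symmetric] by (simp add: cmp_assoc)
  finally show "(Id Y \<star> h) \<bullet> F = sc v ((f \<star> Id X) \<bullet> E)" by (simp add: h_def cmp_assoc tns_cmp2)
qed

lemma Mu_assoc_tns:
  assumes [simp]: "bimonoid \<C> A" "arr x" "arr y" "arr z" "cd x = und A" "cd y = und A" "cd z = und A"
  shows "Mu A \<bullet> ((Mu A \<bullet> (x \<star> y)) \<star> z) = Mu A \<bullet> (x \<star> (Mu A \<bullet> (y \<star> z))) \<bullet> As (dm x) (dm y) (dm z)"
proof -
  let ?A = "und A"
  have "Mu A \<bullet> ((Mu A \<bullet> (x \<star> y)) \<star> z) = (Mu A \<bullet> (Mu A \<star> Id ?A)) \<bullet> ((x \<star> y) \<star> z)" by (simp add: cmp_assoc tns_cmp)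
  also have "\<dots> = Mu A \<bullet> (Id ?A \<star> Mu A) \<bullet> (As ?A ?A ?A \<bullet> ((x \<star> y) \<star> z))" by (simp add: Mu_assoc cmp_assoc)
  finally show ?thesis by (simp add: As_nat tns_cmp2 cmp_assoc)
qed

lemma Mu_comm:
  assumes A: "bc_hopf_monoid \<C> A" and [simp]: "arr x" "arr y" "cd x = und A" "cd y = und A"
  shows "Mu A \<bullet> (x \<star> y) = Mu A \<bullet> (y \<star> x) \<bullet> Sy (dm x) (dm y)"
proof -
  note [simp] = bc_bim[OF A]
  have "Mu A \<bullet> (x \<star> y) = (Mu A \<bullet> Sy (und A) (und A)) \<bullet> (x \<star> y)" by (simp add: Mu_Sy[OF A])
  then show ?thesis by (simp add: Sy_nat cmp_assoc)
qed

text \<open>In elements, \<open>\<phi>(i(y) a v) = \<phi>(a i(y) v) = \<epsilon>(y) \<phi>(a v)\<close>.\<close>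

lemma invariant_pairing:
  assumes A: "bc_hopf_monoid \<C> A" and i: "bhom B A i" and [simp]: "arr \<phi>" "dm \<phi> = und A" "arr v" "dm v = V" "cd v = und A"
    and inv: "Mu A \<bullet> (v \<star> i) = Ru (und A) \<bullet> (v \<star> Ep B)"
  shows "(\<phi> \<bullet> Mu A \<bullet> (Id (und A) \<star> v)) \<bullet> (act A i \<star> Id V) = (\<phi> \<bullet> Mu A \<bullet> (Id (und A) \<star> v)) \<bullet> (triv B (und A) \<star> Id V)"
proof -
  let ?A = "und A" and ?B = "und B"
  note [simp] = bhom_simps[OF i]
  have [simp]: "V \<in> ob \<C>" using dm_ob[of v] by simp
  have "Mu A \<bullet> (i \<star> v) = Ru ?A \<bullet> (v \<star> Ep B) \<bullet> Sy ?B V" using Mu_comm[OF A, of i v] cmp_eq_assoc[OF inv] by (simp add: cmp_assoc)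
  also have "(v \<star> Ep B) \<bullet> Sy ?B V = Sy \<one> ?A \<bullet> (Ep B \<star> v)" using Sy_nat[of "Ep B" v \<one> ?A] by simp
  finally have iv: "Mu A \<bullet> (i \<star> v) = Lu ?A \<bullet> (Ep B \<star> v)" by (simp add: cmp_eq_assoc[OF Ru_Sy])
  have "Mu A \<bullet> (act A i \<star> v) = Mu A \<bullet> ((Mu A \<bullet> (Id ?A \<star> i)) \<star> v) \<bullet> (Sy ?B ?A \<star> Id V)"
    using Mu_comm[OF A, of i "Id ?A"] by (simp add: act_def tns_cmp cmp_assoc)
  also have "\<dots> = Mu A \<bullet> (Id ?A \<star> (Lu ?A \<bullet> (Ep B \<star> v))) \<bullet> As ?A ?B V \<bullet> (Sy ?B ?A \<star> Id V)"
    using cmp_eq_assoc[OF Mu_assoc_tns[of A "Id ?A" i v], of "Sy ?B ?A \<star> Id V"] iv by (simp add: cmp_assoc)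
  also have "\<dots> = Mu A \<bullet> (Id ?A \<star> Lu ?A) \<bullet> (As ?A \<one> ?A \<bullet> ((Id ?A \<star> Ep B) \<star> v)) \<bullet> (Sy ?B ?A \<star> Id V)"
    using As_nat[of "Id ?A" "Ep B" v ?A \<one> ?A] by (simp add: cmp_assoc tns_cmp2)
  also have "\<dots> = Mu A \<bullet> ((Ru ?A \<bullet> ((Id ?A \<star> Ep B) \<bullet> Sy ?B ?A)) \<star> v)"
    by (simp add: cmp_assoc cmp_eq_assoc[OF triangle'] tns_cmp2 tns_cmp)
  also have "(Id ?A \<star> Ep B) \<bullet> Sy ?B ?A = Sy \<one> ?A \<bullet> (Ep B \<star> Id ?A)" using Sy_nat[of "Ep B" "Id ?A" \<one> ?A] by simp
  also have "Ru ?A \<bullet> Sy \<one> ?A \<bullet> (Ep B \<star> Id ?A) = triv B ?A" by (simp add: triv_def cmp_eq_assoc[OF Ru_Sy])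
  finally have "Mu A \<bullet> (act A i \<star> v) = Mu A \<bullet> (triv B ?A \<star> v)" .
  then show ?thesis by (simp add: cmp_assoc tns_cmp)
qed

text \<open>
  By nondegeneracy it is enough to pair with \<open>a\<close>, and \<open>\<phi>(h(y) i(z) a)\<close> is a multiple of
  \<open>d(y \<otimes> f(i(z) a)) = \<epsilon>(z) d(y \<otimes> f(a))\<close>.
\<close>

lemma dual_map_invariant:
  assumes A: "bc_hopf_monoid \<C> A" and i: "bhom B A i" and f: "bhom A Q f" and z: "f \<bullet> act A i = f \<bullet> triv B (und A)"
    and fr: "frob (und A) E (\<phi> \<bullet> Mu A) u" and [simp]: "arr \<phi>" "dm \<phi> = und A" "cd \<phi> = \<one>"
    and [simp]: "arr h" "dm h = und Q" "cd h = und A" "arr d" "dm d = und Q \<odot> und Q" "cd d = \<one>"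
    and e: "\<phi> \<bullet> Mu A \<bullet> (h \<star> Id (und A)) = sc u (d \<bullet> (Id (und Q) \<star> f))"
  shows "Mu A \<bullet> (h \<star> i) = Ru (und A) \<bullet> (h \<star> Ep B)"
proof -
  let ?A = "und A" and ?B = "und B" and ?Q = "und Q" and ?b = "\<phi> \<bullet> Mu A"
  note [simp] = bhom_simps[OF i] bhom_simps[OF f] frobD(8,9)[OF fr]
  have flip: "?b \<bullet> (Id ?A \<star> x) = (?b \<bullet> (x \<star> Id ?A)) \<bullet> Sy ?A (dm x)" if [simp]: "arr x" "cd x = ?A" for x
    using Mu_comm[OF A, of "Id ?A" x] by (simp add: cmp_assoc)
  have 1: "?b \<bullet> (h \<star> act A i) = ?b \<bullet> (h \<star> triv B ?A)"
  proof -
    have *: "?b \<bullet> (h \<star> y) = sc u (d \<bullet> (Id ?Q \<star> (f \<bullet> y)))" if [simp]: "arr y" "cd y = ?A" for y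
    proof -
      have "?b \<bullet> (h \<star> y) = (\<phi> \<bullet> Mu A \<bullet> (h \<star> Id ?A)) \<bullet> (Id ?Q \<star> y)" by (simp add: cmp_assoc tns_cmp)
      then show ?thesis unfolding e by (simp add: sc_cmp cmp_assoc tns_cmp)
    qed
    show ?thesis using *[of "act A i"] *[of "triv B ?A"] z by simp
  qed
  have "?b \<bullet> ((Mu A \<bullet> (h \<star> i)) \<star> Id ?A) = (?b \<bullet> (h \<star> act A i)) \<bullet> As ?Q ?B ?A"
    using Mu_assoc_tns[of A h i "Id ?A"] by (simp add: act_def cmp_assoc)
  also have "\<dots> = ?b \<bullet> (Id ?A \<star> Lu ?A) \<bullet> ((h \<star> (Ep B \<star> Id ?A)) \<bullet> As ?Q ?B ?A)"
    unfolding 1 by (simp add: triv_def cmp_assoc tns_cmp2)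
  also have "(h \<star> (Ep B \<star> Id ?A)) \<bullet> As ?Q ?B ?A = As ?A \<one> ?A \<bullet> ((h \<star> Ep B) \<star> Id ?A)"
    using As_nat[of h "Ep B" "Id ?A" ?A \<one> ?A] by simp
  also have "?b \<bullet> (Id ?A \<star> Lu ?A) \<bullet> As ?A \<one> ?A \<bullet> ((h \<star> Ep B) \<star> Id ?A) = ?b \<bullet> ((Ru ?A \<bullet> (h \<star> Ep B)) \<star> Id ?A)"
    by (simp add: cmp_assoc cmp_eq_assoc[OF triangle'] tns_cmp tns_cmp2)
  finally have 2: "?b \<bullet> ((Mu A \<bullet> (h \<star> i)) \<star> Id ?A) = ?b \<bullet> ((Ru ?A \<bullet> (h \<star> Ep B)) \<star> Id ?A)" .
  show ?thesis by (rule frob_nondegenerate[OF fr, of _ "?Q \<odot> ?B"]) (use flip 2 in simp_all)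
qed

end

context hopf_setting
begin

interpretation op: hopf_setting "op_smc \<C>" by (rule op_hopf_setting)

text \<open>Costability makes kernels equalizers of coactions, and they remain so beside any object.\<close>

lemma kern_tensor_mono:
  assumes c: "kern Q N g J j" and [simp]: "V \<in> ob \<C>" "arr x" "arr y" "cd x = und J \<odot> V" "cd y = und J \<odot> V"
    and e: "(j \<star> Id V) \<bullet> x = (j \<star> Id V) \<bullet> y"
  shows "x = y"
proof -
  note [simp] = bch_simps[OF kern_bch(1)[OF c]] bch_simps[OF kern_bch(2)[OF c]]
  have c': "op.coker (op_bimon N) (op_bimon Q) (rv g) (op_bimon J) (rv j)" using c by (simp add: op_coker)
  have "rv x = rv y"
    by (rule op.tepi_cancel[OF _ op.coker_tepi(1)[OF c'], of _ V]) (use e in \<open>simp_all add: op_cmp op_tns op_struct op_arr\<close>)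
  then show ?thesis by simp
qed

lemma kern_lift_tns:
  assumes c: "kern Q N g J j" and h: "V \<in> ob \<C>" "arr w" "cd w = und Q \<odot> V"
    "(((g \<star> Id (und Q)) \<bullet> De Q) \<star> Id V) \<bullet> w = (((Et N \<star> Id (und Q)) \<bullet> Lu' (und Q)) \<star> Id V) \<bullet> w"
  shows "\<exists>w'. arr w' \<and> dm w' = dm w \<and> cd w' = und J \<odot> V \<and> (j \<star> Id V) \<bullet> w' = w"
proof -
  note [simp] = bch_simps[OF kern_bch(1)[OF c]] bch_simps[OF kern_bch(2)[OF c]] h(1-3)
  have c': "op.coker (op_bimon N) (op_bimon Q) (rv g) (op_bimon J) (rv j)" using c by (simp add: op_coker)
  obtain h' where h': "op.arr h'" "dm h' = und (op_bimon J) \<odot> V" "cd h' = cd (rv w)" "op.cmp h' (op.tns (rv j) (op.Id V)) = rv w"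
    using op.coker_quotient_factor_tns[OF c', of V "rv w"] h(4)
    by (auto simp add: op.act_def op.triv_def op_cmp op_tns op_struct op_struct' op_arr cmp_assoc)
  then have "arr (rv h')" "dm (rv h') = dm w" "cd (rv h') = und J \<odot> V" "(j \<star> Id V) \<bullet> rv h' = w"
    using rv_sel[of "rv h'"] by (simp_all add: op_cmp op_tns op_struct op_arr)
  then show ?thesis by blast
qed

end


context symmetric_monoidal_category
begin

lemma contr_post:
  assumes [simp]: "bimonoid \<C> A" "arr \<chi>" "dm \<chi> = und A" "cd \<chi> = \<one>" "arr \<phi>" "dm \<phi> = und A" "cd \<phi> = \<one>"
  shows "\<phi> \<bullet> contr A \<chi> = \<chi> \<bullet> Ru (und A) \<bullet> (Id (und A) \<star> \<phi>) \<bullet> De A"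
proof -
  have "\<phi> \<bullet> contr A \<chi> = Lu \<one> \<bullet> (\<chi> \<star> Id \<one>) \<bullet> (Id (und A) \<star> \<phi>) \<bullet> De A"
    using Lu_nat[of \<phi> \<one>, THEN cmp_eq_assoc, of "(\<chi> \<star> Id (und A)) \<bullet> De A", symmetric]
    by (simp add: contr_def cmp_assoc tns_cmp2)
  then show ?thesis
    unfolding Lu_Ru using Ru_nat[of \<chi> \<one>, THEN cmp_eq_assoc, of "(Id (und A) \<star> \<phi>) \<bullet> De A"] by (simp add: cmp_assoc)
qed

text \<open>Comparing counits, \<open>\<epsilon> \<circ> r = \<epsilon> \<circ> i \<circ> r\<close>, and the counit of \<open>\<chi>(a\<^sub>1) a\<^sub>2\<close> is \<open>\<chi>(a)\<close>.\<close>

lemma coun_contr: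
  assumes i: "bhom B A i" and [simp]: "arr r" "dm r = und A" "cd r = und B" "arr \<chi>" "dm \<chi> = und A" "cd \<chi> = \<one>"
    and ir: "i \<bullet> r = contr A \<chi>"
  shows "Ep B \<bullet> r = \<chi>"
proof -
  note [simp] = bhom_simps[OF i]
  have "Ep B \<bullet> r = Ep A \<bullet> i \<bullet> r" using cmp_eq_assoc[OF bhom_eqs(4)[OF i], of r] by simp
  then show ?thesis unfolding ir by (simp add: contr_post De_Ep)
qed

text \<open>In elements, \<open>\<chi>(a\<^sub>1) \<phi>(a\<^sub>2) = \<chi>(1) \<phi>(a)\<close>.\<close>

lemma ncoint_contr:
  assumes [simp]: "bimonoid \<C> A" and p: "ncoint A \<phi>" and [simp]: "arr \<chi>" "dm \<chi> = und A" "cd \<chi> = \<one>" "\<chi> \<bullet> Et A = Id \<one>"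
  shows "\<phi> \<bullet> contr A \<chi> = \<phi>"
  using cmp_eq_assoc[OF assms(6), of \<phi>] ncoint_simps[OF p] by (simp add: contr_post ncoint_eqs(2)[OF p])

text \<open>In elements, \<open>r(\<sigma>) y = r(\<sigma> i(y)) = \<epsilon>(y) r(\<sigma>)\<close>.\<close>

lemma right_int_integral:
  assumes i: "bhom B A i" and s: "nint A \<sigma>" and r: "right_int B A i r"
  shows "Mu B \<bullet> ((r \<bullet> \<sigma>) \<star> Id (und B)) = Ru (und B) \<bullet> ((r \<bullet> \<sigma>) \<star> Ep B)"
proof -
  let ?A = "und A" and ?B = "und B"
  note [simp] = bhom_simps[OF i] nint_simps[OF s] right_int_simps[OF r]
  have "Mu B \<bullet> ((r \<bullet> \<sigma>) \<star> Id ?B) = (Mu B \<bullet> (r \<star> Id ?B)) \<bullet> (\<sigma> \<star> Id ?B)" by (simp add: cmp_assoc tns_cmp)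
  also have "\<dots> = r \<bullet> (Mu A \<bullet> (\<sigma> \<star> Id ?A)) \<bullet> (Id \<one> \<star> i)" unfolding right_int_eqs(1)[OF r] by (simp add: cmp_assoc tns_cmp)
  also have "\<dots> = (r \<bullet> Ru ?A) \<bullet> (\<sigma> \<star> Ep B)" unfolding nint_eqs(1)[OF s] by (simp add: cmp_assoc tns_cmp bhom_eqs(4)[OF i])
  also have "\<dots> = Ru ?B \<bullet> ((r \<bullet> \<sigma>) \<star> Ep B)" using Ru_nat[of r ?B, THEN cmp_eq_assoc, of "\<sigma> \<star> Ep B"] by (simp add: cmp_assoc tns_cmp)
  finally show ?thesis .
qed

lemma nint_section:
  assumes E: "bc_hopf_monoid \<C> E" and p: "bhom E I p" and r: "right_int E I p s" and ps: "p \<bullet> s = Id (und I)" and t: "nint I \<tau>"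
  shows "nint E (s \<bullet> \<tau>)"
proof -
  note [simp] = bhom_simps[OF p] nint_simps[OF t] right_int_simps[OF r]
  have "Mu E \<bullet> ((s \<bullet> \<tau>) \<star> Id (und E)) = (Mu E \<bullet> (s \<star> Id (und E))) \<bullet> (\<tau> \<star> Id (und E))" by (simp add: cmp_assoc tns_cmp)
  also have "\<dots> = s \<bullet> (Mu I \<bullet> (\<tau> \<star> Id (und I))) \<bullet> (Id \<one> \<star> p)" unfolding right_int_eqs(1)[OF r] by (simp add: cmp_assoc tns_cmp)
  also have "\<dots> = (s \<bullet> Ru (und I)) \<bullet> (\<tau> \<star> Ep E)" unfolding nint_eqs(1)[OF t] by (simp add: cmp_assoc tns_cmp bhom_eqs(4)[OF p])
  also have "\<dots> = Ru (und E) \<bullet> ((s \<bullet> \<tau>) \<star> Ep E)"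
    using Ru_nat[of s "und E", THEN cmp_eq_assoc, of "\<tau> \<star> Ep E"] by (simp add: cmp_assoc tns_cmp)
  finally have "Mu E \<bullet> ((s \<bullet> \<tau>) \<star> Id (und E)) = Ru (und E) \<bullet> ((s \<bullet> \<tau>) \<star> Ep E)" .
  moreover have "Ep E \<bullet> s \<bullet> \<tau> = Id \<one>"
    using cmp_eq_assoc[OF ps, of \<tau>] cmp_eq_assoc[OF bhom_eqs(4)[OF p], of "s \<bullet> \<tau>"] by (simp add: cmp_assoc)
  ultimately show ?thesis by (intro nintI[OF E]) simp_all
qed

end

context hopf_setting
begin

text \<open>
  Let \<open>i : B \<rightarrow> A\<close> be the kernel, \<open>g : Q \<rightarrow> N\<close> the cokernel and \<open>f = j \<circ> \<pi>\<close> the image factorization of \<open>f\<close>, through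
  \<open>J\<close>.  Let \<open>V\<close> be the object of elements \<open>v\<close> of \<open>A\<close> with \<open>v i(y) = \<epsilon>(y) v\<close>.  The pairing \<open>\<phi>(a v)\<close> on \<open>A \<otimes> V\<close>
  factors through an evaluation \<open>J \<otimes> V \<rightarrow> \<one>\<close>.  Conversely, the adjoint \<open>h\<close> of \<open>f\<close> takes values in \<open>V\<close>; so the copairing
  of \<open>Q\<close> yields an element \<open>w\<close> of \<open>Q \<otimes> V\<close>.  In \<open>Q \<otimes> A\<close> it becomes a multiple of the image of the copairing of \<open>A\<close>
  under \<open>f\<close>, and therefore lies in \<open>J \<otimes> V\<close>.  The evaluation of \<open>w\<close> is the inverse of \<open>\<langle>f\<rangle>\<close> up to volumes:
  if \<open>\<nu> : J \<rightarrow> A\<close> is induced by translation by the integral \<open>r(\<sigma>)\<close> of \<open>B\<close>, whose counit is \<open>\<langle>f\<rangle>\<close>, then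
  \<open>\<langle>f\<rangle>\<close> times the evaluation is \<open>\<phi>(\<nu>(x) v)\<close>, and on \<open>w\<close> this is computed from \<open>S(\<sigma>\<^sub>1) \<sigma>\<^sub>2 = \<epsilon>(\<sigma>)\<close>.
\<close>

theorem bracket_invertible:
  assumes f: "bch A Q f" and VA: "unit_volume A \<sigma> \<phi>" and VQ: "unit_volume Q \<tau> \<psi>"
  shows "inv_scal (\<psi> \<bullet> f \<bullet> \<sigma>)"
proof -
  have A: "bc_hopf_monoid \<C> A" and s: "nint A \<sigma>" and p: "ncoint A \<phi>" and u: "inv_scal (\<phi> \<bullet> \<sigma>)"
    and Q: "bc_hopf_monoid \<C> Q" and t: "nint Q \<tau>" and q: "ncoint Q \<psi>" and v: "inv_scal (\<psi> \<bullet> \<tau>)"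
    using VA VQ unfolding unit_volume_def by blast+
  let ?A = "und A" and ?Q = "und Q" and ?u = "\<phi> \<bullet> \<sigma>" and ?v = "\<psi> \<bullet> \<tau>" and ?c = "\<psi> \<bullet> f \<bullet> \<sigma>"
  note [simp] = bch_simps[OF f] nint_simps[OF s] nint_simps[OF t] ncoint_simps[OF p] ncoint_simps[OF q]
    inv_scal_scal[OF u] inv_scal_scal[OF v]
  have c [simp]: "scal ?c" unfolding scal_def by simp
  obtain S where S [simp]: "arr S" "dm S = ?A" "cd S = ?A" and SA: "Mu A \<bullet> (S \<star> Id ?A) \<bullet> De A = Et A \<bullet> Ep A"
    by (rule antipodeE[OF A])
  obtain R where R [simp]: "arr R" "dm R = ?Q" "cd R = ?Q" and RQ: "Mu Q \<bullet> (R \<star> Id ?Q) \<bullet> De Q = Et Q \<bullet> Ep Q"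
    by (rule antipodeE[OF Q])
  define E where "E = (S \<star> Id ?A) \<bullet> De A \<bullet> \<sigma>"
  define F where "F = (R \<star> Id ?Q) \<bullet> De Q \<bullet> \<tau>"
  have EA: "frob ?A E (\<phi> \<bullet> Mu A) ?u" unfolding E_def by (rule hopf_frobenius[OF A s p u S SA])
  have FQ: "frob ?Q F (\<psi> \<bullet> Mu Q) ?v" unfolding F_def by (rule hopf_frobenius[OF Q t q v R RQ])
  note [simp] = frobD(1-7)[OF EA] frobD(1-7)[OF FQ]
  obtain B i where i: "kern A Q f B i" using kern_exists[OF f] by blast
  obtain N g where g: "coker A Q f N g" using coker_exists[OF f] by blast
  obtain J j pi where j: "kern Q N g J j" and pi: "coker B A i J pi" and jpi: "j \<bullet> pi = f" by (rule image_factor[OF i g])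
  note [simp] = bch_simps[OF kern_bch(2)[OF i]] bch_simps[OF coker_bch(2)[OF g]] bch_simps[OF kern_bch(2)[OF j]]
    bch_simps[OF coker_bch(2)[OF pi]]
  let ?B = "und B" and ?N = "und N" and ?J = "und J"
  obtain r where r: "right_int B A i r" and ri: "r \<bullet> i = Id ?B" and ir: "i \<bullet> r = contr A (\<psi> \<bullet> f)"
    by (rule integral_retraction[OF i q])
  obtain s' where s': "right_int Q N g s'" and gs: "g \<bullet> s' = Id ?N" by (rule integral_section[OF g s])
  note [simp] = right_int_simps[OF r] right_int_simps[OF s']
  \<comment> \<open>Invariance under \<open>B\<close> is expressed with elements of \<open>A\<close> through the retraction \<open>r\<close>, since the equalizer requires a pairing.\<close>
  let ?t1 = "Mu A \<bullet> (Id ?A \<star> (i \<bullet> r))" and ?t2 = "Ru ?A \<bullet> (Id ?A \<star> (Ep B \<bullet> r))"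
  have pre: "arr ?t1" "dm ?t1 = ?A \<odot> ?A" "cd ?t1 = ?A" "arr ?t2" "dm ?t2 = ?A \<odot> ?A" "cd ?t2 = ?A" by simp_all
  have oA: "?A \<in> ob \<C>" by simp
  obtain V io where [simp]: "arr io" "dm io = V" "cd io = ?A" and io: "?t1 \<bullet> (io \<star> Id ?A) = ?t2 \<bullet> (io \<star> Id ?A)"
    and mono: "\<And>W x y. arr x \<Longrightarrow> arr y \<Longrightarrow> dm x = W \<Longrightarrow> dm y = W \<Longrightarrow> cd x = V \<Longrightarrow> cd y = V \<Longrightarrow> io \<bullet> x = io \<bullet> y \<Longrightarrow> x = y"
    and univ: "\<And>v. arr v \<Longrightarrow> cd v = ?A \<Longrightarrow> ?t1 \<bullet> (v \<star> Id ?A) = ?t2 \<bullet> (v \<star> Id ?A) \<Longrightarrow> \<exists>w. arr w \<and> dm w = dm v \<and> cd w = V \<and> io \<bullet> w = v"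
    by (rule frob_equalizer[OF equalizers EA oA pre]) (rule that)
  have [simp]: "V \<in> ob \<C>" using dm_ob[of io] by simp
  have inv: "Mu A \<bullet> (io \<star> i) = Ru ?A \<bullet> (io \<star> Ep B)"
  proof -
    have "(?t1 \<bullet> (io \<star> Id ?A)) \<bullet> (Id V \<star> i) = (?t2 \<bullet> (io \<star> Id ?A)) \<bullet> (Id V \<star> i)" unfolding io ..
    then show ?thesis by (simp add: cmp_assoc tns_cmp ri)
  qed
  define h where "h = Lu ?A \<bullet> ((\<psi> \<bullet> Mu Q) \<star> Id ?A) \<bullet> As' ?Q ?Q ?A \<bullet> (Id ?Q \<star> ((f \<star> Id ?A) \<bullet> E)) \<bullet> Ru' ?Q"
  have [simp]: "arr h" "dm h = ?Q" "cd h = ?A" unfolding h_def by (rule frob_dual_map(1-3)[OF EA FQ]; simp)+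
  have hE: "(\<phi> \<bullet> Mu A) \<bullet> (h \<star> Id ?A) = sc ?u ((\<psi> \<bullet> Mu Q) \<bullet> (Id ?Q \<star> f))" "(Id ?Q \<star> h) \<bullet> F = sc ?v ((f \<star> Id ?A) \<bullet> E)"
    unfolding h_def by (rule frob_dual_map(4,5)[OF EA FQ]; simp)+
  have fact: "f \<bullet> act A i = f \<bullet> triv B ?A" by (rule hom_act[of B A i Q f, OF _ _ kern_zero[OF i]]) simp_all
  have hinv: "Mu A \<bullet> (h \<star> i) = Ru ?A \<bullet> (h \<star> Ep B)"
    by (rule dual_map_invariant[of A B i Q f, OF A _ _ fact EA, of h "\<psi> \<bullet> Mu Q"]) (use hE(1) in \<open>simp_all add: cmp_assoc\<close>)
  have "?t1 \<bullet> (h \<star> Id ?A) = (Mu A \<bullet> (h \<star> i)) \<bullet> (Id ?Q \<star> r)" "?t2 \<bullet> (h \<star> Id ?A) = (Ru ?A \<bullet> (h \<star> Ep B)) \<bullet> (Id ?Q \<star> r)"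
    by (simp_all add: cmp_assoc tns_cmp)
  then obtain hV where [simp]: "arr hV" "dm hV = ?Q" "cd hV = V" and hV: "io \<bullet> hV = h"
    using univ[of h] hinv by auto
  define w where "w = (Id ?Q \<star> hV) \<bullet> F"
  have [simp]: "arr w" "dm w = \<one>" "cd w = ?Q \<odot> V" by (simp_all add: w_def)
  have iow: "(Id ?Q \<star> io) \<bullet> w = sc ?v ((f \<star> Id ?A) \<bullet> E)" unfolding hE(2)[symmetric] by (simp add: w_def tns_cmp2 hV)
  \<comment> \<open>Tensoring with \<open>N \<otimes> Q\<close> preserves the monomorphism \<open>V \<rightarrow> A\<close>, because \<open>Q\<close> is a Frobenius object and \<open>N\<close> a retract of
    \<open>Q\<close>.  So the coinvariance of \<open>w\<close> under \<open>N\<close> may be tested in \<open>N \<otimes> Q \<otimes> A\<close>, where it holds since \<open>g \<circ> f\<close> is trivial.\<close>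
  have lift: "(((g \<star> Id ?Q) \<bullet> De Q) \<star> Id V) \<bullet> w = (((Et N \<star> Id ?Q) \<bullet> Lu' ?Q) \<star> Id V) \<bullet> w"
    (is "?l = ?r")
  proof -
    have 1: "(Id (?N \<odot> ?Q) \<star> io) \<bullet> (y \<star> Id V) \<bullet> w = sc ?v (((y \<bullet> f) \<star> Id ?A) \<bullet> E)"
      if [simp]: "arr y" "dm y = ?Q" "cd y = ?N \<odot> ?Q" for y
    proof -
      have "(Id (?N \<odot> ?Q) \<star> io) \<bullet> (y \<star> Id V) \<bullet> w = (y \<star> Id ?A) \<bullet> (Id ?Q \<star> io) \<bullet> w" by (simp add: tns_cmp2)
      then show ?thesis unfolding iow by (simp add: cmp_sc tns_cmp2)
    qed
    have "((g \<star> Id ?Q) \<bullet> De Q) \<bullet> f = ((g \<bullet> f) \<star> f) \<bullet> De A" by (simp add: cmp_assoc bhom_eqs(3)[of A Q f] tns_cmp2)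
    also have "\<dots> = (Et N \<star> f) \<bullet> (Lu' ?A \<bullet> Lu ?A) \<bullet> (Ep A \<star> Id ?A) \<bullet> De A" by (simp add: coker_zero[OF g] tns_cmp2)
    also have "\<dots> = (Et N \<star> f) \<bullet> Lu' ?A \<bullet> (Lu ?A \<bullet> (Ep A \<star> Id ?A) \<bullet> De A)" by (simp only: cmp_assoc)
    also have "\<dots> = ((Et N \<star> Id ?Q) \<bullet> Lu' ?Q) \<bullet> f" by (simp add: De_Ep Lu'_nat tns_cmp2 cmp_assoc)
    finally have 2: "((g \<star> Id ?Q) \<bullet> De Q) \<bullet> f = ((Et N \<star> Id ?Q) \<bullet> Lu' ?Q) \<bullet> f" .
    have e: "(Id (?N \<odot> ?Q) \<star> io) \<bullet> ?l = (Id (?N \<odot> ?Q) \<star> io) \<bullet> ?r"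
      using 1[of "(g \<star> Id ?Q) \<bullet> De Q"] 1[of "(Et N \<star> Id ?Q) \<bullet> Lu' ?Q"] 2 by simp
    have As: "(Id ?N \<star> (Id ?Q \<star> io)) \<bullet> As ?N ?Q V \<bullet> z = As ?N ?Q ?A \<bullet> (Id (?N \<odot> ?Q) \<star> io) \<bullet> z" for z
      using As_nat[of "Id ?N" "Id ?Q" io ?N ?Q ?A, THEN cmp_eq_assoc, of z] by (simp add: cmp_assoc)
    have "(Id ?Q \<star> (Id ?Q \<star> io)) \<bullet> (s' \<star> Id (?Q \<odot> V)) \<bullet> As ?N ?Q V \<bullet> z
      = (s' \<star> Id (?Q \<odot> ?A)) \<bullet> As ?N ?Q ?A \<bullet> (Id (?N \<odot> ?Q) \<star> io) \<bullet> z" for z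
      unfolding As[symmetric] by (simp add: tns_cmp2)
    then have e2: "(Id ?Q \<star> (Id ?Q \<star> io)) \<bullet> (s' \<star> Id (?Q \<odot> V)) \<bullet> As ?N ?Q V \<bullet> ?l
      = (Id ?Q \<star> (Id ?Q \<star> io)) \<bullet> (s' \<star> Id (?Q \<odot> V)) \<bullet> As ?N ?Q V \<bullet> ?r" using e by simp
    have m2: "x = y" if xy: "arr x" "arr y" "dm x = Y" "dm y = Y" "cd x = ?Q \<odot> V" "cd y = ?Q \<odot> V" "(Id ?Q \<star> io) \<bullet> x = (Id ?Q \<star> io) \<bullet> y" for Y x y
      by (rule frob_mono[OF FQ, where m = io and V = V and x = x and y = y and Y = Y]) (use xy mono in simp_all)
    have "(s' \<star> Id (?Q \<odot> V)) \<bullet> As ?N ?Q V \<bullet> ?l = (s' \<star> Id (?Q \<odot> V)) \<bullet> As ?N ?Q V \<bullet> ?r"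
      by (rule frob_mono[OF FQ _ _ m2 _ _ _ _ _ _ e2]) simp_all
    then have "(g \<star> Id (?Q \<odot> V)) \<bullet> (s' \<star> Id (?Q \<odot> V)) \<bullet> As ?N ?Q V \<bullet> ?l = (g \<star> Id (?Q \<odot> V)) \<bullet> (s' \<star> Id (?Q \<odot> V)) \<bullet> As ?N ?Q V \<bullet> ?r"
      by simp
    then have "As ?N ?Q V \<bullet> ?l = As ?N ?Q V \<bullet> ?r" by (simp add: tns_cmp2 gs)
    then have "As' ?N ?Q V \<bullet> As ?N ?Q V \<bullet> ?l = As' ?N ?Q V \<bullet> As ?N ?Q V \<bullet> ?r" by simp
    then show ?thesis by simp
  qed
  obtain w2 where [simp]: "arr w2" "dm w2 = \<one>" "cd w2 = ?J \<odot> V" and w2: "(j \<star> Id V) \<bullet> w2 = w"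
    using kern_lift_tns[OF j _ _ _ lift] by auto
  have iow2: "(Id ?J \<star> io) \<bullet> w2 = sc ?v ((pi \<star> Id ?A) \<bullet> E)"
  proof (rule kern_tensor_mono[OF j, of ?A])
    have "(j \<star> Id ?A) \<bullet> (Id ?J \<star> io) \<bullet> w2 = (Id ?Q \<star> io) \<bullet> (j \<star> Id V) \<bullet> w2" by (simp add: tns_cmp2)
    then show "(j \<star> Id ?A) \<bullet> (Id ?J \<star> io) \<bullet> w2 = (j \<star> Id ?A) \<bullet> sc ?v ((pi \<star> Id ?A) \<bullet> E)"
      unfolding w2 iow by (simp add: cmp_sc tns_cmp2 jpi)
  qed simp_all
  let ?h = "\<phi> \<bullet> Mu A \<bullet> (Id ?A \<star> io)"
  have hi: "?h \<bullet> (act A i \<star> Id V) = ?h \<bullet> (triv B ?A \<star> Id V)"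
    by (rule invariant_pairing[OF A]) (simp_all add: inv)
  obtain ev where [simp]: "arr ev" "dm ev = ?J \<odot> V" "cd ev = \<one>" and ev: "ev \<bullet> (pi \<star> Id V) = ?h"
    using coker_quotient_factor_tns[OF pi _ _ _ hi] by auto
  let ?\<tau> = "r \<bullet> \<sigma>"
  have Er: "Ep B \<bullet> r = \<psi> \<bullet> f" by (rule coun_contr[of B A i]) (simp_all add: ir)
  have tint: "Mu B \<bullet> (?\<tau> \<star> Id ?B) = Ru ?B \<bullet> (?\<tau> \<star> Ep B)" by (rule right_int_integral[OF _ s r]) simp
  let ?L = "ltrans A (i \<bullet> ?\<tau>)"
  have La: "?L \<bullet> act A i = ?L \<bullet> triv B ?A" by (rule ltrans_act[of B A i ?\<tau>, OF _ _ _ _ tint]) simp_all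
  obtain nu where [simp]: "arr nu" "dm nu = ?J" "cd nu = ?A" and nu: "nu \<bullet> pi = ?L"
    using coker_quotient_factor[OF pi _ _ La] by auto
  have cev: "\<phi> \<bullet> Mu A \<bullet> (nu \<star> io) = sc ?c ev"
  proof (rule tepi_cancel[OF _ coker_tepi(1)[OF pi], of _ V])
    have "(\<phi> \<bullet> Mu A \<bullet> (nu \<star> io)) \<bullet> (pi \<star> Id V) = ?h \<bullet> (?L \<star> Id V)" by (simp add: cmp_assoc tns_cmp nu)
    also have "?L = act A i \<bullet> (?\<tau> \<star> Id ?A) \<bullet> Lu' ?A" by (simp add: act_Lu'[of B A i])
    also have "?h \<bullet> ((act A i \<bullet> (?\<tau> \<star> Id ?A) \<bullet> Lu' ?A) \<star> Id V) = (?h \<bullet> (act A i \<star> Id V)) \<bullet> (((?\<tau> \<star> Id ?A) \<bullet> Lu' ?A) \<star> Id V)"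
      by (simp add: cmp_assoc tns_cmp)
    also have "\<dots> = ?h \<bullet> ((triv B ?A \<bullet> (?\<tau> \<star> Id ?A) \<bullet> Lu' ?A) \<star> Id V)" unfolding hi by (simp add: cmp_assoc tns_cmp)
    also have "triv B ?A \<bullet> (?\<tau> \<star> Id ?A) \<bullet> Lu' ?A = sc ?c (Id ?A)"
      using cmp_eq_assoc[OF Er, of \<sigma>] by (simp add: triv_def sc_def cmp_assoc tns_cmp2)
    also have "?h \<bullet> (sc ?c (Id ?A) \<star> Id V) = sc ?c ev \<bullet> (pi \<star> Id V)"
      using ev by (simp add: sc_tns cmp_sc sc_cmp)
    finally show "(\<phi> \<bullet> Mu A \<bullet> (nu \<star> io)) \<bullet> (pi \<star> Id V) = sc ?c ev \<bullet> (pi \<star> Id V)" .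
  qed simp_all
  have phD: "\<phi> \<bullet> i \<bullet> r = \<phi>"
    unfolding ir by (rule ncoint_contr[OF _ p]) (simp_all add: cmp_assoc bhom_eqs(2)[of A Q f])
  have MuE: "Mu A \<bullet> E = Et A"
  proof -
    have "Mu A \<bullet> E = (Mu A \<bullet> (S \<star> Id ?A) \<bullet> De A) \<bullet> \<sigma>" by (simp add: E_def cmp_assoc)
    then show ?thesis unfolding SA by (simp add: cmp_assoc)
  qed
  have LEt: "?L \<bullet> Et A = i \<bullet> ?\<tau>"
  proof -
    have "?L \<bullet> Et A = (Mu A \<bullet> (Id ?A \<star> Et A)) \<bullet> ((i \<bullet> ?\<tau>) \<star> Id \<one>) \<bullet> Ru' \<one>"
      by (simp add: ltrans_def cmp_assoc Lu'_nat tns_cmp2 Lu'_Ru')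
    also have "((i \<bullet> ?\<tau>) \<star> Id \<one>) \<bullet> Ru' \<one> = Ru' ?A \<bullet> i \<bullet> ?\<tau>" using Ru'_nat[of "i \<bullet> ?\<tau>" ?A] by simp
    finally show ?thesis by (simp add: Mu_Et)
  qed
  have sev: "scal (ev \<bullet> w2)" unfolding scal_def by simp
  have "?c \<bullet> (ev \<bullet> w2) = sc ?c ev \<bullet> w2" unfolding sc_scal[OF c sev, symmetric] by (rule sc_cmp[OF c, symmetric]) simp_all
  also have "\<dots> = \<phi> \<bullet> Mu A \<bullet> (nu \<star> Id ?A) \<bullet> (Id ?J \<star> io) \<bullet> w2" unfolding cev[symmetric] by (simp add: cmp_assoc tns_cmp2)
  also have "\<dots> = sc ?v (\<phi> \<bullet> (Mu A \<bullet> (?L \<star> Id ?A)) \<bullet> E)" unfolding iow2 by (simp add: cmp_sc tns_cmp2 nu cmp_assoc)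
  also have "(Mu A \<bullet> (?L \<star> Id ?A)) \<bullet> E = i \<bullet> r \<bullet> \<sigma>" by (simp add: ltrans_Mu cmp_assoc MuE LEt)
  also have "\<phi> \<bullet> i \<bullet> r \<bullet> \<sigma> = ?u" using cmp_eq_assoc[OF phD[folded cmp_assoc], of \<sigma>] by (simp add: cmp_assoc)
  also have "sc ?v ?u = ?v \<bullet> ?u" by (rule sc_scal) simp_all
  finally have "inv_scal (?c \<bullet> (ev \<bullet> w2))" using inv_scal_cmp[OF v u] by simp
  then show ?thesis by (rule inv_scal_factor[OF _ c sev])
qed

end


context hopf_setting
begin

interpretation op: hopf_setting "op_smc \<C>" by (rule op_hopf_setting)

lemma ncoint_retraction:
  assumes E: "bc_hopf_monoid \<C> E" and k: "bhom K E k" and r: "right_int K E k r" and rk: "r \<bullet> k = Id (und K)" and t: "ncoint K \<phi>"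
  shows "ncoint E (\<phi> \<bullet> r)"
proof -
  note [simp] = bhom_simps[OF k] ncoint_simps[OF t] right_int_simps[OF r]
  have "op.nint (op_bimon E) (op.cmp (rv r) (rv \<phi>))"
    by (rule op.nint_section[of _ "op_bimon K" "rv k"]) (use E k r t rk in \<open>simp_all add: op_bc_hopf op_bhom op_right_int op_cmp op_struct op_ncoint\<close>)
  then show ?thesis using op_ncoint[of E "\<phi> \<bullet> r"] by (simp add: op_cmp)
qed

text \<open>
  The retraction \<open>r\<close> of the kernel carries the integral of \<open>A\<close> to an integral with counit \<open>\<langle>f\<rangle>\<close>, which can be
  normalized; the cointegral of \<open>A\<close> restricts.  The inverse volume changes by the factor \<open>\<langle>f\<rangle>\<^sup>-\<^sup>1\<close>, since contraction with
  \<open>\<psi> \<circ> f\<close> preserves the cointegral of \<open>A\<close>.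
\<close>

lemma unit_volume_kernel:
  assumes f: "bch A Q f" and VA: "unit_volume A \<sigma> \<phi>" and VQ: "unit_volume Q \<tau> \<psi>" and i: "kern A Q f I i"
  shows "\<exists>\<sigma>' \<phi>'. unit_volume I \<sigma>' \<phi>'"
proof -
  have A: "bc_hopf_monoid \<C> A" and s: "nint A \<sigma>" and p: "ncoint A \<phi>" and u: "inv_scal (\<phi> \<bullet> \<sigma>)" and q: "ncoint Q \<psi>"
    using VA VQ unfolding unit_volume_def by blast+
  note [simp] = bch_simps[OF f] bch_simps[OF kern_bch(2)[OF i]] nint_simps[OF s] ncoint_simps[OF p] ncoint_simps[OF q]
  let ?I = "und I" and ?c = "\<psi> \<bullet> f \<bullet> \<sigma>"
  obtain r where r: "right_int I A i r" and ri: "r \<bullet> i = Id ?I" and ir: "i \<bullet> r = contr A (\<psi> \<bullet> f)"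
    by (rule integral_retraction[OF i q])
  note [simp] = right_int_simps[OF r]
  have c: "inv_scal ?c" by (rule bracket_invertible[OF f VA VQ])
  then obtain t where c' [simp]: "scal ?c" and t [simp]: "scal t" and tc: "t \<bullet> ?c = Id \<one>" by (rule inv_scalE)
  have Er: "Ep I \<bullet> r = \<psi> \<bullet> f" by (rule coun_contr[of I A i]) (simp_all add: ir)
  let ?s = "sc t (r \<bullet> \<sigma>)"
  have "Mu I \<bullet> (?s \<star> Id ?I) = Ru ?I \<bullet> (?s \<star> Ep I)"
    using right_int_integral[OF _ s r] by (simp add: sc_tns cmp_sc)
  moreover have "Ep I \<bullet> ?s = Id \<one>"
  proof -
    have "Ep I \<bullet> ?s = sc t ?c" using cmp_eq_assoc[OF Er, of \<sigma>] by (simp add: cmp_sc cmp_assoc)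
    also have "\<dots> = Id \<one>" unfolding sc_scal[OF t c'] by (rule tc)
    finally show ?thesis .
  qed
  ultimately have n: "nint I ?s" by (intro nintI) simp_all
  have phD: "\<phi> \<bullet> i \<bullet> r = \<phi>"
    unfolding ir by (rule ncoint_contr[OF _ p]) (simp_all add: cmp_assoc bhom_eqs(2)[of A Q f])
  have "(\<phi> \<bullet> i) \<bullet> ?s = sc t (\<phi> \<bullet> \<sigma>)"
    using cmp_eq_assoc[OF phD[folded cmp_assoc], of \<sigma>] by (simp add: cmp_sc cmp_assoc)
  also have "\<dots> = t \<bullet> (\<phi> \<bullet> \<sigma>)" by (rule sc_scal[OF t inv_scal_scal[OF u]])
  finally have v: "(\<phi> \<bullet> i) \<bullet> ?s = t \<bullet> (\<phi> \<bullet> \<sigma>)" .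
  have "inv_scal t" by (rule inv_scalI[OF t c']) (use tc scal_comm[OF t c'] in simp)
  then have "unit_volume I ?s (\<phi> \<bullet> i)"
    unfolding unit_volume_def v using n ncoint_restrict[OF i p] inv_scal_cmp[OF _ u] by simp
  then show ?thesis by blast
qed

text \<open>
  The integral is \<open>s(\<tau>)\<close> and the cointegral is \<open>\<phi> \<circ> r\<close>, for a section \<open>s\<close> of \<open>p\<close> and a retraction \<open>r\<close> of \<open>k\<close> given by
  the (co)integrals of \<open>K\<close> and \<open>I\<close>.  The inverse volume is the product of those of \<open>K\<close> and \<open>I\<close>, because
  \<open>r(k(\<sigma>) a) = \<epsilon>(r(a)) \<sigma> = \<psi>(p(a)) \<sigma>\<close>.
\<close>

lemma unit_volume_extension:
  assumes c: "coker K E k I p" and k: "kern E I p K k" and VK: "unit_volume K \<sigma> \<phi>" and VI: "unit_volume I \<tau> \<psi>"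
  shows "\<exists>\<sigma>' \<phi>'. unit_volume E \<sigma>' \<phi>'"
proof -
  have s: "nint K \<sigma>" and f: "ncoint K \<phi>" and u: "inv_scal (\<phi> \<bullet> \<sigma>)" and t: "nint I \<tau>" and g: "ncoint I \<psi>" and v: "inv_scal (\<psi> \<bullet> \<tau>)"
    using VK VI unfolding unit_volume_def by blast+
  note [simp] = bch_simps[OF coker_bch(1)[OF c]] bch_simps[OF coker_bch(2)[OF c]] nint_simps[OF s] nint_simps[OF t]
    ncoint_simps[OF f] ncoint_simps[OF g]
  let ?E = "und E" and ?K = "und K"
  obtain s' where s': "right_int E I p s'" "p \<bullet> s' = Id (und I)" and sp: "s' \<bullet> p = ltrans E (k \<bullet> \<sigma>)" by (rule integral_section[OF c s])
  obtain r where r: "right_int K E k r" "r \<bullet> k = Id ?K" and kr: "k \<bullet> r = contr E (\<psi> \<bullet> p)" by (rule integral_retraction[OF k g])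
  note [simp] = right_int_simps[OF s'(1)] right_int_simps[OF r(1)]
  have n: "nint E (s' \<bullet> \<tau>)" by (rule nint_section[of E I p]) (simp_all add: s' t)
  have m: "ncoint E (\<phi> \<bullet> r)" by (rule ncoint_retraction[of E K k]) (simp_all add: r f)
  have Er: "Ep K \<bullet> r = \<psi> \<bullet> p" by (rule coun_contr[of K E k]) (simp_all add: kr)
  have "r \<bullet> ltrans E (k \<bullet> \<sigma>) = r \<bullet> Mu E \<bullet> (Id ?E \<star> (k \<bullet> \<sigma>)) \<bullet> Ru' ?E"
    using cmp_eq_assoc[OF Mu_comm[of E "k \<bullet> \<sigma>" "Id ?E"], of "Lu' ?E"] by (simp add: ltrans_def cmp_assoc Sy_Lu')
  also have "\<dots> = (Mu K \<bullet> (r \<star> Id ?K)) \<bullet> (Id ?E \<star> \<sigma>) \<bullet> Ru' ?E" unfolding right_int_eqs(1)[OF r(1)] by (simp add: cmp_assoc tns_cmp2)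
  also have "\<dots> = (Mu K \<bullet> (Id ?K \<star> \<sigma>)) \<bullet> (r \<star> Id \<one>) \<bullet> Ru' ?E" by (simp add: cmp_assoc tns_cmp2)
  also have "\<dots> = (Lu ?K \<bullet> (Id \<one> \<star> \<sigma>)) \<bullet> ((\<psi> \<bullet> p) \<star> Id \<one>) \<bullet> Ru' ?E" unfolding nint_eqs(2)[OF s] by (simp add: cmp_assoc tns_cmp2 Er)
  also have "((\<psi> \<bullet> p) \<star> Id \<one>) \<bullet> Ru' ?E = Ru' \<one> \<bullet> \<psi> \<bullet> p" using Ru'_nat[of "\<psi> \<bullet> p" \<one>] by simp
  also have "(Lu ?K \<bullet> (Id \<one> \<star> \<sigma>)) \<bullet> Ru' \<one> \<bullet> \<psi> \<bullet> p = \<sigma> \<bullet> \<psi> \<bullet> p" by (simp add: Lu_nat cmp_assoc Lu_Ru)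
  finally have "(\<phi> \<bullet> r \<bullet> s') \<bullet> p = (\<phi> \<bullet> \<sigma> \<bullet> \<psi>) \<bullet> p" by (simp add: cmp_assoc sp)
  then have "\<phi> \<bullet> r \<bullet> s' = \<phi> \<bullet> \<sigma> \<bullet> \<psi>" by (rule tepi_epi) (simp_all add: coker_tepi[OF c])
  from cmp_eq_assoc[OF this[folded cmp_assoc], of \<tau>] have "(\<phi> \<bullet> r) \<bullet> (s' \<bullet> \<tau>) = (\<phi> \<bullet> \<sigma>) \<bullet> (\<psi> \<bullet> \<tau>)" by (simp add: cmp_assoc)
  then have "unit_volume E (s' \<bullet> \<tau>) (\<phi> \<bullet> r)" unfolding unit_volume_def using n m inv_scal_cmp[OF u v] by simp
  then show ?thesis by blast
qed

lemma kern_mono: "kern A B f K k \<Longrightarrow> mono_arr (Hopf_bc \<C>) K A (mor k)"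
  using H.kernel_mono unfolding kern_def by blast

lemma bch_homE:
  assumes "s \<in> hom (Hopf_bc \<C>) A B" obtains g where "bch A B g" "s = mor g"
  using assms that[of "mk (und A) s (und B)"] unfolding bch_mk by simp

lemma bch_monoI:
  assumes f: "bch A B f" and m: "\<And>W s t. bch W A s \<Longrightarrow> bch W A t \<Longrightarrow> f \<bullet> s = f \<bullet> t \<Longrightarrow> s = t"
  shows "mono_arr (Hopf_bc \<C>) A B (mor f)"
  unfolding mono_arr_def
proof (intro conjI allI ballI impI)
  show "mor f \<in> hom (Hopf_bc \<C>) A B" by (rule bch_mor[OF f])
  fix W s t assume st: "s \<in> hom (Hopf_bc \<C>) W A" "t \<in> hom (Hopf_bc \<C>) W A" and eq: "comp (Hopf_bc \<C>) (mor f) s = comp (Hopf_bc \<C>) (mor f) t"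
  obtain a b where a: "bch W A a" "s = mor a" and b: "bch W A b" "t = mor b" using bch_homE st by metis
  note [simp] = bch_simps[OF f] bch_simps[OF a(1)] bch_simps[OF b(1)]
  have "f \<bullet> a = f \<bullet> b" by (rule arr_eqI) (use eq a b in simp_all)
  then show "s = t" using m a b by blast
qed

lemma bch_monoD: "mono_arr (Hopf_bc \<C>) A B (mor f) \<Longrightarrow> bch A B f \<Longrightarrow> bch W A s \<Longrightarrow> bch W A t \<Longrightarrow> f \<bullet> s = f \<bullet> t \<Longrightarrow> s = t"
  by (metis H.monoD bch_mor mk_und mor_cmp_bch Hopf_bc_sel(4))

text \<open>
  Restricted to \<open>E\<close>, the morphism \<open>\<xi>\<close> takes values in \<open>K'\<close> and is annihilated by \<open>q\<close>; this is \<open>p\<close>.  Since \<open>E\<close> is the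
  preimage of the subobject \<open>I\<close> of the image \<open>J\<close> of \<open>\<xi>\<close>, it maps onto \<open>I\<close>.
\<close>

lemma kernel_of_composite:
  assumes k: "kern A B \<xi> K k" and q: "coker A B \<xi> Q q" and k': "kern B C \<xi>' K' k'"
    and e: "kern A C (\<xi>' \<bullet> \<xi>) E e" and i: "kern K' Q (q \<bullet> k') I i"
  obtains \<kappa> p where "kern E I p K \<kappa>" "coker K E \<kappa> I p"
proof -
  obtain J m x where m: "kern B Q q J m" and x: "coker K A k J x" and mx: "m \<bullet> x = \<xi>" by (rule image_factor[OF k q])
  note b = kern_bch(1)[OF k] kern_bch(2)[OF k] coker_bch(2)[OF q] kern_bch(1)[OF k'] kern_bch(2)[OF k'] kern_bch(2)[OF e]
    kern_bch(2)[OF i] kern_bch(2)[OF m] coker_bch(2)[OF x]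
  note [simp] = bch_simps[OF b(1)] bch_simps[OF b(2)] bch_simps[OF b(3)] bch_simps[OF b(4)] bch_simps[OF b(5)]
    bch_simps[OF b(6)] bch_simps[OF b(7)] bch_simps[OF b(8)] bch_simps[OF b(9)]
  have zero: "g \<bullet> Et Y \<bullet> Ep X = Et Z \<bullet> Ep X" if "bch Y Z g" for g X Y Z
    using cmp_eq_assoc[OF bhom_eqs(2)[OF bch_simps(3)[OF that]]] by simp
  have zero': "(Et Z \<bullet> Ep Y) \<bullet> g = Et Z \<bullet> Ep X" if "bch X Y g" for g X Y Z
    using bhom_eqs(4)[OF bch_simps(3)[OF that]] by (simp add: cmp_assoc)
  have ki: "bch I B (k' \<bullet> i)" by (rule bch_cmp[OF b(7,5)])
  have kim: "mono_arr (Hopf_bc \<C>) I B (mor (k' \<bullet> i))"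
    using H.mono_comp[OF kern_mono[OF i] kern_mono[OF k']] by simp
  \<comment> \<open>\<open>I\<close> is also a subobject of \<open>J\<close>, because \<open>q\<close> annihilates it.\<close>
  obtain h where h: "bch I J h" and mh: "m \<bullet> h = k' \<bullet> i"
    using kern_factor[OF m ki] kern_zero[OF i] by (auto simp: cmp_assoc)
  obtain p' where p': "bch E K' p'" and kp': "k' \<bullet> p' = \<xi> \<bullet> e"
    using kern_factor[OF k' bch_cmp[OF b(6,1)]] kern_zero[OF e] by (auto simp: cmp_assoc)
  have "(q \<bullet> k') \<bullet> p' = (q \<bullet> \<xi>) \<bullet> e" by (simp add: cmp_assoc kp')
  then have "(q \<bullet> k') \<bullet> p' = Et Q \<bullet> Ep E" by (simp add: coker_zero[OF q] zero'[OF b(6)])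
  then obtain p where p: "bch E I p" and ip: "i \<bullet> p = p'" using kern_factor[OF i p'] by blast
  have kip: "k' \<bullet> i \<bullet> p = \<xi> \<bullet> e" using kp' ip by simp
  note [simp] = bch_simps[OF h] bch_simps[OF p'] bch_simps[OF p]
  have "m \<bullet> (x \<bullet> e) = m \<bullet> (h \<bullet> p)" using kip cmp_eq_assoc[OF mh, of p] cmp_eq_assoc[OF mx, of e] by (simp add: cmp_assoc)
  then have sq: "x \<bullet> e = h \<bullet> p" by (rule kern_unique[OF m bch_cmp[OF b(6,9)] bch_cmp[OF p h]])
  have epi: "epi_arr (Hopf_bc \<C>) E I (mor p)"
  proof (rule H.pullback_epi[of A J "mor x" I "mor h" E "mor e"])
    show "epi_arr (Hopf_bc \<C>) A J (mor x)" using H.cokernel_epi x unfolding coker_def by blast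
    show "mono_arr (Hopf_bc \<C>) I J (mor h)"
    proof (rule bch_monoI[OF h])
      fix W s t assume st: "bch W I s" "bch W I t" "h \<bullet> s = h \<bullet> t"
      have "(k' \<bullet> i) \<bullet> s = (k' \<bullet> i) \<bullet> t" unfolding mh[symmetric] by (simp add: cmp_assoc st(3))
      then show "s = t" by (rule bch_monoD[OF kim ki st(1,2)])
    qed
    show "mono_arr (Hopf_bc \<C>) E A (mor e)" by (rule kern_mono[OF e])
    show "mor p \<in> hom (Hopf_bc \<C>) E I" by (rule bch_mor[OF p])
    show "comp (Hopf_bc \<C>) (mor x) (mor e) = comp (Hopf_bc \<C>) (mor h) (mor p)" using mor_eq[OF sq] by simp
    fix W t t' assume t: "t \<in> hom (Hopf_bc \<C>) W A" "t' \<in> hom (Hopf_bc \<C>) W I" "comp (Hopf_bc \<C>) (mor x) t = comp (Hopf_bc \<C>) (mor h) t'"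
    obtain y z where y: "bch W A y" "t = mor y" and z: "bch W I z" "t' = mor z" using t bch_homE by metis
    note [simp] = bch_simps[OF y(1)] bch_simps[OF z(1)]
    have xt: "x \<bullet> y = h \<bullet> z" by (rule arr_eqI) (use t(3) y z in simp_all)
    have "\<xi> \<bullet> y = k' \<bullet> i \<bullet> z" using cmp_eq_assoc[OF mx, of y] cmp_eq_assoc[OF mh, of z] xt by (simp add: cmp_assoc)
    then have "(\<xi>' \<bullet> \<xi>) \<bullet> y = (\<xi>' \<bullet> k') \<bullet> i \<bullet> z" by (simp add: cmp_assoc)
    also have "\<dots> = Et C \<bullet> Ep W" unfolding kern_zero[OF k'] by (rule zero'[OF bch_cmp[OF z(1) b(7)]])
    finally obtain u where u: "bch W E u" "e \<bullet> u = y" using kern_factor[OF e y(1)] by blast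
    then show "\<exists>u. u \<in> hom (Hopf_bc \<C>) W E \<and> comp (Hopf_bc \<C>) (mor e) u = t"
      using bch_mor[OF u(1)] mor_cmp_bch[OF u(1) b(6)] y(2) by auto
  qed
  have "(\<xi>' \<bullet> \<xi>) \<bullet> k = Et C \<bullet> Ep K" by (simp add: cmp_assoc kern_zero[OF k] zero[OF b(4)])
  then obtain \<kappa> where ka: "bch K E \<kappa>" and eka: "e \<bullet> \<kappa> = k" using kern_factor[OF e b(2)] by blast
  note [simp] = bch_simps[OF ka]
  have "(k' \<bullet> i) \<bullet> (p \<bullet> \<kappa>) = \<xi> \<bullet> k" using cmp_eq_assoc[OF kip[folded cmp_assoc], of \<kappa>] eka by (simp add: cmp_assoc)
  then have "is_zero_arr (Hopf_bc \<C>) K B (comp (Hopf_bc \<C>) (mor (k' \<bullet> i)) (mor (p \<bullet> \<kappa>)))"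
    unfolding Hopf_bc_sel(4) mor_cmp_bch[OF bch_cmp[OF ka p] ki, symmetric] zero_bch[OF bch_cmp[OF bch_cmp[OF ka p] ki]]
    using kern_zero[OF k] by simp
  then have "is_zero_arr (Hopf_bc \<C>) K I (mor (p \<bullet> \<kappa>))"
    by (rule H.mono_zero[OF kim bch_mor[OF bch_cmp[OF ka p]]])
  have "is_kernel (Hopf_bc \<C>) E I (mor p) K (mor \<kappa>)"
  proof (rule H.kernelI)
    show "mor p \<in> hom (Hopf_bc \<C>) E I" by (rule bch_mor[OF p])
    show "is_zero_arr (Hopf_bc \<C>) K I (comp (Hopf_bc \<C>) (mor p) (mor \<kappa>))"
      using \<open>is_zero_arr (Hopf_bc \<C>) K I (mor (p \<bullet> \<kappa>))\<close> by simp
    show "mono_arr (Hopf_bc \<C>) K E (mor \<kappa>)"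
    proof (rule bch_monoI[OF ka])
      fix W s t assume st: "bch W K s" "bch W K t" "\<kappa> \<bullet> s = \<kappa> \<bullet> t"
      have "k \<bullet> s = k \<bullet> t" unfolding eka[symmetric] by (simp add: cmp_assoc st(3))
      then show "s = t" by (rule kern_unique[OF k st(1,2)])
    qed
    fix W t assume t: "t \<in> hom (Hopf_bc \<C>) W E" and z: "is_zero_arr (Hopf_bc \<C>) W I (comp (Hopf_bc \<C>) (mor p) t)"
    obtain y where y: "bch W E y" "t = mor y" using bch_homE[OF t] .
    note [simp] = bch_simps[OF y(1)]
    have "p \<bullet> y = Et I \<bullet> Ep W" using z zero_bch[OF bch_cmp[OF y(1) p]] y(2) by simp
    then have "(k' \<bullet> i) \<bullet> p \<bullet> y = Et B \<bullet> Ep W" using zero[OF ki] by simp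
    then have "\<xi> \<bullet> e \<bullet> y = Et B \<bullet> Ep W" using cmp_eq_assoc[OF kip[folded cmp_assoc], of y] by (simp add: cmp_assoc)
    then obtain w where w: "bch W K w" "k \<bullet> w = e \<bullet> y" using kern_factor[OF k bch_cmp[OF y(1) b(6)]] by blast
    have "e \<bullet> (\<kappa> \<bullet> w) = e \<bullet> y" using w(2) cmp_eq_assoc[OF eka, of w] by simp
    then have "\<kappa> \<bullet> w = y" by (rule kern_unique[OF e bch_cmp[OF w(1) ka] y(1)])
    then show "\<exists>u. u \<in> hom (Hopf_bc \<C>) W K \<and> comp (Hopf_bc \<C>) (mor \<kappa>) u = t"
      using bch_mor[OF w(1)] mor_cmp_bch[OF w(1) ka] y(2) by auto
  qed
  then have "kern E I p K \<kappa>" "coker K E \<kappa> I p"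
    unfolding kern_def coker_def using p ka H.epi_cokernel_of_kernel[OF epi] by blast+
  then show ?thesis using that by blast
qed

lemma unit_volume_composite:
  assumes k: "kern A B \<xi> K k" and q: "coker A B \<xi> Q q" and k': "kern B C \<xi>' K' k'" and e: "kern A C (\<xi>' \<bullet> \<xi>) E e"
    and VK: "unit_volume K \<sigma> \<phi>" and VQ: "unit_volume Q \<tau> \<psi>" and VK': "unit_volume K' \<sigma>' \<phi>'"
  shows "\<exists>\<sigma> \<phi>. unit_volume E \<sigma> \<phi>"
proof -
  have f: "bch K' Q (q \<bullet> k')" by (rule bch_cmp[OF kern_bch(2)[OF k'] coker_bch(2)[OF q]])
  obtain I i where i: "kern K' Q (q \<bullet> k') I i" using kern_exists[OF f] by blast
  obtain \<kappa> p where "kern E I p K \<kappa>" "coker K E \<kappa> I p" by (rule kernel_of_composite[OF k q k' e i])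
  then show ?thesis using unit_volume_kernel[OF f VK' VQ i] unit_volume_extension VK by blast
qed

end

context hopf_setting
begin

interpretation op: hopf_setting "op_smc \<C>" by (rule op_hopf_setting)

text \<open>The dual of \<open>unit_volume_composite\<close>.\<close>

lemma unit_volume_composite_coker:
  assumes q': "coker B C \<xi>' Q' q'" and k': "kern B C \<xi>' K' k'" and q: "coker A B \<xi> Q q" and e: "coker A C (\<xi>' \<bullet> \<xi>) E e"
    and VQ': "unit_volume Q' \<sigma> \<phi>" and VK': "unit_volume K' \<sigma>' \<phi>'" and VQ: "unit_volume Q \<tau> \<psi>"
  shows "\<exists>\<sigma> \<phi>. unit_volume E \<sigma> \<phi>"
proof -
  have "\<exists>\<sigma> \<phi>. op.unit_volume (op_bimon E) \<sigma> \<phi>"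
    by (rule op.unit_volume_composite[of "op_bimon C" "op_bimon B" "rv \<xi>'" "op_bimon Q'" "rv q'" "op_bimon K'" "rv k'"
        "op_bimon A" "rv \<xi>" "op_bimon Q" "rv q" "op_bimon E" "rv e" "rv \<phi>" "rv \<sigma>" "rv \<phi>'" "rv \<sigma>'" "rv \<psi>" "rv \<tau>"])
      (use assms in \<open>simp_all add: op_kern op_coker op_unit_volume op_cmp\<close>)
  then obtain s t where "op.unit_volume (op_bimon E) s t" by blast
  then show ?thesis using op_unit_volume[of E "rv s" "rv t"] by auto
qed

end


context symmetric_monoidal_category
begin

lemma Aut_inverse:
  assumes "a \<in> Aut \<C> \<one>"
  obtains t where "scal (mk \<one> a \<one>)" "scal t" "t \<bullet> mk \<one> a \<one> = Id \<one>" "inv_arr \<C> \<one> \<one> a = mor t"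
proof -
  have a: "a \<in> Hom \<one> \<one>" using assms unfolding Aut_def iso_arr_def by blast
  then have "inv_scal (mk \<one> a \<one>)" using assms unfolding inv_scal_Aut by simp
  then obtain t where t: "scal (mk \<one> a \<one>)" "scal t" "t \<bullet> mk \<one> a \<one> = Id \<one>" by (rule inv_scalE)
  have "mk \<one> a \<one> \<bullet> t = Id \<one>" using scal_comm[OF t(1,2)] t(3) by simp
  from mor_eq[OF this] mor_eq[OF t(3)] have "a \<cdot> mor t = ide \<one>" "mor t \<cdot> a = ide \<one>" using t(1,2) a by simp_all
  then have "inv_arr \<C> \<one> \<one> a = mor t" using a t(2) by (intro inv_arr_eqI) (simp_all add: is_inverse_def)
  then show ?thesis using that t by blast
qed

end

context hopf_setting
begin

lemma chosen_kern:
  assumes f: "bch A B f"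
  shows "\<exists>k. kern A B f (Ker \<C> A B (mor f)) k \<and> mor k = ker \<C> A B (mor f)"
    and "\<exists>q. coker A B f (Cok \<C> A B (mor f)) q \<and> mor q = cok \<C> A B (mor f)"
proof -
  have "\<exists>p. is_kernel (Hopf_bc \<C>) A B (mor f) (fst p) (snd p)" using H.kernel_exists[OF bch_mor[OF f]] by simp
  from kern_mk[OF someI_ex[OF this, folded kernel_pair_def], unfolded mk_und[OF f]]
  show "\<exists>k. kern A B f (Ker \<C> A B (mor f)) k \<and> mor k = ker \<C> A B (mor f)" by (intro exI conjI) (assumption, simp)
  have "\<exists>p. is_cokernel (Hopf_bc \<C>) A B (mor f) (fst p) (snd p)" using H.cokernel_exists[OF bch_mor[OF f]] by simp
  from coker_mk[OF someI_ex[OF this, folded cokernel_pair_def], unfolded mk_und[OF f]]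
  show "\<exists>q. coker A B f (Cok \<C> A B (mor f)) q \<and> mor q = cok \<C> A B (mor f)" by (intro exI conjI) (assumption, simp)
qed

lemma Fredholm_iff:
  assumes f: "bch A B f"
  shows "Fredholm \<C> A B (mor f) \<longleftrightarrow> (\<exists>\<sigma> \<phi>. unit_volume (Ker \<C> A B (mor f)) \<sigma> \<phi>) \<and> (\<exists>\<sigma> \<phi>. unit_volume (Cok \<C> A B (mor f)) \<sigma> \<phi>)"
proof -
  obtain k q where k: "kern A B f (Ker \<C> A B (mor f)) k" and q: "coker A B f (Cok \<C> A B (mor f)) q"
    using chosen_kern[OF f] by blast
  show ?thesis
    unfolding unit_volume_iff[OF bch_simps(1)[OF kern_bch(2)[OF k]], symmetric] unit_volume_iff[OF bch_simps(2)[OF coker_bch(2)[OF q]], symmetric]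
      Fredholm_def using f bhom_mor unfolding bch_def by blast
qed

text \<open>The scalars \<open>\<upsilon>(\<xi>)\<^sup>-\<^sup>1 \<upsilon>(\<xi>')\<^sup>-\<^sup>1\<close> and \<open>\<omega>(\<xi>, \<xi>')\<close> combine to \<open>\<upsilon>(\<xi>' \<circ> \<xi>)\<^sup>-\<^sup>1\<close> by the coboundary condition.\<close>

theorem pushforward_comp:
  assumes u: "normalized_1_cochain \<C> \<upsilon>" and d: "coboundary_is_omega \<C> \<upsilon>"
    and f: "bch A B f" and g: "bch B C g" and F: "Fredholm \<C> A B (mor f)" and G: "Fredholm \<C> B C (mor g)"
  shows "Fredholm \<C> A C (mor (g \<bullet> f))"
    "pushforward \<C> \<upsilon> A C (mor (g \<bullet> f)) = pushforward \<C> \<upsilon> A B (mor f) \<cdot> pushforward \<C> \<upsilon> B C (mor g)"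
proof -
  note h = bch_cmp[OF f g]
  obtain k where k: "kern A B f (Ker \<C> A B (mor f)) k" using chosen_kern(1)[OF f] by blast
  obtain q where q: "coker A B f (Cok \<C> A B (mor f)) q" and mq: "mor q = cok \<C> A B (mor f)" using chosen_kern(2)[OF f] by blast
  obtain k' where k': "kern B C g (Ker \<C> B C (mor g)) k'" and mk': "mor k' = ker \<C> B C (mor g)" using chosen_kern(1)[OF g] by blast
  obtain q' where q': "coker B C g (Cok \<C> B C (mor g)) q'" using chosen_kern(2)[OF g] by blast
  obtain e where e: "kern A C (g \<bullet> f) (Ker \<C> A C (mor (g \<bullet> f))) e" using chosen_kern(1)[OF h] by blast
  obtain r where r: "coker A C (g \<bullet> f) (Cok \<C> A C (mor (g \<bullet> f))) r" using chosen_kern(2)[OF h] by blast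
  obtain \<sigma> \<phi> where VK: "unit_volume (Ker \<C> A B (mor f)) \<sigma> \<phi>" using F unfolding Fredholm_iff[OF f] by blast
  obtain \<tau> \<psi> where VQ: "unit_volume (Cok \<C> A B (mor f)) \<tau> \<psi>" using F unfolding Fredholm_iff[OF f] by blast
  obtain \<sigma>' \<phi>' where VK': "unit_volume (Ker \<C> B C (mor g)) \<sigma>' \<phi>'" using G unfolding Fredholm_iff[OF g] by blast
  obtain \<tau>' \<psi>' where VQ': "unit_volume (Cok \<C> B C (mor g)) \<tau>' \<psi>'" using G unfolding Fredholm_iff[OF g] by blast
  obtain s3 p3 where VE: "unit_volume (Ker \<C> A C (mor (g \<bullet> f))) s3 p3"
    using unit_volume_composite[OF k q k' e VK VQ VK'] by blast
  obtain s4 p4 where VR: "unit_volume (Cok \<C> A C (mor (g \<bullet> f))) s4 p4"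
    using unit_volume_composite_coker[OF q' k' q r VQ' VK' VQ] by blast
  show H: "Fredholm \<C> A C (mor (g \<bullet> f))" unfolding Fredholm_iff[OF h] using VE VR by blast
  have n: "nint (Ker \<C> A B (mor f)) \<sigma>" "ncoint (Cok \<C> A B (mor f)) \<psi>" "nint (Ker \<C> B C (mor g)) \<sigma>'"
    "ncoint (Cok \<C> B C (mor g)) \<psi>'" "nint (Ker \<C> A C (mor (g \<bullet> f))) s3" "ncoint (Cok \<C> A C (mor (g \<bullet> f))) p4"
    using VK VQ VK' VQ' VE VR unfolding unit_volume_def by blast+
  obtain m where m: "gen_int A B f (Ker \<C> A B (mor f)) k \<sigma> (Cok \<C> A B (mor f)) q \<psi> m" using gen_int_exists[OF k q n(1,2)] by blast
  obtain m' where m': "gen_int B C g (Ker \<C> B C (mor g)) k' \<sigma>' (Cok \<C> B C (mor g)) q' \<psi>' m'" using gen_int_exists[OF k' q' n(3,4)] by blast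
  obtain m3 where m3: "gen_int A C (g \<bullet> f) (Ker \<C> A C (mor (g \<bullet> f))) e s3 (Cok \<C> A C (mor (g \<bullet> f))) r p4 m3"
    using gen_int_exists[OF e r n(5,6)] by blast
  let ?c = "\<psi> \<bullet> q \<bullet> k' \<bullet> \<sigma>'"
  note comp = gen_int_comp[OF m m' m3]
  note [simp] = bch_simps[OF f] bch_simps[OF g] bch_simps[OF coker_bch(2)[OF q]] bch_simps[OF kern_bch(2)[OF k']]
    nint_simps[OF n(3)] ncoint_simps[OF n(2)]
  have rm: "right_int A B f m" "right_int B C g m'" "right_int A C (g \<bullet> f) m3" using m m' m3 unfolding gen_int_def by blast+
  note [simp] = right_int_simps[OF rm(1)] right_int_simps[OF rm(2)] right_int_simps[OF rm(3)]
  have c: "scal ?c" unfolding scal_def by simp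
  have om: "omega \<C> A B C (mor f) (mor g) = mor ?c"
  proof -
    have "?c = \<psi> \<bullet> ((q \<bullet> k') \<bullet> \<sigma>')" by (simp add: cmp_assoc)
    from mor_eq[OF this] show ?thesis
      unfolding omega_def bracket_def mq[symmetric] mk'[symmetric] integral_of_eq[OF bch_simps(4)[OF kern_bch(2)[OF k']] n(3)]
        cointegral_of_eq[OF bch_simps(5)[OF coker_bch(2)[OF q]] n(2)] by simp
  qed
  let ?u = "\<upsilon> A B (mor f)" and ?u' = "\<upsilon> B C (mor g)" and ?w = "\<upsilon> A C (mor (g \<bullet> f))"
  have au: "?u \<in> Aut \<C> \<one>" "?u' \<in> Aut \<C> \<one>" "?w \<in> Aut \<C> \<one>" using u F G H unfolding normalized_1_cochain_def by blast+
  obtain t where t: "scal (mk \<one> ?u \<one>)" "scal t" "t \<bullet> mk \<one> ?u \<one> = Id \<one>" "inv_arr \<C> \<one> \<one> ?u = mor t" by (rule Aut_inverse[OF au(1)])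
  obtain t' where t': "scal (mk \<one> ?u' \<one>)" "scal t'" "t' \<bullet> mk \<one> ?u' \<one> = Id \<one>" "inv_arr \<C> \<one> \<one> ?u' = mor t'" by (rule Aut_inverse[OF au(2)])
  obtain t3 where t3: "scal (mk \<one> ?w \<one>)" "scal t3" "t3 \<bullet> mk \<one> ?w \<one> = Id \<one>" "inv_arr \<C> \<one> \<one> ?w = mor t3" by (rule Aut_inverse[OF au(3)])
  let ?U = "mk \<one> ?u \<one>" and ?U' = "mk \<one> ?u' \<one>" and ?W = "mk \<one> ?w \<one>"
  \<comment> \<open>The coboundary condition as an equation of scalars; together with the inverses \<open>t, t', t3\<close> it removes the factor \<open>?c\<close>.\<close>
  have "?u \<cdot> ?u' = mor ?c \<cdot> ?w"
    using d F G om mor_cmp_bch[OF f g] unfolding coboundary_is_omega_def by metis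
  then have cob: "?U \<bullet> ?U' = ?c \<bullet> ?W" using scal_simps[OF t(1)] scal_simps[OF t'(1)] scal_simps[OF t3(1)]
    by (intro arr_eqI) simp_all
  have "?W \<bullet> t3 = Id \<one>" using scal_comm[OF t3(1,2)] t3(3) by simp
  then have "t \<bullet> t' \<bullet> ?c = t \<bullet> t' \<bullet> (?c \<bullet> ?W) \<bullet> t3" using c t t' by (simp add: cmp_assoc)
  also have "\<dots> = t \<bullet> (t' \<bullet> ?U) \<bullet> ?U' \<bullet> t3" unfolding cob[symmetric] by (simp add: cmp_assoc)
  also have "t' \<bullet> ?U = ?U \<bullet> t'" by (rule scal_comm[OF t'(2) t(1)])
  also have "t \<bullet> (?U \<bullet> t') \<bullet> ?U' \<bullet> t3 = t3"
    using cmp_eq_assoc[OF t(3), of "t' \<bullet> ?U' \<bullet> t3"] cmp_eq_assoc[OF t'(3), of t3] t3(2) t'(1,2) by (simp add: cmp_assoc)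
  finally have tc: "t \<bullet> t' \<bullet> ?c = t3" .
  have "sc t m \<bullet> sc t' m' = sc t (sc t' (sc ?c m3))"
    using t(2) t'(2) sc_cmp[of t m "sc t' m'"] cmp_sc[of t' m m'] by (simp add: comp)
  also have "\<dots> = sc t3 m3" using t(2) t'(2) c by (simp add: sc_sc cmp_assoc tc)
  finally have "sc t3 m3 = sc t m \<bullet> sc t' m'" ..
  from mor_eq[OF this]
  show "pushforward \<C> \<upsilon> A C (mor (g \<bullet> f)) = pushforward \<C> \<upsilon> A B (mor f) \<cdot> pushforward \<C> \<upsilon> B C (mor g)"
    unfolding pushforward_def t(4) t'(4) t3(4) gen_int_mor[OF m] gen_int_mor[OF m'] gen_int_mor[OF m3]
    using t(2) t'(2) t3(2) by simp
qed

end

theorem proposition15p16: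
  fixes \<C> :: "('o, 'm) smcat" (structure)
    and \<upsilon> :: "('o, 'm) bimon \<Rightarrow> ('o, 'm) bimon \<Rightarrow> 'm \<Rightarrow> 'm"
    and A B C :: "('o, 'm) bimon"
    and \<xi> \<xi>' :: "'m"
  assumes "symmetric_monoidal_category \<C>"
    and "has_equalizers \<C>" and "has_coequalizers \<C>"
    and "bistable \<C>"
    and "abelian_category (Hopf_bc \<C>)"
    and "normalized_1_cochain \<C> \<upsilon>"
    and "coboundary_is_omega \<C> \<upsilon>"
    and "bc_hopf_monoid \<C> A" and "bc_hopf_monoid \<C> B" and "bc_hopf_monoid \<C> C"
    and "bimonoid_hom \<C> A B \<xi>" and "bimonoid_hom \<C> B C \<xi>'"
    and "Fredholm \<C> A B \<xi>" and "Fredholm \<C> B C \<xi>'"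
  shows "Fredholm \<C> A C (\<xi>' \<cdot> \<xi>) \<and>
         pushforward \<C> \<upsilon> A C (\<xi>' \<cdot> \<xi>) = pushforward \<C> \<upsilon> A B \<xi> \<cdot> pushforward \<C> \<upsilon> B C \<xi>'"
proof -
  interpret symmetric_monoidal_category \<C> by (rule assms(1))
  interpret hopf_setting \<C> by unfold_locales (rule assms)+
  let ?f = "mk (und A) \<xi> (und B)" and ?g = "mk (und B) \<xi>' (und C)"
  have f: "bch A B ?f" and g: "bch B C ?g" unfolding bch_def bhom_mk using assms by blast+
  have "mor (cmp ?g ?f) = \<xi>' \<cdot> \<xi>" using mor_cmp_bch[OF f g] by simp
  then show ?thesis using pushforward_comp[OF assms(6,7) f g] assms(13,14) by simp
qed

end
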